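(* Let $T>0$ and let $\mu$ be a centred probability measure on $\mathbb{R}$ without atoms. Let $F:\mathbb{R}\times\mathbb{R}\to\mathbb{R}$, $(w,s)\mapsto F(w,s)$, be an upper semicontinuous strictly supermodular serrated function with ridge $R_F=\{(w,a_w):w\in\mathbb{R}\}$, $a_w\in\mathbb{R}\cup\{-\infty,+\infty\}$. For a process $M$ write $S_T=\max_{0\le t\le T}M_t$. Then: (i) If $R_F=\{(w,+\infty):w\in\mathbb{R}\}$ (that is, $s\mapsto F(w_0,s)$ is increasing on $\mathbb{R}$ for every $w_0\in\mathbb{R}$), then the functional $\mathbb{E}[F(M_T,S_T)]$, considered on the set of all $\mu$-admissible processes $M$, is maximized by the Azéma-Yor embedding of $\mu$. (ii) For a general ridge, define $g(w)=\min\bigl(\beta_\mu(w),\max(a_w,0,w)\bigr)$, where $\beta_\mu$ is the barycenter function of $\mu$. Then there is a $\mu$-admissible process for which the joint distribution of $(M_T,S_T)$ is $g_\#\mu$, and amongst all $\mu$-admissible processes $M$ the functional $\mathbb{E}[F(M_T,S_T)]$ is maximized by the process with this joint distribution.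
   Context: A probability measure $\mu$ on $\mathbb{R}$ is centred if $\int_{\mathbb{R}_{\ge 0}}x\,\mu(dx)<+\infty$ and $\int_{\mathbb{R}}x\,\mu(dx)=0$. A process $(M_t)_{0\le t\le T}$ is $\mu$-admissible if it is a uniformly integrable martingale with $M_0=0$ and $M_T\sim\mu$. Different admissible processes may live on different probability spaces; jumps are allowed. $F$ is supermodular if $w_1<w_2$ and $s_1<s_2$ imply $F(w_1,s_1)+F(w_2,s_2)\ge F(w_1,s_2)+F(w_2,s_1)$; it is strictly supermodular if the latter inequality is always strict. $F$ is serrated if for every $w_0\in\mathbb{R}$ there is $a_{w_0}\in\mathbb{R}\cup\{-\infty,+\infty\}$ such that $s\mapsto F(w_0,s)$ is increasing on $(-\infty,a_{w_0})$ and decreasing on $(a_{w_0},+\infty)$ (the value $-\infty$ or $+\infty$ means that $F(w_0,\cdot)$ is decreasing, respectively increasing, on all of $\mathbb{R}$). The ridge of $F$ is $R_F=\{(w_0,a_{w_0}):w_0\in\mathbb{R}\}$. The barycenter function of $\mu$ is $\beta_\mu(k)=\mathbb{E}_\mu[x\mid x\ge k]$, defined for $k$ with $\mu([k,+\infty))>0$ (a set of full $\mu$-measure). For a function $g$ defined $\mu$-almost everywhere, $g_\#\mu$ denotes the measure on $\mathbb{R}\times\mathbb{R}$ that is the image of $\mu$ under the map $w\mapsto(w,g(w))$. The Azéma-Yor embedding is given by the stopping time $\tau=\inf\{t\ge 0:\ \max_{0\le u\le t}W_u\ge\beta_\mu(W_t)\}$ of a standard Brownian motion $W$ started at $0$.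 It is regarded as a $\mu$-admissible process on $[0,T]$ by a deterministic time change, e.g. $M_t=W_{\tau\wedge (t/(T-t))}$ for $t<T$ and $M_T=W_\tau$. The joint law of $(M_T,S_T)$ for it is the image of $\mu$ under $w\mapsto(w,\beta_\mu(w))$. Convention: "the functional is maximized by a process" means that no $\mu$-admissible process achieves a higher value of the functional; if the value of the functional at the maximizing process is $-\infty$, then all $\mu$-admissible processes are optimal. *)

theory Defs
  imports "HOL-Probability.Probability"
begin

section \<open>Martingales on a compact time interval\<close>

definition cadlag_on :: "real \<Rightarrow> (real \<Rightarrow> real) \<Rightarrow> bool" where
  "cadlag_on T x \<longleftrightarrow>
     (\<forall>t\<in>{0..<T}. (x \<longlongrightarrow> x t) (at_right t)) \<and>
     (\<forall>t\<in>{0<..T}. \<exists>l. (x \<longlongrightarrow> l) (at_left t))"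

definition martingale_on ::
  "'a measure \<Rightarrow> real \<Rightarrow> (real \<Rightarrow> 'a measure) \<Rightarrow> (real \<Rightarrow> 'a \<Rightarrow> real) \<Rightarrow> bool" where
  "martingale_on P T \<F> X \<longleftrightarrow>
     filtration (space P) \<F> \<and>
     (\<forall>t\<in>{0..T}. subalgebra P (\<F> t) \<and> X t \<in> borel_measurable (\<F> t) \<and> integrable P (X t)) \<and>
     (\<forall>s\<in>{0..T}. \<forall>t\<in>{s..T}. AE \<omega> in P. real_cond_exp P (\<F> s) (X t) \<omega> = X s \<omega>)"

definition uniformly_integrable_on :: "'a measure \<Rightarrow> 't set \<Rightarrow> ('t \<Rightarrow> 'a \<Rightarrow> real) \<Rightarrow> bool" where
  "uniformly_integrable_on P I X \<longleftrightarrow>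
     (\<forall>t\<in>I. integrable P (X t)) \<and>
     (\<forall>\<epsilon>>0. \<exists>K. \<forall>t\<in>I. (LINT \<omega>:{\<omega>\<in>space P. \<bar>X t \<omega>\<bar> > K}|P. \<bar>X t \<omega>\<bar>) \<le> \<epsilon>)"

text \<open>
  Jumps are allowed; as usual, paths are right-continuous with left limits. The filtration
  is not part of the data: some filtration making \<open>X\<close> a martingale has to exist
  (the natural one will do).
\<close>
definition admissible ::
  "real \<Rightarrow> real measure \<Rightarrow> 'a measure \<Rightarrow> (real \<Rightarrow> 'a \<Rightarrow> real) \<Rightarrow> bool" where
  "admissible T \<mu> P X \<longleftrightarrow>
     prob_space P \<and>
     (\<forall>\<omega>\<in>space P. cadlag_on T (\<lambda>t. X t \<omega>)) \<and>
     (\<exists>\<F>. martingale_on P T \<F> X) \<and>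
     uniformly_integrable_on P {0..T} X \<and>
     (AE \<omega> in P. X 0 \<omega> = 0) \<and>
     distr P borel (X T) = \<mu>"

text \<open>
  For a path with jumps the maximum need not be attained, hence the supremum. It is a
  genuine finite supremum, because right-continuous paths with left limits are bounded on
  compact intervals.
\<close>
definition running_max :: "(real \<Rightarrow> 'a \<Rightarrow> real) \<Rightarrow> real \<Rightarrow> 'a \<Rightarrow> real" where
  "running_max X t \<omega> = (SUP u\<in>{0..t}. X u \<omega>)"

definition joint_law :: "real \<Rightarrow> 'a measure \<Rightarrow> (real \<Rightarrow> 'a \<Rightarrow> real) \<Rightarrow> (real \<times> real) measure" where
  "joint_law T P X = distr P borel (\<lambda>\<omega>. (X T \<omega>, running_max X T \<omega>))"


section \<open>The functional and its maximizers\<close>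

text \<open>
  The expectation with values in the extended reals. The predicate is relational since no
  value exists when positive and negative part both have infinite integral.
\<close>
definition has_expectation :: "'a measure \<Rightarrow> ('a \<Rightarrow> real) \<Rightarrow> ereal \<Rightarrow> bool" where
  "has_expectation P Y v \<longleftrightarrow>
     Y \<in> borel_measurable P \<and>
     ((\<integral>\<^sup>+ \<omega>. ennreal (Y \<omega>) \<partial>P) < \<infinity> \<or> (\<integral>\<^sup>+ \<omega>. ennreal (- Y \<omega>) \<partial>P) < \<infinity>) \<and>
     v = enn2ereal (\<integral>\<^sup>+ \<omega>. ennreal (Y \<omega>) \<partial>P) - enn2ereal (\<integral>\<^sup>+ \<omega>. ennreal (- Y \<omega>) \<partial>P)"

definition functional_value ::
  "real \<Rightarrow> (real \<Rightarrow> real \<Rightarrow> real) \<Rightarrow> 'a measure \<Rightarrow> (real \<Rightarrow> 'a \<Rightarrow> real) \<Rightarrow> ereal \<Rightarrow> bool" where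
  "functional_value T F P X v \<longleftrightarrow> has_expectation P (\<lambda>\<omega>. F (X T \<omega>) (running_max X T \<omega>)) v"

text \<open>
  \<open>Y\<close> does not achieve a higher value of the functional than \<open>X\<close>. In particular, if the
  value at \<open>X\<close> is \<open>-\<infinity>\<close>, then so is the value at \<open>Y\<close>, if it exists.
\<close>
definition achieves_no_higher_value ::
  "real \<Rightarrow> (real \<Rightarrow> real \<Rightarrow> real) \<Rightarrow> 'a measure \<Rightarrow> (real \<Rightarrow> 'a \<Rightarrow> real) \<Rightarrow>
   'b measure \<Rightarrow> (real \<Rightarrow> 'b \<Rightarrow> real) \<Rightarrow> bool" where
  "achieves_no_higher_value T F Q Y P X \<longleftrightarrow>
     (\<forall>v v'. functional_value T F P X v \<longrightarrow> functional_value T F Q Y v' \<longrightarrow> v' \<le> v)"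


section \<open>Payoff functions\<close>

definition usc :: "('a::topological_space \<Rightarrow> real) \<Rightarrow> bool" where
  "usc f \<longleftrightarrow> (\<forall>x c. f x < c \<longrightarrow> (\<forall>\<^sub>F y in nhds x. f y < c))"

definition strictly_supermodular :: "(real \<Rightarrow> real \<Rightarrow> real) \<Rightarrow> bool" where
  "strictly_supermodular F \<longleftrightarrow>
     (\<forall>w1 w2 s1 s2. w1 < w2 \<longrightarrow> s1 < s2 \<longrightarrow> F w1 s1 + F w2 s2 > F w1 s2 + F w2 s1)"

text \<open>\<open>F\<close> is serrated, and its ridge is the graph of \<open>a\<close>.\<close>
definition serrated_with_ridge :: "(real \<Rightarrow> real \<Rightarrow> real) \<Rightarrow> (real \<Rightarrow> ereal) \<Rightarrow> bool" where
  "serrated_with_ridge F a \<longleftrightarrow>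
     (\<forall>w. mono_on {s. ereal s < a w} (F w) \<and> antimono_on {s. a w < ereal s} (F w))"


section \<open>Target measures and the barycenter function\<close>

text \<open>
  Finiteness of the integral over the positive half-line together with total integral zero
  amounts to integrability together with mean zero.
\<close>
definition centred :: "real measure \<Rightarrow> bool" where
  "centred \<mu> \<longleftrightarrow> real_distribution \<mu> \<and> integrable \<mu> (\<lambda>x. x) \<and> (\<integral>x. x \<partial>\<mu>) = 0"

definition no_atoms :: "real measure \<Rightarrow> bool" where
  "no_atoms \<mu> \<longleftrightarrow> (\<forall>x. measure \<mu> {x} = 0)"

text \<open>
  Meaningful only where \<open>{k..}\<close> has positive mass; elsewhere the value is \<open>0\<close>. The latter
  happens only on a null set of \<open>\<mu>\<close>, and the stopping rule below is always met there, just
  as under the other common convention \<open>\<beta>(k) = k\<close>.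
\<close>
definition barycenter :: "real measure \<Rightarrow> real \<Rightarrow> real" where
  "barycenter \<mu> k = (LINT x:{k..}|\<mu>. x) / measure \<mu> {k..}"

definition capped_barycenter :: "real measure \<Rightarrow> (real \<Rightarrow> ereal) \<Rightarrow> real \<Rightarrow> real" where
  "capped_barycenter \<mu> a w =
     real_of_ereal (min (ereal (barycenter \<mu> w)) (max (a w) (max 0 (ereal w))))"

definition graph_law :: "real measure \<Rightarrow> (real \<Rightarrow> real) \<Rightarrow> (real \<times> real) measure" where
  "graph_law \<mu> g = distr \<mu> borel (\<lambda>w. (w, g w))"


section \<open>Brownian motion and the Azema--Yor embedding\<close>

definition standard_brownian_motion :: "'a measure \<Rightarrow> (real \<Rightarrow> 'a \<Rightarrow> real) \<Rightarrow> bool" where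
  "standard_brownian_motion P W \<longleftrightarrow>
     prob_space P \<and>
     (\<forall>t\<ge>0. W t \<in> borel_measurable P) \<and>
     (AE \<omega> in P. W 0 \<omega> = 0) \<and>
     (\<forall>\<omega>\<in>space P. continuous_on {0..} (\<lambda>t. W t \<omega>)) \<and>
     (\<forall>s t. 0 \<le> s \<longrightarrow> s < t \<longrightarrow>
        distributed P lborel (\<lambda>\<omega>. W t \<omega> - W s \<omega>) (normal_density 0 (sqrt (t - s)))) \<and>
     (\<forall>n (ts :: nat \<Rightarrow> real). 0 \<le> ts 0 \<longrightarrow> mono ts \<longrightarrow>
        prob_space.indep_vars P (\<lambda>_. borel) (\<lambda>i \<omega>. W (ts (Suc i)) \<omega> - W (ts i) \<omega>) {..<n})"

definition azema_yor_time :: "real measure \<Rightarrow> (real \<Rightarrow> 'a \<Rightarrow> real) \<Rightarrow> 'a \<Rightarrow> ereal" where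
  "azema_yor_time \<mu> W \<omega> =
     Inf (ereal ` {t. 0 \<le> t \<and> running_max W t \<omega> \<ge> barycenter \<mu> (W t \<omega>)})"

text \<open>
  The deterministic time change \<open>t / (T - t)\<close> maps \<open>[0, T)\<close> onto \<open>[0, \<infinity>)\<close>. The first case
  concerns a null set only; there the process is set to \<open>0\<close> because the stopped value
  and the left limit of the path at time \<open>T\<close> need not exist.
\<close>
definition azema_yor_process ::
  "real \<Rightarrow> real measure \<Rightarrow> (real \<Rightarrow> 'a \<Rightarrow> real) \<Rightarrow> real \<Rightarrow> 'a \<Rightarrow> real" where
  "azema_yor_process T \<mu> W t \<omega> =
     (if azema_yor_time \<mu> W \<omega> = \<infinity> then 0
      else if t < T then W (min (real_of_ereal (azema_yor_time \<mu> W \<omega>)) (t / (T - t))) \<omega>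
      else W (real_of_ereal (azema_yor_time \<mu> W \<omega>)) \<omega>)"

end

theory Submission
  imports Defs "HOL-Real_Asymp.Real_Asymp"
begin

text \<open>
  Optimality. By Doob's inequality the maximum of an admissible martingale satisfies
  \<open>P (S > u) \<le> \<mu> {\<beta> > u}\<close>. The payoff does not decrease if \<open>S\<close> is replaced by its minimum with
  \<open>max (a w) 0 w\<close>, and on that range it is nondecreasing in \<open>s\<close>. Cut into increments over
  levels \<open>[u, u']\<close>, supermodularity makes each increment nondecreasing in \<open>w\<close>, so among all events
  of the given probability it is best placed on \<open>{\<beta> > u}\<close>.

  Existence. Let \<open>w\<close> have law \<open>\<mu>\<close> and let \<open>N\<close> be an independent Poisson random set whose
  intensity is chosen such that the barycenter of the group that is revealed at level \<open>g x\<close> (the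
  target \<open>x\<close> itself, and a fraction of all targets above \<open>x\<close>) equals \<open>g x\<close>. Scanning the line
  from below, the martingale is \<open>g\<close> of the first point of \<open>N \<union> {w}\<close> ahead until \<open>w\<close> is passed.

  Azema--Yor embedding. Stop Brownian motion also on leaving the interval \<open>(-n, \<beta> b)\<close>, and
  let \<open>V\<close> be the stopped value. The event \<open>V \<ge> k\<close> occurs iff the path reaches \<open>\<beta> k\<close>, hence
  \<open>E (V - k)\<^sup>+ = (\<beta> k - k) P (V \<ge> k)\<close>. The target \<open>\<mu>\<close> satisfies the same relation, which is
  a linear differential equation for the tail, so both tails are proportional. Finally the
  interval grows, and the stopped values converge in \<open>L\<^sup>1\<close>.
\<close>

subsection \<open>Barycenter function\<close>

text \<open>The intensity solves one equation. A target \<open>x\<close> joined by a fraction r of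
  all targets above it forms a group with barycenter (x + r moment x) / (1 + r mass x); equating
  this with \<open>gr x\<close> yields r = (gr x - x) / (moment x - gr x mass x). Where the
  prescribed maximum is the barycenter itself the denominator vanishes and r = \<infinity>: Poisson
  points are then met immediately, and the martingale follows \<beta> up to the target. Much of the
  existence proof serves to let finite and infinite rates coexist. Poisson sets are used because
  what lies ahead of a level is independent of what was seen, so one mean identity per level
  suffices.

  In the optimality part neither value has to be finite, so integrals cannot be subtracted at first;
  the comparison is carried out on bounded levels and then for positive and negative parts.

  For Brownian motion the stopped path need not be bounded, while optional stopping is proved for
  bounded values. Inside a box it applies, and the lower barrier changes every tail by the same
  factor n / call (- n), which tends to 1.\<close>

locale atomless_target = real_distribution \<mu> for \<mu> :: "real measure" +
  assumes integrable_id: "integrable \<mu> (\<lambda>x. x)"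
    and mean_zero: "(\<integral>x. x \<partial>\<mu>) = 0"
    and no_atom: "measure \<mu> {x} = 0"
begin

abbreviation \<beta> :: "real \<Rightarrow> real" where
  "\<beta> \<equiv> barycenter \<mu>"

definition mass :: "real \<Rightarrow> real" where
  "mass k = measure \<mu> {k..}"

definition moment :: "real \<Rightarrow> real" where
  "moment k = (\<integral>x. indicator {k..} x * x \<partial>\<mu>)"

lemma barycenter_eq: "\<beta> k = moment k / mass k"
  by (simp add: barycenter_def moment_def mass_def set_lebesgue_integral_def)

lemma mass_eq_integral: "mass k = (\<integral>x. indicator {k..} x \<partial>\<mu>)"
  by (simp add: mass_def)

lemma integrable_indicator_mult [simp]:
  "A \<in> sets borel \<Longrightarrow> integrable \<mu> (\<lambda>x. indicator A x * x)"
  using integrable_mult_indicator[of A \<mu> "\<lambda>x. x"] integrable_id by simp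

lemma integrable_indicator_borel [simp]:
  "A \<in> sets borel \<Longrightarrow> integrable \<mu> (indicator A :: real \<Rightarrow> real)"
  by (simp add: integrable_indicator_iff emeasure_eq_measure)

lemma AE_neq: "AE x in \<mu>. x \<noteq> k"
proof (rule AE_I[where N="{k}"])
  show "emeasure \<mu> {k} = 0"
    using no_atom[of k] by (simp add: emeasure_eq_measure)
qed auto

text \<open>Absence of atoms: when \<open>u n\<close> tends to \<open>k\<close>, the indicators of
  the rays converge at every point except \<open>k\<close>.\<close>

lemma continuous_tail_integral:
  assumes "integrable \<mu> f"
  shows "isCont (\<lambda>k. \<integral>x. indicator {k..} x * (f x :: real) \<partial>\<mu>) k"
proof (rule continuous_at_sequentiallyI)
  fix u :: "nat \<Rightarrow> real" assume u: "u \<longlonglongrightarrow> k"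
  have [measurable]: "f \<in> borel_measurable \<mu>" using assms by auto
  show "(\<lambda>n. \<integral>x. indicator {u n..} x * f x \<partial>\<mu>) \<longlonglongrightarrow> (\<integral>x. indicator {k..} x * f x \<partial>\<mu>)"
  proof (rule integral_dominated_convergence[where w="\<lambda>x. norm (f x)"])
    show "AE x in \<mu>. (\<lambda>n. indicator {u n..} x * f x) \<longlonglongrightarrow> indicator {k..} x * f x"
      using AE_neq[of k]
    proof eventually_elim
      case (elim x)
      have "eventually (\<lambda>n. indicator {u n..} x = (indicator {k..} x :: real)) sequentially"
      proof (cases "x < k")
        case True
        then show ?thesis
          using order_tendstoD(1)[OF u, of x] by (auto elim!: eventually_mono simp: indicator_def)
      next
        case False
        with elim have "k < x" by simp
        then show ?thesis
          using order_tendstoD(2)[OF u, of x] by (auto elim!: eventually_mono simp: indicator_def)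
      qed
      then show ?case
        by (intro tendsto_eventually) (auto elim!: eventually_mono)
    qed
  qed (use assms in \<open>auto simp: indicator_def\<close>)
qed

lemma isCont_mass: "isCont mass k"
  using continuous_tail_integral[of "\<lambda>_. 1" k] by (simp add: mass_def[abs_def])

lemma isCont_moment: "isCont moment k"
  using continuous_tail_integral[OF integrable_id, of k] by (simp add: moment_def[abs_def])

lemma borel_measurable_mass [measurable]: "mass \<in> borel_measurable borel"
  using isCont_mass by (intro borel_measurable_continuous_onI) (simp add: continuous_on_eq_continuous_at)

lemma borel_measurable_moment [measurable]: "moment \<in> borel_measurable borel"
  using isCont_moment by (intro borel_measurable_continuous_onI) (simp add: continuous_on_eq_continuous_at)

lemma borel_measurable_barycenter [measurable]: "\<beta> \<in> borel_measurable borel"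
  by (simp add: barycenter_eq[abs_def])

lemma isCont_barycenter: "mass k > 0 \<Longrightarrow> isCont \<beta> k"
  using isCont_mass isCont_moment by (auto simp: barycenter_eq[abs_def] intro!: continuous_intros)

lemma mass_nonneg: "0 \<le> mass k" and mass_le_1: "mass k \<le> 1"
  by (simp_all add: mass_def)

lemma mass_antimono: "k \<le> k' \<Longrightarrow> mass k' \<le> mass k"
  unfolding mass_def by (intro finite_measure_mono) auto

lemma moment_diff_le:
  assumes "k \<le> k'"
  shows "moment k - moment k' \<le> k' * (mass k - mass k')"
    and "moment k - moment k' \<ge> k * (mass k - mass k')"
proof -
  have 1: "moment k - moment k' = (\<integral>x. (indicator {k..} x - indicator {k'..} x) * x \<partial>\<mu>)"
    unfolding moment_def by (subst Bochner_Integration.integral_diff[symmetric]) (simp_all add: left_diff_distrib)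
  have 2: "c * (mass k - mass k') = (\<integral>x. (indicator {k..} x - indicator {k'..} x) * c \<partial>\<mu>)" for c
    unfolding mass_eq_integral
    by (simp add: Bochner_Integration.integral_diff)
  have i: "integrable \<mu> (\<lambda>x. (indicator {k..} x - indicator {k'..} x) * x)"
    by (simp add: left_diff_distrib)
  have i2: "integrable \<mu> (\<lambda>x. (indicator {k..} x - indicator {k'..} x) * c)" for c :: real
    by simp
  show "moment k - moment k' \<le> k' * (mass k - mass k')"
    unfolding 1 2 using assms i i2 by (intro integral_mono) (simp_all, auto simp: indicator_def)
  show "moment k - moment k' \<ge> k * (mass k - mass k')"
    unfolding 1 2 using assms i i2 by (intro integral_mono) (simp_all, auto simp: indicator_def)
qed

text \<open>The call price E (x - k)^+, written through tails so that its relation to the barycenter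
  is purely algebraic.\<close>

definition call :: "real \<Rightarrow> real" where
  "call k = moment k - k * mass k"

lemma call_eq: "call k = (\<integral>x. max 0 (x - k) \<partial>\<mu>)"
proof -
  have "call k = (\<integral>x. indicator {k..} x * x - indicator {k..} x * k \<partial>\<mu>)"
    unfolding call_def moment_def mass_eq_integral
    by (subst Bochner_Integration.integral_diff) auto
  also have "\<dots> = (\<integral>x. max 0 (x - k) \<partial>\<mu>)"
    by (intro Bochner_Integration.integral_cong) (auto simp: indicator_def)
  finally show ?thesis .
qed

lemma integrable_pos_part: "integrable \<mu> (\<lambda>x. max 0 (x - k))"
  using integrable_id by (intro integrable_max) auto

text \<open>Without an atom at \<open>k\<close>, mass on \<open>{k..}\<close> sits strictly above
  \<open>k\<close>. This is the source of the strict inequality in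
  \<open>barycenter_greater\<close>.\<close>

lemma mass_pos_iff_call: "mass k > 0 \<longleftrightarrow> call k > 0"
proof
  assume m: "mass k > 0"
  have "call k \<ge> 0" unfolding call_eq by (intro integral_nonneg_AE) auto
  moreover have "call k \<noteq> 0"
  proof
    assume "call k = 0"
    then have "AE x in \<mu>. max 0 (x - k) = 0"
      unfolding call_eq by (subst (asm) integral_nonneg_eq_0_iff_AE) (auto simp: integrable_pos_part)
    with AE_neq[of k] have "AE x in \<mu>. x \<notin> {k..}"
      by eventually_elim auto
    then have "mass k = 0"
      unfolding mass_def by (subst measure_eq_0_null_sets) (auto simp: AE_iff_null_sets)
    with m show False by simp
  qed
  ultimately show "call k > 0" by simp
next
  assume "call k > 0"
  show "mass k > 0"
  proof (rule ccontr)
    assume "\<not> ?thesis"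
    then have "mass k = 0" using mass_nonneg[of k] by simp
    then have "AE x in \<mu>. x \<notin> {k..}"
      unfolding mass_def by (subst AE_iff_null_sets[symmetric]) (auto simp: null_sets_def emeasure_eq_measure)
    then have "(\<integral>x. max 0 (x - k) \<partial>\<mu>) = (\<integral>x. 0 \<partial>\<mu>)"
      by (intro integral_cong_AE) (auto elim!: eventually_mono)
    with \<open>call k > 0\<close> show False by (simp add: call_eq)
  qed
qed

text \<open>For negative \<open>k\<close> the tail moment is minus the integral over
  \<open>{..<k}\<close>, because the mean is zero.\<close>

lemma moment_nonneg: "0 \<le> moment k"
proof (cases "k \<ge> 0")
  case True
  then show ?thesis unfolding moment_def by (intro integral_nonneg_AE) (auto simp: indicator_def)
next
  case False
  have "indicator {k..} x * x + indicator {..<k} x * x = x" for x :: real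
    by (auto simp: indicator_def)
  then have "moment k + (\<integral>x. indicator {..<k} x * x \<partial>\<mu>) = (\<integral>x. x \<partial>\<mu>)"
    unfolding moment_def
    by (subst Bochner_Integration.integral_add[symmetric]) simp_all
  moreover have "0 \<le> (\<integral>x. - (indicator {..<k} x * x) \<partial>\<mu>)"
    using False by (intro integral_nonneg_AE) (auto simp: indicator_def)
  ultimately show ?thesis by (simp add: mean_zero)
qed

lemma barycenter_nonneg: "0 \<le> \<beta> k"
  by (simp add: barycenter_eq moment_nonneg mass_nonneg)

lemma barycenter_greater: "mass k > 0 \<Longrightarrow> k < \<beta> k"
  using mass_pos_iff_call[of k] by (simp add: barycenter_eq call_def field_simps)

text \<open>Also true beyond the support: there the call vanishes, hence so does the moment, and the
  default value 0 of \<beta> does no harm. Later algebra is thereby free of case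
  distinctions.\<close>

lemma moment_eq: "moment k = \<beta> k * mass k"
proof (cases "mass k > 0")
  case False
  then have "mass k = 0" using mass_nonneg[of k] by simp
  moreover have "call k \<le> 0" using False mass_pos_iff_call by auto
  moreover have "call k \<ge> 0" unfolding call_eq by (intro integral_nonneg_AE) auto
  ultimately show ?thesis by (simp add: call_def)
qed (simp add: barycenter_eq)

lemma call_eq_barycenter: "call k = (\<beta> k - k) * mass k"
  by (simp add: call_def moment_eq algebra_simps)

text \<open>Lowering the threshold from \<open>k'\<close> to \<open>k\<close> adds only mass located
  at or below \<open>k'\<close>, which is less than \<open>\<beta> k'\<close>, so the average cannot
  grow. Beyond the support \<beta> drops to its default value 0, hence the condition on
  \<open>k'\<close>.\<close>

lemma barycenter_mono:
  assumes "k \<le> k'" "mass k' > 0"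
  shows "\<beta> k \<le> \<beta> k'"
proof -
  define d where "d = mass k - mass k'"
  have d: "d \<ge> 0" using mass_antimono[OF assms(1)] by (simp add: d_def)
  have m: "mass k > 0" using d assms by (simp add: d_def)
  have "moment k \<le> moment k' + k' * d"
    using moment_diff_le(1)[OF assms(1)] by (simp add: d_def)
  also have "k' * d \<le> \<beta> k' * d"
    using barycenter_greater[OF assms(2)] d by (intro mult_right_mono) auto
  also have "moment k' + \<beta> k' * d = \<beta> k' * mass k"
    by (simp add: moment_eq d_def algebra_simps)
  finally show ?thesis
    using m by (simp add: barycenter_eq[of k] field_simps)
qed

text \<open>Otherwise almost all targets above \<open>k\<close> would lie strictly below their own
  mean. The lemma guarantees that a path staying below \<open>\<beta> k\<close> remains where
  \<beta> is monotone.\<close>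

lemma mass_barycenter_pos:
  assumes "mass k > 0"
  shows "mass (\<beta> k) > 0"
proof (rule ccontr)
  assume "\<not> ?thesis"
  then have "mass (\<beta> k) = 0" using mass_nonneg[of "\<beta> k"] by simp
  then have 1: "AE x in \<mu>. x \<notin> {\<beta> k..}"
    unfolding mass_def by (subst AE_iff_null_sets[symmetric]) (auto simp: null_sets_def emeasure_eq_measure)
  have "(\<integral>x. indicator {k..} x * (\<beta> k - x) \<partial>\<mu>) = \<beta> k * mass k - moment k"
    unfolding moment_def mass_eq_integral
    by (simp add: right_diff_distrib Bochner_Integration.integral_diff mult.commute[of _ "\<beta> k"])
  then have "(\<integral>x. indicator {k..} x * (\<beta> k - x) \<partial>\<mu>) = 0"
    by (simp add: moment_eq)
  moreover have "integrable \<mu> (\<lambda>x. indicator {k..} x * (\<beta> k - x))"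
    by (simp add: right_diff_distrib)
  moreover have "AE x in \<mu>. 0 \<le> indicator {k..} x * (\<beta> k - x)"
    using 1 by eventually_elim (auto simp: indicator_def)
  ultimately have "AE x in \<mu>. indicator {k..} x * (\<beta> k - x) = 0"
    using integral_nonneg_eq_0_iff_AE by blast
  with 1 have "AE x in \<mu>. x \<notin> {k..}"
    by eventually_elim (auto simp: indicator_def split: if_splits)
  then have "mass k = 0"
    unfolding mass_def by (subst measure_eq_0_null_sets) (auto simp: AE_iff_null_sets)
  with assms show False by simp
qed

lemma tendsto_tail_integral:
  assumes "integrable \<mu> f"
  shows "((\<lambda>k. \<integral>x. indicator {k..} x * (f x :: real) \<partial>\<mu>) \<longlongrightarrow> 0) at_top"
    and "((\<lambda>k. \<integral>x. indicator {k..} x * f x \<partial>\<mu>) \<longlongrightarrow> (\<integral>x. f x \<partial>\<mu>)) at_bot"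
proof -
  have [measurable]: "f \<in> borel_measurable \<mu>" using assms by auto
  show "((\<lambda>k. \<integral>x. indicator {k..} x * f x \<partial>\<mu>) \<longlongrightarrow> 0) at_top"
  proof (rule tendsto_at_topI_sequentially)
    fix u :: "nat \<Rightarrow> real" assume u: "filterlim u at_top sequentially"
    have "(\<lambda>n. \<integral>x. indicator {u n..} x * f x \<partial>\<mu>) \<longlonglongrightarrow> (\<integral>x. 0 \<partial>\<mu>)"
    proof (rule integral_dominated_convergence[where w="\<lambda>x. norm (f x)"])
      show "AE x in \<mu>. (\<lambda>n. indicator {u n..} x * f x) \<longlonglongrightarrow> 0"
      proof (rule AE_I2)
        fix x
        have "eventually (\<lambda>n. u n > x) sequentially"
          using u by (auto simp: filterlim_at_top_dense)
        then show "(\<lambda>n. indicator {u n..} x * f x) \<longlonglongrightarrow> 0"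
          by (intro tendsto_eventually) (auto elim!: eventually_mono)
      qed
    qed (use assms in \<open>auto simp: indicator_def\<close>)
    then show "(\<lambda>n. \<integral>x. indicator {u n..} x * f x \<partial>\<mu>) \<longlonglongrightarrow> 0" by simp
  qed
  show "((\<lambda>k. \<integral>x. indicator {k..} x * f x \<partial>\<mu>) \<longlongrightarrow> (\<integral>x. f x \<partial>\<mu>)) at_bot"
  proof (rule tendsto_at_botI_sequentially)
    fix u :: "nat \<Rightarrow> real" assume u: "filterlim u at_bot sequentially"
    show "(\<lambda>n. \<integral>x. indicator {u n..} x * f x \<partial>\<mu>) \<longlonglongrightarrow> (\<integral>x. f x \<partial>\<mu>)"
    proof (rule integral_dominated_convergence[where w="\<lambda>x. norm (f x)"])
      show "AE x in \<mu>. (\<lambda>n. indicator {u n..} x * f x) \<longlonglongrightarrow> f x"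
      proof (rule AE_I2)
        fix x
        have "eventually (\<lambda>n. u n < x) sequentially"
          using u by (auto simp: filterlim_at_bot_dense)
        then have "eventually (\<lambda>n. indicator {u n..} x * f x = f x) sequentially"
          by (rule eventually_mono) auto
        then show "(\<lambda>n. indicator {u n..} x * f x) \<longlonglongrightarrow> f x"
          by (rule tendsto_eventually)
      qed
    qed (use assms in \<open>auto simp: indicator_def\<close>)
  qed
qed

lemma mass_at_top: "(mass \<longlongrightarrow> 0) at_top" and mass_at_bot: "(mass \<longlongrightarrow> 1) at_bot"
  using tendsto_tail_integral[of "\<lambda>_. 1"] prob_space by (simp_all add: mass_def[abs_def])

lemma moment_at_top: "(moment \<longlongrightarrow> 0) at_top" and moment_at_bot: "(moment \<longlongrightarrow> 0) at_bot"
  using tendsto_tail_integral[OF integrable_id] by (simp_all add: moment_def[abs_def] mean_zero)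

text \<open>As \<open>mass\<close> is continuous and antitone, its zero set is empty or a closed
  ray; the ray contains its left end point and is therefore itself a null set.\<close>

lemma AE_mass_pos: "AE x in \<mu>. mass x > 0"
proof (cases "\<exists>k. mass k = 0")
  case False
  then show ?thesis using mass_nonneg by (auto simp: less_le)
next
  case True
  define K where "K = {k. mass k = 0}"
  have ne: "K \<noteq> {}" using True by (auto simp: K_def)
  have "eventually (\<lambda>k. mass k > 1/2) at_bot"
    by (rule order_tendstoD(1)[OF mass_at_bot]) simp
  then obtain b where b: "mass b > 1/2" by (auto simp: eventually_at_bot_linorder)
  have bd: "bdd_below K"
  proof (rule bdd_belowI)
    fix k assume "k \<in> K"
    then show "b \<le> k" using b mass_antimono[of k b] by (auto simp: K_def intro: ccontr)
  qed
  have "closed K"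
    unfolding K_def using isCont_mass
    by (intro closed_Collect_eq continuous_intros) (simp_all add: continuous_on_eq_continuous_at)
  then have "Inf K \<in> K" using closed_contains_Inf[OF ne bd] by simp
  then have "mass (Inf K) = 0" by (simp add: K_def)
  then have "AE x in \<mu>. x \<notin> {Inf K..}"
    unfolding mass_def by (subst AE_iff_null_sets[symmetric]) (auto simp: null_sets_def emeasure_eq_measure)
  then show ?thesis
  proof eventually_elim
    case (elim x)
    have "mass x \<noteq> 0"
    proof
      assume "mass x = 0"
      then have "Inf K \<le> x" using bd by (intro cInf_lower) (auto simp: K_def)
      with elim show False by simp
    qed
    then show ?case using mass_nonneg[of x] by simp
  qed
qed

text \<open>A law of mean zero cannot be concentrated on the open negative half-line.\<close>

lemma mass_greater_0_if_nonpos: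
  assumes "k \<le> 0" shows "mass k > 0"
proof -
  have "mass 0 > 0"
  proof (rule ccontr)
    assume "\<not> ?thesis"
    then have "mass 0 = 0" using mass_nonneg[of 0] by simp
    then have 1: "AE x in \<mu>. x \<notin> {0..}"
      unfolding mass_def by (subst AE_iff_null_sets[symmetric]) (auto simp: null_sets_def emeasure_eq_measure)
    then have "AE x in \<mu>. 0 \<le> - x" by eventually_elim auto
    then have "AE x in \<mu>. - x = 0"
      using integral_nonneg_eq_0_iff_AE[of \<mu> "\<lambda>x. - x"] integrable_id mean_zero by simp
    with 1 have "AE x in \<mu>. False" by eventually_elim auto
    then show False by (simp add: AE_False prob_space)
  qed
  then show ?thesis using mass_antimono[OF assms] by simp
qed

text \<open>Excludes stopping at time 0 in the Azema--Yor rule: there path and maximum both equal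
  0.\<close>

lemma barycenter_pos_0: "0 < \<beta> 0"
  using barycenter_greater[OF mass_greater_0_if_nonpos[of 0]] by simp

end

subsection \<open>Running maxima of paths with left limits\<close>

text \<open>Compactness by bisection: near each time the one-sided limits bound the path on a
  punctured neighbourhood.\<close>

lemma cadlag_on_bdd_above:
  assumes "cadlag_on T x"
  shows "bdd_above (x ` {0..T})"
proof (cases "0 \<le> T")
  case False
  then show ?thesis by simp
next
  case True
  define P where "P a b \<longleftrightarrow> bdd_above (x ` ({a..b} \<inter> {0..T}))" for a b
  have "P 0 T"
    using True
  proof (induct rule: Bolzano)
    case (trans a b c)
    then have *: "{a..c} \<inter> {0..T} = ({a..b} \<inter> {0..T}) \<union> ({b..c} \<inter> {0..T})" by auto
    show ?case using trans(1,2) unfolding P_def * image_Un by (intro bdd_above_Un[THEN iffD2] conjI)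
  next
    case (local t)
    have "\<exists>r>t. \<exists>B. \<forall>s. t < s \<and> s < r \<and> s \<le> T \<longrightarrow> x s \<le> B"
    proof (cases "t < T")
      case True
      then have "(x \<longlongrightarrow> x t) (at_right t)"
        using assms local by (auto simp: cadlag_on_def)
      then have "eventually (\<lambda>s. x s < x t + 1) (at_right t)"
        by (rule order_tendstoD) simp
      then show ?thesis
        using gt_ex[of t] by (auto simp: eventually_at_right[OF gt_ex[THEN someI_ex]] intro: less_imp_le)
    next
      case False
      then show ?thesis by (intro exI[of _ "t + 1"]) auto
    qed
    then obtain r B where r: "r > t" "\<And>s. t < s \<Longrightarrow> s < r \<Longrightarrow> s \<le> T \<Longrightarrow> x s \<le> B" by blast
    have "\<exists>l<t. \<exists>B. \<forall>s. l < s \<and> s < t \<and> 0 \<le> s \<longrightarrow> x s \<le> B"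
    proof (cases "0 < t")
      case True
      then obtain y where "(x \<longlongrightarrow> y) (at_left t)"
        using assms local by (force simp: cadlag_on_def)
      then have "eventually (\<lambda>s. x s < y + 1) (at_left t)"
        by (rule order_tendstoD) simp
      then show ?thesis
        using True by (auto simp: eventually_at_left[of 0 t] intro: less_imp_le)
    next
      case False
      then show ?thesis by (intro exI[of _ "t - 1"]) auto
    qed
    then obtain l C where l: "l < t" "\<And>s. l < s \<Longrightarrow> s < t \<Longrightarrow> 0 \<le> s \<Longrightarrow> x s \<le> C" by blast
    show ?case
    proof (intro exI[of _ "min (r - t) (t - l)"] conjI allI impI)
      show "0 < min (r - t) (t - l)" using r l by simp
      fix a b assume ab: "a \<le> t \<and> t \<le> b \<and> b - a < min (r - t) (t - l)"
      show "P a b"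
        unfolding P_def
      proof (rule bdd_aboveI2)
        fix s assume s: "s \<in> {a..b} \<inter> {0..T}"
        consider "s < t" | "s = t" | "t < s" by linarith
        then show "x s \<le> max (x t) (max B C)"
        proof cases
          case 1 then show ?thesis using l(2)[of s] s ab by (auto simp: le_max_iff_disj)
        next
          case 3 then show ?thesis using r(2)[of s] s ab by (auto simp: le_max_iff_disj)
        qed auto
      qed
    qed
  qed
  then show ?thesis by (simp add: P_def)
qed

lemma running_max_upper:
  assumes "cadlag_on T (\<lambda>t. X t \<xi>)" "0 \<le> t" "t \<le> T"
  shows "X t \<xi> \<le> running_max X T \<xi>"
  unfolding running_max_def using assms
  by (intro cSUP_upper cadlag_on_bdd_above) auto

text \<open>The end point is added by hand, since right-continuity offers no rational approximation
  of \<open>T\<close> inside the interval.\<close>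

definition rational_times :: "real \<Rightarrow> real set" where
  "rational_times T = insert T (\<rat> \<inter> {0..T})"

lemma countable_rational_times [simp]: "countable (rational_times T)"
  by (auto simp: rational_times_def intro: countable_subset[OF _ countable_rat])

lemma rational_times_subset: "0 \<le> T \<Longrightarrow> rational_times T \<subseteq> {0..T}"
  by (auto simp: rational_times_def)

lemma rational_times_nonempty [simp]: "rational_times T \<noteq> {}"
  by (auto simp: rational_times_def)

lemma running_max_eq_rational:
  assumes "cadlag_on T (\<lambda>t. X t \<xi>)" "0 \<le> T"
  shows "running_max X T \<xi> = (SUP t\<in>rational_times T. X t \<xi>)"
  unfolding running_max_def
proof (rule antisym)
  have bdd: "bdd_above ((\<lambda>t. X t \<xi>) ` {0..T})"
    by (rule cadlag_on_bdd_above[OF assms(1)])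
  then have bdd': "bdd_above ((\<lambda>t. X t \<xi>) ` rational_times T)"
    by (rule bdd_above_mono) (use rational_times_subset[OF assms(2)] in auto)
  show "(SUP t\<in>rational_times T. X t \<xi>) \<le> (SUP t\<in>{0..T}. X t \<xi>)"
    using rational_times_subset[OF assms(2)] bdd by (intro cSUP_subset_mono) auto
  show "(SUP t\<in>{0..T}. X t \<xi>) \<le> (SUP t\<in>rational_times T. X t \<xi>)" (is "_ \<le> ?S")
  proof (rule cSUP_least)
    fix t assume t: "t \<in> {0..T}"
    show "X t \<xi> \<le> ?S"
    proof (rule ccontr)
      assume contr: "\<not> ?thesis"
      have "t \<noteq> T"
      proof
        assume "t = T"
        then have "X t \<xi> \<le> ?S" using bdd' by (intro cSUP_upper) (auto simp: rational_times_def)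
        with contr show False by simp
      qed
      with t have tT: "t < T" by auto
      then have "((\<lambda>t. X t \<xi>) \<longlongrightarrow> X t \<xi>) (at_right t)"
        using assms t by (auto simp: cadlag_on_def)
      then have "eventually (\<lambda>s. ?S < X s \<xi>) (at_right t)"
        using contr by (intro order_tendstoD) auto
      then obtain b where b: "b > t" "\<And>s. t < s \<Longrightarrow> s < b \<Longrightarrow> ?S < X s \<xi>"
        using tT by (auto simp: eventually_at_right[of t T])
      obtain q where q: "q \<in> \<rat>" "t < q" "q < min b T"
        using Rats_dense_in_real[of t "min b T"] b tT by auto
      have "X q \<xi> \<le> ?S"
        using bdd' q t by (intro cSUP_upper) (auto simp: rational_times_def)
      with b(2)[of q] q show False by simp
    qed
  qed (use assms in auto)
qed

lemma borel_measurable_running_max: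
  assumes "\<And>\<xi>. \<xi> \<in> space N \<Longrightarrow> cadlag_on T (\<lambda>t. X t \<xi>)"
    and "\<And>t. 0 \<le> t \<Longrightarrow> t \<le> T \<Longrightarrow> X t \<in> borel_measurable N" "0 \<le> T"
  shows "running_max X T \<in> borel_measurable N"
proof -
  have "(\<lambda>\<xi>. SUP t\<in>rational_times T. X t \<xi>) \<in> borel_measurable N"
  proof (rule borel_measurable_cSUP)
    fix t assume "t \<in> rational_times T"
    then show "X t \<in> borel_measurable N" using rational_times_subset[OF assms(3)] by (intro assms(2)) auto
  next
    fix \<xi> assume "\<xi> \<in> space N"
    then show "bdd_above ((\<lambda>t. X t \<xi>) ` rational_times T)"
      using rational_times_subset[OF assms(3)]
      by (intro bdd_above_mono[OF cadlag_on_bdd_above[OF assms(1)]]) auto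
  qed simp
  then show ?thesis
    by (rule measurable_cong[THEN iffD1, rotated]) (simp add: running_max_eq_rational assms)
qed

subsection \<open>Doob's maximal inequality\<close>

lemma martingale_on_integral:
  assumes "martingale_on P T \<F> X" "prob_space P" "s \<in> {0..T}" "t \<in> {s..T}" "A \<in> sets (\<F> s)"
  shows "(\<integral>\<xi>. indicator A \<xi> * X t \<xi> \<partial>P) = (\<integral>\<xi>. indicator A \<xi> * X s \<xi> \<partial>P)"
proof -
  interpret prob_space P by fact
  have t: "t \<in> {0..T}" using assms(3,4) by auto
  have sub: "subalgebra P (\<F> s)" and int: "integrable P (X t)" "integrable P (X s)"
    and ae: "AE \<xi> in P. real_cond_exp P (\<F> s) (X t) \<xi> = X s \<xi>"
    using assms t by (auto simp: martingale_on_def)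
  interpret sigma_finite_subalgebra P "\<F> s"
    by (intro finite_measure_subalgebra_is_sigma_finite)
       (simp add: finite_measure_subalgebra_def finite_measure_subalgebra_axioms_def sub finite_measure_axioms)
  have [measurable]: "A \<in> sets P" using sub assms(5) by (auto simp: subalgebra_def)
  have [measurable]: "X s \<in> borel_measurable P" using int by auto
  have "(\<integral>\<xi>. indicator A \<xi> * X t \<xi> \<partial>P) = (\<integral>\<xi>. indicator A \<xi> * real_cond_exp P (\<F> s) (X t) \<xi> \<partial>P)"
    using real_cond_exp_intA[OF int(1) assms(5)] by (simp add: set_lebesgue_integral_def)
  also have "\<dots> = (\<integral>\<xi>. indicator A \<xi> * X s \<xi> \<partial>P)"
    by (intro integral_cong_AE) (use ae in auto)
  finally show ?thesis .
qed

lemma martingale_on_measurable: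
  assumes "martingale_on P T \<F> X" "0 \<le> t" "t \<le> T"
  shows "X t \<in> borel_measurable P"
  using assms by (auto simp: martingale_on_def intro: measurable_from_subalg)

text \<open>Induction on the largest time. A new latest time \<open>t\<close> enlarges the event by
  the paths that exceed \<open>u\<close> at \<open>t\<close> for the first time. This part is known
  at time \<open>t\<close>, so that on it \<open>X t\<close> may be exchanged for
  \<open>X T\<close>.\<close>

lemma doob_maximal_finite:
  assumes M: "martingale_on P T \<F> X" and P: "prob_space P"
    and "finite J" "J \<subseteq> {0..T}" "0 \<le> T"
  shows "u * measure P {\<xi>\<in>space P. \<exists>t\<in>J. X t \<xi> > u} \<le>
    (\<integral>\<xi>. indicator {\<xi>\<in>space P. \<exists>t\<in>J. X t \<xi> > u} \<xi> * X T \<xi> \<partial>P)"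
  using assms(3,4)
proof (induction J rule: finite_linorder_max_induct)
  case empty
  then show ?case by simp
next
  case (insert t J)
  interpret prob_space P by fact
  let ?A = "\<lambda>J. {\<xi>\<in>space P. \<exists>t\<in>J. X t \<xi> > u}"
  let ?B = "?A {t} - ?A J"
  have t: "t \<in> {0..T}" using insert by auto
  interpret filtration "space P" \<F> using M by (simp add: martingale_on_def)
  have m: "X s \<in> borel_measurable (\<F> t)" if "s \<in> insert t J" for s
  proof -
    have "s \<in> {0..T}" "s \<le> t" using insert that by auto
    then have "X s \<in> borel_measurable (\<F> s)" "sets (\<F> s) \<subseteq> sets (\<F> t)"
      using M sets_F_mono by (auto simp: martingale_on_def)
    then show ?thesis using space_F by (auto simp: measurable_def)
  qed
  have AF: "?A J' \<in> sets (\<F> t)" if "J' \<subseteq> insert t J" for J'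
  proof -
    have "?A J' = (\<Union>s\<in>J'. {\<xi>\<in>space (\<F> t). X s \<xi> > u})" by (auto simp: space_F)
    moreover have "\<dots> \<in> sets (\<F> t)"
    proof (intro sets.finite_UN)
      show "finite J'" using that insert(1) by (auto intro: finite_subset)
      fix s assume "s \<in> J'"
      then have [measurable]: "X s \<in> borel_measurable (\<F> t)" using that m by auto
      show "{\<xi>\<in>space (\<F> t). X s \<xi> > u} \<in> sets (\<F> t)" by measurable
    qed
    ultimately show ?thesis by simp
  qed
  have sub: "sets (\<F> t) \<subseteq> sets P" using M t by (auto simp: martingale_on_def subalgebra_def)
  have BF: "?B \<in> sets (\<F> t)" by (intro sets.Diff AF) auto
  have [simp]: "?A J \<in> sets P" "?B \<in> sets P" using AF[of J] BF sub by auto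
  have int: "integrable P (X s)" if "s \<in> {0..T}" for s using M that by (auto simp: martingale_on_def)
  have int': "integrable P (\<lambda>\<xi>. indicator C \<xi> * X s \<xi>)" if "s \<in> {0..T}" "C \<in> sets P" for s C
    using integrable_mult_indicator[OF that(2) int[OF that(1)]] by simp
  have un: "?A (insert t J) = ?A J \<union> ?B" by auto
  have "?B \<inter> space P = ?B" by auto
  then have "u * measure P ?B = (\<integral>\<xi>. indicator ?B \<xi> * u \<partial>P)" by simp
  also have "\<dots> \<le> (\<integral>\<xi>. indicator ?B \<xi> * X t \<xi> \<partial>P)"
  proof (rule integral_mono)
    show "integrable P (\<lambda>\<xi>. indicator ?B \<xi> * X t \<xi>)" by (rule int'[OF t \<open>?B \<in> sets P\<close>])
    show "integrable P (\<lambda>\<xi>. indicator ?B \<xi> * u)"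
      by (intro integrable_mult_left)
         (rule integrable_real_indicator[OF \<open>?B \<in> sets P\<close>], simp add: emeasure_eq_measure)
  qed (auto simp: indicator_def)
  also have "\<dots> = (\<integral>\<xi>. indicator ?B \<xi> * X T \<xi> \<partial>P)"
    using martingale_on_integral[OF M P t _ BF, of T] t by simp
  finally have "u * measure P ?B \<le> (\<integral>\<xi>. indicator ?B \<xi> * X T \<xi> \<partial>P)" .
  moreover have "measure P (?A (insert t J)) = measure P (?A J) + measure P ?B"
    unfolding un by (rule finite_measure_Union[OF \<open>?A J \<in> sets P\<close> \<open>?B \<in> sets P\<close>]) blast
  moreover have "(\<integral>\<xi>. indicator (?A (insert t J)) \<xi> * X T \<xi> \<partial>P) =
      (\<integral>\<xi>. indicator (?A J) \<xi> * X T \<xi> + indicator ?B \<xi> * X T \<xi> \<partial>P)"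
    unfolding un by (intro Bochner_Integration.integral_cong refl) (auto simp: indicator_def)
  moreover have "\<dots> = (\<integral>\<xi>. indicator (?A J) \<xi> * X T \<xi> \<partial>P) + (\<integral>\<xi>. indicator ?B \<xi> * X T \<xi> \<partial>P)"
    using \<open>0 \<le> T\<close> by (intro Bochner_Integration.integral_add int' \<open>?A J \<in> sets P\<close> \<open>?B \<in> sets P\<close>) auto
  ultimately show ?case
    using insert by (simp add: distrib_left)
qed

text \<open>Finite sets \<open>J n\<close> exhaust the rational times. Thanks to the strict
  inequality the finite events increase exactly to the event for the supremum.\<close>

lemma doob_maximal:
  assumes "admissible T \<mu> P X" "0 < T"
  shows "u * measure P {\<xi>\<in>space P. running_max X T \<xi> > u} \<le>
    (\<integral>\<xi>. indicator {\<xi>\<in>space P. running_max X T \<xi> > u} \<xi> * X T \<xi> \<partial>P)"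
proof -
  interpret prob_space P using assms by (simp add: admissible_def)
  obtain \<F> where M: "martingale_on P T \<F> X" using assms by (auto simp: admissible_def)
  have cad: "\<And>\<xi>. \<xi> \<in> space P \<Longrightarrow> cadlag_on T (\<lambda>t. X t \<xi>)" using assms by (auto simp: admissible_def)
  define J where "J n = from_nat_into (rational_times T) ` {..n::nat}" for n
  have J: "finite (J n)" "J n \<subseteq> {0..T}" for n
    using rational_times_subset[of T] assms(2) from_nat_into[of "rational_times T"]
    by (auto simp: J_def)
  have Jun: "(\<Union>n. J n) = rational_times T"
  proof -
    have "(\<Union>n. f ` {..n::nat}) = range f" for f :: "nat \<Rightarrow> real" by auto
    then show ?thesis by (simp add: J_def)
  qed
  let ?A = "\<lambda>n. {\<xi>\<in>space P. \<exists>t\<in>J n. X t \<xi> > u}"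
  let ?S = "{\<xi>\<in>space P. running_max X T \<xi> > u}"
  have [measurable]: "X t \<in> borel_measurable P" if "t \<in> {0..T}" for t
    using martingale_on_measurable[OF M] that by auto
  have [measurable]: "X T \<in> borel_measurable P" using assms by simp
  have intT: "integrable P (X T)" using M assms by (auto simp: martingale_on_def)
  have A[measurable]: "?A n \<in> sets P" for n
  proof -
    have "?A n = (\<Union>s\<in>J n. {\<xi>\<in>space P. X s \<xi> > u})" by auto
    also have "\<dots> \<in> sets P" using J[of n] by (intro sets.finite_UN) auto
    finally show ?thesis .
  qed
  have inc: "incseq ?A" by (auto simp: incseq_def J_def)
  have Sun: "?S = (\<Union>n. ?A n)"
  proof -
    have "u < running_max X T \<xi> \<longleftrightarrow> (\<exists>t\<in>rational_times T. u < X t \<xi>)" if w: "\<xi> \<in> space P" for \<xi>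
    proof -
      have "bdd_above ((\<lambda>t. X t \<xi>) ` rational_times T)"
        using rational_times_subset[of T] assms(2)
        by (intro bdd_above_mono[OF cadlag_on_bdd_above[OF cad[OF w]]]) auto
      then show ?thesis
        using assms(2) by (simp add: running_max_eq_rational[of T X \<xi>] cad[OF w] less_cSUP_iff)
    qed
    then show ?thesis by (auto simp flip: Jun)
  qed
  have [measurable]: "?S \<in> sets P" unfolding Sun by measurable
  have "(\<lambda>n. u * measure P (?A n)) \<longlonglongrightarrow> u * measure P ?S"
    unfolding Sun using A inc by (intro tendsto_intros finite_Lim_measure_incseq) auto
  moreover have "(\<lambda>n. \<integral>\<xi>. indicator (?A n) \<xi> * X T \<xi> \<partial>P) \<longlonglongrightarrow> (\<integral>\<xi>. indicator ?S \<xi> * X T \<xi> \<partial>P)"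
  proof (rule integral_dominated_convergence[where w="\<lambda>\<xi>. \<bar>X T \<xi>\<bar>"])
    show "AE \<xi> in P. (\<lambda>n. indicator (?A n) \<xi> * X T \<xi>) \<longlonglongrightarrow> indicator ?S \<xi> * X T \<xi>"
      unfolding Sun by (intro AE_I2 tendsto_intros LIMSEQ_indicator_incseq inc)
  qed (use intT in \<open>auto simp: indicator_def\<close>)
  ultimately show ?thesis
    using doob_maximal_finite[OF M prob_space_axioms J] assms(2)
    by (intro LIMSEQ_le) auto
qed

subsection \<open>Domination of the maximum by the barycenter\<close>

context atomless_target
begin

text \<open>Let \<open>k0\<close> be the left end of the region where \<beta> exceeds
  \<open>u\<close>. By continuity \<open>\<beta> k0 \<le> u\<close>, and the hypothesis yields (u -
  k0) Q(A) \<le> E (W - k0)^+ = call k0 \<le> (u - k0) mass k0. Two cases are degenerate: if the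
  region is empty, \<open>u\<close> is not below the right end of the support and \<open>A\<close>
  is null; if it is unbounded below, the right-hand side is 1.\<close>

lemma barycenter_domination:
  assumes Q: "prob_space Q" and W[measurable]: "W \<in> borel_measurable Q" and law: "distr Q borel W = \<mu>"
    and A[measurable]: "A \<in> sets Q" and ineq: "u * measure Q A \<le> (\<integral>\<xi>. indicator A \<xi> * W \<xi> \<partial>Q)"
  shows "measure Q A \<le> measure \<mu> {w. \<beta> w > u}"
proof -
  interpret Q: prob_space Q by fact
  have [measurable]: "{w. \<beta> w > u} \<in> sets borel" by measurable
  have intW: "integrable Q W"
    using integrable_id unfolding law[symmetric] by (subst (asm) integrable_distr_eq) auto
  have intA: "integrable Q (\<lambda>\<xi>. indicator A \<xi> * W \<xi>)"
    using integrable_mult_indicator[OF A intW] by simp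
  have indW: "(\<integral>\<xi>. indicator A \<xi> * (W \<xi> - k) \<partial>Q) = (\<integral>\<xi>. indicator A \<xi> * W \<xi> \<partial>Q) - k * measure Q A" for k
    using intA by (simp add: right_diff_distrib Bochner_Integration.integral_diff integrable_indicator_iff Q.emeasure_eq_measure)
  have intAk: "integrable Q (\<lambda>\<xi>. indicator A \<xi> * (W \<xi> - k))" for k
    using intA by (simp add: right_diff_distrib integrable_indicator_iff Q.emeasure_eq_measure)
  define K where "K = {k. mass k > 0 \<and> \<beta> k > u}"
  have down: "k' \<in> K" if "k \<in> K" "k \<le> k'" "mass k' > 0" for k k'
    using that barycenter_mono[of k k'] by (auto simp: K_def)
  show ?thesis
  proof (cases "K = {}")
    case True
    then have "\<not> mass u > 0" using barycenter_greater[of u] by (auto simp: K_def)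
    then have "mass u = 0" using mass_nonneg[of u] by simp
    then have "AE x in \<mu>. x \<notin> {u..}"
      unfolding mass_def by (subst AE_iff_null_sets[symmetric]) (auto simp: null_sets_def emeasure_eq_measure)
    then have Wu: "AE \<xi> in Q. W \<xi> < u"
      unfolding law[symmetric] by (subst (asm) AE_distr_iff) (auto simp: not_le)
    have "(\<integral>\<xi>. indicator A \<xi> * (u - W \<xi>) \<partial>Q) = u * measure Q A - (\<integral>\<xi>. indicator A \<xi> * W \<xi> \<partial>Q)"
      using intA by (simp add: right_diff_distrib Bochner_Integration.integral_diff integrable_indicator_iff Q.emeasure_eq_measure)
    moreover have "(\<integral>\<xi>. indicator A \<xi> * (u - W \<xi>) \<partial>Q) \<ge> 0"
      by (intro integral_nonneg_AE) (use Wu in \<open>auto simp: indicator_def\<close>)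
    ultimately have "(\<integral>\<xi>. indicator A \<xi> * (u - W \<xi>) \<partial>Q) = 0" using ineq by simp
    moreover have "integrable Q (\<lambda>\<xi>. indicator A \<xi> * (u - W \<xi>))"
      using intA by (simp add: right_diff_distrib integrable_indicator_iff Q.emeasure_eq_measure)
    moreover have "AE \<xi> in Q. 0 \<le> indicator A \<xi> * (u - W \<xi>)"
      using Wu by eventually_elim (auto simp: indicator_def)
    ultimately have "AE \<xi> in Q. indicator A \<xi> * (u - W \<xi>) = 0"
      using integral_nonneg_eq_0_iff_AE by blast
    with Wu have "AE \<xi> in Q. \<xi> \<notin> A"
      by eventually_elim (auto simp: indicator_def split: if_splits)
    then have "measure Q A = 0"
      by (subst measure_eq_0_null_sets) (auto simp: AE_iff_null_sets)
    then show ?thesis by simp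
  next
    case ne: False
    show ?thesis
    proof (cases "bdd_below K")
      case False
      have "AE w in \<mu>. w \<in> {w. \<beta> w > u}"
        using AE_mass_pos
      proof eventually_elim
        case (elim w)
        from False obtain k where "k \<in> K" "k < w"
          by (auto simp: bdd_below_def not_le)
        then have "w \<in> K" using down[of k w] elim by auto
        then show ?case by (simp add: K_def)
      qed
      then have "measure \<mu> {w. \<beta> w > u} = 1"
        by (intro prob_eq_1[THEN iffD2]) auto
      then show ?thesis by simp
    next
      case bdd: True
      define k0 where "k0 = Inf K"
      have k0: "k0 \<le> k" if "k \<in> K" for k using bdd that by (auto simp: k0_def intro: cInf_lower)
      have mk0: "mass k0 > 0"
        using ne k0 mass_antimono by (force simp: K_def)
      have "\<beta> k0 \<le> u"
      proof (rule ccontr)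
        assume "\<not> \<beta> k0 \<le> u"
        then have "eventually (\<lambda>k. \<beta> k > u) (at k0)"
          using isCont_barycenter[OF mk0] by (intro order_tendstoD) (auto simp: isCont_def)
        then have "eventually (\<lambda>k. \<beta> k > u) (at_left k0)"
          by (rule filter_leD[rotated]) (simp add: at_le)
        moreover have "eventually (\<lambda>k. k < k0) (at_left k0)" by (simp add: eventually_at_filter)
        ultimately have "eventually (\<lambda>k. \<beta> k > u \<and> k < k0) (at_left k0)" by eventually_elim simp
        then obtain k where k: "\<beta> k > u" "k < k0"
          using eventually_happens[of _ "at_left k0"] by (auto simp: trivial_limit_at_left_real)
        then have "k \<in> K" using mk0 mass_antimono[of k k0] by (auto simp: K_def)
        with k0[of k] k show False by simp
      qed
      with barycenter_greater[OF mk0] have uk: "u > k0" by simp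
      have "(u - k0) * measure Q A \<le> (\<integral>\<xi>. indicator A \<xi> * (W \<xi> - k0) \<partial>Q)"
        unfolding indW using ineq by (simp add: algebra_simps)
      also have "\<dots> \<le> (\<integral>\<xi>. max 0 (W \<xi> - k0) \<partial>Q)"
        using intAk intW by (intro integral_mono) (auto simp: indicator_def)
      also have "\<dots> = call k0"
        unfolding call_eq using integral_distr[of W Q borel "\<lambda>x. max 0 (x - k0)"] by (simp add: law)
      also have "\<dots> \<le> (u - k0) * mass k0"
        unfolding call_eq_barycenter using \<open>\<beta> k0 \<le> u\<close> mk0 by (intro mult_right_mono) auto
      finally have "measure Q A \<le> mass k0" using uk by simp
      also have "mass k0 \<le> measure \<mu> {w. \<beta> w > u}"
        unfolding mass_def
      proof (rule finite_measure_mono_AE)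
        show "AE x in \<mu>. x \<in> {k0..} \<longrightarrow> x \<in> {w. \<beta> w > u}"
          using AE_mass_pos AE_neq[of k0]
        proof eventually_elim
          case (elim w)
          show ?case
          proof
            assume "w \<in> {k0..}"
            with elim have "k0 < w" by auto
            then obtain k where "k \<in> K" "k < w" using ne cInf_lessD[of K w] by (auto simp: k0_def)
            then have "w \<in> K" using down[of k w] elim by auto
            then show "w \<in> {w. \<beta> w > u}" by (simp add: K_def)
          qed
        qed
      qed simp
      finally show ?thesis .
    qed
  qed
qed

end

subsection \<open>The payoff clamped at the ridge\<close>

lemma usc_imp_borel_measurable:
  fixes f :: "'a::topological_space \<Rightarrow> real"
  assumes "usc f"
  shows "f \<in> borel_measurable borel"
proof (rule borel_measurableI_less)
  fix c
  have "open {x. f x < c}"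
    using assms by (subst open_subopen) (auto simp: usc_def eventually_nhds subset_eq)
  then show "{x \<in> space borel. f x < c} \<in> sets borel" by simp
qed

text \<open>A telescoping sum over the cells already entered. The cell containing \<open>x\<close>
  counts in full, so the sum ends at the first grid point at or above \<open>x\<close>. It serves
  both the layered payoff and the discretized stopping rule.\<close>

lemma sum_levels:
  fixes f :: "nat \<Rightarrow> real"
  assumes "0 \<le> x"
  shows "(\<Sum>i<M. (if real i < x then f (Suc i) - f i else 0)) = f (min M (nat \<lceil>x\<rceil>)) - f 0"
proof (induction M)
  case (Suc M)
  show ?case
  proof (cases "real M < x")
    case True
    then have "M < nat \<lceil>x\<rceil>" by (simp add: zless_nat_eq_int_zless less_ceiling_iff)
    then show ?thesis using Suc True by (simp add: min_def)
  next
    case False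
    then have "nat \<lceil>x\<rceil> \<le> M" by (simp add: nat_le_iff ceiling_le_iff)
    then show ?thesis using Suc False by (simp add: min_absorb2)
  qed
qed simp

section \<open>Supermodular payoffs with a ridge\<close>

locale serrated_payoff =
  fixes F :: "real \<Rightarrow> real \<Rightarrow> real" and a :: "real \<Rightarrow> ereal"
  assumes usc: "usc (\<lambda>(w, s). F w s)"
    and supermodular: "strictly_supermodular F"
    and serrated: "serrated_with_ridge F a"
begin

lemma supermodularD:
  assumes "w1 \<le> w2" "s1 \<le> s2"
  shows "F w1 s2 - F w1 s1 \<le> F w2 s2 - F w2 s1"
proof (cases "w1 = w2 \<or> s1 = s2")
  case False
  then have "w1 < w2" "s1 < s2" using assms by auto
  then have "F w1 s1 + F w2 s2 > F w1 s2 + F w2 s1" using supermodular unfolding strictly_supermodular_def by blast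
  then show ?thesis by linarith
qed auto

lemma usc_section:
  assumes "F w s < c"
  shows "eventually (\<lambda>y. F w y < c) (nhds s)"
proof -
  have "eventually (\<lambda>p. (\<lambda>(w, s). F w s) p < c) (nhds (w, s))"
    using usc assms unfolding usc_def by (metis case_prod_conv)
  moreover have "filterlim (\<lambda>y. (w, y)) (nhds (w, s)) (nhds s)"
    by (intro tendsto_Pair tendsto_const filterlim_ident)
  ultimately have "eventually (\<lambda>y. (\<lambda>(w, s). F w s) (w, y) < c) (nhds s)"
    by (rule eventually_compose_filterlim)
  then show ?thesis by simp
qed

text \<open>Serratedness is silent about the ridge point itself. Upper semicontinuity forbids a drop
  there and extends the monotonicity to the closed side.\<close>

lemma up:
  assumes "s \<le> s'" "ereal s' \<le> a w"
  shows "F w s \<le> F w s'"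
proof (cases "ereal s' < a w")
  case True
  have "ereal s \<le> ereal s'" using assms by simp
  with True have "ereal s < a w" by (rule le_less_trans[rotated])
  then show ?thesis
    using serrated assms True unfolding serrated_with_ridge_def mono_on_def by auto
next
  case False
  show ?thesis
  proof (rule ccontr)
    assume "\<not> ?thesis"
    then have lt: "F w s' < F w s" and "s < s'" using assms by (auto simp: not_le less_le)
    have "eventually (\<lambda>y. F w y < F w s) (at_left s')"
      using usc_section[OF lt] by (auto simp: eventually_at_filter elim: eventually_mono)
    then obtain b where b: "b < s'" "\<And>y. b < y \<Longrightarrow> y < s' \<Longrightarrow> F w y < F w s"
      using \<open>s < s'\<close> by (auto simp: eventually_at_left[of s s'])
    obtain y where y: "max b s < y" "y < s'" using dense[of "max b s" s'] b \<open>s < s'\<close> by auto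
    then have "ereal y < a w" using assms(2) by (meson less_ereal.simps(1) less_le_trans)
    moreover have "ereal s < a w" using assms(2) \<open>s < s'\<close> by (meson less_ereal.simps(1) less_le_trans)
    ultimately have "F w s \<le> F w y"
      using serrated y unfolding serrated_with_ridge_def mono_on_def by auto
    with b(2)[of y] y show False by simp
  qed
qed

lemma down:
  assumes "s \<le> s'" "a w \<le> ereal s"
  shows "F w s' \<le> F w s"
proof (cases "a w < ereal s")
  case True
  have "ereal s \<le> ereal s'" using assms by simp
  with True have "a w < ereal s'" by (rule less_le_trans)
  then show ?thesis
    using serrated assms True unfolding serrated_with_ridge_def monotone_on_def by auto
next
  case False
  show ?thesis
  proof (rule ccontr)
    assume "\<not> ?thesis"
    then have lt: "F w s < F w s'" and "s < s'" using assms by (auto simp: not_le less_le)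
    have "eventually (\<lambda>y. F w y < F w s') (at_right s)"
      using usc_section[OF lt] by (auto simp: eventually_at_filter elim: eventually_mono)
    then obtain b where b: "b > s" "\<And>y. s < y \<Longrightarrow> y < b \<Longrightarrow> F w y < F w s'"
      using \<open>s < s'\<close> by (auto simp: eventually_at_right[of s s'])
    obtain y where y: "s < y" "y < min b s'" using dense[of s "min b s'"] b \<open>s < s'\<close> by auto
    then have "a w < ereal y" using assms(2) by (meson less_ereal.simps(1) le_less_trans)
    moreover have "a w < ereal s'" using assms(2) \<open>s < s'\<close> by (meson less_ereal.simps(1) le_less_trans)
    ultimately have "F w s' \<le> F w y"
      using serrated y unfolding serrated_with_ridge_def monotone_on_def by auto
    with b(2)[of y] y show False by simp
  qed
qed

text \<open>If the ridge decreased, there would be two levels between which \<open>F w1\<close> does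
  not fall and \<open>F w2\<close> does not rise; strict supermodularity excludes exactly
  this.\<close>

lemma ridge_mono:
  assumes "w1 \<le> w2"
  shows "a w1 \<le> a w2"
proof (rule ccontr)
  assume "\<not> ?thesis"
  then have lt: "a w2 < a w1" by simp
  with assms have "w1 < w2" by (auto simp: less_le)
  obtain s2 where s2: "a w2 < ereal s2" "ereal s2 < a w1" using ereal_dense2[OF lt] by auto
  obtain s1 where s1: "a w2 < ereal s1" "ereal s1 < ereal s2" using ereal_dense2[OF s2(1)] by auto
  have "F w1 s1 \<le> F w1 s2" using s1 s2 by (intro up) auto
  moreover have "F w2 s2 \<le> F w2 s1" using s1 s2 by (intro down) auto
  moreover have "F w1 s1 + F w2 s2 > F w1 s2 + F w2 s1"
    using supermodular \<open>w1 < w2\<close> s1 unfolding strictly_supermodular_def by auto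
  ultimately show False by simp
qed

lemma borel_measurable_ridge [measurable]: "a \<in> borel_measurable borel"
proof (rule borel_measurableI_greater)
  fix y
  have "is_interval {w. y < a w}"
    unfolding is_interval_1 using ridge_mono by (auto intro: less_le_trans)
  then show "{w \<in> space borel. y < a w} \<in> sets borel"
    by (simp add: real_interval_borel_measurable)
qed

text \<open>
  The competing maximum may be cut off at \<open>max (a w) 0 w\<close> without loss, and on what remains
  the payoff is nondecreasing in \<open>s\<close>; \<open>h w\<close> is its constant continuation to all of \<open>\<real>\<close>.
\<close>

definition c :: "real \<Rightarrow> ereal" where
  "c w = max (a w) (max 0 (ereal w))"

definition cl :: "real \<Rightarrow> real \<Rightarrow> real" where
  "cl w s = real_of_ereal (min (ereal (max s (max 0 w))) (c w))"

definition h :: "real \<Rightarrow> real \<Rightarrow> real" where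
  "h w s = F w (cl w s)"

lemma max0_le_c: "ereal (max 0 w) \<le> c w"
  by (auto simp: c_def max_def zero_ereal_def)

lemma c_cases: "c w = a w \<and> ereal (max 0 w) \<le> a w \<or> c w = ereal (max 0 w) \<and> a w \<le> ereal (max 0 w)"
  by (auto simp: c_def max_def zero_ereal_def)

lemma ereal_cl: "ereal (cl w s) = min (ereal (max s (max 0 w))) (c w)"
proof -
  have "\<bar>min (ereal (max s (max 0 w))) (c w)\<bar> \<noteq> \<infinity>"
    using max0_le_c[of w] by (cases "c w") (auto simp: min_def simp del: ereal_max)
  then show ?thesis by (simp add: cl_def ereal_real')
qed

lemma cl_le_c: "ereal (cl w s) \<le> c w"
  by (simp add: ereal_cl)

lemma cl_ge: "max 0 w \<le> cl w s"
proof -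
  have "ereal (max 0 w) \<le> ereal (cl w s)"
    unfolding ereal_cl using max0_le_c[of w] by (simp del: ereal_max)
  then show ?thesis by (simp del: ereal_max)
qed

lemma cl_le: "cl w s \<le> max s (max 0 w)"
proof -
  have "ereal (cl w s) \<le> ereal (max s (max 0 w))" unfolding ereal_cl by (simp del: ereal_max)
  then show ?thesis by (simp del: ereal_max)
qed

lemma cl_mono: "s \<le> s' \<Longrightarrow> cl w s \<le> cl w s'"
proof -
  assume "s \<le> s'"
  then have "ereal (cl w s) \<le> ereal (cl w s')"
    unfolding ereal_cl by (intro min.mono) (auto simp: max.coboundedI1 simp del: ereal_max)
  then show ?thesis by simp
qed

lemma cl_id: "max 0 w \<le> s \<Longrightarrow> ereal s \<le> c w \<Longrightarrow> cl w s = s"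
  using ereal_cl[of w s] by (simp add: max_absorb1 min_absorb1 del: ereal_max)

lemma cl_const: "c w \<le> ereal s \<Longrightarrow> s \<le> s' \<Longrightarrow> cl w s' = cl w s"
proof -
  assume *: "c w \<le> ereal s" "s \<le> s'"
  then have "c w \<le> ereal (max s (max 0 w))" "c w \<le> ereal (max s' (max 0 w))"
    by (auto simp: max_def elim: order_trans)
  then show ?thesis by (simp add: cl_def min_absorb2 del: ereal_max)
qed

lemma F_mono_cl:
  assumes "max 0 w \<le> s" "s \<le> s'" "ereal s' \<le> c w"
  shows "F w s \<le> F w s'"
proof (cases "c w = a w")
  case True
  then show ?thesis using assms by (intro up) auto
next
  case False
  then have "c w = ereal (max 0 w)" using c_cases[of w] by auto
  then have "s = s'" using assms by (auto simp: max_def split: if_splits simp del: ereal_max)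
  then show ?thesis by simp
qed

lemma h_mono: "s \<le> s' \<Longrightarrow> h w s \<le> h w s'"
  unfolding h_def by (intro F_mono_cl cl_ge cl_mono cl_le_c)

text \<open>Where clamping changes \<open>s\<close>, it moves it down to \<open>c w\<close>, which
  is at or beyond the ridge, and there the payoff is nonincreasing.\<close>

lemma F_le_h:
  assumes "max 0 w \<le> s"
  shows "F w s \<le> h w s"
proof (cases "ereal s \<le> c w")
  case True
  then show ?thesis using assms by (simp add: h_def cl_id)
next
  case False
  then have c: "ereal (cl w s) = c w" using ereal_cl[of w s] assms by (auto simp: min_def max_def)
  have "F w s \<le> F w (cl w s)"
  proof (rule down)
    show "cl w s \<le> s" using cl_le[of w s] assms by simp
    show "a w \<le> ereal (cl w s)" unfolding c by (simp add: c_def)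
  qed
  then show ?thesis by (simp add: h_def)
qed

text \<open>Clamping to an interval that depends on \<open>w\<close> could destroy supermodularity.
  It survives at levels above both targets: if \<open>w1\<close> still gains at \<open>u\<close>,
  its ceiling is the ridge, and the ceiling of \<open>w2\<close> is at least as high because the
  ridge is nondecreasing.\<close>

lemma h_increment_mono:
  assumes "w1 \<le> w2" "w2 \<le> u" "0 \<le> u" "u \<le> u'"
  shows "h w1 u' - h w1 u \<le> h w2 u' - h w2 u"
proof (cases "c w1 \<le> ereal u")
  case True
  then have "h w1 u' = h w1 u" by (simp add: h_def cl_const[OF _ assms(4)])
  then show ?thesis using h_mono[of u u' w2] assms by simp
next
  case False
  then have u1: "cl w1 u = u" using assms by (intro cl_id) auto
  define v where "v = cl w1 u'"
  have uv: "u \<le> v" "v \<le> u'" using cl_mono[OF assms(4), of w1] cl_le[of w1 u'] u1 assms by (auto simp: v_def)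
  have c1: "c w1 = a w1"
  proof (rule ccontr)
    assume "c w1 \<noteq> a w1"
    then have "c w1 = ereal (max 0 w1)" using c_cases[of w1] by auto
    with False assms show False by simp
  qed
  then have "ereal v \<le> a w2"
    using cl_le_c[of w1 u'] ridge_mono[OF assms(1)] by (simp add: v_def)
  then have vc: "ereal v \<le> c w2" by (simp add: c_def le_max_iff_disj)
  then have uc: "ereal u \<le> c w2" using uv by (meson ereal_less_eq(3) order_trans)
  have "h w1 u' - h w1 u = F w1 v - F w1 u" by (simp add: h_def u1 v_def)
  also have "\<dots> \<le> F w2 v - F w2 u" using assms uv by (intro supermodularD) auto
  also have "\<dots> = h w2 v - h w2 u" using assms uv vc uc by (simp add: h_def cl_id)
  also have "\<dots> \<le> h w2 u' - h w2 u" using h_mono[OF uv(2)] by simp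
  finally show ?thesis .
qed

text \<open>Monotonicity gives the lower estimate and upper semicontinuity the upper one. From the
  left jumps are possible, which decides the direction of rounding in \<open>grid\<close>.\<close>

lemma h_right_continuous: "(h w \<longlongrightarrow> h w s) (at_right s)"
proof -
  consider "s < max 0 w" | "max 0 w \<le> s" "c w \<le> ereal s" | "max 0 w \<le> s" "ereal s < c w"
    by (meson not_le)
  then show ?thesis
  proof cases
    case 1
    have "eventually (\<lambda>s'. s < s' \<and> s' < max 0 w) (at_right s)"
      using 1 by (auto simp: eventually_at_right[of s "max 0 w"])
    then have "eventually (\<lambda>s'. h w s' = h w s) (at_right s)"
      by eventually_elim (use 1 in \<open>simp add: h_def cl_def max_absorb2\<close>)
    then show ?thesis by (rule tendsto_eventually)
  next
    case 2
    have "eventually (\<lambda>s'. s < s') (at_right s)" by (simp add: eventually_at_filter)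
    then have "eventually (\<lambda>s'. h w s' = h w s) (at_right s)"
      by eventually_elim (simp add: h_def cl_const[OF 2(2) less_imp_le])
    then show ?thesis by (rule tendsto_eventually)
  next
    case 3
    obtain b where b: "ereal s < ereal b" "ereal b < c w" using ereal_dense2[OF 3(2)] by auto
    have ev: "eventually (\<lambda>s'. s < s' \<and> s' < b) (at_right s)"
      using b by (auto simp: eventually_at_right[of s b])
    have hF: "h w s' = F w s'" if "s \<le> s'" "s' < b" for s'
    proof -
      have "ereal s' \<le> c w" using that b(2) by (meson ereal_less_eq(3) less_imp_le order_trans)
      then show ?thesis using 3 that by (simp add: h_def cl_id)
    qed
    show ?thesis
    proof (rule order_tendstoI)
      fix y assume "y < h w s"
      show "eventually (\<lambda>s'. y < h w s') (at_right s)"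
        using ev by eventually_elim (use \<open>y < h w s\<close> h_mono[of s _ w] in \<open>force intro: less_le_trans\<close>)
    next
      fix y assume "h w s < y"
      then have "F w s < y" using hF[of s] b by simp
      from usc_section[OF this] have "eventually (\<lambda>s'. F w s' < y) (at_right s)"
        by (auto simp: eventually_at_filter elim: eventually_mono)
      then show "eventually (\<lambda>s'. h w s' < y) (at_right s)"
        using ev by eventually_elim (simp add: hF)
    qed
  qed
qed

lemma borel_measurable_F [measurable]: "(\<lambda>x. F (f x) (g x)) \<in> borel_measurable M"
  if [measurable]: "f \<in> borel_measurable M" "g \<in> borel_measurable M"
proof -
  have [measurable]: "(\<lambda>(w, s). F w s) \<in> borel_measurable borel" by (rule usc_imp_borel_measurable[OF usc])
  have "(\<lambda>x. (\<lambda>(w, s). F w s) (f x, g x)) \<in> borel_measurable M" by measurable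
  then show ?thesis by simp
qed

lemma borel_measurable_c [measurable]: "c \<in> borel_measurable borel"
  unfolding c_def[abs_def] by measurable

lemma borel_measurable_h [measurable]: "(\<lambda>x. h (f x) (g x)) \<in> borel_measurable M"
  if [measurable]: "f \<in> borel_measurable M" "g \<in> borel_measurable M"
  unfolding h_def cl_def by measurable

text \<open>A unimodal function is bounded below by the smaller of its two end values and above by
  its value at the ridge, or at the nearer end if the ridge lies outside.\<close>

lemma F_bounded_on_interval:
  assumes "0 \<le> L"
  obtains B where "\<And>s s'. 0 \<le> s \<Longrightarrow> s \<le> L \<Longrightarrow> 0 \<le> s' \<Longrightarrow> s' \<le> L \<Longrightarrow> F w s' - F w s \<le> B"
proof -
  have lower: "min (F w 0) (F w L) \<le> F w s" if "0 \<le> s" "s \<le> L" for s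
  proof (cases "ereal s \<le> a w")
    case True
    then show ?thesis using up[of 0 s w] that by simp
  next
    case False
    then show ?thesis using down[of s L w] that by (simp add: not_le less_imp_le min_le_iff_disj)
  qed
  obtain C where upper: "\<And>s. 0 \<le> s \<Longrightarrow> s \<le> L \<Longrightarrow> F w s \<le> C"
  proof -
    consider "a w \<le> 0" | "ereal L \<le> a w" | r where "a w = ereal r" "0 \<le> r"
      by (cases "a w") (auto simp: zero_ereal_def, metis linear)
    then show ?thesis
    proof cases
      case 1
      then show ?thesis using down[of 0 _ w] by (intro that[of "F w 0"]) (simp add: zero_ereal_def)
    next
      case 2
      then show ?thesis using up[of _ L w] by (intro that[of "F w L"]) simp
    next
      case (3 r)
      have "F w s \<le> F w r" for s
        using up[of s r w] down[of r s w] 3 by (cases "s \<le> r") auto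
      then show ?thesis by (intro that[of "F w r"]) simp
    qed
  qed
  show ?thesis
    using lower upper by (intro that[of "C - min (F w 0) (F w L)"]) (smt (verit))
qed

text \<open>Uniformity in \<open>w\<close> comes from supermodularity: for \<open>w \<le> L\<close>
  every increment is at most that of \<open>F L\<close> between the same clamped points, and for
  \<open>w > L\<close> the function is constant up to level \<open>L\<close>.\<close>

lemma h_bounded:
  assumes "0 \<le> L"
  obtains B where "0 \<le> B" "\<And>w s s'. s \<le> L \<Longrightarrow> s' \<le> L \<Longrightarrow> \<bar>h w s' - h w s\<bar> \<le> B"
proof -
  obtain B where B: "\<And>s s'. 0 \<le> s \<Longrightarrow> s \<le> L \<Longrightarrow> 0 \<le> s' \<Longrightarrow> s' \<le> L \<Longrightarrow> F L s' - F L s \<le> B"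
    using F_bounded_on_interval[OF assms] by metis
  have "0 \<le> B" using B[of 0 0] assms by simp
  have *: "h w s' - h w s \<le> B" if "s \<le> s'" "s' \<le> L" for w s s'
  proof (cases "w \<le> L")
    case False
    then have "h w s' = h w s" using that assms by (simp add: h_def cl_def max_absorb2)
    then show ?thesis using \<open>0 \<le> B\<close> by simp
  next
    case True
    have "cl w s' \<le> L" "cl w s \<le> L" using cl_le[of w s'] cl_le[of w s] that True assms by auto
    moreover have "0 \<le> cl w s'" "0 \<le> cl w s" using cl_ge[of w s'] cl_ge[of w s] by auto
    ultimately have "F L (cl w s') - F L (cl w s) \<le> B" by (intro B)
    moreover have "h w s' - h w s \<le> F L (cl w s') - F L (cl w s)"
      unfolding h_def by (intro supermodularD True cl_mono that)
    ultimately show ?thesis by simp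
  qed
  show ?thesis
  proof (rule that[OF \<open>0 \<le> B\<close>])
    fix w s s' assume "s \<le> L" "s' \<le> L"
    then show "\<bar>h w s' - h w s\<bar> \<le> B"
      using *[of s s' w] *[of s' s w] h_mono[of s s' w] h_mono[of s' s w] by (cases "s \<le> s'") auto
  qed
qed

end

subsection \<open>Rearrangement inequality\<close>

text \<open>As \<open>ennreal\<close> sends negative reals to 0, this is subadditivity of the
  positive part.\<close>

lemma ennreal_le_add:
  assumes "x \<le> y + z"
  shows "ennreal x \<le> ennreal y + ennreal z"
proof -
  have *: "ennreal (max 0 y) = ennreal y" for y by (simp add: max_def ennreal_neg)
  have "ennreal x \<le> ennreal (max 0 y + max 0 z)" using assms by (intro ennreal_leI) linarith
  also have "\<dots> = ennreal y + ennreal z" by (simp add: ennreal_plus *)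
  finally show ?thesis .
qed

lemma has_expectation_finite:
  assumes "has_expectation P Y v" "(\<integral>\<^sup>+\<xi>. ennreal (Y \<xi>) \<partial>P) < \<infinity>" "(\<integral>\<^sup>+\<xi>. ennreal (- Y \<xi>) \<partial>P) < \<infinity>"
  shows "integrable P Y" "v = ereal (\<integral>\<xi>. Y \<xi> \<partial>P)"
proof -
  show i: "integrable P Y"
    using assms unfolding real_integrable_def has_expectation_def by auto
  have e: "enn2ereal x = ereal (enn2real x)" if "x < \<infinity>" for x
    using that by (cases x) (auto simp: enn2ereal_ennreal)
  show "v = ereal (\<integral>\<xi>. Y \<xi> \<partial>P)"
    using assms unfolding has_expectation_def real_lebesgue_integral_def[OF i] by (simp add: e)
qed

locale embedding_problem = atomless_target \<mu> + serrated_payoff F a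
  for \<mu> :: "real measure" and F a
begin

lemma h_barycenter:
  assumes "mass w > 0"
  shows "h w (\<beta> w) = F w (capped_barycenter \<mu> a w)"
proof -
  have "max (\<beta> w) (max 0 w) = \<beta> w"
    using barycenter_nonneg[of w] barycenter_greater[OF assms] by simp
  then show ?thesis by (simp add: h_def cl_def capped_barycenter_def c_def)
qed

text \<open>Only this much of admissibility enters the comparison; the martingale property is
  condensed into the last clause.\<close>

definition embedded :: "'q measure \<Rightarrow> ('q \<Rightarrow> real) \<Rightarrow> ('q \<Rightarrow> real) \<Rightarrow> bool" where
  "embedded Q W S \<longleftrightarrow> prob_space Q \<and> W \<in> borel_measurable Q \<and> S \<in> borel_measurable Q \<and>
     distr Q borel W = \<mu> \<and> (AE \<xi> in Q. max 0 (W \<xi>) \<le> S \<xi>) \<and>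
     (\<forall>u\<ge>0. measure Q {\<xi>\<in>space Q. S \<xi> > u} \<le> measure \<mu> {w. \<beta> w > u})"

lemma embeddedD:
  assumes "embedded Q W S"
  shows "prob_space Q" "W \<in> borel_measurable Q" "S \<in> borel_measurable Q"
    "distr Q borel W = \<mu>" "AE \<xi> in Q. max 0 (W \<xi>) \<le> S \<xi>"
    "0 \<le> u \<Longrightarrow> measure Q {\<xi>\<in>space Q. S \<xi> > u} \<le> measure Q {\<xi>\<in>space Q. \<beta> (W \<xi>) > u}"
    "AE \<xi> in Q. mass (W \<xi>) > 0"
proof -
  show *: "prob_space Q" "W \<in> borel_measurable Q" "S \<in> borel_measurable Q"
    "distr Q borel W = \<mu>" "AE \<xi> in Q. max 0 (W \<xi>) \<le> S \<xi>"
    using assms by (auto simp: embedded_def)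
  note [measurable] = *(2,3)
  show "measure Q {\<xi>\<in>space Q. S \<xi> > u} \<le> measure Q {\<xi>\<in>space Q. \<beta> (W \<xi>) > u}" if "0 \<le> u"
  proof -
    have "measure \<mu> {w. \<beta> w > u} = measure Q {\<xi>\<in>space Q. \<beta> (W \<xi>) > u}"
      by (subst *(4)[symmetric], subst measure_distr) (auto simp: vimage_def Int_def conj_commute)
    with that assms show ?thesis by (auto simp: embedded_def)
  qed
  have "AE w in distr Q borel W. mass w > 0" unfolding *(4) by (rule AE_mass_pos)
  then show "AE \<xi> in Q. mass (W \<xi>) > 0"
    by (subst (asm) AE_distr_iff) auto
qed

text \<open>
  Level by level: by monotonicity of the increments in \<open>w\<close> and of \<open>\<beta>\<close>, the increment over
  \<open>[u, u']\<close> is at most \<open>\<iota>\<close> where \<open>\<beta> \<le> u\<close> and at least \<open>\<iota>\<close> where \<open>\<beta> > u\<close>; above the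
  level both indicators equal \<open>1\<close>.
\<close>

lemma level_inequality:
  assumes E: "embedded Q W S" and u: "0 \<le> u" "u \<le> u'"
  shows "(\<integral>\<xi>. (indicator {u<..} (S \<xi>) - indicator {u<..} (\<beta> (W \<xi>))) * (h (W \<xi>) u' - h (W \<xi>) u) \<partial>Q) \<le> 0"
proof -
  note D = embeddedD[OF E]
  interpret Q: prob_space Q by (rule D)
  note [measurable] = D(2,3)
  define I where "I w = h w u' - h w u" for w
  define K where "K = {w. w \<le> u \<and> mass w > 0 \<and> \<beta> w \<le> u}"
  \<comment> \<open>The members of \<open>K\<close> lie to the left of all other relevant targets
    because \<beta> is monotone, so \<iota> separates the increments of the two groups. For empty
    \<open>K\<close> the value 0 is still a lower bound.\<close>
  define \<iota> where "\<iota> = (if K = {} then 0 else Sup (I ` K))"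
  have I0: "0 \<le> I w" for w using h_mono[OF u(2)] by (simp add: I_def)
  have Imono: "I w \<le> I w'" if "w \<le> w'" "w' \<le> u" for w w'
    using h_increment_mono[OF that u] by (simp add: I_def)
  have bdd: "bdd_above (I ` K)" by (rule bdd_aboveI2[of _ _ "I u"]) (auto simp: K_def intro: Imono)
  have \<iota>0: "0 \<le> \<iota>"
    using bdd I0 by (auto simp: \<iota>_def intro: cSup_upper2)
  have upper: "I w \<le> \<iota>" if "w \<in> K" for w
    using that bdd by (auto simp: \<iota>_def intro: cSup_upper)
  have lower: "\<iota> \<le> I w" if "w \<le> u" "mass w > 0" "\<beta> w > u" for w
  proof (cases "K = {}")
    case False
    have "Sup (I ` K) \<le> I w"
    proof (rule cSup_least)
      fix y assume "y \<in> I ` K"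
      then obtain v where v: "v \<in> K" "y = I v" by auto
      have "v \<le> w"
      proof (rule ccontr)
        assume "\<not> v \<le> w"
        then have "\<beta> w \<le> \<beta> v" using v by (intro barycenter_mono) (auto simp: K_def)
        with v that show False by (auto simp: K_def)
      qed
      then show "y \<le> I w" using v that by (auto intro: Imono)
    qed (use False in auto)
    with False show ?thesis by (simp add: \<iota>_def)
  qed (simp add: \<iota>_def I0)
  let ?d = "\<lambda>\<xi>. indicator {u<..} (S \<xi>) - indicator {u<..} (\<beta> (W \<xi>)) :: real"
  have pw: "AE \<xi> in Q. ?d \<xi> * I (W \<xi>) \<le> \<iota> * ?d \<xi>"
    using D(5,7)
  proof eventually_elim
    case (elim \<xi>)
    show ?case
    proof (cases "W \<xi> \<le> u")
      case False
      then have "S \<xi> > u" "\<beta> (W \<xi>) > u" using elim barycenter_greater[of "W \<xi>"] by auto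
      then show ?thesis by simp
    next
      case True
      then show ?thesis
        using upper[of "W \<xi>"] lower[of "W \<xi>"] elim
        by (auto simp: indicator_def K_def)
    qed
  qed
  have "(\<integral>\<xi>. ?d \<xi> * I (W \<xi>) \<partial>Q) \<le> (\<integral>\<xi>. \<iota> * ?d \<xi> \<partial>Q)" if "integrable Q (\<lambda>\<xi>. ?d \<xi> * I (W \<xi>))"
  proof (rule integral_mono_AE[OF that _ pw])
    show "integrable Q (\<lambda>\<xi>. \<iota> * ?d \<xi>)"
      by (rule Q.integrable_const_bound[where B="\<bar>\<iota>\<bar>"]) (auto simp: indicator_def abs_mult)
  qed
  moreover have "(\<integral>\<xi>. \<iota> * ?d \<xi> \<partial>Q) = \<iota> * (measure Q {\<xi>\<in>space Q. S \<xi> > u} - measure Q {\<xi>\<in>space Q. \<beta> (W \<xi>) > u})"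
  proof -
    have "(\<integral>\<xi>. indicator {u<..} (f \<xi>) \<partial>Q) = measure Q {\<xi>\<in>space Q. f \<xi> > u}"
      if [measurable]: "f \<in> borel_measurable Q" for f :: "_ \<Rightarrow> real"
    proof -
      have "(\<integral>\<xi>. indicator {u<..} (f \<xi>) \<partial>Q) = (\<integral>\<xi>. indicator {\<xi>\<in>space Q. f \<xi> > u} \<xi> \<partial>Q :: real)"
        by (intro Bochner_Integration.integral_cong) (auto simp: indicator_def)
      also have "\<dots> = measure Q {\<xi>\<in>space Q. f \<xi> > u}"
        by (auto intro!: arg_cong[where f="measure Q"])
      finally show ?thesis .
    qed
    moreover have "integrable Q (\<lambda>\<xi>. indicator {u<..} (f \<xi>) :: real)"
      if [measurable]: "f \<in> borel_measurable Q" for f :: "_ \<Rightarrow> real"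
      by (rule Q.integrable_const_bound[where B=1]) (auto simp: indicator_def)
    ultimately show ?thesis by (simp add: Bochner_Integration.integral_diff)
  qed
  moreover have "\<iota> * (measure Q {\<xi>\<in>space Q. S \<xi> > u} - measure Q {\<xi>\<in>space Q. \<beta> (W \<xi>) > u}) \<le> 0"
    using \<iota>0 D(6)[OF u(1)] by (simp add: mult_nonneg_nonpos)
  ultimately show ?thesis
    unfolding I_def[symmetric] by (cases "integrable Q (\<lambda>\<xi>. ?d \<xi> * I (W \<xi>))") (auto simp: not_integrable_integral_eq)
qed

text \<open>Rounds \<open>s\<close> up to a multiple of 1/2^n and caps at \<open>L\<close>. Rounding
  up fits the right-continuity of \<open>h w\<close>.\<close>

definition grid :: "nat \<Rightarrow> nat \<Rightarrow> real \<Rightarrow> real" where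
  "grid L n s = real (min (L * 2 ^ n) (nat \<lceil>s * 2 ^ n\<rceil>)) / 2 ^ n"

lemma grid_le: "grid L n s \<le> L"
proof -
  have "real (min (L * 2 ^ n) (nat \<lceil>s * 2 ^ n\<rceil>)) \<le> real (L * 2 ^ n)" by (intro of_nat_mono) simp
  then show ?thesis by (simp add: grid_def divide_le_eq)
qed

lemma grid_eq: "0 \<le> s \<Longrightarrow> grid L n s = min (real L) (real_of_int \<lceil>s * 2 ^ n\<rceil> / 2 ^ n)"
  by (simp add: grid_def of_nat_min min_divide_distrib_right)

lemma grid_ge: "0 \<le> s \<Longrightarrow> min s L \<le> grid L n s"
proof -
  assume "0 \<le> s"
  moreover have "s \<le> real_of_int \<lceil>s * 2 ^ n\<rceil> / 2 ^ n" by (simp add: le_divide_eq)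
  ultimately show ?thesis by (simp add: grid_eq min.coboundedI1)
qed

lemma grid_tendsto:
  assumes "0 \<le> s"
  shows "(\<lambda>n. grid L n s) \<longlonglongrightarrow> min s (real L)"
proof -
  have "(\<lambda>n. real_of_int \<lceil>s * 2 ^ n\<rceil> / 2 ^ n) \<longlonglongrightarrow> s"
  proof (rule tendsto_sandwich[of "\<lambda>_. s" _ _ "\<lambda>n. s + (1/2) ^ n"])
    show "eventually (\<lambda>n. s \<le> real_of_int \<lceil>s * 2 ^ n\<rceil> / 2 ^ n) sequentially"
      by (simp add: le_divide_eq)
    show "eventually (\<lambda>n. real_of_int \<lceil>s * 2 ^ n\<rceil> / 2 ^ n \<le> s + (1/2) ^ n) sequentially"
    proof (rule always_eventually, rule allI)
      fix n
      have "real_of_int \<lceil>s * 2 ^ n\<rceil> \<le> s * 2 ^ n + 1" by linarith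
      then show "real_of_int \<lceil>s * 2 ^ n\<rceil> / 2 ^ n \<le> s + (1/2) ^ n"
        by (simp add: divide_le_eq distrib_right power_one_over)
    qed
    show "(\<lambda>n. s + (1/2) ^ n) \<longlonglongrightarrow> s"
      using tendsto_add[OF tendsto_const[of s] LIMSEQ_power_zero[of "1/2::real"]] by simp
  qed simp
  then have "(\<lambda>n. min (real L) (real_of_int \<lceil>s * 2 ^ n\<rceil> / 2 ^ n)) \<longlonglongrightarrow> min (real L) s"
    by (intro tendsto_intros)
  then show ?thesis using assms by (simp add: grid_eq min.commute)
qed

lemma h_grid_tendsto:
  assumes "0 \<le> s"
  shows "(\<lambda>n. h w (grid L n s)) \<longlonglongrightarrow> h w (min s (real L))"
proof -
  let ?m = "min s (real L)"
  have "(h w \<longlongrightarrow> h w ?m) (at ?m within {?m..})"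
    using h_right_continuous[of w ?m] by (simp add: at_within_Ici_at_right)
  then have "continuous (at ?m within {?m..}) (h w)"
    by (simp add: continuous_within)
  then show ?thesis
    by (rule continuous_within_tendsto_compose') (use assms in \<open>auto simp: grid_ge grid_tendsto\<close>)
qed

text \<open>On the grid the difference of payoffs is a finite sum of level increments, each covered
  by \<open>level_inequality\<close>. As the mesh tends to 0, the uniform bound from
  \<open>h_bounded\<close> dominates.\<close>

lemma truncated_inequality:
  assumes E: "embedded Q W S"
  shows "integrable Q (\<lambda>\<xi>. h (W \<xi>) (min (S \<xi>) (real L)) - h (W \<xi>) (min (\<beta> (W \<xi>)) (real L)))"
    and "(\<integral>\<xi>. h (W \<xi>) (min (S \<xi>) (real L)) - h (W \<xi>) (min (\<beta> (W \<xi>)) (real L)) \<partial>Q) \<le> 0"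
proof -
  note D = embeddedD[OF E]
  interpret Q: prob_space Q by (rule D)
  note [measurable] = D(2,3)
  obtain B where B: "0 \<le> B" "\<And>w s s'. s \<le> real L \<Longrightarrow> s' \<le> real L \<Longrightarrow> \<bar>h w s' - h w s\<bar> \<le> B"
    using h_bounded[of "real L"] by auto
  have [measurable]: "(\<lambda>\<xi>. grid L n (f \<xi>)) \<in> borel_measurable Q"
    if [measurable]: "f \<in> borel_measurable Q" for n f
    unfolding grid_def by measurable
  let ?d = "\<lambda>n \<xi>. h (W \<xi>) (grid L n (S \<xi>)) - h (W \<xi>) (grid L n (\<beta> (W \<xi>)))"
  let ?D = "\<lambda>\<xi>. h (W \<xi>) (min (S \<xi>) (real L)) - h (W \<xi>) (min (\<beta> (W \<xi>)) (real L))"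
  show "integrable Q ?D"
    by (rule Q.integrable_const_bound[where B=B]) (auto intro!: AE_I2 B)
  have "(\<integral>\<xi>. ?d n \<xi> \<partial>Q) \<le> 0" for n
  proof -
    let ?u = "\<lambda>i. real i / 2 ^ n"
    let ?t = "\<lambda>i \<xi>. (indicator {?u i<..} (S \<xi>) - indicator {?u i<..} (\<beta> (W \<xi>))) * (h (W \<xi>) (?u (Suc i)) - h (W \<xi>) (?u i))"
    have grid_sum: "(\<Sum>i<L * 2^n. indicator {?u i<..} s * (h w (?u (Suc i)) - h w (?u i))) = h w (grid L n s) - h w 0"
      if "0 \<le> s" for s w
    proof -
      have "(\<Sum>i<L * 2^n. indicator {?u i<..} s * (h w (?u (Suc i)) - h w (?u i))) =
          (\<Sum>i<L * 2^n. if real i < s * 2 ^ n then h w (?u (Suc i)) - h w (?u i) else 0)"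
        by (intro sum.cong) (auto simp: indicator_def divide_less_eq)
      also have "\<dots> = h w (grid L n s) - h w 0"
        using sum_levels[of "s * 2^n" "\<lambda>i. h w (?u i)" "L * 2^n"] that by (simp add: grid_def)
      finally show ?thesis .
    qed
    have eq: "AE \<xi> in Q. ?d n \<xi> = (\<Sum>i<L * 2^n. ?t i \<xi>)"
      using D(5)
    proof eventually_elim
      case (elim \<xi>)
      then have "?d n \<xi> = (h (W \<xi>) (grid L n (S \<xi>)) - h (W \<xi>) 0) - (h (W \<xi>) (grid L n (\<beta> (W \<xi>))) - h (W \<xi>) 0)"
        by simp
      also have "\<dots> = (\<Sum>i<L * 2^n. ?t i \<xi>)"
        using elim barycenter_nonneg[of "W \<xi>"]
        by (subst (1 2) grid_sum[symmetric]) (auto simp: sum_subtractf left_diff_distrib)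
      finally show ?case .
    qed
    have int: "integrable Q (?t i)" if "i < L * 2 ^ n" for i
    proof (rule Q.integrable_const_bound[where B=B])
      have "real (Suc i) \<le> real (L * 2 ^ n)"
        using that by (intro of_nat_mono) simp
      then have "real (Suc i) \<le> real L * 2 ^ n" by simp
      then have "?u (Suc i) \<le> real L" "?u i \<le> real L" by (simp_all add: divide_le_eq)
      then have "\<bar>h (W \<xi>) (?u (Suc i)) - h (W \<xi>) (?u i)\<bar> \<le> B" for \<xi> by (intro B)
      then show "AE \<xi> in Q. norm (?t i \<xi>) \<le> B"
        using B(1) by (intro AE_I2) (auto simp: indicator_def abs_mult simp del: of_nat_Suc)
    qed measurable
    have "(\<integral>\<xi>. ?d n \<xi> \<partial>Q) = (\<integral>\<xi>. (\<Sum>i<L * 2^n. ?t i \<xi>) \<partial>Q)"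
      by (intro integral_cong_AE eq) measurable
    also have "\<dots> = (\<Sum>i<L * 2^n. \<integral>\<xi>. ?t i \<xi> \<partial>Q)"
      by (intro Bochner_Integration.integral_sum int) auto
    also have "\<dots> \<le> 0"
      by (intro sum_nonpos level_inequality[OF E]) (auto simp: divide_right_mono)
    finally show ?thesis .
  qed
  moreover have "(\<lambda>n. \<integral>\<xi>. ?d n \<xi> \<partial>Q) \<longlonglongrightarrow> (\<integral>\<xi>. ?D \<xi> \<partial>Q)"
  proof (rule integral_dominated_convergence[where w="\<lambda>_. B"])
    show "AE \<xi> in Q. (\<lambda>n. ?d n \<xi>) \<longlonglongrightarrow> ?D \<xi>"
      using D(5)
    proof eventually_elim
      case (elim \<xi>)
      then show ?case using barycenter_nonneg by (intro tendsto_intros h_grid_tendsto) auto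
    qed
  qed (auto intro!: AE_I2 B grid_le)
  ultimately show "(\<integral>\<xi>. ?D \<xi> \<partial>Q) \<le> 0"
    by (intro LIMSEQ_le_const2) auto
qed

text \<open>The difference of payoffs need not be integrable, hence the formulation by positive and
  negative parts. Capping both arguments at \<open>L\<close> can only shrink the negative part, so
  the bound on the right is free of \<open>L\<close>, and Fatou recovers the positive part on the
  left.\<close>

lemma rearrangement_inequality:
  assumes E: "embedded Q W S"
  shows "(\<integral>\<^sup>+\<xi>. ennreal (h (W \<xi>) (S \<xi>) - h (W \<xi>) (\<beta> (W \<xi>))) \<partial>Q) \<le>
    (\<integral>\<^sup>+\<xi>. ennreal (h (W \<xi>) (\<beta> (W \<xi>)) - h (W \<xi>) (S \<xi>)) \<partial>Q)"
proof -
  note D = embeddedD[OF E]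
  interpret Q: prob_space Q by (rule D)
  note [measurable] = D(2,3)
  let ?d = "\<lambda>L \<xi>. h (W \<xi>) (min (S \<xi>) (real L)) - h (W \<xi>) (min (\<beta> (W \<xi>)) (real L))"
  let ?D = "\<lambda>\<xi>. h (W \<xi>) (S \<xi>) - h (W \<xi>) (\<beta> (W \<xi>))"
  have step: "(\<integral>\<^sup>+\<xi>. ennreal (?d L \<xi>) \<partial>Q) \<le> (\<integral>\<^sup>+\<xi>. ennreal (- ?D \<xi>) \<partial>Q)" for L
  proof -
    have i: "integrable Q (?d L)" by (rule truncated_inequality[OF E])
    have fin: "(\<integral>\<^sup>+\<xi>. ennreal (?d L \<xi>) \<partial>Q) < \<infinity>" "(\<integral>\<^sup>+\<xi>. ennreal (- ?d L \<xi>) \<partial>Q) < \<infinity>"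
      using i unfolding real_integrable_def by (auto simp: less_top)
    have "enn2real (\<integral>\<^sup>+\<xi>. ennreal (?d L \<xi>) \<partial>Q) \<le> enn2real (\<integral>\<^sup>+\<xi>. ennreal (- ?d L \<xi>) \<partial>Q)"
      using truncated_inequality(2)[OF E, of L] by (subst (asm) real_lebesgue_integral_def[OF i]) simp
    from ennreal_leI[OF this] have "(\<integral>\<^sup>+\<xi>. ennreal (?d L \<xi>) \<partial>Q) \<le> (\<integral>\<^sup>+\<xi>. ennreal (- ?d L \<xi>) \<partial>Q)"
      using fin by (simp only: ennreal_enn2real infinity_ennreal_def)
    also have "\<dots> \<le> (\<integral>\<^sup>+\<xi>. ennreal (- ?D \<xi>) \<partial>Q)"
    proof (intro nn_integral_mono)
      fix \<xi>
      let ?h = "h (W \<xi>)" and ?s = "S \<xi>" and ?b = "\<beta> (W \<xi>)"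
      consider "?b \<le> ?s" | "?s \<le> L" "?s \<le> ?b" | "real L \<le> ?s" "?s \<le> ?b" by linarith
      then show "ennreal (- ?d L \<xi>) \<le> ennreal (- ?D \<xi>)"
      proof cases
        case 1
        then have "?h (min ?b (real L)) \<le> ?h (min ?s (real L))" by (intro h_mono min.mono) auto
        then show ?thesis by (simp add: ennreal_neg)
      next
        case 2
        then show ?thesis using h_mono[of "min ?b (real L)" ?b "W \<xi>"] by (intro ennreal_leI) (simp add: min_absorb1)
      next
        case 3
        then show ?thesis using h_mono[of ?s ?b "W \<xi>"] by (intro ennreal_leI) (simp add: min_absorb2)
      qed
    qed
    finally show ?thesis .
  qed
  have lim: "ennreal (?D \<xi>) = liminf (\<lambda>L. ennreal (?d L \<xi>))" for \<xi>
  proof -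
    obtain L0 :: nat where L0: "max (S \<xi>) (\<beta> (W \<xi>)) \<le> real L0" using real_arch_simple by blast
    have "eventually (\<lambda>L. ennreal (?d L \<xi>) = ennreal (?D \<xi>)) sequentially"
      using eventually_ge_at_top[of L0]
    proof eventually_elim
      case (elim L)
      then have "real L0 \<le> real L" by simp
      with L0 have "S \<xi> \<le> real L" "\<beta> (W \<xi>) \<le> real L" by linarith+
      then show ?case by (simp add: min_absorb1)
    qed
    then have "(\<lambda>L. ennreal (?d L \<xi>)) \<longlonglongrightarrow> ennreal (?D \<xi>)" by (rule tendsto_eventually)
    then show ?thesis by (simp add: lim_imp_Liminf)
  qed
  have "(\<integral>\<^sup>+\<xi>. ennreal (?D \<xi>) \<partial>Q) = (\<integral>\<^sup>+\<xi>. liminf (\<lambda>L. ennreal (?d L \<xi>)) \<partial>Q)"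
    by (rule nn_integral_cong) (rule lim)
  also have "\<dots> \<le> liminf (\<lambda>L. \<integral>\<^sup>+\<xi>. ennreal (?d L \<xi>) \<partial>Q)"
    by (rule nn_integral_liminf) measurable
  also have "\<dots> \<le> (\<integral>\<^sup>+\<xi>. ennreal (- ?D \<xi>) \<partial>Q)"
    by (intro Liminf_le always_eventually allI step) simp
  finally show ?thesis by simp
qed

subsection \<open>Optimality\<close>

lemma admissible_embedded:
  assumes "admissible T \<mu> Q N" "0 < T"
  shows "embedded Q (N T) (running_max N T)"
proof -
  interpret Q: prob_space Q using assms by (simp add: admissible_def)
  obtain \<F> where M: "martingale_on Q T \<F> N" using assms by (auto simp: admissible_def)
  have cad: "\<And>\<xi>. \<xi> \<in> space Q \<Longrightarrow> cadlag_on T (\<lambda>t. N t \<xi>)" using assms by (auto simp: admissible_def)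
  have N[measurable]: "N T \<in> borel_measurable Q" using martingale_on_measurable[OF M] assms by simp
  have S[measurable]: "running_max N T \<in> borel_measurable Q"
    using assms cad martingale_on_measurable[OF M] by (intro borel_measurable_running_max) auto
  have law: "distr Q borel (N T) = \<mu>" using assms by (simp add: admissible_def)
  have "AE \<xi> in Q. N 0 \<xi> = 0" using assms by (simp add: admissible_def)
  moreover have "AE \<xi> in Q. N 0 \<xi> \<le> running_max N T \<xi> \<and> N T \<xi> \<le> running_max N T \<xi>"
    using assms by (intro AE_I2 conjI running_max_upper cad) auto
  ultimately have "AE \<xi> in Q. max 0 (N T \<xi>) \<le> running_max N T \<xi>"
    by eventually_elim auto
  moreover have "measure Q {\<xi>\<in>space Q. running_max N T \<xi> > u} \<le> measure \<mu> {w. \<beta> w > u}" for u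
    by (rule barycenter_domination[OF Q.prob_space_axioms N law _ doob_maximal[OF assms]]) measurable
  ultimately show ?thesis
    using law by (simp add: embedded_def Q.prob_space_axioms N S)
qed

lemma borel_measurable_capped [measurable]: "capped_barycenter \<mu> a \<in> borel_measurable borel"
  unfolding capped_barycenter_def[abs_def] zero_ereal_def by measurable

lemma has_expectation_graph:
  assumes M: "(\<lambda>\<xi>. (X \<xi>, S \<xi>)) \<in> borel_measurable P"
    and law: "distr P borel (\<lambda>\<xi>. (X \<xi>, S \<xi>)) = graph_law \<mu> (capped_barycenter \<mu> a)"
    and v: "has_expectation P (\<lambda>\<xi>. F (X \<xi>) (S \<xi>)) v"
  shows "has_expectation \<mu> (\<lambda>w. F w (capped_barycenter \<mu> a w)) v"
proof -
  have *: "(\<integral>\<^sup>+\<xi>. f (X \<xi>) (S \<xi>) \<partial>P) = (\<integral>\<^sup>+w. f w (capped_barycenter \<mu> a w) \<partial>\<mu>)"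
    if [measurable]: "(\<lambda>(x, s). f x s) \<in> borel_measurable borel" for f :: "real \<Rightarrow> real \<Rightarrow> ennreal"
  proof -
    have "(\<integral>\<^sup>+\<xi>. (\<lambda>(x, s). f x s) (X \<xi>, S \<xi>) \<partial>P) = (\<integral>\<^sup>+z. (\<lambda>(x, s). f x s) z \<partial>distr P borel (\<lambda>\<xi>. (X \<xi>, S \<xi>)))"
      using M by (subst nn_integral_distr) auto
    also have "\<dots> = (\<integral>\<^sup>+w. (\<lambda>(x, s). f x s) (w, capped_barycenter \<mu> a w) \<partial>\<mu>)"
      unfolding law graph_law_def by (subst nn_integral_distr) auto
    finally show ?thesis by simp
  qed
  have m: "(\<lambda>z. ennreal ((\<lambda>(w, s). F w s) z)) \<in> borel_measurable borel"
    "(\<lambda>z. ennreal (- (\<lambda>(w, s). F w s) z)) \<in> borel_measurable borel"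
    using usc_imp_borel_measurable[OF usc] by measurable
  have "(\<integral>\<^sup>+\<xi>. ennreal (F (X \<xi>) (S \<xi>)) \<partial>P) = (\<integral>\<^sup>+w. ennreal (F w (capped_barycenter \<mu> a w)) \<partial>\<mu>)"
    "(\<integral>\<^sup>+\<xi>. ennreal (- F (X \<xi>) (S \<xi>)) \<partial>P) = (\<integral>\<^sup>+w. ennreal (- F w (capped_barycenter \<mu> a w)) \<partial>\<mu>)"
    using *[of "\<lambda>w s. ennreal (F w s)"] *[of "\<lambda>w s. ennreal (- F w s)"]
    using m by (simp_all add: case_prod_beta')
  then show ?thesis using v by (simp add: has_expectation_def)
qed

text \<open>A strictly higher \<open>v'\<close> excludes \<open>v = \<infinity>\<close> and
  \<open>v' = - \<infinity>\<close>. This makes the positive part of the candidate and the negative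
  part of the competitor finite; the rearrangement inequality then bounds the remaining parts, and
  ordinary integrals may be subtracted.\<close>

lemma optimality:
  assumes E: "embedded Q W S"
    and v: "has_expectation \<mu> (\<lambda>w. F w (capped_barycenter \<mu> a w)) v"
    and v': "has_expectation Q (\<lambda>\<xi>. F (W \<xi>) (S \<xi>)) v'"
  shows "v' \<le> v"
proof (rule ccontr)
  assume "\<not> v' \<le> v"
  then have lt: "v < v'" by simp
  note D = embeddedD[OF E]
  interpret Q: prob_space Q by (rule D)
  note [measurable] = D(2,3)
  let ?A = "\<lambda>\<xi>. F (W \<xi>) (S \<xi>)" and ?A' = "\<lambda>\<xi>. h (W \<xi>) (S \<xi>)" and ?B = "\<lambda>\<xi>. h (W \<xi>) (\<beta> (W \<xi>))"
  let ?p = "\<lambda>f. \<integral>\<^sup>+\<xi>. ennreal (f \<xi>) \<partial>Q"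
  have AA': "AE \<xi> in Q. ?A \<xi> \<le> ?A' \<xi>" using D(5) by eventually_elim (rule F_le_h)
  have BW: "AE \<xi> in Q. F (W \<xi>) (capped_barycenter \<mu> a (W \<xi>)) = ?B \<xi>"
    using D(7) by eventually_elim (simp add: h_barycenter)
  have pB: "(\<integral>\<^sup>+w. ennreal (F w (capped_barycenter \<mu> a w)) \<partial>\<mu>) = ?p ?B"
    by (subst D(4)[symmetric], subst nn_integral_distr) (use BW in \<open>auto intro!: nn_integral_cong_AE\<close>)
  have nB: "(\<integral>\<^sup>+w. ennreal (- F w (capped_barycenter \<mu> a w)) \<partial>\<mu>) = ?p (\<lambda>\<xi>. - ?B \<xi>)"
    by (subst D(4)[symmetric], subst nn_integral_distr) (use BW in \<open>auto intro!: nn_integral_cong_AE\<close>)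
  have v_eq: "v = enn2ereal (?p ?B) - enn2ereal (?p (\<lambda>\<xi>. - ?B \<xi>))"
    and v_fin: "?p ?B < \<infinity> \<or> ?p (\<lambda>\<xi>. - ?B \<xi>) < \<infinity>"
    using v by (simp_all add: has_expectation_def pB nB)
  have v'_eq: "v' = enn2ereal (?p ?A) - enn2ereal (?p (\<lambda>\<xi>. - ?A \<xi>))"
    and v'_fin: "?p ?A < \<infinity> \<or> ?p (\<lambda>\<xi>. - ?A \<xi>) < \<infinity>"
    using v' by (simp_all add: has_expectation_def)
  have Bp: "?p ?B < \<infinity>"
  proof (rule ccontr)
    assume "\<not> ?thesis"
    then have "?p ?B = \<infinity>" "?p (\<lambda>\<xi>. - ?B \<xi>) < \<infinity>" using v_fin by (auto simp: less_top[symmetric])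
    then have "v = \<infinity>" unfolding v_eq by (cases "?p (\<lambda>\<xi>. - ?B \<xi>)") (auto simp: enn2ereal_ennreal)
    with lt show False by simp
  qed
  have An: "?p (\<lambda>\<xi>. - ?A \<xi>) < \<infinity>"
  proof (rule ccontr)
    assume "\<not> ?thesis"
    then have "?p (\<lambda>\<xi>. - ?A \<xi>) = \<infinity>" "?p ?A < \<infinity>" using v'_fin by (auto simp: less_top[symmetric])
    then have "v' = - \<infinity>" unfolding v'_eq by (cases "?p ?A") (auto simp: enn2ereal_ennreal)
    with lt show False by simp
  qed
  have sum_le: "?p f \<le> ?p g + ?p g'" if "AE \<xi> in Q. f \<xi> \<le> g \<xi> + g' \<xi>"
    and [measurable]: "g \<in> borel_measurable Q" "g' \<in> borel_measurable Q" for f g g'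
  proof -
    have "?p f \<le> (\<integral>\<^sup>+\<xi>. ennreal (g \<xi>) + ennreal (g' \<xi>) \<partial>Q)"
      using that(1) by (intro nn_integral_mono_AE) (auto elim!: eventually_mono intro: ennreal_le_add)
    also have "\<dots> = ?p g + ?p g'" by (rule nn_integral_add) measurable
    finally show ?thesis .
  qed
  have "?p (\<lambda>\<xi>. ?B \<xi> - ?A' \<xi>) \<le> ?p ?B + ?p (\<lambda>\<xi>. - ?A \<xi>)"
    using AA' by (intro sum_le) (auto elim!: eventually_mono)
  also have "\<dots> < \<infinity>" using Bp An by simp
  finally have Dn: "?p (\<lambda>\<xi>. ?B \<xi> - ?A' \<xi>) < \<infinity>" .
  have Dp: "?p (\<lambda>\<xi>. ?A' \<xi> - ?B \<xi>) \<le> ?p (\<lambda>\<xi>. ?B \<xi> - ?A' \<xi>)" by (rule rearrangement_inequality[OF E])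
  have iD: "integrable Q (\<lambda>\<xi>. ?A' \<xi> - ?B \<xi>)"
    unfolding real_integrable_def using Dn le_less_trans[OF Dp Dn] by (auto simp: less_top)
  have D0: "(\<integral>\<xi>. ?A' \<xi> - ?B \<xi> \<partial>Q) \<le> 0"
    using Dp Dn by (subst real_lebesgue_integral_def[OF iD]) (auto intro!: enn2real_mono)
  have pD: "?p (\<lambda>\<xi>. ?A' \<xi> - ?B \<xi>) < \<infinity>" using Dp Dn by simp
  have "?p ?A \<le> ?p ?B + ?p (\<lambda>\<xi>. ?A' \<xi> - ?B \<xi>)"
    using AA' by (intro sum_le) (auto elim!: eventually_mono)
  also have "\<dots> < \<infinity>" using Bp pD by simp
  finally have A: "integrable Q ?A" "v' = ereal (\<integral>\<xi>. ?A \<xi> \<partial>Q)"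
    using has_expectation_finite[OF v' _ An] by auto
  have "?p (\<lambda>\<xi>. - ?B \<xi>) \<le> ?p (\<lambda>\<xi>. - ?A \<xi>) + ?p (\<lambda>\<xi>. ?A' \<xi> - ?B \<xi>)"
    using AA' by (intro sum_le) (auto elim!: eventually_mono)
  also have "\<dots> < \<infinity>" using An pD by simp
  finally have Bn: "?p (\<lambda>\<xi>. - ?B \<xi>) < \<infinity>" .
  have "has_expectation Q ?B v" unfolding has_expectation_def using v_eq v_fin by auto
  then have B: "integrable Q ?B" "v = ereal (\<integral>\<xi>. ?B \<xi> \<partial>Q)"
    using has_expectation_finite[OF _ Bp Bn] by auto
  have "(\<integral>\<xi>. ?A \<xi> \<partial>Q) \<le> (\<integral>\<xi>. ?B \<xi> + (?A' \<xi> - ?B \<xi>) \<partial>Q)"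
    using AA' A(1) B(1) iD by (intro integral_mono_AE Bochner_Integration.integrable_add) auto
  also have "\<dots> = (\<integral>\<xi>. ?B \<xi> \<partial>Q) + (\<integral>\<xi>. ?A' \<xi> - ?B \<xi> \<partial>Q)"
    by (intro Bochner_Integration.integral_add B iD)
  also have "\<dots> \<le> (\<integral>\<xi>. ?B \<xi> \<partial>Q)" using D0 by simp
  finally show False using lt A(2) B(2) by simp
qed

end

subsection \<open>Closed martingales\<close>

text \<open>The two total integrals are compared separately, because the generator need not contain
  the whole space.\<close>

lemma set_integral_eq_generated:
  fixes f g :: "'a \<Rightarrow> real"
  assumes "Int_stable G" "G \<subseteq> sets P" and int: "integrable P f" "integrable P g"
    and eq: "\<And>A. A \<in> G \<Longrightarrow> (LINT \<xi>:A|P. f \<xi>) = (LINT \<xi>:A|P. g \<xi>)"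
    and tot: "(\<integral>\<xi>. f \<xi> \<partial>P) = (\<integral>\<xi>. g \<xi> \<partial>P)"
    and A: "A \<in> sigma_sets (space P) G"
  shows "(LINT \<xi>:A|P. f \<xi>) = (LINT \<xi>:A|P. g \<xi>)"
proof -
  have sub: "sigma_sets (space P) G \<subseteq> sets P" by (rule sets.sigma_sets_subset[OF assms(2)])
  have si: "set_integrable P B f" "set_integrable P B g" if "B \<in> sets P" for B
    using integrable_mult_indicator[OF that int(1)] integrable_mult_indicator[OF that int(2)]
    by (simp_all add: set_integrable_def)
  have sp: "(LINT \<xi>:space P|P. h \<xi>) = (\<integral>\<xi>. h \<xi> \<partial>P)" for h :: "'a \<Rightarrow> real"
    unfolding set_lebesgue_integral_def by (intro Bochner_Integration.integral_cong) auto
  have "G \<subseteq> Pow (space P)" using assms(2) sets.sets_into_space by blast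
  with assms(1) show ?thesis
    using A
  proof (induction rule: sigma_sets_induct_disjoint)
    case (basic B)
    then show ?case by (rule eq)
  next
    case empty
    then show ?case by (simp add: set_lebesgue_integral_def)
  next
    case (compl B)
    then have B: "B \<in> sets P" using sub by auto
    have c: "(LINT \<xi>:space P - B|P. h \<xi>) = (\<integral>\<xi>. h \<xi> \<partial>P) - (LINT \<xi>:B|P. h \<xi>)"
      if "set_integrable P B h" "set_integrable P (space P - B) h" for h :: "'a \<Rightarrow> real"
    proof -
      have "(LINT \<xi>:B \<union> (space P - B)|P. h \<xi>) = (LINT \<xi>:B|P. h \<xi>) + (LINT \<xi>:space P - B|P. h \<xi>)"
        using that by (intro set_integral_Un) auto
      moreover have "B \<union> (space P - B) = space P" using sets.sets_into_space[OF B] by auto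
      ultimately show ?thesis by (simp add: sp)
    qed
    show ?case using compl B by (simp add: c si tot)
  next
    case (union B)
    then have B: "B i \<in> sets P" for i using sub by auto
    then have "(\<Union>i. B i) \<in> sets P" by auto
    then show ?case
      using union B by (simp add: lebesgue_integral_countable_add disjoint_family_on_def si)
  qed
qed

text \<open>The processes constructed below are adapted only up to null sets (their initial value,
  or the paths that are never stopped); the augmentation absorbs these exceptions.\<close>

definition augment :: "'a measure \<Rightarrow> 'a measure \<Rightarrow> 'a measure" where
  "augment P G = sigma (space P) {A \<in> sets P. \<exists>B\<in>sets G. AE \<xi> in P. \<xi> \<in> A \<longleftrightarrow> \<xi> \<in> B}"

lemma space_augment [simp]: "space (augment P G) = space P"
  unfolding augment_def by (intro space_measure_of) (auto dest: sets.sets_into_space)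

lemma sets_augment:
  assumes "subalgebra P G"
  shows "sets (augment P G) = {A \<in> sets P. \<exists>B\<in>sets G. AE \<xi> in P. \<xi> \<in> A \<longleftrightarrow> \<xi> \<in> B}" (is "_ = ?S")
proof -
  have sp: "space G = space P" using assms by (simp add: subalgebra_def)
  have "sigma_algebra (space P) ?S"
    unfolding sigma_algebra_iff2
  proof (intro conjI ballI allI impI)
    show "?S \<subseteq> Pow (space P)" by (auto dest: sets.sets_into_space)
    show "{} \<in> ?S" by (auto intro!: bexI[of _ "{}"])
  next
    fix A assume "A \<in> ?S"
    then obtain B where "A \<in> sets P" "B \<in> sets G" "AE \<xi> in P. \<xi> \<in> A \<longleftrightarrow> \<xi> \<in> B" by auto
    moreover from this(2) have "space P - B \<in> sets G" unfolding sp[symmetric] by (rule sets.compl_sets)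
    ultimately show "space P - A \<in> ?S"
      by (intro CollectI conjI bexI[of _ "space P - B"]) (auto elim!: eventually_mono)
  next
    fix A :: "nat \<Rightarrow> _" assume "range A \<subseteq> ?S"
    then have "\<forall>i. \<exists>B. A i \<in> sets P \<and> B \<in> sets G \<and> (AE \<xi> in P. \<xi> \<in> A i \<longleftrightarrow> \<xi> \<in> B)" by blast
    then obtain B where B: "\<And>i. A i \<in> sets P" "\<And>i. B i \<in> sets G" "\<And>i. AE \<xi> in P. \<xi> \<in> A i \<longleftrightarrow> \<xi> \<in> B i"
      by metis
    have "AE \<xi> in P. \<forall>i. \<xi> \<in> A i \<longleftrightarrow> \<xi> \<in> B i" using B(3) by (simp add: AE_all_countable)
    then have "AE \<xi> in P. \<xi> \<in> (\<Union>i. A i) \<longleftrightarrow> \<xi> \<in> (\<Union>i. B i)" by eventually_elim auto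
    then show "(\<Union>i. A i) \<in> ?S"
      using B(1,2) by (intro CollectI conjI bexI[of _ "\<Union>i. B i"]) auto
  qed
  then show ?thesis
    unfolding augment_def by (rule sigma_algebra.sets_measure_of_eq)
qed

lemma subalgebra_augment: "subalgebra P G \<Longrightarrow> subalgebra P (augment P G)"
  by (auto simp: sets_augment subalgebra_def)

lemma measurable_augment:
  fixes X X' :: "'a \<Rightarrow> real"
  assumes "subalgebra P G" "X \<in> borel_measurable P" "X' \<in> borel_measurable G" "AE \<xi> in P. X \<xi> = X' \<xi>"
  shows "X \<in> borel_measurable (augment P G)"
proof (rule measurableI)
  fix B :: "real set" assume B: "B \<in> sets borel"
  have sp: "space G = space P" using assms by (simp add: subalgebra_def)
  have "X -` B \<inter> space P \<in> sets P" "X' -` B \<inter> space P \<in> sets G"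
    using measurable_sets[OF assms(2) B] measurable_sets[OF assms(3) B] by (simp_all add: sp)
  moreover have "AE \<xi> in P. \<xi> \<in> X -` B \<inter> space P \<longleftrightarrow> \<xi> \<in> X' -` B \<inter> space P"
    using assms(4) by eventually_elim auto
  ultimately show "X -` B \<inter> space (augment P G) \<in> sets (augment P G)"
    unfolding sets_augment[OF assms(1)] by (simp only: space_augment) blast
qed simp

lemma set_integral_augment:
  fixes f :: "'a \<Rightarrow> real"
  assumes "A \<in> sets P" "B \<in> sets P" "AE \<xi> in P. \<xi> \<in> A \<longleftrightarrow> \<xi> \<in> B" "f \<in> borel_measurable P"
  shows "(LINT \<xi>:A|P. f \<xi>) = (LINT \<xi>:B|P. f \<xi>)"
  unfolding set_lebesgue_integral_def
  using assms by (intro integral_cong_AE) (auto elim!: eventually_mono simp: indicator_def)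

text \<open>On events of \<open>G t\<close> the process integrates like \<open>Y\<close>. Hence the
  integral of |X t| over {|X t| > K} is at most that of |Y| over the same event, whose probability
  is at most E|Y| / K uniformly in \<open>t\<close>.\<close>

lemma (in prob_space) uniformly_integrable_closed:
  fixes X :: "'t \<Rightarrow> 'a \<Rightarrow> real"
  assumes Y: "integrable M Y" and X: "\<And>t. t \<in> I \<Longrightarrow> integrable M (X t)"
    and meas: "\<And>t. t \<in> I \<Longrightarrow> X t \<in> borel_measurable (G t)" and sub: "\<And>t. t \<in> I \<Longrightarrow> subalgebra M (G t)"
    and eq: "\<And>t A. t \<in> I \<Longrightarrow> A \<in> sets (G t) \<Longrightarrow> (LINT \<xi>:A|M. Y \<xi>) = (LINT \<xi>:A|M. X t \<xi>)"
  shows "uniformly_integrable_on M I X"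
  unfolding uniformly_integrable_on_def
proof (intro conjI ballI allI impI X)
  fix \<epsilon> :: real assume "\<epsilon> > 0"
  have [measurable]: "Y \<in> borel_measurable M" using Y by auto
  have si: "set_integrable M A f" if "A \<in> sets M" "integrable M f" for A and f :: "'a \<Rightarrow> real"
    using integrable_mult_indicator[OF that] by (simp add: set_integrable_def)
  have "(\<lambda>n. LINT \<xi>:{\<xi>\<in>space M. \<bar>Y \<xi>\<bar> > real n}|M. \<bar>Y \<xi>\<bar>) \<longlonglongrightarrow> (\<integral>\<xi>. 0 \<partial>M)"
    unfolding set_lebesgue_integral_def
  proof (rule integral_dominated_convergence[where w="\<lambda>\<xi>. \<bar>Y \<xi>\<bar>"])
    show "AE \<xi> in M. (\<lambda>n. indicator {\<xi>\<in>space M. \<bar>Y \<xi>\<bar> > real n} \<xi> *\<^sub>R \<bar>Y \<xi>\<bar>) \<longlonglongrightarrow> 0"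
    proof (rule AE_I2)
      fix \<xi>
      obtain n0 :: nat where "\<bar>Y \<xi>\<bar> \<le> real n0" using real_arch_simple by blast
      then have "eventually (\<lambda>n. \<not> real n < \<bar>Y \<xi>\<bar>) sequentially"
        by (intro eventually_sequentiallyI[of n0]) auto
      then have "eventually (\<lambda>n. indicator {\<xi>\<in>space M. \<bar>Y \<xi>\<bar> > real n} \<xi> *\<^sub>R \<bar>Y \<xi>\<bar> = 0) sequentially"
        by (rule eventually_mono) (simp add: indicator_def)
      then show "(\<lambda>n. indicator {\<xi>\<in>space M. \<bar>Y \<xi>\<bar> > real n} \<xi> *\<^sub>R \<bar>Y \<xi>\<bar>) \<longlonglongrightarrow> 0"
        by (rule tendsto_eventually)
    qed
  qed (use Y in \<open>auto simp: indicator_def\<close>)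
  then have "eventually (\<lambda>n. (LINT \<xi>:{\<xi>\<in>space M. \<bar>Y \<xi>\<bar> > real n}|M. \<bar>Y \<xi>\<bar>) < \<epsilon> / 2) sequentially"
    using \<open>\<epsilon> > 0\<close> by (intro order_tendstoD) auto
  then obtain c :: nat where c: "(LINT \<xi>:{\<xi>\<in>space M. \<bar>Y \<xi>\<bar> > real c}|M. \<bar>Y \<xi>\<bar>) < \<epsilon> / 2"
    by (auto simp: eventually_sequentially)
  define E where "E = (\<integral>\<xi>. \<bar>Y \<xi>\<bar> \<partial>M)"
  have E: "0 \<le> E" by (simp add: E_def)
  \<comment> \<open>Chosen such that c times the probability of {|X t| > K} is at most \<epsilon> /
    2; the integral of |Y| over {|Y| > c} accounts for the other half. The summand 1 keeps
    \<open>K\<close> positive.\<close>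
  define K where "K = 2 * real c * E / \<epsilon> + 1"
  have K: "K > 0" using E \<open>\<epsilon> > 0\<close> by (simp add: K_def add_nonneg_pos)
  show "\<exists>K. \<forall>t\<in>I. (LINT \<xi>:{\<xi> \<in> space M. K < \<bar>X t \<xi>\<bar>}|M. \<bar>X t \<xi>\<bar>) \<le> \<epsilon>"
  proof (intro exI[of _ K] ballI)
    fix t assume t: "t \<in> I"
    have sp: "space (G t) = space M" and sG: "sets (G t) \<subseteq> sets M" using sub[OF t] by (auto simp: subalgebra_def)
    have mG: "X t \<in> borel_measurable (G t)" by (rule meas[OF t])
    have [measurable]: "X t \<in> borel_measurable M" using X[OF t] by auto
    let ?A = "{\<xi>\<in>space M. K < \<bar>X t \<xi>\<bar>}"
    let ?P = "{\<xi>\<in>space M. K < X t \<xi>}" and ?N = "{\<xi>\<in>space M. X t \<xi> < - K}"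
    have PN: "?P \<in> sets (G t)" "?N \<in> sets (G t)"
      using mG unfolding sp[symmetric] by measurable
    have un: "?A = ?P \<union> ?N" "?P \<inter> ?N = {}" using K by auto
    have "(LINT \<xi>:?A|M. \<bar>X t \<xi>\<bar>) = (LINT \<xi>:?P|M. \<bar>X t \<xi>\<bar>) + (LINT \<xi>:?N|M. \<bar>X t \<xi>\<bar>)"
      unfolding un(1) using X[OF t] by (intro set_integral_Un un(2) si) auto
    also have "(LINT \<xi>:?P|M. \<bar>X t \<xi>\<bar>) = (LINT \<xi>:?P|M. X t \<xi>)"
      using K by (intro set_lebesgue_integral_cong) auto
    also have "\<dots> = (LINT \<xi>:?P|M. Y \<xi>)" using eq[OF t PN(1)] by simp
    also have "(LINT \<xi>:?N|M. \<bar>X t \<xi>\<bar>) = (LINT \<xi>:?N|M. - X t \<xi>)"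
      using K by (intro set_lebesgue_integral_cong) auto
    also have "\<dots> = - (LINT \<xi>:?N|M. Y \<xi>)" using eq[OF t PN(2)] X[OF t] by (simp add: set_integral_uminus si)
    also have "(LINT \<xi>:?P|M. Y \<xi>) + - (LINT \<xi>:?N|M. Y \<xi>) \<le> (LINT \<xi>:?P|M. \<bar>Y \<xi>\<bar>) + (LINT \<xi>:?N|M. \<bar>Y \<xi>\<bar>)"
    proof (rule add_mono)
      show "(LINT \<xi>:?P|M. Y \<xi>) \<le> (LINT \<xi>:?P|M. \<bar>Y \<xi>\<bar>)"
        using Y by (intro set_integral_mono si) auto
      have "(LINT \<xi>:?N|M. - Y \<xi>) \<le> (LINT \<xi>:?N|M. \<bar>Y \<xi>\<bar>)"
        using Y by (intro set_integral_mono si) auto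
      then show "- (LINT \<xi>:?N|M. Y \<xi>) \<le> (LINT \<xi>:?N|M. \<bar>Y \<xi>\<bar>)"
        using Y by (simp add: set_integral_uminus si)
    qed
    also have "\<dots> = (LINT \<xi>:?A|M. \<bar>Y \<xi>\<bar>)"
      unfolding un(1) using Y by (intro set_integral_Un[symmetric] un(2) si) auto
    finally have XY: "(LINT \<xi>:?A|M. \<bar>X t \<xi>\<bar>) \<le> (LINT \<xi>:?A|M. \<bar>Y \<xi>\<bar>)" .
    have "integrable M (\<lambda>\<xi>. indicator ?A \<xi> * K)"
      by (intro integrable_mult_left integrable_real_indicator) (auto simp: emeasure_eq_measure)
    then have "(\<integral>\<xi>. indicator ?A \<xi> * K \<partial>M) \<le> (LINT \<xi>:?A|M. \<bar>X t \<xi>\<bar>)"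
      unfolding set_lebesgue_integral_def using si[of ?A "\<lambda>\<xi>. \<bar>X t \<xi>\<bar>"] X[OF t]
      by (intro integral_mono) (simp_all add: set_integrable_def, auto simp: indicator_def)
    also have "(\<integral>\<xi>. indicator ?A \<xi> * K \<partial>M) = K * prob ?A"
      by (simp add: Int_absorb1)
    also note XY
    also have "(LINT \<xi>:?A|M. \<bar>Y \<xi>\<bar>) \<le> E"
      unfolding set_lebesgue_integral_def E_def using Y si[of ?A "\<lambda>\<xi>. \<bar>Y \<xi>\<bar>"]
      by (intro integral_mono) (auto simp: set_integrable_def indicator_def)
    finally have KE: "K * prob ?A \<le> E" .
    have "real c * prob ?A \<le> \<epsilon> / 2"
    proof -
      have "2 * real c * E / \<epsilon> * prob ?A \<le> E"
        using KE[unfolded K_def distrib_right mult_1] measure_nonneg[of M ?A] unfolding K_def by linarith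
      then have "2 * real c * prob ?A * E \<le> \<epsilon> * E" using \<open>\<epsilon> > 0\<close> by (simp add: field_simps)
      then show ?thesis
      proof (cases "E = 0")
        case True
        with KE K have "prob ?A = 0" by (simp add: mult_le_0_iff measure_le_0_iff)
        then show ?thesis using \<open>\<epsilon> > 0\<close> by simp
      next
        case False
        then show ?thesis using E \<open>2 * real c * prob ?A * E \<le> \<epsilon> * E\<close> by simp
      qed
    qed
    moreover have "(LINT \<xi>:?A|M. \<bar>Y \<xi>\<bar>) \<le>
        (\<integral>\<xi>. indicator {\<xi>\<in>space M. \<bar>Y \<xi>\<bar> > real c} \<xi> * \<bar>Y \<xi>\<bar> + indicator ?A \<xi> * real c \<partial>M)"
      unfolding set_lebesgue_integral_def
    proof (rule integral_mono)
      show "integrable M (\<lambda>\<xi>. indicator ?A \<xi> *\<^sub>R \<bar>Y \<xi>\<bar>)"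
        using si[of ?A "\<lambda>\<xi>. \<bar>Y \<xi>\<bar>"] Y by (simp add: set_integrable_def)
      show "integrable M (\<lambda>\<xi>. indicator {\<xi>\<in>space M. \<bar>Y \<xi>\<bar> > real c} \<xi> * \<bar>Y \<xi>\<bar> + indicator ?A \<xi> * real c)"
        using si[of "{\<xi>\<in>space M. \<bar>Y \<xi>\<bar> > real c}" "\<lambda>\<xi>. \<bar>Y \<xi>\<bar>"] Y
        by (intro Bochner_Integration.integrable_add)
           (auto simp: set_integrable_def emeasure_eq_measure intro!: integrable_mult_left integrable_real_indicator)
    qed (auto simp: indicator_def)
    moreover have "(\<integral>\<xi>. indicator {\<xi>\<in>space M. \<bar>Y \<xi>\<bar> > real c} \<xi> * \<bar>Y \<xi>\<bar> + indicator ?A \<xi> * real c \<partial>M) =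
       (LINT \<xi>:{\<xi>\<in>space M. \<bar>Y \<xi>\<bar> > real c}|M. \<bar>Y \<xi>\<bar>) + real c * prob ?A"
      using si[of "{\<xi>\<in>space M. \<bar>Y \<xi>\<bar> > real c}" "\<lambda>\<xi>. \<bar>Y \<xi>\<bar>"] Y
      by (subst Bochner_Integration.integral_add)
         (auto simp: set_integrable_def set_lebesgue_integral_def emeasure_eq_measure Int_absorb1 intro!: integrable_mult_left integrable_real_indicator)
    ultimately show "(LINT \<xi>:?A|M. \<bar>X t \<xi>\<bar>) \<le> \<epsilon>" using XY c by linarith
  qed
qed

text \<open>It suffices to compare every \<open>X t\<close> with the terminal value: for s \<le> t
  both \<open>X s\<close> and \<open>X t\<close> then integrate like \<open>X T\<close> over the
  events known at time s.\<close>

lemma admissibleI: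
  fixes X :: "real \<Rightarrow> 'a \<Rightarrow> real" and G :: "real \<Rightarrow> 'a measure"
  assumes P: "prob_space P" and T: "0 < T"
    and cad: "\<And>\<xi>. \<xi> \<in> space P \<Longrightarrow> cadlag_on T (\<lambda>t. X t \<xi>)"
    and X0: "AE \<xi> in P. X 0 \<xi> = 0" and law: "distr P borel (X T) = \<mu>"
    and int: "\<And>t. 0 \<le> t \<Longrightarrow> t \<le> T \<Longrightarrow> integrable P (X t)"
    and sub: "\<And>t. 0 \<le> t \<Longrightarrow> t \<le> T \<Longrightarrow> subalgebra P (G t)"
    and mono: "\<And>s t. 0 \<le> s \<Longrightarrow> s \<le> t \<Longrightarrow> t \<le> T \<Longrightarrow> sets (G s) \<subseteq> sets (G t)"
    and adapted: "\<And>t. 0 \<le> t \<Longrightarrow> t \<le> T \<Longrightarrow> \<exists>X'\<in>borel_measurable (G t). AE \<xi> in P. X t \<xi> = X' \<xi>"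
    and eq: "\<And>t A. 0 \<le> t \<Longrightarrow> t \<le> T \<Longrightarrow> A \<in> sets (G t) \<Longrightarrow> (LINT \<xi>:A|P. X T \<xi>) = (LINT \<xi>:A|P. X t \<xi>)"
  shows "admissible T \<mu> P X"
proof -
  interpret prob_space P by (rule P)
  \<comment> \<open>Times are clamped to \<open>[0, T]\<close> because a filtration is indexed by
    all reals.\<close>
  define F where "F t = augment P (G (max 0 (min t T)))" for t
  have F: "F t = augment P (G t)" if "t \<in> {0..T}" for t using that by (simp add: F_def)
  have subF: "subalgebra P (F t)" for t
    unfolding F_def using T by (intro subalgebra_augment sub) auto
  have "filtration (space P) F"
  proof
    show "space (F t) = space P" for t by (simp add: F_def)
    fix s t :: real assume "s \<le> t"
    then have "sets (G (max 0 (min s T))) \<subseteq> sets (G (max 0 (min t T)))"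
      using T by (intro mono) auto
    then show "sets (F s) \<subseteq> sets (F t)"
      using T by (auto simp: F_def sets_augment sub)
  qed
  moreover have meas: "X t \<in> borel_measurable (F t)" if "t \<in> {0..T}" for t
    using adapted[of t] int[of t] that sub[of t] by (auto simp: F intro: measurable_augment)
  moreover have eqF: "(LINT \<xi>:A|P. X T \<xi>) = (LINT \<xi>:A|P. X t \<xi>)" if t: "t \<in> {0..T}" and A: "A \<in> sets (F t)" for t A
  proof -
    have subt: "subalgebra P (G t)" using t by (auto intro: sub)
    obtain B where B: "A \<in> sets P" "B \<in> sets (G t)" "AE \<xi> in P. \<xi> \<in> A \<longleftrightarrow> \<xi> \<in> B"
      using A t by (auto simp: F sets_augment[OF subt])
    then have "B \<in> sets P" using subt by (auto simp: subalgebra_def)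
    then have "(LINT \<xi>:A|P. X s \<xi>) = (LINT \<xi>:B|P. X s \<xi>)" if "s \<in> {0..T}" for s
      using B int[of s] that by (intro set_integral_augment) auto
    then show ?thesis using eq[of t B] t B T by simp
  qed
  moreover have "AE \<xi> in P. real_cond_exp P (F s) (X t) \<xi> = X s \<xi>" if s: "s \<in> {0..T}" and t: "t \<in> {s..T}" for s t
  proof -
    interpret sigma_finite_subalgebra P "F s"
      by (intro finite_measure_subalgebra_is_sigma_finite)
         (simp add: finite_measure_subalgebra_def finite_measure_subalgebra_axioms_def subF finite_measure_axioms)
    show ?thesis
    proof (rule real_cond_exp_charact)
      fix A assume A: "A \<in> sets (F s)"
      then have "A \<in> sets (F t)" using \<open>filtration (space P) F\<close> t filtration.sets_F_mono by fastforce
      then show "(LINT \<xi>:A|P. X t \<xi>) = (LINT \<xi>:A|P. X s \<xi>)"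
        using eqF[OF s A] eqF[of t A] s t by auto
    qed (use s t int meas in auto)
  qed
  ultimately have "martingale_on P T F X"
    unfolding martingale_on_def using int subF by auto
  moreover have "uniformly_integrable_on P {0..T} X"
    using T by (intro uniformly_integrable_closed[where Y="X T" and G=F] int meas eqF subF) auto
  ultimately show ?thesis
    unfolding admissible_def using P cad X0 law by blast
qed

subsection \<open>Poisson random sets\<close>

text \<open>The probability that a Poisson set misses a region of intensity mass \<open>x\<close>,
  where \<open>x\<close> may be infinite.\<close>

definition exp_neg :: "ennreal \<Rightarrow> real" where
  "exp_neg x = (if x = \<top> then 0 else exp (- enn2real x))"

lemma exp_neg_ennreal: "0 \<le> x \<Longrightarrow> exp_neg (ennreal x) = exp (- x)"
  by (simp add: exp_neg_def)

lemma exp_neg_add: "exp_neg (x + y) = exp_neg x * exp_neg y"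
  by (cases x; cases y) (auto simp: exp_neg_def exp_diff exp_minus exp_add field_simps enn2real_plus)

lemma exp_neg_nonneg: "0 \<le> exp_neg x" and exp_neg_le_1: "exp_neg x \<le> 1"
  by (auto simp: exp_neg_def)

lemma exp_neg_0 [simp]: "exp_neg 0 = 1" and exp_neg_top [simp]: "exp_neg \<top> = 0"
  by (simp_all add: exp_neg_def)

lemma exp_neg_antimono: "x \<le> y \<Longrightarrow> exp_neg y \<le> exp_neg x"
  by (auto simp: exp_neg_def top_unique intro!: enn2real_mono simp: less_top)

lemma prod_exp_neg_tendsto:
  fixes p :: "nat \<Rightarrow> real"
  assumes "\<And>n. 0 \<le> p n"
  shows "(\<lambda>n. \<Prod>i\<le>n. exp (- p i)) \<longlonglongrightarrow> exp_neg (\<Sum>n. ennreal (p n))"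
proof -
  have prod: "(\<Prod>i\<le>n. exp (- p i)) = exp (- (\<Sum>i\<le>n. p i))" for n
    by (simp add: exp_sum sum_negf flip: sum_negf)
  show ?thesis
  proof (cases "summable p")
    case True
    then have "(\<lambda>n. \<Sum>i\<le>n. p i) \<longlonglongrightarrow> suminf p"
      by (simp add: summable_LIMSEQ')
    moreover have "exp_neg (\<Sum>n. ennreal (p n)) = exp (- suminf p)"
      using True assms by (subst suminf_ennreal2) (auto simp: exp_neg_ennreal suminf_nonneg)
    ultimately show ?thesis unfolding prod by (auto intro!: tendsto_intros)
  next
    case False
    have "(\<Sum>n. ennreal (p n)) = \<top>"
      using False summable_suminf_not_top[of p] assms by blast
    moreover have "filterlim (\<lambda>n. \<Sum>i\<le>n. p i) at_top sequentially"
    proof (rule ccontr)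
      assume "\<not> ?thesis"
      then obtain B where B: "\<not> eventually (\<lambda>n. B \<le> (\<Sum>i\<le>n. p i)) sequentially"
        by (auto simp: filterlim_at_top)
      have "incseq (\<lambda>n. \<Sum>i\<le>n. p i)" using assms by (intro incseq_SucI) simp
      have "(\<Sum>i\<le>n. p i) \<le> B" for n
      proof (rule ccontr)
        assume "\<not> ?thesis"
        then have "B \<le> (\<Sum>i\<le>m. p i)" if "n \<le> m" for m
          using incseqD[OF \<open>incseq _\<close> that] by linarith
        then show False using B by (auto simp: eventually_sequentially)
      qed
      then have "summable p" using assms by (intro bounded_imp_summable) auto
      with False show False by simp
    qed
    then have "(\<lambda>n. exp (- (\<Sum>i\<le>n. p i))) \<longlonglongrightarrow> 0"
      by (intro filterlim_compose[OF exp_at_bot] filterlim_compose[OF filterlim_uminus_at_bot_at_top])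
    ultimately show ?thesis unfolding prod by simp
  qed
qed

section \<open>Layers of an intensity and thinning\<close>

lemma min_1_ennreal_diff:
  assumes "0 \<le> x"
  shows "min 1 (ennreal x - of_nat m) = ennreal (max 0 (min 1 (x - real m)))"
proof -
  have "ennreal x - of_nat m = ennreal (x - real m)"
    unfolding ennreal_of_nat_eq_real_of_nat by (rule ennreal_minus) simp
  moreover have "min 1 (ennreal y) = ennreal (max 0 (min 1 y))" for y
  proof (cases "1 \<le> y")
    case True
    then show ?thesis using ennreal_leI[OF True] by (simp add: min_absorb1)
  next
    case False
    then have "ennreal y \<le> 1" using ennreal_leI[of y 1] by simp
    then show ?thesis using False by (simp add: min_absorb2 max_def ennreal_neg)
  qed
  ultimately show ?thesis by simp
qed

lemma sum_min_truncated: "(\<Sum>n<m. min 1 (r - of_nat n)) = min r (of_nat m)" for r :: ennreal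
proof (induction m)
  case (Suc m)
  show ?case
  proof (cases r)
    case top
    then show ?thesis using Suc by (simp add: ennreal_top_minus add.commute)
  next
    case (real x)
    have "min 1 (r - of_nat m) = ennreal (max 0 (min 1 (x - real m)))"
      using real by (simp add: min_1_ennreal_diff)
    moreover have m: "min r (of_nat n) = ennreal (min x (real n))" for n
      unfolding real(2) ennreal_of_nat_eq_real_of_nat using real(1) by (auto simp: min_def)
    ultimately have "(\<Sum>n<Suc m. min 1 (r - of_nat n)) = ennreal (min x (real m)) + ennreal (max 0 (min 1 (x - real m)))"
      using Suc by (simp only: sum.lessThan_Suc)
    also have "\<dots> = ennreal (min x (real m) + max 0 (min 1 (x - real m)))"
      using real by (intro ennreal_plus[symmetric]) auto
    also have "min x (real m) + max 0 (min 1 (x - real m)) = min x (real (Suc m))" by auto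
    finally show ?thesis by (simp only: m)
  qed
qed simp

text \<open>Slices an intensity into layers of density at most 1 (subtraction in
  \<open>ennreal\<close> is truncated at 0). Each layer can be realized by thinning a Poisson number
  of samples of \<mu>, and infinite rates are covered by infinitely many layers.\<close>

lemma suminf_min_truncated: "(\<Sum>n. min 1 (r - of_nat n)) = r" for r :: ennreal
proof -
  have "(\<lambda>m. min r (of_nat m)) \<longlonglongrightarrow> min r \<top>"
    by (intro tendsto_min tendsto_const) (rule of_nat_tendsto_top_ennreal)
  then have "(\<lambda>m. \<Sum>n<m. min 1 (r - of_nat n)) \<longlonglongrightarrow> r"
    by (simp add: sum_min_truncated)
  then have "(\<lambda>n. min 1 (r - of_nat n)) sums r" by (simp add: sums_def)
  then show ?thesis by (rule sums_unique[symmetric])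
qed

abbreviation unit_uniform :: "real measure" where
  "unit_uniform \<equiv> uniform_measure lborel {0..1}"

lemma emeasure_unit_uniform_le: "emeasure unit_uniform {y. ennreal (real n + y) \<le> r} = min 1 (r - of_nat n)"
proof -
  have [measurable]: "{y. ennreal (real n + y) \<le> r} \<in> sets borel" by measurable
  have "emeasure unit_uniform {y. ennreal (real n + y) \<le> r} = emeasure lborel ({0..1} \<inter> {y. ennreal (real n + y) \<le> r})"
    by (simp add: emeasure_uniform_measure divide_ennreal_def)
  also have "\<dots> = min 1 (r - of_nat n)"
  proof (cases r)
    case top
    then show ?thesis by (simp add: ennreal_top_minus)
  next
    case (real x)
    have "{0..1} \<inter> {y. ennreal (real n + y) \<le> r} = {0..min 1 (x - real n)}"
      using real by auto
    moreover have "min 1 (r - of_nat n) = ennreal (max 0 (min 1 (x - real n)))"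
      using real by (simp add: min_1_ennreal_diff)
    ultimately show ?thesis by (cases "x \<ge> real n") (auto simp: max_def)
  qed
  finally show ?thesis .
qed

text \<open>The marks do the thinning: given \<open>x\<close>, a uniform mark satisfies n + y \<le>
  r x with probability min 1 (r x - n), the height of layer \<open>n\<close> at
  \<open>x\<close>.\<close>

lemma emeasure_thinned:
  assumes \<mu>: "real_distribution \<mu>" and [measurable]: "r \<in> borel_measurable borel" "B \<in> sets borel"
  shows "emeasure (\<mu> \<Otimes>\<^sub>M unit_uniform) {(x, y). x \<in> B \<and> ennreal (real n + y) \<le> r x} =
    (\<integral>\<^sup>+x\<in>B. min 1 (r x - of_nat n) \<partial>\<mu>)"
proof -
  interpret \<mu>: real_distribution \<mu> by fact
  interpret U: prob_space unit_uniform by (intro prob_space_uniform_measure) auto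
  let ?R = "{(x, y). x \<in> B \<and> ennreal (real n + y) \<le> r x}"
  have R: "?R \<in> sets (\<mu> \<Otimes>\<^sub>M unit_uniform)"
  proof -
    have "{z \<in> space (\<mu> \<Otimes>\<^sub>M unit_uniform). fst z \<in> B \<and> ennreal (real n + snd z) \<le> r (fst z)} \<in> sets (\<mu> \<Otimes>\<^sub>M unit_uniform)"
      by measurable
    also have "{z \<in> space (\<mu> \<Otimes>\<^sub>M unit_uniform). fst z \<in> B \<and> ennreal (real n + snd z) \<le> r (fst z)} = ?R"
      by (auto simp: space_pair_measure)
    finally show ?thesis .
  qed
  have "emeasure (\<mu> \<Otimes>\<^sub>M unit_uniform) ?R = (\<integral>\<^sup>+x. emeasure unit_uniform (Pair x -` ?R) \<partial>\<mu>)"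
    by (rule U.emeasure_pair_measure_alt[OF R])
  also have "\<dots> = (\<integral>\<^sup>+x. min 1 (r x - of_nat n) * indicator B x \<partial>\<mu>)"
  proof (rule nn_integral_cong)
    fix x
    have "Pair x -` ?R = (if x \<in> B then {y. ennreal (real n + y) \<le> r x} else {})" by auto
    then show "emeasure unit_uniform (Pair x -` ?R) = min 1 (r x - of_nat n) * indicator B x"
      by (auto simp: emeasure_unit_uniform_le simp del: emeasure_uniform_measure)
  qed
  finally show ?thesis by simp
qed

text \<open>Given that there are \<open>k\<close> samples, all of them miss \<open>R\<close> with
  probability q^k, where q = 1 - Z(R); the generating function of the Poisson law with parameter 1
  at q is exp (q - 1).\<close>

lemma poisson_void:
  assumes Z: "prob_space Z" and R: "R \<in> sets Z"
  shows "measure (measure_pmf (poisson_pmf 1) \<Otimes>\<^sub>M (\<Pi>\<^sub>M i\<in>UNIV::nat set. Z))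
      {z \<in> space (measure_pmf (poisson_pmf 1) \<Otimes>\<^sub>M (\<Pi>\<^sub>M i\<in>UNIV::nat set. Z)). \<forall>i<fst z. snd z i \<notin> R} =
    exp (- measure Z R)" (is "measure ?Q ?V = _")
    and "{z \<in> space (measure_pmf (poisson_pmf 1) \<Otimes>\<^sub>M (\<Pi>\<^sub>M i\<in>UNIV::nat set. Z)). \<forall>i<fst z. snd z i \<notin> R} \<in>
      sets (measure_pmf (poisson_pmf 1) \<Otimes>\<^sub>M (\<Pi>\<^sub>M i\<in>UNIV::nat set. Z))"
proof -
  interpret Z: prob_space Z by fact
  interpret ZZ: sequence_space Z by unfold_locales
  note [measurable] = R
  let ?p = "measure_pmf (poisson_pmf 1)"
  show V: "?V \<in> sets ?Q" by measurable
  define q where "q = 1 - measure Z R"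
  have q: "0 \<le> q" by (simp add: q_def)
  have slice: "emeasure ZZ.S (Pair k -` ?V) = ennreal (q ^ k)" for k
  proof -
    have *: "Pair k -` ?V = Pi UNIV (\<lambda>i. if i < k then space Z - R else space Z)"
      by (auto simp: space_pair_measure space_PiM Pi_iff PiE_iff split: if_splits)
    have lim: "(\<lambda>n. \<Prod>i\<le>n. measure Z (if i < k then space Z - R else space Z)) \<longlonglongrightarrow>
        measure ZZ.S (Pi UNIV (\<lambda>i. if i < k then space Z - R else space Z))"
      by (rule ZZ.measure_PiM_countable) auto
    have ev: "eventually (\<lambda>n. (\<Prod>i\<le>n. measure Z (if i < k then space Z - R else space Z)) = q ^ k) sequentially"
      using eventually_ge_at_top[of k]
    proof eventually_elim
      case (elim n)
      have "(\<Prod>i\<le>n. measure Z (if i < k then space Z - R else space Z)) = (\<Prod>i\<le>n. if i < k then q else 1)"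
        by (intro prod.cong) (auto simp: q_def Z.prob_compl Z.prob_space)
      also have "\<dots> = (\<Prod>i\<in>{..<k}. q)"
        using elim by (intro prod.mono_neutral_cong_right) auto
      finally show ?case by simp
    qed
    have "measure ZZ.S (Pair k -` ?V) = q ^ k"
      unfolding * by (rule LIMSEQ_unique[OF lim tendsto_eventually[OF ev]])
    then show ?thesis by (simp add: ZZ.P.emeasure_eq_measure)
  qed
  have "emeasure ?Q ?V = (\<integral>\<^sup>+k. ennreal (q ^ k) \<partial>?p)"
    by (subst ZZ.P.emeasure_pair_measure_alt[OF V]) (simp only: slice)
  also have "\<dots> = (\<Sum>k. ennreal (1 / fact k * exp (- 1) * q ^ k))"
    by (simp add: nn_integral_measure_pmf nn_integral_count_space_nat ennreal_mult'[symmetric] q)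
  also have "\<dots> = ennreal (exp (- measure Z R))"
  proof (rule suminf_ennreal_eq)
    have "(\<lambda>k. q ^ k /\<^sub>R fact k) sums exp q" by (rule exp_converges)
    then have "(\<lambda>k. exp (- 1) * (q ^ k /\<^sub>R fact k)) sums (exp (- 1) * exp q)" by (rule sums_mult)
    moreover have "exp (- 1) * exp q = exp (- measure Z R)" by (simp add: q_def flip: exp_add)
    moreover have "exp (- 1) * (q ^ k /\<^sub>R fact k) = 1 / fact k * exp (- 1) * q ^ k" for k
      by (simp add: divide_inverse)
    ultimately show "(\<lambda>k. 1 / fact k * exp (- 1) * q ^ k) sums exp (- measure Z R)"
      by simp
  qed (use q in auto)
  finally show "measure ?Q ?V = exp (- measure Z R)"
    by (simp add: measure_def)
qed

text \<open>Independent layers, each a Poisson number of marked samples; the product of their void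
  probabilities is the exponential of minus the total intensity. The random set enters only through
  the events of missing a Borel set, so no sigma-algebra on sets of reals has to be fixed.\<close>

lemma ex_poisson_random_set:
  assumes \<mu>: "real_distribution \<mu>" and r[measurable]: "r \<in> borel_measurable borel"
  obtains P :: "(real \<Rightarrow> real) measure" and w :: "(real \<Rightarrow> real) \<Rightarrow> real" and N :: "(real \<Rightarrow> real) \<Rightarrow> real set"
  where "prob_space P" "w \<in> borel_measurable P"
    "\<And>B. B \<in> sets borel \<Longrightarrow> {\<xi>\<in>space P. N \<xi> \<inter> B = {}} \<in> sets P"
    "\<And>B C. B \<in> sets borel \<Longrightarrow> C \<in> sets borel \<Longrightarrow>
      measure P {\<xi>\<in>space P. N \<xi> \<inter> B = {} \<and> w \<xi> \<in> C} = exp_neg (\<integral>\<^sup>+x\<in>B. r x \<partial>\<mu>) * measure \<mu> C"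
proof -
  interpret \<mu>: real_distribution \<mu> by fact
  interpret U: prob_space unit_uniform by (intro prob_space_uniform_measure) auto
  define Z where "Z = \<mu> \<Otimes>\<^sub>M unit_uniform"
  interpret Zp: pair_prob_space \<mu> unit_uniform ..
  have Z: "prob_space Z" unfolding Z_def by (rule Zp.prob_space_axioms)
  have [measurable_cong]: "sets Z = sets (borel \<Otimes>\<^sub>M borel)"
    unfolding Z_def by (intro sets_pair_measure_cong) auto
  have spZ: "space Z = UNIV" by (simp add: Z_def space_pair_measure)
  interpret Z: prob_space Z by (rule Z)
  interpret ZZ: sequence_space Z by unfold_locales
  let ?p = "measure_pmf (poisson_pmf 1)"
  define Q where "Q = ?p \<Otimes>\<^sub>M ZZ.S"
  interpret Qp: pair_prob_space ?p ZZ.S ..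
  have Q: "prob_space Q" unfolding Q_def by (rule Qp.prob_space_axioms)
  have [measurable_cong]: "sets Q = sets (count_space UNIV \<Otimes>\<^sub>M ZZ.S)"
    unfolding Q_def by (intro sets_pair_measure_cong) auto
  have spQ: "space Q = UNIV" by (simp add: Q_def space_pair_measure space_PiM spZ)
  interpret Q: prob_space Q by (rule Q)
  interpret QQ: sequence_space Q by unfold_locales
  interpret P0p: pair_prob_space \<mu> QQ.S ..
  define P0 where "P0 = \<mu> \<Otimes>\<^sub>M QQ.S"
  have P0: "prob_space P0" unfolding P0_def by (rule P0p.prob_space_axioms)
  interpret P0: prob_space P0 by (rule P0)
  have spP0: "space P0 = UNIV" by (simp add: P0_def space_pair_measure space_PiM spQ)
  define R where "R B n = {(x, y). x \<in> B \<and> ennreal (real n + y) \<le> r x}" for B n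
  have R: "R B n \<in> sets Z" if [measurable]: "B \<in> sets borel" for B n
  proof -
    have "{z \<in> space Z. fst z \<in> B \<and> ennreal (real n + snd z) \<le> r (fst z)} \<in> sets Z"
      by measurable
    also have "{z \<in> space Z. fst z \<in> B \<and> ennreal (real n + snd z) \<le> r (fst z)} = R B n"
      by (auto simp: R_def spZ)
    finally show ?thesis .
  qed
  define N0 where "N0 f = {x. \<exists>n. \<exists>i<fst (f n). x = fst (snd (f n) i) \<and> ennreal (real n + snd (snd (f n) i)) \<le> r x}"
    for f :: "nat \<Rightarrow> nat \<times> (nat \<Rightarrow> real \<times> real)"
  define V where "V B n = {z \<in> space Q. \<forall>i<fst z. snd z i \<notin> R B n}" for B n
  have V: "V B n \<in> sets Q" "measure Q (V B n) = exp (- measure Z (R B n))" if "B \<in> sets borel" for B n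
    unfolding V_def Q_def using poisson_void[OF Z R[OF that]] by auto
  have N0_iff: "N0 f \<inter> B = {} \<longleftrightarrow> f \<in> Pi UNIV (V B)" for f B
    unfolding N0_def V_def R_def spQ Pi_iff case_prod_beta' by blast
  have void: "measure QQ.S (Pi UNIV (V B)) = exp_neg (\<integral>\<^sup>+x\<in>B. r x \<partial>\<mu>)" if B[measurable]: "B \<in> sets borel" for B
  proof -
    have lim: "(\<lambda>n. \<Prod>i\<le>n. measure Q (V B i)) \<longlonglongrightarrow> measure QQ.S (Pi UNIV (V B))"
      by (rule QQ.measure_PiM_countable) (rule V[OF B])
    have lim': "(\<lambda>n. \<Prod>i\<le>n. measure Q (V B i)) \<longlonglongrightarrow> exp_neg (\<Sum>n. ennreal (measure Z (R B n)))"
      unfolding V(2)[OF B] by (rule prod_exp_neg_tendsto) simp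
    have "measure QQ.S (Pi UNIV (V B)) = exp_neg (\<Sum>n. emeasure Z (R B n))"
      unfolding Z.emeasure_eq_measure by (rule LIMSEQ_unique[OF lim lim'])
    also have "(\<Sum>n. emeasure Z (R B n)) = (\<Sum>n. \<integral>\<^sup>+x\<in>B. min 1 (r x - of_nat n) \<partial>\<mu>)"
      unfolding Z_def R_def by (simp add: emeasure_thinned[OF \<mu> r B])
    also have "\<dots> = (\<integral>\<^sup>+x. (\<Sum>n. min 1 (r x - of_nat n) * indicator B x) \<partial>\<mu>)"
      by (rule nn_integral_suminf[symmetric]) measurable
    also have "\<dots> = (\<integral>\<^sup>+x\<in>B. r x \<partial>\<mu>)"
      by (simp add: suminf_min_truncated)
    finally show ?thesis .
  qed
  \<comment> \<open>Transport to a space of real functions: target (tag 0), sample numbers (tag 1),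
    positions (tag 2) and marks (tag 3) are stored as values at coded natural numbers, and
    \<open>pr\<close> is a left inverse of the encoding \<open>h\<close>.\<close>
  define idx where "idx t n i = real (prod_encode (t, prod_encode (n, i)))" for t n i :: nat
  define h :: "real \<times> (nat \<Rightarrow> nat \<times> (nat \<Rightarrow> real \<times> real)) \<Rightarrow> real \<Rightarrow> real" where
    "h z u = (case prod_decode (nat \<lfloor>u\<rfloor>) of (t, v) \<Rightarrow> case prod_decode v of (n, i) \<Rightarrow>
       if t = 0 then fst z else if t = 1 then real (fst (snd z n))
       else if t = 2 then fst (snd (snd z n) i) else snd (snd (snd z n) i))" for z u
  define pr :: "(real \<Rightarrow> real) \<Rightarrow> real \<times> (nat \<Rightarrow> nat \<times> (nat \<Rightarrow> real \<times> real))" where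
    "pr \<xi> = (\<xi> (idx 0 0 0), \<lambda>n. (nat \<lfloor>\<xi> (idx 1 n 0)\<rfloor>, \<lambda>i. (\<xi> (idx 2 n i), \<xi> (idx 3 n i))))" for \<xi>
  have pr_h: "pr (h z) = z" for z
    by (cases z) (auto simp: pr_def h_def idx_def fun_eq_iff prod_eq_iff)
  let ?PM = "\<Pi>\<^sub>M u\<in>(UNIV::real set). (borel :: real measure)"
  have h[measurable]: "h \<in> measurable P0 ?PM"
  proof (rule measurable_PiM_single')
    fix u
    show "(\<lambda>z. h z u) \<in> borel_measurable P0"
      unfolding h_def P0_def by (simp split: prod.split) measurable
  qed (auto simp: space_PiM)
  have pr[measurable]: "pr \<in> measurable ?PM P0"
  proof -
    have "(\<lambda>\<xi>. (nat \<lfloor>\<xi> (idx 1 n 0)\<rfloor>, \<lambda>i. (\<xi> (idx 2 n i), \<xi> (idx 3 n i)))) \<in> measurable ?PM Q" for n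
    proof -
      have "(\<lambda>\<xi>. \<lambda>i. (\<xi> (idx 2 n i), \<xi> (idx 3 n i))) \<in> measurable ?PM ZZ.S"
        by (rule measurable_PiM_single') (auto simp: spZ)
      then show ?thesis by measurable
    qed
    then have "(\<lambda>\<xi>. \<lambda>n. (nat \<lfloor>\<xi> (idx 1 n 0)\<rfloor>, \<lambda>i. (\<xi> (idx 2 n i), \<xi> (idx 3 n i)))) \<in> measurable ?PM QQ.S"
      by (intro measurable_PiM_single') (auto simp: spQ)
    then show ?thesis unfolding pr_def[abs_def] P0_def by measurable
  qed
  define P where "P = distr P0 ?PM h"
  have distr_pr: "distr P P0 pr = P0"
    unfolding P_def by (subst distr_distr) (auto simp: comp_def pr_h distr_id2)
  have prP[measurable]: "pr \<in> measurable P P0" unfolding P_def by simp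
  define w where "w \<xi> = fst (pr \<xi>)" for \<xi>
  define N where "N \<xi> = N0 (snd (pr \<xi>))" for \<xi>
  have set0: "UNIV \<times> Pi UNIV (V B) \<in> sets P0" "C \<times> Pi UNIV (V B) \<in> sets P0"
    if "B \<in> sets borel" "C \<in> sets borel" for B C
    using V[OF that(1)] that(2) unfolding P0_def by (auto intro!: pair_measureI)
  show ?thesis
  proof (rule that)
    show "prob_space P" unfolding P_def by (rule P0.prob_space_distr) simp
    have "fst \<in> borel_measurable P0" unfolding P0_def by measurable
    then show "w \<in> borel_measurable P" unfolding w_def[abs_def] by measurable
    fix B :: "real set" assume B: "B \<in> sets borel"
    have "{\<xi>\<in>space P. N \<xi> \<inter> B = {}} = pr -` (UNIV \<times> Pi UNIV (V B)) \<inter> space P"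
      by (auto simp: N_def N0_iff mem_Times_iff)
    then show "{\<xi>\<in>space P. N \<xi> \<inter> B = {}} \<in> sets P"
      using measurable_sets[OF prP set0(1)[OF B]] by simp
    fix C :: "real set" assume C: "C \<in> sets borel"
    have "{\<xi>\<in>space P. N \<xi> \<inter> B = {} \<and> w \<xi> \<in> C} = pr -` (C \<times> Pi UNIV (V B)) \<inter> space P"
      by (auto simp: N_def w_def N0_iff mem_Times_iff)
    then have "measure P {\<xi>\<in>space P. N \<xi> \<inter> B = {} \<and> w \<xi> \<in> C} = measure (distr P P0 pr) (C \<times> Pi UNIV (V B))"
      using set0[OF B C] by (simp add: measure_distr)
    also have "\<dots> = measure \<mu> C * measure QQ.S (Pi UNIV (V B))"
      unfolding distr_pr unfolding P0_def using C V[OF B]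
      by (simp add: measure_def QQ.P.emeasure_pair_measure_Times QQ.infprod_in_sets enn2real_mult)
    finally show "measure P {\<xi>\<in>space P. N \<xi> \<inter> B = {} \<and> w \<xi> \<in> C} = exp_neg (\<integral>\<^sup>+x\<in>B. r x \<partial>\<mu>) * measure \<mu> C"
      by (simp add: void[OF B])
  qed
qed

subsection \<open>Right-continuous version of the prescribed maximum\<close>

lemma emeasure_greaterThan_eq_SUP:
  fixes x :: real
  assumes "sets M = sets borel"
  shows "emeasure M {x<..} = (SUP n. emeasure M {x + 1 / real (Suc n)..})"
proof -
  have un: "{x<..} = (\<Union>n. {x + 1 / real (Suc n)..})"
  proof (intro set_eqI iffI)
    fix y assume "y \<in> {x<..}"
    then obtain n where "inverse (real (Suc n)) < y - x" using reals_Archimedean[of "y - x"] by auto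
    then have "x + 1 / real (Suc n) \<le> y" by (simp add: inverse_eq_divide)
    then show "y \<in> (\<Union>n. {x + 1 / real (Suc n)..})" by blast
  next
    fix y assume "y \<in> (\<Union>n. {x + 1 / real (Suc n)..})"
    then obtain n where "x + 1 / real (Suc n) \<le> y" by blast
    moreover have "0 < 1 / real (Suc n)" by simp
    ultimately have "x < y" by linarith
    then show "y \<in> {x<..}" by simp
  qed
  have inc: "incseq (\<lambda>n. {x + 1 / real (Suc n)..})"
    by (intro incseq_SucI atLeast_subset_iff[THEN iffD2] disjI2 add_left_mono frac_le)  simp_all
  have "range (\<lambda>n. {x + 1 / real (Suc n)..}) \<subseteq> sets M"
    unfolding assms by (intro image_subsetI) simp
  from SUP_emeasure_incseq[OF this inc] show ?thesis unfolding un by (rule sym)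
qed

lemma measure_eqI_atLeast:
  fixes M N :: "real measure"
  assumes sets: "sets M = sets borel" "sets N = sets borel"
    and fin: "finite_measure M"
    and eq: "\<And>x. emeasure M {x..} = emeasure N {x..}"
  shows "M = N"
proof (rule measure_eqI_lessThan[OF sets])
  interpret finite_measure M by fact
  show "emeasure M {x<..} < \<infinity>" for x by (simp add: emeasure_eq_measure)
  show "emeasure M {x<..} = emeasure N {x<..}" for x
    using sets eq by (simp add: emeasure_greaterThan_eq_SUP)
qed

lemma measure_eqI_atLeast_above:
  fixes M N :: "real measure"
  assumes sets: "sets M = sets borel" "sets N = sets borel"
    and fin: "finite_measure M" and null: "emeasure M {..j} = 0" "emeasure N {..j} = 0"
    and eq: "\<And>x. j < x \<Longrightarrow> emeasure M {x..} = emeasure N {x..}"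
  shows "M = N"
proof (rule measure_eqI_lessThan[OF sets])
  interpret finite_measure M by fact
  show "emeasure M {x<..} < \<infinity>" for x by (simp add: emeasure_eq_measure)
  have *: "emeasure M {x<..} = emeasure N {x<..}" if "j \<le> x" for x
  proof -
    have "j < x + 1 / real (Suc n)" for n
      using that divide_pos_pos[of 1 "real (Suc n)"] by linarith
    then show ?thesis using sets eq by (simp only: emeasure_greaterThan_eq_SUP)
  qed
  fix x
  show "emeasure M {x<..} = emeasure N {x<..}"
  proof (cases "j \<le> x")
    case False
    have "emeasure K {x<..} = emeasure K {j<..}" if "sets K = sets borel" "emeasure K {..j} = 0" for K
    proof -
      have "{x<..} = {j<..} \<union> {x<..j}" using False by auto
      moreover have "{x<..j} \<in> null_sets K"
        using that emeasure_mono[of "{x<..j}" "{..j}" K] by (auto simp: null_sets_def subset_eq)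
      ultimately show ?thesis using that by (simp add: emeasure_Un_null_set)
    qed
    then show ?thesis using sets null *[of j] by simp
  qed (rule *)
qed

text \<open>
  The exponential \<open>exp (- T)\<close> satisfies \<open>d exp (- T) = - exp (- T) dT\<close> for continuous \<open>T\<close>;
  both sides have the same increments up to an error quadratic in the increment of \<open>T\<close>.
\<close>

lemma eq_if_quadratic_increments:
  fixes d T :: "real \<Rightarrow> real"
  assumes q: "\<And>x y. \<bar>d x - d y\<bar> \<le> (T x - T y)\<^sup>2" and T: "continuous_on {a..b} T" and "a \<le> b"
  shows "d a = d b"
proof -
  have bound: "\<bar>d a - d b\<bar> \<le> (T b - T a)\<^sup>2 / real (Suc n)" for n
  proof -
    \<comment> \<open>Equally spaced values of \<open>T\<close>, attained by the intermediate value
      theorem. Each of the \<open>Suc n\<close> steps contributes an error of at most the square of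
      one spacing, so the total decays like 1 / Suc n.\<close>
    define s where "s k = T a + (T b - T a) * (real k / real (Suc n))" for k
    have "\<exists>x\<in>{a..b}. T x = s k" if "k \<le> Suc n" for k
    proof -
      define p where "p = real k / real (Suc n)"
      have p: "0 \<le> p" "p \<le> 1" using that by (simp_all add: p_def divide_le_eq)
      have sp: "s k = T a + (T b - T a) * p" by (simp add: s_def p_def)
      consider "T a \<le> T b" | "T b \<le> T a" by linarith
      then show ?thesis
      proof cases
        case 1
        have "(T b - T a) * p \<le> (T b - T a) * 1" using 1 p by (intro mult_left_mono) auto
        moreover have "0 \<le> (T b - T a) * p" using 1 p by (intro mult_nonneg_nonneg) auto
        ultimately have "T a \<le> s k" "s k \<le> T b" unfolding sp by simp_all
        then show ?thesis using IVT'[of T a "s k" b] T \<open>a \<le> b\<close> by auto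
      next
        case 2
        have "(T b - T a) * 1 \<le> (T b - T a) * p" using 2 p by (intro mult_left_mono_neg) auto
        moreover have "(T b - T a) * p \<le> 0" using 2 p by (intro mult_nonpos_nonneg) auto
        ultimately have "T b \<le> s k" "s k \<le> T a" unfolding sp by simp_all
        then show ?thesis using IVT2'[of T b "s k" a] T \<open>a \<le> b\<close> by auto
      qed
    qed
    then obtain x where x: "\<And>k. k \<le> Suc n \<Longrightarrow> T (x k) = s k" by metis
    have step: "\<bar>d (x (Suc k)) - d (x k)\<bar> \<le> ((T b - T a) / real (Suc n))\<^sup>2" if "k < Suc n" for k
    proof -
      have "T (x (Suc k)) - T (x k) = (T b - T a) / real (Suc n)"
        using x[of k] x[of "Suc k"] that by (simp add: s_def field_simps)
      then show ?thesis using q[of "x (Suc k)" "x k"] by simp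
    qed
    have "\<bar>d (x m) - d (x 0)\<bar> \<le> real m * ((T b - T a) / real (Suc n))\<^sup>2" if "m \<le> Suc n" for m
      using that
    proof (induction m)
      case (Suc m)
      then show ?case using step[of m] by (simp add: distrib_right)
    qed simp
    from this[of "Suc n"] have "\<bar>d (x (Suc n)) - d (x 0)\<bar> \<le> (T b - T a)\<^sup>2 / real (Suc n)"
      by (simp add: power_divide power2_eq_square del: of_nat_Suc)
    moreover have "d (x (Suc n)) = d b" using q[of "x (Suc n)" b] x[of "Suc n"] by (simp add: s_def)
    moreover have "d (x 0) = d a" using q[of "x 0" a] x[of 0] by (simp add: s_def)
    ultimately show ?thesis by simp
  qed
  have "(\<lambda>n. (T b - T a)\<^sup>2 * (1 / real (Suc n))) \<longlonglongrightarrow> (T b - T a)\<^sup>2 * 0"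
    by (intro tendsto_mult tendsto_const LIMSEQ_Suc lim_1_over_n)
  then have "\<bar>d a - d b\<bar> \<le> 0"
    using bound by (intro LIMSEQ_le_const) auto
  then show ?thesis by simp
qed

text \<open>Over \<open>[x, y)\<close> both the integral and the drop of exp (- cdf) lie between exp
  (- T y) (T y - T x) and exp (- T x) (T y - T x), and these bounds differ by at most the square of
  T y - T x. Without atoms the distribution function \<open>T\<close> is continuous and end points
  of intervals do not count.\<close>

lemma exp_cdf_integral:
  assumes M: "finite_borel_measure M" and atom: "\<And>x. measure M {x} = 0" and "i \<le> b"
  shows "(\<integral>\<^sup>+x\<in>{i..<b}. ennreal (exp (- cdf M x)) \<partial>M) = ennreal (exp (- cdf M i) - exp (- cdf M b))"
proof -
  interpret finite_borel_measure M by fact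
  let ?T = "cdf M"
  have mono: "x \<le> y \<Longrightarrow> ?T x \<le> ?T y" for x y by (rule cdf_nondecreasing)
  have meas[measurable]: "?T \<in> borel_measurable borel"
    by (rule borel_measurable_mono) (auto intro!: monoI mono)
  have cont: "continuous_on S ?T" for S
    using atom by (auto intro!: continuous_at_imp_continuous_on simp: isCont_cdf)
  have T0: "0 \<le> ?T x" for x by (simp add: cdf_def)
  have "measure M {x..<y} = ?T y - ?T x" if "x \<le> y" for x y
  proof -
    have "{..y} = {..x} \<union> {x<..y}" using that by auto
    then have "?T y = measure M ({..x} \<union> {x<..y})" by (simp add: cdf_def)
    also have "\<dots> = ?T x + measure M {x<..y}"
      unfolding cdf_def by (rule finite_measure_Union) auto
    finally have "?T y = ?T x + measure M {x<..y}" .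
    moreover have "measure M {x<..y} = measure M {x..<y}"
    proof (cases "x = y")
      case False
      have a: "measure M (A \<union> {z}) = measure M A" if "z \<notin> A" "A \<in> sets borel" for A z
        using that atom[of z] by (subst finite_measure_Union) auto
      have "{x<..y} = {x<..<y} \<union> {y}" "{x..<y} = {x<..<y} \<union> {x}" using that False by auto
      then show ?thesis using a[of y "{x<..<y}"] a[of x "{x<..<y}"] by simp
    qed simp
    ultimately show ?thesis by simp
  qed
  note ivl = this
  define f where "f x = (\<integral>z. indicator {..<x} z * exp (- ?T z) \<partial>M)" for x
  have int: "integrable M (\<lambda>z. indicator A z * exp (- ?T z))" if [measurable]: "A \<in> sets borel" for A
  proof (rule integrable_const_bound[where B=1])
    show "AE x in M. norm (indicator A x * exp (- ?T x)) \<le> 1" using T0 by (auto simp: indicator_def)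
    note [measurable_cong] = M_is_borel
    show "(\<lambda>z. indicator A z * exp (- ?T z)) \<in> borel_measurable M" by measurable
  qed
  have f_diff: "f y - f x = (\<integral>z. indicator {x..<y} z * exp (- ?T z) \<partial>M)" if "x \<le> y" for x y
  proof -
    have "f y = (\<integral>z. indicator {..<x} z * exp (- ?T z) + indicator {x..<y} z * exp (- ?T z) \<partial>M)"
      unfolding f_def using that by (intro Bochner_Integration.integral_cong) (auto simp: indicator_def)
    also have "\<dots> = f x + (\<integral>z. indicator {x..<y} z * exp (- ?T z) \<partial>M)"
      unfolding f_def by (intro Bochner_Integration.integral_add int) auto
    finally show ?thesis by simp
  qed
  have sandwich: "exp (- ?T y) * (?T y - ?T x) \<le> f y - f x" "f y - f x \<le> exp (- ?T x) * (?T y - ?T x)" if "x \<le> y" for x y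
  proof -
    have c: "(\<integral>z. indicator {x..<y} z * c \<partial>M) = c * (?T y - ?T x)" "integrable M (\<lambda>z. indicator {x..<y} z * c)" for c
      using ivl[OF that] sets_eq_imp_space_eq[OF M_is_borel]
      by (auto intro!: integrable_mult_left integrable_real_indicator simp: emeasure_eq_measure)
    show "exp (- ?T y) * (?T y - ?T x) \<le> f y - f x"
      unfolding f_diff[OF that] c(1)[symmetric]
      by (intro integral_mono c int) (auto simp: indicator_def mono)
    show "f y - f x \<le> exp (- ?T x) * (?T y - ?T x)"
      unfolding f_diff[OF that] c(1)[symmetric]
      by (intro integral_mono c int) (auto simp: indicator_def mono)
  qed
  have exp_sandwich: "exp (- t) * (t - s) \<le> exp (- s) - exp (- t)" "exp (- s) - exp (- t) \<le> exp (- s) * (t - s)"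
    and exp_lip: "exp (- s) - exp (- t) \<le> t - s" if "0 \<le> s" "s \<le> t" for s t :: real
  proof -
    have "exp (- s) = exp (- t) * exp (t - s)" by (simp flip: exp_add)
    moreover have "1 + (t - s) \<le> exp (t - s)" by (rule exp_ge_add_one_self)
    then have "exp (- t) * (1 + (t - s)) \<le> exp (- t) * exp (t - s)" by (intro mult_left_mono) auto
    ultimately show "exp (- t) * (t - s) \<le> exp (- s) - exp (- t)" by (simp add: algebra_simps)
    have "exp (- t) = exp (- s) * exp (s - t)" by (simp flip: exp_add)
    moreover have "1 + (s - t) \<le> exp (s - t)" by (rule exp_ge_add_one_self)
    then have "exp (- s) * (1 + (s - t)) \<le> exp (- s) * exp (s - t)" by (intro mult_left_mono) auto
    ultimately show *: "exp (- s) - exp (- t) \<le> exp (- s) * (t - s)" by (simp add: algebra_simps)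
    have "exp (- s) * (t - s) \<le> 1 * (t - s)" using that by (intro mult_right_mono) auto
    with * show "exp (- s) - exp (- t) \<le> t - s" by simp
  qed
  have quad: "\<bar>(f x + exp (- ?T x)) - (f y + exp (- ?T y))\<bar> \<le> (?T x - ?T y)\<^sup>2" if "x \<le> y" for x y
  proof -
    let ?s = "?T x" and ?t = "?T y"
    have st: "0 \<le> ?s" "?s \<le> ?t" using T0 mono[OF that] by auto
    have "(exp (- ?s) - exp (- ?t)) * (?t - ?s) \<le> (?t - ?s) * (?t - ?s)"
      using exp_lip[OF st] st by (intro mult_right_mono) auto
    then show ?thesis
      using sandwich[OF that] exp_sandwich[OF st]
      by (auto simp: power2_eq_square algebra_simps abs_le_iff)
  qed
  have quad': "\<bar>(f x + exp (- ?T x)) - (f y + exp (- ?T y))\<bar> \<le> (?T x - ?T y)\<^sup>2" for x y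
    using quad[of x y] quad[of y x] by (cases "x \<le> y") (auto simp: power2_commute abs_minus_commute)
  have "f i + exp (- ?T i) = f b + exp (- ?T b)"
    by (rule eq_if_quadratic_increments[of "\<lambda>x. f x + exp (- ?T x)" ?T, OF quad' cont \<open>i \<le> b\<close>])
  then have "exp (- ?T i) - exp (- ?T b) = (\<integral>z. indicator {i..<b} z * exp (- ?T z) \<partial>M)"
    using f_diff[OF \<open>i \<le> b\<close>] by simp
  moreover have "(\<integral>\<^sup>+x\<in>{i..<b}. ennreal (exp (- ?T x)) \<partial>M) = (\<integral>\<^sup>+x. ennreal (indicator {i..<b} x * exp (- ?T x)) \<partial>M)"
    by (intro nn_integral_cong) (auto simp: indicator_def)
  moreover have "\<dots> = ennreal (\<integral>x. indicator {i..<b} x * exp (- ?T x) \<partial>M)"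
    by (rule nn_integral_eq_integral[OF int]) auto
  ultimately show ?thesis by simp
qed

section \<open>Prescribed maxima below the barycenter and the Poisson intensity\<close>

locale capped_target = atomless_target +
  fixes g :: "real \<Rightarrow> real"
  assumes g_mono: "x \<le> y \<Longrightarrow> mass y > 0 \<Longrightarrow> g x \<le> g y"
    and g_ge: "mass x > 0 \<Longrightarrow> max 0 x \<le> g x"
    and g_le: "mass x > 0 \<Longrightarrow> g x \<le> \<beta> x"
begin

text \<open>Beyond the support \<open>g\<close> is unconstrained. The identity keeps the function
  monotone there, as it is at least every barycenter taken inside the support.\<close>

definition gx :: "real \<Rightarrow> real" where
  "gx x = (if mass x > 0 then g x else x)"

lemma mass_0_imp_pos: "\<not> mass x > 0 \<Longrightarrow> 0 < x"
  using mass_greater_0_if_nonpos[of x] by (cases "x \<le> 0") auto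

lemma barycenter_le_if_no_mass:
  assumes "mass x > 0" "\<not> mass y > 0"
  shows "\<beta> x \<le> y"
proof -
  have y: "mass y = 0" using assms(2) mass_nonneg[of y] by simp
  have "x \<le> y" using assms mass_antimono[of y x] by (cases "x \<le> y") auto
  from moment_diff_le(1)[OF this] y have "moment x \<le> y * mass x"
    by (simp add: moment_eq[of y])
  then show ?thesis using assms(1) by (simp add: barycenter_eq divide_le_eq)
qed

lemma gx_mono: "x \<le> y \<Longrightarrow> gx x \<le> gx y"
  using g_mono[of x y] barycenter_le_if_no_mass[of x y] g_le[of x] mass_antimono[of x y]
  by (auto simp: gx_def)

lemma gx_ge: "max 0 x \<le> gx x"
  using g_ge[of x] mass_0_imp_pos[of x] by (auto simp: gx_def)

text \<open>The right limit of \<open>gx\<close>. It differs from \<open>gx\<close> only at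
  discontinuities, that is at countably many points, which are null for \<mu>.\<close>

definition gr :: "real \<Rightarrow> real" where
  "gr x = Inf (gx ` {x<..})"

lemma bdd_gx: "bdd_below (gx ` A)"
  using gx_ge by (intro bdd_belowI2[of _ 0]) (auto intro: order_trans[OF max.cobounded1])

lemma gr_le: "x < y \<Longrightarrow> gr x \<le> gx y"
  unfolding gr_def using bdd_gx by (intro cInf_lower) auto

lemma gr_ge: "gx x \<le> gr x"
  unfolding gr_def by (intro cInf_greatest) (auto intro: gx_mono)

lemma gr_ge_max: "max 0 x \<le> gr x"
  using gx_ge gr_ge order_trans by blast

lemma gr_nonneg: "0 \<le> gr x" and gr_ge_self: "x \<le> gr x"
  using gr_ge_max[of x] by auto

lemma gr_mono: "x \<le> y \<Longrightarrow> gr x \<le> gr y"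
  using gr_le[of x y] gr_ge[of y] by (cases "x = y") auto

lemma gr_less: "gr x < c \<Longrightarrow> \<exists>y>x. gx y < c"
  unfolding gr_def by (subst (asm) cInf_less_iff[OF _ bdd_gx]) auto

lemma gr_right_continuous: "(gr \<longlongrightarrow> gr x) (at_right x)"
proof (rule order_tendstoI)
  fix c assume "c < gr x"
  moreover have "eventually (\<lambda>y. x < y) (at_right x)" by (simp add: eventually_at_filter)
  ultimately show "eventually (\<lambda>y. c < gr y) (at_right x)"
    by (auto elim!: eventually_mono intro: less_le_trans[OF _ gr_mono])
next
  fix c assume "gr x < c"
  then obtain y where y: "x < y" "gx y < c" using gr_less by blast
  then have "eventually (\<lambda>z. z < y) (at_right x)" by (auto simp: eventually_at_right[of x y])
  then show "eventually (\<lambda>y. gr y < c) (at_right x)"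
    by eventually_elim (use y gr_le in \<open>auto intro: le_less_trans\<close>)
qed

lemma borel_measurable_gr [measurable]: "gr \<in> borel_measurable borel"
  by (rule borel_measurable_mono) (auto intro!: monoI gr_mono)

text \<open>The bound survives the passage to right limits because \<beta> is continuous where the
  tail has mass.\<close>

lemma gr_le_barycenter:
  assumes "mass x > 0"
  shows "gr x \<le> \<beta> x"
proof (rule tendsto_lowerbound)
  show "(\<beta> \<longlongrightarrow> \<beta> x) (at_right x)"
    using isCont_barycenter[OF assms] by (auto simp: isCont_def intro: tendsto_within_subset)
  have "eventually (\<lambda>y. mass y > 0) (at x)"
    using isCont_mass[of x] assms by (intro order_tendstoD) (auto simp: isCont_def)
  then have "eventually (\<lambda>y. mass y > 0) (at_right x)"
    by (rule filter_leD[rotated]) (simp add: at_le)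
  moreover have "eventually (\<lambda>y. x < y) (at_right x)" by (simp add: eventually_at_filter)
  ultimately show "eventually (\<lambda>y. gr x \<le> \<beta> y) (at_right x)"
  proof eventually_elim
    case (elim y)
    then show ?case using gr_le[of x y] g_le[of y] by (simp add: gx_def)
  qed
qed simp

lemma AE_gr_eq: "AE x in \<mu>. gr x = g x"
proof -
  have "countable {x. \<not> isCont gx x}"
    by (rule mono_ctble_discont) (auto intro!: monoI gx_mono)
  then have "AE x in \<mu>. \<forall>y\<in>{x. \<not> isCont gx x}. x \<noteq> y"
    by (subst AE_ball_countable) (auto intro: AE_neq)
  then show ?thesis
    using AE_mass_pos
  proof eventually_elim
    case (elim x)
    then have c: "(gx \<longlongrightarrow> gx x) (at_right x)"
      by (auto simp: isCont_def intro: tendsto_within_subset)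
    have "eventually (\<lambda>y. x < y) (at_right x)" by (simp add: eventually_at_filter)
    then have "gr x \<le> gx x"
      by (intro tendsto_lowerbound[OF c]) (auto elim!: eventually_mono intro: gr_le)
    with gr_ge[of x] elim show ?case by (simp add: gx_def)
  qed
qed

text \<open>Equals (\<beta> x - gr x) mass x, so it vanishes exactly where the prescribed maximum is
  the barycenter or no mass is left.\<close>

definition slack :: "real \<Rightarrow> real" where
  "slack x = moment x - gr x * mass x"

lemma slack_nonneg: "0 \<le> slack x"
proof (cases "mass x > 0")
  case True
  then show ?thesis using gr_le_barycenter[OF True] by (simp add: slack_def moment_eq mult_right_mono)
next
  case False
  then have "mass x = 0" using mass_nonneg[of x] by simp
  then show ?thesis by (simp add: slack_def moment_eq)
qed

lemma slack_le_moment: "slack x \<le> moment x"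
  using gr_nonneg[of x] mass_nonneg[of x] by (simp add: slack_def)

lemma borel_measurable_slack [measurable]: "slack \<in> borel_measurable borel"
  unfolding slack_def[abs_def] by measurable

lemma slack_right_continuous: "(slack \<longlongrightarrow> slack x) (at_right x)"
  unfolding slack_def[abs_def] using isCont_moment[of x] isCont_mass[of x]
  by (intro tendsto_intros gr_right_continuous) (auto simp: isCont_def intro: tendsto_within_subset)

text \<open>
  Intensity of the Poisson set: at level \<open>gr x\<close> the group consists of \<open>\<mu> (dx)\<close> and of the
  fraction \<open>rate x \<mu> (dx)\<close> of everything above \<open>x\<close>; the rate makes its barycenter \<open>gr x\<close>.
\<close>

definition rate :: "real \<Rightarrow> ennreal" where
  "rate x = (if slack x = 0 then \<top> else ennreal ((gr x - x) / slack x))"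

lemma borel_measurable_rate [measurable]: "rate \<in> borel_measurable borel"
  unfolding rate_def[abs_def] by measurable

definition \<nu> :: "real set \<Rightarrow> ennreal" where
  "\<nu> B = (\<integral>\<^sup>+x\<in>B. rate x \<partial>\<mu>)"

lemma \<nu>_eq_emeasure: "B \<in> sets borel \<Longrightarrow> \<nu> B = emeasure (density \<mu> rate) B"
  by (simp add: \<nu>_def emeasure_density)

lemma \<nu>_mono: "A \<in> sets borel \<Longrightarrow> B \<in> sets borel \<Longrightarrow> A \<subseteq> B \<Longrightarrow> \<nu> A \<le> \<nu> B"
  unfolding \<nu>_def by (intro nn_integral_mono) (auto simp: indicator_def)

lemma \<nu>_Un: "A \<in> sets borel \<Longrightarrow> B \<in> sets borel \<Longrightarrow> A \<inter> B = {} \<Longrightarrow> \<nu> (A \<union> B) = \<nu> A + \<nu> B"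
  by (simp add: \<nu>_eq_emeasure plus_emeasure)

lemma \<nu>_singleton [simp]: "\<nu> {x} = 0"
proof -
  have "(\<integral>\<^sup>+y. rate y * indicator {x} y \<partial>\<mu>) = (\<integral>\<^sup>+y. 0 \<partial>\<mu>)"
    by (intro nn_integral_cong_AE) (use AE_neq[of x] in \<open>auto simp: indicator_def elim!: eventually_mono\<close>)
  then show ?thesis by (simp add: \<nu>_def)
qed

lemma \<nu>_empty [simp]: "\<nu> {} = 0"
  by (simp add: \<nu>_def)

text \<open>Right-continuity keeps the slack away from 0 on a right neighbourhood, where the rate is
  therefore bounded.\<close>

lemma \<nu>_finite_right:
  assumes "0 < slack x"
  obtains y where "x < y" "\<nu> {x<..<y} < \<top>"
proof -
  have "eventually (\<lambda>z. slack x / 2 < slack z) (at_right x)"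
    using slack_right_continuous assms by (intro order_tendstoD) auto
  then obtain y where y: "x < y" "\<And>z. x < z \<Longrightarrow> z < y \<Longrightarrow> slack x / 2 < slack z"
    by (auto simp: eventually_at_right[OF less_add_one[of x]])
  define K where "K = (gr y + \<bar>x\<bar>) / (slack x / 2)"
  have le: "rate z * indicator {x<..<y} z \<le> ennreal K" for z
  proof (cases "z \<in> {x<..<y}")
    case True
    then have s: "slack x / 2 < slack z" using y by auto
    have "gr z - z \<le> gr y + \<bar>x\<bar>" using gr_mono[of z y] True by auto
    then have "(gr z - z) / slack z \<le> (gr y + \<bar>x\<bar>) / (slack x / 2)"
      using s assms gr_nonneg[of y] by (intro frac_le) auto
    then show ?thesis using s assms True by (auto simp: rate_def K_def intro!: ennreal_leI)
  qed simp
  have "\<nu> {x<..<y} \<le> (\<integral>\<^sup>+z. ennreal K \<partial>\<mu>)"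
    unfolding \<nu>_def by (intro nn_integral_mono le)
  also have "\<dots> < \<top>" by (simp add: emeasure_eq_measure ennreal_mult_less_top)
  finally show ?thesis using y(1) that by blast
qed

end

section \<open>Law of the first Poisson point beyond a level\<close>

locale poisson_embedding = capped_target \<mu> g + P: prob_space P
  for \<mu> g and P :: "'a measure" +
  fixes w :: "'a \<Rightarrow> real" and N :: "'a \<Rightarrow> real set"
  assumes w_measurable [measurable]: "w \<in> borel_measurable P"
    and void_sets: "B \<in> sets borel \<Longrightarrow> {\<xi>\<in>space P. N \<xi> \<inter> B = {}} \<in> sets P"
    and void_prob: "B \<in> sets borel \<Longrightarrow> C \<in> sets borel \<Longrightarrow>
      measure P {\<xi>\<in>space P. N \<xi> \<inter> B = {} \<and> w \<xi> \<in> C} = exp_neg (\<nu> B) * measure \<mu> C"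
begin

lemma void_pred [measurable]: "B \<in> sets borel \<Longrightarrow> Measurable.pred P (\<lambda>\<xi>. N \<xi> \<inter> B = {})"
  using void_sets by (simp add: pred_def)

lemma distr_w: "distr P borel w = \<mu>"
proof (rule measure_eqI)
  fix A assume "A \<in> sets (distr P borel w)"
  then have A: "A \<in> sets borel" by simp
  have "measure P (w -` A \<inter> space P) = measure P {\<xi>\<in>space P. N \<xi> \<inter> {} = {} \<and> w \<xi> \<in> A}"
    by (auto intro!: arg_cong[where f="measure P"])
  also have "\<dots> = measure \<mu> A" using void_prob[of "{}" A] A by simp
  finally show "emeasure (distr P borel w) A = emeasure \<mu> A"
    using A by (simp add: emeasure_distr P.emeasure_eq_measure emeasure_eq_measure)
qed simp

text \<open>Survival probability: no Poisson point lies strictly between \<open>j\<close> and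
  \<open>i\<close>.\<close>

definition e :: "real \<Rightarrow> real \<Rightarrow> real" where
  "e j i = exp_neg (\<nu> {j<..<i})"

lemma e_antimono: "i \<le> i' \<Longrightarrow> e j i' \<le> e j i"
  unfolding e_def by (intro exp_neg_antimono \<nu>_mono) auto

lemma e_bounds: "0 \<le> e j i" "e j i \<le> 1"
  by (simp_all add: e_def exp_neg_nonneg exp_neg_le_1)

lemma e_self [simp]: "i \<le> j \<Longrightarrow> e j i = 1"
  by (simp add: e_def)

lemma borel_measurable_e [measurable]: "e j \<in> borel_measurable borel"
proof -
  have "(\<lambda>i. - e j i) \<in> borel_measurable borel"
    by (rule borel_measurable_mono) (auto intro!: monoI e_antimono)
  then have "(\<lambda>i. - (- e j i)) \<in> borel_measurable borel" by measurable
  then show ?thesis by simp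
qed

text \<open>The first point beyond \<open>j\<close>; the junk value \<open>j - 1\<close> stands for \<open>\<infinity>\<close>.\<close>

definition first :: "real \<Rightarrow> 'a \<Rightarrow> real" where
  "first j \<xi> = (if N \<xi> \<inter> {j<..} = {} then j - 1 else Inf (N \<xi> \<inter> {j<..}))"

lemma first_ge_j: "N \<xi> \<inter> {j<..} \<noteq> {} \<Longrightarrow> j \<le> first j \<xi>"
proof -
  assume ne: "N \<xi> \<inter> {j<..} \<noteq> {}"
  have "j \<le> Inf (N \<xi> \<inter> {j<..})" by (rule cInf_greatest[OF ne]) simp
  with ne show ?thesis by (simp add: first_def)
qed

lemma first_ge_iff:
  assumes "j < i"
  shows "i \<le> first j \<xi> \<longleftrightarrow> N \<xi> \<inter> {j<..} \<noteq> {} \<and> N \<xi> \<inter> {j<..<i} = {}"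
proof (cases "N \<xi> \<inter> {j<..} = {}")
  case True
  then show ?thesis using assms by (simp add: first_def)
next
  case False
  have "i \<le> Inf (N \<xi> \<inter> {j<..}) \<longleftrightarrow> (\<forall>x\<in>N \<xi> \<inter> {j<..}. i \<le> x)"
    by (rule le_cInf_iff[OF False]) (auto intro!: bdd_belowI[of _ j])
  also have "\<dots> \<longleftrightarrow> (\<forall>x. \<not> (x \<in> N \<xi> \<and> j < x \<and> x < i))" by (auto simp: not_less)
  also have "\<dots> \<longleftrightarrow> N \<xi> \<inter> {j<..<i} = {}" by auto
  finally show ?thesis using False by (simp add: first_def)
qed

lemma first_measurable [measurable]: "first j \<in> borel_measurable P"
proof (rule borel_measurableI_ge)
  fix i
  have 1: "i \<le> j - 1 \<or> N \<xi> \<inter> {j<..} \<noteq> {} \<longleftrightarrow> i \<le> first j \<xi>" if "i \<le> j" for \<xi>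
    using first_ge_j[of \<xi> j] that by (cases "N \<xi> \<inter> {j<..} = {}") (auto simp: first_def)
  show "{\<xi> \<in> space P. i \<le> first j \<xi>} \<in> sets P"
  proof (cases "i \<le> j")
    case True
    have "{\<xi> \<in> space P. i \<le> j - 1 \<or> \<not> N \<xi> \<inter> {j<..} = {}} \<in> sets P" by measurable
    then show ?thesis using 1[OF True] by simp
  next
    case False
    have "{\<xi> \<in> space P. \<not> N \<xi> \<inter> {j<..} = {} \<and> N \<xi> \<inter> {j<..<i} = {}} \<in> sets P" by measurable
    then show ?thesis using first_ge_iff[of j i] False by simp
  qed
qed

definition \<kappa> :: "real \<Rightarrow> real measure" where
  "\<kappa> j = distr P borel (first j)"

lemma prob_space_\<kappa>: "prob_space (\<kappa> j)"
  unfolding \<kappa>_def by (rule P.prob_space_distr) simp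

lemma sets_\<kappa> [simp, measurable_cong]: "sets (\<kappa> j) = sets borel" and space_\<kappa> [simp]: "space (\<kappa> j) = UNIV"
  by (simp_all add: \<kappa>_def)

lemma measure_\<kappa>_ivl:
  assumes "j \<le> i" "i \<le> i'"
  shows "measure (\<kappa> j) {i..<i'} = e j i - e j i'"
proof (cases "i = i'")
  case False
  then have lt: "i < i'" using assms by simp
  have v: "measure P {\<xi>\<in>space P. N \<xi> \<inter> {j<..<b} = {}} = e j b" for b
    using void_prob[of "{j<..<b}" UNIV] prob_space by (simp add: e_def)
  have eq: "{\<xi>\<in>space P. first j \<xi> \<in> {i..<i'}} =
      {\<xi>\<in>space P. N \<xi> \<inter> {j<..<i} = {}} - {\<xi>\<in>space P. N \<xi> \<inter> {j<..<i'} = {}}"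
  proof -
    have "i \<le> first j \<xi> \<and> \<not> i' \<le> first j \<xi> \<longleftrightarrow> N \<xi> \<inter> {j<..<i} = {} \<and> N \<xi> \<inter> {j<..<i'} \<noteq> {}" for \<xi>
    \<comment> \<open>The value \<open>j\<close> is taken when points accumulate at \<open>j\<close>
      from the right; the junk value \<open>j - 1\<close> keeps this apart from an empty set
      ahead.\<close>
    proof (cases "i = j")
      case True
      then show ?thesis
        using first_ge_iff[of j i' \<xi>] first_ge_j[of \<xi> j] lt by (auto simp: first_def)
    next
      case False
      then show ?thesis
        using first_ge_iff[of j i' \<xi>] first_ge_iff[of j i \<xi>] lt assms by auto
    qed
    then show ?thesis by (auto simp: not_le)
  qed
  have "measure (\<kappa> j) {i..<i'} = measure P {\<xi>\<in>space P. first j \<xi> \<in> {i..<i'}}"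
    unfolding \<kappa>_def by (simp add: measure_distr vimage_def Int_def conj_commute)
  also have "\<dots> = e j i - e j i'"
    unfolding eq using lt by (subst P.finite_measure_Diff) (auto simp: v)
  finally show ?thesis .
qed simp

lemma e_mult:
  assumes "j \<le> x" "x < y"
  shows "e j y = e j x * exp_neg (\<nu> {x<..<y})"
proof (cases "x = j")
  case False
  then have "{j<..<y} = {j<..<x} \<union> ({x} \<union> {x<..<y})" using assms by auto
  then have "\<nu> {j<..<y} = \<nu> {j<..<x} + \<nu> ({x} \<union> {x<..<y})"
    by (simp only:) (rule \<nu>_Un, auto)
  also have "\<nu> ({x} \<union> {x<..<y}) = \<nu> {x} + \<nu> {x<..<y}" by (rule \<nu>_Un) auto
  finally have "\<nu> {j<..<y} = \<nu> {j<..<x} + \<nu> {x<..<y}" by simp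
  then show ?thesis by (simp add: e_def exp_neg_add)
qed (simp add: e_def)

text \<open>The probability that the first point lies in \<open>[x, b)\<close> is at most 1 - exp (-
  \<nu> (x, b)). Positive slack makes this intensity finite near \<open>x\<close>, and it tends to 0
  as b decreases to \<open>x\<close>.\<close>

lemma \<kappa>_atom:
  assumes "j \<le> x" "0 < slack x"
  shows "measure (\<kappa> j) {x} = 0"
proof -
  interpret \<kappa>: prob_space "\<kappa> j" by (rule prob_space_\<kappa>)
  obtain y where y: "x < y" "\<nu> {x<..<y} < \<top>" using \<nu>_finite_right[OF assms(2)] .
  define b where "b n = x + (y - x) / real (Suc n)" for n
  have b: "x < b n" "b n \<le> y" "b (Suc n) \<le> b n" for n
  proof -
    show "x < b n" using y(1) by (simp add: b_def)
    have "(y - x) / real (Suc n) \<le> (y - x) / 1" using y(1) by (intro frac_le) auto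
    then show "b n \<le> y" by (simp add: b_def)
    have "(y - x) / real (Suc (Suc n)) \<le> (y - x) / real (Suc n)" using y(1) by (intro frac_le) auto
    then show "b (Suc n) \<le> b n" by (simp add: b_def)
  qed
  have fin: "\<nu> {x<..<b n} < \<top>" for n
  proof -
    have "\<nu> {x<..<b n} \<le> \<nu> {x<..<y}" using b[of n] by (intro \<nu>_mono) auto
    then show ?thesis using y(2) by (rule le_less_trans)
  qed
  have blim: "b \<longlonglongrightarrow> x"
  proof -
    have "(\<lambda>n. x + (y - x) * (1 / real (Suc n))) \<longlonglongrightarrow> x + (y - x) * 0"
      by (intro tendsto_intros LIMSEQ_Suc lim_1_over_n)
    then show ?thesis by (simp add: b_def[abs_def])
  qed
  have "decseq (\<lambda>n. {x<..<b n})" using b(3) by (intro decseq_SucI) (auto intro: less_le_trans[OF _ b(3)])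
  then have "(\<lambda>n. emeasure (density \<mu> rate) {x<..<b n}) \<longlonglongrightarrow> emeasure (density \<mu> rate) (\<Inter>n. {x<..<b n})"
    using fin b by (intro Lim_emeasure_decseq) (auto simp: \<nu>_eq_emeasure less_top[symmetric])
  moreover have "(\<Inter>n. {x<..<b n}) = {}"
  proof -
    have False if "\<And>n. x < z \<and> z < b n" for z
    proof -
      have "z \<le> x" using blim by (rule LIMSEQ_le_const) (use that in \<open>auto intro: less_imp_le\<close>)
      with that show False by force
    qed
    then show ?thesis by (auto simp: set_eq_iff)
  qed
  ultimately have "(\<lambda>n. \<nu> {x<..<b n}) \<longlonglongrightarrow> ennreal 0" by (simp add: \<nu>_eq_emeasure)
  then have "(\<lambda>n. enn2real (\<nu> {x<..<b n})) \<longlonglongrightarrow> 0" by (rule tendsto_enn2real) simp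
  then have "(\<lambda>n. 1 - exp (- enn2real (\<nu> {x<..<b n}))) \<longlonglongrightarrow> 1 - exp (- 0)"
    by (intro tendsto_diff tendsto_const tendsto_exp tendsto_minus)
  then have lim: "(\<lambda>n. 1 - exp_neg (\<nu> {x<..<b n})) \<longlonglongrightarrow> 0"
    using fin by (simp add: exp_neg_def less_top[symmetric])
  have "measure (\<kappa> j) {x} \<le> 1 - exp_neg (\<nu> {x<..<b n})" for n
  proof -
    have "measure (\<kappa> j) {x} \<le> measure (\<kappa> j) {x..<b n}" using b by (intro \<kappa>.finite_measure_mono) auto
    also have "\<dots> = e j x * (1 - exp_neg (\<nu> {x<..<b n}))"
      using assms(1) b[of n] by (simp add: measure_\<kappa>_ivl e_mult right_diff_distrib)
    also have "\<dots> \<le> 1 * (1 - exp_neg (\<nu> {x<..<b n}))"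
      using e_bounds exp_neg_le_1 by (intro mult_right_mono) auto
    finally show ?thesis by simp
  qed
  then have "measure (\<kappa> j) {x} \<le> 0" by (intro LIMSEQ_le_const[OF lim]) auto
  then show ?thesis by (simp add: measure_le_0_iff)
qed

text \<open>The survival probability is exp of minus the distribution function of rate times \<mu>
  on the interval, so \<open>exp_cdf_integral\<close> identifies the density as rate times survival
  probability.\<close>

lemma \<kappa>_density:
  assumes b: "j < b" "\<nu> {j<..<b} < \<top>"
  shows "density (\<kappa> j) (indicator {j<..<b}) = density \<mu> (\<lambda>x. rate x * ennreal (e j x) * indicator {j<..<b} x)"
proof (rule measure_eqI_atLeast_above[where j=j])
  interpret \<kappa>: prob_space "\<kappa> j" by (rule prob_space_\<kappa>)
  define M where "M = density \<mu> (\<lambda>x. rate x * indicator {j<..<b} x)"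
  have sM[simp]: "sets M = sets borel" "space M = UNIV" by (simp_all add: M_def)
  have em: "emeasure M A = \<nu> (A \<inter> {j<..<b})" if "A \<in> sets borel" for A
    using that unfolding M_def \<nu>_def by (simp add: emeasure_density indicator_inter_arith mult_ac)
  have fM: "finite_measure M"
    by (rule finite_measureI) (use b in \<open>simp add: em less_top[symmetric]\<close>)
  interpret M: finite_borel_measure M
    by (intro finite_borel_measure.intro fM finite_borel_measure_axioms.intro) simp
  have atom: "measure M {x} = 0" for x
  proof -
    have "emeasure M {x} \<le> \<nu> {x}" by (subst em, simp, rule \<nu>_mono) auto
    then show ?thesis by (simp add: measure_def)
  qed
  have cdf: "exp (- cdf M x) = e j x" if "j < x" "x \<le> b" for x
  proof -
    have "{j<..<b} \<inter> {..x} \<subseteq> {j<..<x} \<union> {x}" using that by auto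
    have "emeasure M {..x} = \<nu> {j<..<x}"
    proof (rule antisym)
      have "emeasure M {..x} \<le> \<nu> ({j<..<x} \<union> {x})" unfolding em[of "{..x}", simplified]
        using that by (intro \<nu>_mono) auto
      also have "\<dots> = \<nu> {j<..<x}" by (subst \<nu>_Un) auto
      finally show "emeasure M {..x} \<le> \<nu> {j<..<x}" .
      show "\<nu> {j<..<x} \<le> emeasure M {..x}" using that by (simp add: em) (intro \<nu>_mono, auto)
    qed
    moreover have "\<nu> {j<..<x} \<noteq> \<top>"
    proof -
      have "\<nu> {j<..<x} \<le> \<nu> {j<..<b}" using that by (intro \<nu>_mono) auto
      then show ?thesis using b by (auto simp: top_unique)
    qed
    ultimately show ?thesis by (simp add: cdf_def measure_def e_def exp_neg_def)
  qed
  show "finite_measure (density (\<kappa> j) (indicator {j<..<b}))"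
    by (rule finite_measureI) (simp add: emeasure_density \<kappa>.emeasure_eq_measure)
  show "emeasure (density (\<kappa> j) (indicator {j<..<b})) {..j} = 0"
    by (simp add: emeasure_density flip: indicator_inter_arith)
  have "(\<integral>\<^sup>+x. rate x * ennreal (e j x) * indicator {j<..<b} x * indicator {..j} x \<partial>\<mu>) = (\<integral>\<^sup>+x. 0 \<partial>\<mu>)"
    by (intro nn_integral_cong) (auto simp: indicator_def)
  then show "emeasure (density \<mu> (\<lambda>x. rate x * ennreal (e j x) * indicator {j<..<b} x)) {..j} = 0"
    by (simp add: emeasure_density)
  fix x assume x: "j < x"
  have 1: "emeasure (density (\<kappa> j) (indicator {j<..<b})) {x..} = emeasure (\<kappa> j) {x..<b}"
  proof -
    have "{j<..<b} \<inter> {x..} = {x..<b}" using x by auto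
    then show ?thesis by (simp add: emeasure_density flip: indicator_inter_arith)
  qed
  have 2: "emeasure (density \<mu> (\<lambda>x. rate x * ennreal (e j x) * indicator {j<..<b} x)) {x..} =
      (\<integral>\<^sup>+z\<in>{x..<b}. ennreal (exp (- cdf M z)) \<partial>M)"
  proof -
    have mM: "(\<lambda>z. ennreal (exp (- cdf M z)) * indicator {x..<b} z) \<in> borel_measurable \<mu>"
    proof -
      have [measurable]: "cdf M \<in> borel_measurable borel"
        by (rule borel_measurable_mono) (auto intro!: monoI M.cdf_nondecreasing)
      show ?thesis by measurable
    qed
    have "(\<integral>\<^sup>+z. f z \<partial>M) = (\<integral>\<^sup>+z. rate z * indicator {j<..<b} z * f z \<partial>\<mu>)"
      if [measurable]: "f \<in> borel_measurable \<mu>" for f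
      unfolding M_def by (subst nn_integral_density) auto
    from this[OF mM] show ?thesis
      by (auto simp: emeasure_density cdf x indicator_def intro!: nn_integral_cong)
  qed
  show "emeasure (density (\<kappa> j) (indicator {j<..<b})) {x..} =
    emeasure (density \<mu> (\<lambda>x. rate x * ennreal (e j x) * indicator {j<..<b} x)) {x..}"
  proof (cases "x \<le> b")
    case True
    show ?thesis
      unfolding 1 2 exp_cdf_integral[OF M.finite_borel_measure_axioms atom True]
      using x True b cdf by (simp add: \<kappa>.emeasure_eq_measure measure_\<kappa>_ivl)
  next
    case False
    then show ?thesis unfolding 1 2 by simp
  qed
qed simp_all

text \<open>The rate is chosen such that rate times slack is \<open>gr x - x\<close>. Infinite rates
  occur only on a null set here, because the intensity of the interval is finite.\<close>

lemma slack_\<kappa>_interval: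
  assumes b: "j < b" "\<nu> {j<..<b} < \<top>"
  shows "(\<integral>\<^sup>+x\<in>{j<..<b}. ennreal (slack x) \<partial>\<kappa> j) = (\<integral>\<^sup>+x\<in>{j<..<b}. ennreal ((gr x - x) * e j x) \<partial>\<mu>)"
proof -
  have "(\<integral>\<^sup>+x\<in>{j<..<b}. ennreal (slack x) \<partial>\<kappa> j) = (\<integral>\<^sup>+x. ennreal (slack x) \<partial>density (\<kappa> j) (indicator {j<..<b}))"
    by (simp add: nn_integral_density mult.commute)
  also have "\<dots> = (\<integral>\<^sup>+x. rate x * ennreal (e j x) * indicator {j<..<b} x * ennreal (slack x) \<partial>\<mu>)"
    unfolding \<kappa>_density[OF b] by (simp add: nn_integral_density)
  also have "\<dots> = (\<integral>\<^sup>+x\<in>{j<..<b}. ennreal ((gr x - x) * e j x) \<partial>\<mu>)"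
  proof (rule nn_integral_cong_AE)
    have "AE x in \<mu>. rate x * indicator {j<..<b} x \<noteq> \<infinity>"
      using b(2) by (intro nn_integral_noteq_infinite) (auto simp: \<nu>_def)
    then show "AE x in \<mu>. rate x * ennreal (e j x) * indicator {j<..<b} x * ennreal (slack x) =
        ennreal ((gr x - x) * e j x) * indicator {j<..<b} x"
    proof eventually_elim
      case (elim x)
      show ?case
      proof (cases "x \<in> {j<..<b}")
        case True
        with elim have s: "slack x \<noteq> 0" by (auto simp: rate_def)
        then have s': "0 < slack x" using slack_nonneg[of x] by simp
        have "rate x * ennreal (e j x) * ennreal (slack x) = ennreal ((gr x - x) / slack x * e j x * slack x)"
          using s s' e_bounds[of j x] gr_ge_self[of x] by (simp add: rate_def ennreal_mult'[symmetric] ennreal_mult[symmetric])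
        also have "(gr x - x) / slack x * e j x * slack x = (gr x - x) * e j x" using s by simp
        finally show ?thesis using True by simp
      qed simp
    qed
  qed
  finally show ?thesis .
qed

text \<open>Up to the explosion point \<open>k\<close>, the infimum of \<open>C\<close>, intervals
  of finite intensity exhaust the half-line. Beyond it the survival probability and the law
  \<open>\<kappa> j\<close> vanish. Atoms of \<open>\<kappa> j\<close> at \<open>j\<close> or
  \<open>k\<close> are possible, but by \<open>\<kappa>_atom\<close> only where the slack is 0. If
  nothing explodes, the intervals exhaust the whole half-line.\<close>

lemma slack_\<kappa>:
  "(\<integral>\<^sup>+x\<in>{j..}. ennreal (slack x) \<partial>\<kappa> j) = (\<integral>\<^sup>+x\<in>{j<..}. ennreal ((gr x - x) * e j x) \<partial>\<mu>)"
proof -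
  interpret \<kappa>: prob_space "\<kappa> j" by (rule prob_space_\<kappa>)
  have atom: "AE x in \<kappa> j. x = z \<longrightarrow> slack x = 0" if "j \<le> z" for z
  proof (cases "slack z = 0")
    case False
    then have "measure (\<kappa> j) {z} = 0" using \<kappa>_atom[OF that] slack_nonneg[of z] by simp
    then have "AE x in \<kappa> j. x \<notin> {z}"
      by (subst AE_iff_null_sets[symmetric]) (auto simp: null_sets_def \<kappa>.emeasure_eq_measure)
    then show ?thesis by eventually_elim simp
  qed simp
  define C where "C = {b. j < b \<and> \<nu> {j<..<b} = \<top>}"
  have up: "y \<in> C" if "x \<in> C" "x \<le> y" for x y
  proof -
    have "\<nu> {j<..<x} \<le> \<nu> {j<..<y}" using that by (intro \<nu>_mono) auto
    then show ?thesis using that by (auto simp: C_def top_unique)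
  qed
  obtain b :: "nat \<Rightarrow> real" and U where U: "U \<in> sets borel" "U \<subseteq> {j<..}" "U = (\<Union>n. {j<..<b n})" "incseq b"
    "\<And>n. j < b n \<Longrightarrow> \<nu> {j<..<b n} < \<top>"
    and c1: "AE x in \<kappa> j. x \<in> {j..} - U \<longrightarrow> slack x = 0"
    and c2: "AE x in \<mu>. x \<in> {j<..} - U \<longrightarrow> e j x = 0"
  proof (cases "C = {}")
    case True
    show ?thesis
    proof (rule that[of "{j<..}" "\<lambda>n. j + real n"])
      show "{j<..} = (\<Union>n. {j<..<j + real n})"
      proof (intro set_eqI iffI)
        fix x assume "x \<in> {j<..}"
        obtain n where "x - j < real n" using reals_Archimedean2 by blast
        with \<open>x \<in> {j<..}\<close> have "x \<in> {j<..<j + real n}" by simp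
        then show "x \<in> (\<Union>n. {j<..<j + real n})" by blast
      qed auto
      show "\<nu> {j<..<j + real n} < \<top>" if "j < j + real n" for n
        using True that by (auto simp: C_def less_top[symmetric])
      show "AE x in \<kappa> j. x \<in> {j..} - {j<..} \<longrightarrow> slack x = 0"
        using atom[OF order_refl] by eventually_elim auto
    qed (auto simp: incseq_def)
  next
    case False
    define k where "k = Inf C"
    have bdd: "bdd_below C" by (auto simp: C_def intro!: bdd_belowI[of _ j])
    have kj: "j \<le> k" unfolding k_def using False by (intro cInf_greatest) (auto simp: C_def)
    have above: "x \<in> C" if "k < x" for x
      using cInf_lessD[OF False, of x] that up by (auto simp: k_def)
    have below: "x \<notin> C" if "x < k" for x
      using cInf_lower[OF _ bdd, of x] that by (auto simp: k_def)
    show ?thesis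
    proof (rule that[of "{j<..<k}" "\<lambda>n. k - (k - j) / real (Suc n)"])
      have lim: "(\<lambda>n. k - (k - j) * (1 / real (Suc n))) \<longlonglongrightarrow> k - (k - j) * 0"
        by (intro tendsto_intros LIMSEQ_Suc lim_1_over_n)
      have less: "k - (k - j) / real (Suc n) < k \<or> k = j" for n using kj by auto
      show "{j<..<k} = (\<Union>n. {j<..<k - (k - j) / real (Suc n)})"
      proof (intro set_eqI iffI)
        fix x assume x: "x \<in> {j<..<k}"
        then have "eventually (\<lambda>n. x < k - (k - j) * (1 / real (Suc n))) sequentially"
          using lim by (intro order_tendstoD) auto
        then obtain n where "x < k - (k - j) * (1 / real (Suc n))" by (auto simp: eventually_sequentially)
        with x have "x \<in> {j<..<k - (k - j) / real (Suc n)}" by simp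
        then show "x \<in> (\<Union>n. {j<..<k - (k - j) / real (Suc n)})" by blast
      next
        fix x assume "x \<in> (\<Union>n. {j<..<k - (k - j) / real (Suc n)})"
        then obtain n where "j < x" "x < k - (k - j) / real (Suc n)" by auto
        then show "x \<in> {j<..<k}" using less[of n] by auto
      qed
      show "incseq (\<lambda>n. k - (k - j) / real (Suc n))"
        using kj by (intro incseq_SucI diff_left_mono frac_le) auto
      show "\<nu> {j<..<k - (k - j) / real (Suc n)} < \<top>" if "j < k - (k - j) / real (Suc n)" for n
        using less[of n] below[of "k - (k - j) / real (Suc n)"] that by (auto simp: C_def less_top[symmetric])
      have "AE x in \<kappa> j. x \<notin> {k<..}"
      proof -
        have "emeasure (\<kappa> j) {k + 1 / real (Suc n)..} = 0" for n
        proof -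
          define y where "y = k + 1 / real (Suc n)"
          have y: "k < y" by (simp add: y_def)
          have "e j y = 0" using above[OF y] by (simp add: C_def e_def)
          then have "measure (\<kappa> j) {j..<y} = 1" using measure_\<kappa>_ivl[of j j y] kj y by simp
          moreover have "measure (\<kappa> j) ({j..<y} \<union> {y..}) = measure (\<kappa> j) {j..<y} + measure (\<kappa> j) {y..}"
            by (rule \<kappa>.finite_measure_Union) auto
          moreover have "measure (\<kappa> j) ({j..<y} \<union> {y..}) \<le> 1" by simp
          ultimately have "measure (\<kappa> j) {y..} \<le> 0" by linarith
          then show ?thesis by (simp add: measure_le_0_iff \<kappa>.emeasure_eq_measure y_def)
        qed
        then have "emeasure (\<kappa> j) {k<..} = 0" by (subst emeasure_greaterThan_eq_SUP) auto
        then show ?thesis by (subst AE_iff_null_sets[symmetric]) (auto simp: null_sets_def)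
      qed
      then show "AE x in \<kappa> j. x \<in> {j..} - {j<..<k} \<longrightarrow> slack x = 0"
        using atom[OF order_refl] atom[OF kj] by eventually_elim auto
      show "AE x in \<mu>. x \<in> {j<..} - {j<..<k} \<longrightarrow> e j x = 0"
        using AE_neq[of k]
      proof eventually_elim
        case (elim x)
        then show ?case using above[of x] by (auto simp: C_def e_def)
      qed
    qed auto
  qed
  have mono: "incseq (\<lambda>n x. f x * indicator {j<..<b n} x :: ennreal)" for f
    using U(4) by (auto simp: incseq_def le_fun_def indicator_def intro: less_le_trans)
  have sup: "(SUP n. f x * indicator {j<..<b n} x) = f x * indicator U x" for f :: "real \<Rightarrow> ennreal" and x
  proof (cases "x \<in> U")
    case True
    then obtain n where "x \<in> {j<..<b n}" using U(3) by auto
    then show ?thesis using True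
      by (intro antisym SUP_least SUP_upper2[of n]) (auto simp: indicator_def)
  next
    case False
    then have "x \<notin> {j<..<b n}" for n using U(3) by auto
    then have "indicator {j<..<b n} x = (0 :: ennreal)" for n by simp
    then show ?thesis using False by simp
  qed
  have conv: "(\<integral>\<^sup>+x\<in>U. f x \<partial>K) = (SUP n. \<integral>\<^sup>+x\<in>{j<..<b n}. f x \<partial>K)"
    if [measurable]: "f \<in> borel_measurable borel" and [measurable_cong]: "sets K = sets borel"
    for f :: "real \<Rightarrow> ennreal" and K
  proof -
    have "(\<integral>\<^sup>+x\<in>U. f x \<partial>K) = (\<integral>\<^sup>+x. (SUP n. f x * indicator {j<..<b n} x) \<partial>K)"
      by (intro nn_integral_cong sup[symmetric])
    also have "\<dots> = (SUP n. \<integral>\<^sup>+x\<in>{j<..<b n}. f x \<partial>K)"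
      by (rule nn_integral_monotone_convergence_SUP[OF mono]) measurable
    finally show ?thesis .
  qed
  have "(\<integral>\<^sup>+x\<in>{j..}. ennreal (slack x) \<partial>\<kappa> j) = (\<integral>\<^sup>+x\<in>U. ennreal (slack x) \<partial>\<kappa> j)"
    using c1 U(2) by (intro nn_integral_cong_AE) (auto simp: indicator_def elim!: eventually_mono)
  also have "\<dots> = (SUP n. \<integral>\<^sup>+x\<in>{j<..<b n}. ennreal (slack x) \<partial>\<kappa> j)"
    by (rule conv) simp_all
  also have "\<dots> = (SUP n. \<integral>\<^sup>+x\<in>{j<..<b n}. ennreal ((gr x - x) * e j x) \<partial>\<mu>)"
  proof (intro SUP_cong refl)
    fix n
    show "(\<integral>\<^sup>+x\<in>{j<..<b n}. ennreal (slack x) \<partial>\<kappa> j) = (\<integral>\<^sup>+x\<in>{j<..<b n}. ennreal ((gr x - x) * e j x) \<partial>\<mu>)"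
      using slack_\<kappa>_interval[of j "b n"] U(5)[of n] by (cases "j < b n") auto
  qed
  also have "\<dots> = (\<integral>\<^sup>+x\<in>U. ennreal ((gr x - x) * e j x) \<partial>\<mu>)"
    by (rule conv[symmetric]) simp_all
  also have "\<dots> = (\<integral>\<^sup>+x\<in>{j<..}. ennreal ((gr x - x) * e j x) \<partial>\<mu>)"
    using c2 U(2) by (intro nn_integral_cong_AE) (auto simp: indicator_def elim!: eventually_mono)
  finally show ?thesis .
qed

section \<open>The next point ahead and its independence of the past\<close>

definition D :: "real \<Rightarrow> 'a \<Rightarrow> real" where
  "D j \<xi> = Inf (insert (w \<xi>) (N \<xi> \<inter> {j<..}))"

lemma D_eq_first:
  assumes "j < w \<xi>"
  shows "D j \<xi> = (if j \<le> first j \<xi> \<and> first j \<xi> < w \<xi> then first j \<xi> else w \<xi>)"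
proof (cases "N \<xi> \<inter> {j<..} = {}")
  case True
  then show ?thesis by (simp add: D_def first_def)
next
  case False
  have "bdd_below (N \<xi> \<inter> {j<..})" by (auto intro!: bdd_belowI[of _ j])
  then have "D j \<xi> = min (w \<xi>) (first j \<xi>)"
    using False by (simp add: D_def first_def cInf_insert inf_min)
  then show ?thesis using first_ge_j[OF False] by (auto simp: min_def)
qed

text \<open>Void probabilities of disjoint sets multiply, so the points up to \<open>j\<close>, the
  target and the first point beyond \<open>j\<close> are independent. It suffices to compare two
  finite measures on right rays.\<close>

lemma void_first_prob:
  assumes [measurable]: "A \<in> sets borel" "C \<in> sets borel" and B: "B \<in> sets borel" "B \<subseteq> {..j}"
  shows "measure P {\<xi>\<in>space P. N \<xi> \<inter> B = {} \<and> w \<xi> \<in> C \<and> first j \<xi> \<in> A} =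
    exp_neg (\<nu> B) * measure \<mu> C * measure (\<kappa> j) A"
proof -
  let ?E = "{\<xi>\<in>space P. N \<xi> \<inter> B = {} \<and> w \<xi> \<in> C}"
  have E: "?E \<in> sets P" using B(1) by measurable
  define c where "c = exp_neg (\<nu> B) * measure \<mu> C"
  have c: "0 \<le> c" by (simp add: c_def exp_neg_nonneg)
  interpret \<kappa>: prob_space "\<kappa> j" by (rule prob_space_\<kappa>)
  have ind: "measure P {\<xi>\<in>space P. N \<xi> \<inter> B = {} \<and> w \<xi> \<in> C \<and> N \<xi> \<inter> B' = {}} = c * exp_neg (\<nu> B')"
    if "B' \<in> sets borel" "B' \<subseteq> {j<..}" for B'
  proof -
    have "{\<xi>\<in>space P. N \<xi> \<inter> B = {} \<and> w \<xi> \<in> C \<and> N \<xi> \<inter> B' = {}} = {\<xi>\<in>space P. N \<xi> \<inter> (B \<union> B') = {} \<and> w \<xi> \<in> C}"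
      by auto
    moreover have "B \<inter> B' = {}" using that B by force
    ultimately show ?thesis using that B by (simp add: void_prob \<nu>_Un exp_neg_add c_def mult_ac)
  qed
  have "distr (density P (indicator ?E)) borel (first j) = density (\<kappa> j) (\<lambda>_. ennreal c)"
  proof (rule measure_eqI_atLeast)
    have d1: "emeasure (distr (density P (indicator ?E)) borel (first j)) S =
        ennreal (measure P {\<xi>\<in>space P. N \<xi> \<inter> B = {} \<and> w \<xi> \<in> C \<and> first j \<xi> \<in> S})" if [measurable]: "S \<in> sets borel" for S
    proof -
      have "emeasure (distr (density P (indicator ?E)) borel (first j)) S = emeasure P (?E \<inter> (first j -` S \<inter> space P))"
        using E by (simp add: emeasure_distr emeasure_density flip: indicator_inter_arith)
      also have "?E \<inter> (first j -` S \<inter> space P) = {\<xi>\<in>space P. N \<xi> \<inter> B = {} \<and> w \<xi> \<in> C \<and> first j \<xi> \<in> S}" by auto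
      finally show ?thesis by (simp add: P.emeasure_eq_measure)
    qed
    have d2: "emeasure (density (\<kappa> j) (\<lambda>_. ennreal c)) S = ennreal (c * measure (\<kappa> j) S)" if "S \<in> sets borel" for S
      using that c by (simp add: emeasure_density_const \<kappa>.emeasure_eq_measure ennreal_mult')
    show "finite_measure (distr (density P (indicator ?E)) borel (first j))"
      by (rule finite_measureI) (simp only: space_distr space_borel d1[OF sets.top, simplified] ennreal_neq_top, simp)
    fix x
    have c0: "measure P ?E = c" using B by (simp add: void_prob c_def)
    have full: "measure (\<kappa> j) {x..} = 1 - measure (\<kappa> j) {..<x}"
    proof -
      have "{x..} = space (\<kappa> j) - {..<x}" by auto
      then show ?thesis using \<kappa>.prob_compl[of "{..<x}"] by simp
    qed
    have eqv: "measure P {\<xi>\<in>space P. N \<xi> \<inter> B = {} \<and> w \<xi> \<in> C \<and> first j \<xi> \<in> {x..}} = c * measure (\<kappa> j) {x..}"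
    proof -
      have k: "measure (\<kappa> j) {x..} = measure P {\<xi>\<in>space P. x \<le> first j \<xi>}"
        unfolding \<kappa>_def by (simp add: measure_distr vimage_def Int_def conj_commute)
      have ne: "measure P {\<xi>\<in>space P. N \<xi> \<inter> {j<..} \<noteq> {}} = 1 - exp_neg (\<nu> {j<..})"
      proof -
        have "{\<xi>\<in>space P. N \<xi> \<inter> {j<..} \<noteq> {}} = space P - {\<xi>\<in>space P. N \<xi> \<inter> {j<..} = {}}" by auto
        then show ?thesis
          using void_prob[of "{j<..}" UNIV] prob_space by (simp add: P.prob_compl)
      qed
      have neE: "measure P {\<xi>\<in>space P. N \<xi> \<inter> B = {} \<and> w \<xi> \<in> C \<and> N \<xi> \<inter> {j<..} \<noteq> {}} = c - c * exp_neg (\<nu> {j<..})"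
      proof -
        have S: "{\<xi>\<in>space P. N \<xi> \<inter> B = {} \<and> w \<xi> \<in> C \<and> N \<xi> \<inter> {j<..} = {}} \<in> sets P"
          using B(1) by measurable
        have "{\<xi>\<in>space P. N \<xi> \<inter> B = {} \<and> w \<xi> \<in> C \<and> N \<xi> \<inter> {j<..} \<noteq> {}} =
            ?E - {\<xi>\<in>space P. N \<xi> \<inter> B = {} \<and> w \<xi> \<in> C \<and> N \<xi> \<inter> {j<..} = {}}" by auto
        moreover have "measure P \<dots> = measure P ?E - measure P {\<xi>\<in>space P. N \<xi> \<inter> B = {} \<and> w \<xi> \<in> C \<and> N \<xi> \<inter> {j<..} = {}}"
          by (rule P.finite_measure_Diff[OF E S]) auto
        ultimately show ?thesis using c0 ind[of "{j<..}"] by simp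
      qed
      \<comment> \<open>The three ranges reflect the possible values of \<open>first j\<close>: the
        junk value, accumulation at \<open>j\<close>, and points strictly beyond
        \<open>j\<close>.\<close>
      consider "x \<le> j - 1" | "j - 1 < x" "x \<le> j" | "j < x" by linarith
      then show ?thesis
      proof cases
        case 1
        have "x \<le> first j \<xi>" for \<xi>
          using 1 first_ge_j[of \<xi> j] by (cases "N \<xi> \<inter> {j<..} = {}") (auto simp: first_def)
        then show ?thesis unfolding k using c0 by (simp add: P.prob_space)
      next
        case 2
        have "x \<le> first j \<xi> \<longleftrightarrow> N \<xi> \<inter> {j<..} \<noteq> {}" for \<xi>
          using 2 first_ge_j[of \<xi> j] by (cases "N \<xi> \<inter> {j<..} = {}") (auto simp: first_def)
        then show ?thesis unfolding k using ne neE by (simp add: right_diff_distrib)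
      next
        case 3
        let ?V = "\<lambda>B'. {\<xi>\<in>space P. N \<xi> \<inter> B' = {}}"
        have v: "measure P (?V B') = exp_neg (\<nu> B')" if "B' \<in> sets borel" for B'
          using void_prob[OF that, of UNIV] prob_space by simp
        have "{\<xi>\<in>space P. x \<le> first j \<xi>} = ?V {j<..<x} - ?V {j<..}"
          using first_ge_iff[OF 3] by auto
        moreover have "measure P (?V {j<..<x} - ?V {j<..}) = measure P (?V {j<..<x}) - measure P (?V {j<..})"
          by (intro P.finite_measure_Diff void_sets) auto
        ultimately have kx: "measure (\<kappa> j) {x..} = exp_neg (\<nu> {j<..<x}) - exp_neg (\<nu> {j<..})"
          unfolding k by (simp add: v)
        let ?W = "\<lambda>B'. {\<xi>\<in>space P. N \<xi> \<inter> B = {} \<and> w \<xi> \<in> C \<and> N \<xi> \<inter> B' = {}}"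
        have W: "?W B' \<in> sets P" if [measurable]: "B' \<in> sets borel" for B'
          using B(1) by measurable
        have "{\<xi>\<in>space P. N \<xi> \<inter> B = {} \<and> w \<xi> \<in> C \<and> first j \<xi> \<in> {x..}} = ?W {j<..<x} - ?W {j<..}"
          using first_ge_iff[OF 3] by auto
        moreover have "measure P (?W {j<..<x} - ?W {j<..}) = measure P (?W {j<..<x}) - measure P (?W {j<..})"
          by (intro P.finite_measure_Diff W) auto
        moreover have "measure P (?W {j<..<x}) = c * exp_neg (\<nu> {j<..<x})" "measure P (?W {j<..}) = c * exp_neg (\<nu> {j<..})"
          using 3 by (auto intro!: ind)
        ultimately show ?thesis unfolding kx by (simp only: right_diff_distrib)
      qed
    qed
    show "emeasure (distr (density P (indicator ?E)) borel (first j)) {x..} = emeasure (density (\<kappa> j) (\<lambda>_. ennreal c)) {x..}"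
      using eqv by (simp add: d1 d2)
  qed simp_all
  then have "emeasure (distr (density P (indicator ?E)) borel (first j)) A = ennreal (c * measure (\<kappa> j) A)"
    using c by (simp add: emeasure_density_const \<kappa>.emeasure_eq_measure ennreal_mult')
  moreover have "emeasure (distr (density P (indicator ?E)) borel (first j)) A = emeasure P (?E \<inter> (first j -` A \<inter> space P))"
    using E by (simp add: emeasure_distr emeasure_density flip: indicator_inter_arith)
  moreover have "?E \<inter> (first j -` A \<inter> space P) = {\<xi>\<in>space P. N \<xi> \<inter> B = {} \<and> w \<xi> \<in> C \<and> first j \<xi> \<in> A}" by auto
  ultimately show ?thesis using c by (simp add: P.emeasure_eq_measure c_def)
qed

end

lemma emeasure_distr_density_indicator:
  assumes "V \<in> sets P" "f \<in> measurable P M" "S \<in> sets M"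
  shows "emeasure (distr (density P (indicator V)) M f) S = emeasure P (V \<inter> (f -` S \<inter> space P))"
  using assms by (simp add: emeasure_distr emeasure_density flip: indicator_inter_arith)

context poisson_embedding
begin

lemma void_w_law:
  assumes B: "B \<in> sets borel"
  shows "distr (density P (indicator {\<xi>\<in>space P. N \<xi> \<inter> B = {}})) borel w = density \<mu> (\<lambda>_. ennreal (exp_neg (\<nu> B)))"
proof (rule measure_eqI)
  fix A assume "A \<in> sets (distr (density P (indicator {\<xi>\<in>space P. N \<xi> \<inter> B = {}})) borel w)"
  then have A: "A \<in> sets borel" by simp
  note V = void_sets[OF B]
  have "{\<xi>\<in>space P. N \<xi> \<inter> B = {}} \<inter> (w -` A \<inter> space P) = {\<xi>\<in>space P. N \<xi> \<inter> B = {} \<and> w \<xi> \<in> A}" by auto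
  then show "emeasure (distr (density P (indicator {\<xi>\<in>space P. N \<xi> \<inter> B = {}})) borel w) A =
      emeasure (density \<mu> (\<lambda>_. ennreal (exp_neg (\<nu> B)))) A"
    using V A B by (simp add: emeasure_distr_density_indicator emeasure_density_const P.emeasure_eq_measure
        void_prob emeasure_eq_measure ennreal_mult' exp_neg_nonneg)
qed simp

lemma void_first_law:
  assumes B: "B \<in> sets borel" "B \<subseteq> {..j}"
  shows "distr (density P (indicator {\<xi>\<in>space P. N \<xi> \<inter> B = {}})) (borel \<Otimes>\<^sub>M borel) (\<lambda>\<xi>. (w \<xi>, first j \<xi>)) =
    density \<mu> (\<lambda>_. ennreal (exp_neg (\<nu> B))) \<Otimes>\<^sub>M \<kappa> j"
proof (rule pair_measure_eqI[symmetric])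
  interpret \<kappa>: prob_space "\<kappa> j" by (rule prob_space_\<kappa>)
  show "sigma_finite_measure (\<kappa> j)" by unfold_locales
  have "finite_measure (density \<mu> (\<lambda>_. ennreal (exp_neg (\<nu> B))))"
    by (rule finite_measureI) (simp add: emeasure_density_const emeasure_eq_measure ennreal_mult_eq_top_iff)
  then show "sigma_finite_measure (density \<mu> (\<lambda>_. ennreal (exp_neg (\<nu> B))))"
    by (simp add: finite_measure_def)
  show "sets (density \<mu> (\<lambda>_. ennreal (exp_neg (\<nu> B))) \<Otimes>\<^sub>M \<kappa> j) =
      sets (distr (density P (indicator {\<xi>\<in>space P. N \<xi> \<inter> B = {}})) (borel \<Otimes>\<^sub>M borel) (\<lambda>\<xi>. (w \<xi>, first j \<xi>)))"
    unfolding sets_distr by (intro sets_pair_measure_cong) auto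
  fix C A assume "C \<in> sets (density \<mu> (\<lambda>_. ennreal (exp_neg (\<nu> B))))" "A \<in> sets (\<kappa> j)"
  then have [measurable]: "C \<in> sets borel" "A \<in> sets borel" by simp_all
  note V = void_sets[OF B(1)]
  have "{\<xi>\<in>space P. N \<xi> \<inter> B = {}} \<inter> ((\<lambda>\<xi>. (w \<xi>, first j \<xi>)) -` (C \<times> A) \<inter> space P) =
      {\<xi>\<in>space P. N \<xi> \<inter> B = {} \<and> w \<xi> \<in> C \<and> first j \<xi> \<in> A}" by auto
  then show "emeasure (density \<mu> (\<lambda>_. ennreal (exp_neg (\<nu> B)))) C * emeasure (\<kappa> j) A =
      emeasure (distr (density P (indicator {\<xi>\<in>space P. N \<xi> \<inter> B = {}})) (borel \<Otimes>\<^sub>M borel) (\<lambda>\<xi>. (w \<xi>, first j \<xi>))) (C \<times> A)"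
    using V by (simp add: emeasure_distr_density_indicator emeasure_density_const P.emeasure_eq_measure
        void_first_prob[OF _ _ B] emeasure_eq_measure \<kappa>.emeasure_eq_measure ennreal_mult' exp_neg_nonneg)
qed

section \<open>The mean identity for the group ahead\<close>

lemma moment_bounded: "moment x \<le> (\<integral>x. \<bar>x\<bar> \<partial>\<mu>)"
  unfolding moment_def using integrable_id
  by (intro integral_mono) (simp_all, auto simp: indicator_def)

text \<open>Fubini: a target \<open>x > j\<close> lies beyond the first point with probability 1 - e
  j x.\<close>

lemma moment_\<kappa>:
  shows "integrable (\<kappa> j) (\<lambda>n. indicator {j..} n * moment n)"
    and "(\<integral>n. indicator {j..} n * moment n \<partial>\<kappa> j) = (\<integral>x. indicator {j<..} x * (x * (1 - e j x)) \<partial>\<mu>)"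
proof -
  interpret \<kappa>: prob_space "\<kappa> j" by (rule prob_space_\<kappa>)
  interpret pp: pair_sigma_finite "\<kappa> j" \<mu> by unfold_locales
  show "integrable (\<kappa> j) (\<lambda>n. indicator {j..} n * moment n)"
    using moment_nonneg moment_bounded
    by (intro \<kappa>.integrable_const_bound[where B="\<integral>x. \<bar>x\<bar> \<partial>\<mu>"]) (simp_all, auto simp: indicator_def)
  let ?f = "\<lambda>n x :: real. indicator {z. j \<le> fst z \<and> fst z < snd z} (n, x) * x"
  have [measurable]: "{z :: real \<times> real. j \<le> fst z \<and> fst z < snd z} \<in> sets (borel \<Otimes>\<^sub>M borel)"
  proof -
    have "{z \<in> space (borel \<Otimes>\<^sub>M borel). j \<le> fst z \<and> fst z < (snd z :: real)} \<in> sets (borel \<Otimes>\<^sub>M borel)" by measurable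
    then show ?thesis by (simp add: space_pair_measure)
  qed
  have "integrable (\<kappa> j \<Otimes>\<^sub>M \<mu>) snd"
    by (rule pp.Fubini_integrable) (use integrable_id in auto)
  then have int: "integrable (\<kappa> j \<Otimes>\<^sub>M \<mu>) (case_prod ?f)"
    by (rule Bochner_Integration.integrable_bound) (measurable, auto simp: indicator_def)
  have "(\<integral>n. indicator {j..} n * moment n \<partial>\<kappa> j) = (\<integral>n. (\<integral>x. ?f n x \<partial>\<mu>) \<partial>\<kappa> j)"
  proof (intro Bochner_Integration.integral_cong refl)
    fix n
    have "(\<integral>x. ?f n x \<partial>\<mu>) = (\<integral>x. indicator {j..} n * (indicator {n..} x * x) \<partial>\<mu>)"
      by (intro integral_cong_AE) (use AE_neq[of n] in \<open>simp_all, auto simp: indicator_def elim!: eventually_mono\<close>)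
    then show "indicator {j..} n * moment n = (\<integral>x. ?f n x \<partial>\<mu>)" by (simp add: moment_def)
  qed
  also have "\<dots> = (\<integral>x. (\<integral>n. ?f n x \<partial>\<kappa> j) \<partial>\<mu>)"
    by (rule pp.Fubini_integral[OF int, symmetric])
  also have "\<dots> = (\<integral>x. indicator {j<..} x * (x * (1 - e j x)) \<partial>\<mu>)"
  proof (intro Bochner_Integration.integral_cong refl)
    fix x
    have "(\<integral>n. ?f n x \<partial>\<kappa> j) = (\<integral>n. indicator {j..<x} n * x \<partial>\<kappa> j)"
      by (intro Bochner_Integration.integral_cong) (auto simp: indicator_def)
    also have "\<dots> = measure (\<kappa> j) {j..<x} * x" by simp
    also have "\<dots> = indicator {j<..} x * (x * (1 - e j x))"
      using measure_\<kappa>_ivl[of j j x] by (cases "j < x") (auto simp: mult.commute)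
    finally show "(\<integral>n. ?f n x \<partial>\<kappa> j) = indicator {j<..} x * (x * (1 - e j x))" .
  qed
  finally show "(\<integral>n. indicator {j..} n * moment n \<partial>\<kappa> j) = (\<integral>x. indicator {j<..} x * (x * (1 - e j x)) \<partial>\<mu>)" .
qed

text \<open>The identity behind the martingale property. Either the target \<open>x\<close> comes
  first, with survival probability \<open>e j x\<close>, or a Poisson point \<open>n\<close> does,
  and then all targets above it share the value \<open>gr n\<close>. Writing gr x = (gr x - x) + x
  and gr n mass n = moment n - slack n, the two corrections cancel by \<open>slack_\<kappa>\<close>;
  what remains adds up to the integral of \<open>x\<close> beyond \<open>j\<close>.\<close>

lemma group_mean:
  "(\<integral>\<^sup>+x\<in>{j<..}. ennreal (gr x * e j x) \<partial>\<mu>) + (\<integral>\<^sup>+n\<in>{j..}. ennreal (gr n * mass n) \<partial>\<kappa> j) = ennreal (moment j)"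
proof -
  interpret \<kappa>: prob_space "\<kappa> j" by (rule prob_space_\<kappa>)
  let ?K = "\<integral>x. \<bar>x\<bar> \<partial>\<mu>"
  have int_slack: "integrable (\<kappa> j) (\<lambda>n. indicator {j..} n * slack n)"
    using slack_nonneg order_trans[OF slack_le_moment moment_bounded]
    by (intro \<kappa>.integrable_const_bound[where B="?K"]) (simp_all, auto simp: indicator_def intro: order_trans[OF slack_nonneg])
  define S where "S = (\<integral>n. indicator {j..} n * slack n \<partial>\<kappa> j)"
  have S0: "0 \<le> S" unfolding S_def using slack_nonneg by (intro integral_nonneg_AE) auto
  have nnS: "(\<integral>\<^sup>+x\<in>{j..}. ennreal (slack x) \<partial>\<kappa> j) = ennreal S"
  proof -
    have "(\<integral>\<^sup>+x\<in>{j..}. ennreal (slack x) \<partial>\<kappa> j) = (\<integral>\<^sup>+x. ennreal (indicator {j..} x * slack x) \<partial>\<kappa> j)"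
      by (intro nn_integral_cong) (auto simp: indicator_def)
    also have "\<dots> = ennreal S"
      unfolding S_def using slack_nonneg by (intro nn_integral_eq_integral[OF int_slack]) auto
    finally show ?thesis .
  qed
  have nnd: "(\<integral>\<^sup>+x. ennreal (indicator {j<..} x * ((gr x - x) * e j x)) \<partial>\<mu>) = ennreal S"
  proof -
    have "(\<integral>\<^sup>+x. ennreal (indicator {j<..} x * ((gr x - x) * e j x)) \<partial>\<mu>) = (\<integral>\<^sup>+x\<in>{j<..}. ennreal ((gr x - x) * e j x) \<partial>\<mu>)"
      by (intro nn_integral_cong) (auto simp: indicator_def)
    then show ?thesis using slack_\<kappa>[of j] nnS by simp
  qed
  have pos: "0 \<le> indicator {j<..} x * ((gr x - x) * e j x)" for x
    using gr_ge_self[of x] e_bounds[of j x] by (auto simp: indicator_def)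
  have int_d: "integrable \<mu> (\<lambda>x. indicator {j<..} x * ((gr x - x) * e j x))"
    by (rule integrableI_nonneg) (use pos nnd in auto)
  have d: "(\<integral>x. indicator {j<..} x * ((gr x - x) * e j x) \<partial>\<mu>) = S"
    using nnd nn_integral_eq_integral[OF int_d] pos S0 by (simp add: integral_nonneg_AE)
  have int_xe: "integrable \<mu> (\<lambda>x. indicator {j<..} x * (x * e j x))"
    using integrable_id
  proof (rule Bochner_Integration.integrable_bound)
    show "AE x in \<mu>. norm (indicator {j<..} x * (x * e j x)) \<le> norm x"
      using e_bounds by (intro AE_I2) (auto simp: indicator_def abs_mult mult_left_le)
  qed measurable
  have ge_eq: "indicator {j<..} x * (gr x * e j x) = indicator {j<..} x * ((gr x - x) * e j x) + indicator {j<..} x * (x * e j x)" for x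
    by (simp add: algebra_simps)
  have int_ge: "integrable \<mu> (\<lambda>x. indicator {j<..} x * (gr x * e j x))"
    unfolding ge_eq by (intro Bochner_Integration.integrable_add int_d int_xe)
  have ge: "(\<integral>x. indicator {j<..} x * (gr x * e j x) \<partial>\<mu>) = S + (\<integral>x. indicator {j<..} x * (x * e j x) \<partial>\<mu>)"
    unfolding ge_eq using int_d int_xe by (simp add: Bochner_Integration.integral_add d)
  have gm_eq: "indicator {j..} n * (gr n * mass n) = indicator {j..} n * moment n - indicator {j..} n * slack n" for n
    by (simp add: slack_def algebra_simps)
  have int_gm: "integrable (\<kappa> j) (\<lambda>n. indicator {j..} n * (gr n * mass n))"
    unfolding gm_eq by (intro Bochner_Integration.integrable_diff moment_\<kappa> int_slack)
  have gm: "(\<integral>n. indicator {j..} n * (gr n * mass n) \<partial>\<kappa> j) = (\<integral>x. indicator {j<..} x * (x * (1 - e j x)) \<partial>\<mu>) - S"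
    unfolding gm_eq using moment_\<kappa>[of j] int_slack by (simp add: Bochner_Integration.integral_diff S_def)
  have int_x1e: "integrable \<mu> (\<lambda>x. indicator {j<..} x * (x * (1 - e j x)))"
    using integrable_id
  proof (rule Bochner_Integration.integrable_bound)
    show "AE x in \<mu>. norm (indicator {j<..} x * (x * (1 - e j x))) \<le> norm x"
      using e_bounds by (intro AE_I2) (auto simp: indicator_def abs_mult mult_left_le)
  qed measurable
  have "(\<integral>x. indicator {j<..} x * (x * e j x) \<partial>\<mu>) + (\<integral>x. indicator {j<..} x * (x * (1 - e j x)) \<partial>\<mu>) = (\<integral>x. indicator {j<..} x * x \<partial>\<mu>)"
    by (subst Bochner_Integration.integral_add[symmetric, OF int_xe int_x1e])
       (intro Bochner_Integration.integral_cong refl, simp add: algebra_simps)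
  also have "\<dots> = moment j"
    unfolding moment_def by (intro integral_cong_AE) (use AE_neq[of j] in \<open>simp_all, auto simp: indicator_def elim!: eventually_mono\<close>)
  finally have sum: "(\<integral>x. indicator {j<..} x * (gr x * e j x) \<partial>\<mu>) + (\<integral>n. indicator {j..} n * (gr n * mass n) \<partial>\<kappa> j) = moment j"
    unfolding ge gm by simp
  have "(\<integral>\<^sup>+x\<in>{j<..}. ennreal (gr x * e j x) \<partial>\<mu>) = (\<integral>\<^sup>+x. ennreal (indicator {j<..} x * (gr x * e j x)) \<partial>\<mu>)"
    by (intro nn_integral_cong) (auto simp: indicator_def)
  also have "\<dots> = ennreal (\<integral>x. indicator {j<..} x * (gr x * e j x) \<partial>\<mu>)"
    using gr_nonneg e_bounds by (intro nn_integral_eq_integral[OF int_ge]) auto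
  finally have 1: "(\<integral>\<^sup>+x\<in>{j<..}. ennreal (gr x * e j x) \<partial>\<mu>) = ennreal (\<integral>x. indicator {j<..} x * (gr x * e j x) \<partial>\<mu>)" .
  have "(\<integral>\<^sup>+n\<in>{j..}. ennreal (gr n * mass n) \<partial>\<kappa> j) = (\<integral>\<^sup>+n. ennreal (indicator {j..} n * (gr n * mass n)) \<partial>\<kappa> j)"
    by (intro nn_integral_cong) (auto simp: indicator_def)
  also have "\<dots> = ennreal (\<integral>n. indicator {j..} n * (gr n * mass n) \<partial>\<kappa> j)"
    using gr_nonneg mass_nonneg by (intro nn_integral_eq_integral[OF int_gm]) auto
  finally have 2: "(\<integral>\<^sup>+n\<in>{j..}. ennreal (gr n * mass n) \<partial>\<kappa> j) = ennreal (\<integral>n. indicator {j..} n * (gr n * mass n) \<partial>\<kappa> j)" .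
  show ?thesis
    unfolding 1 2 sum[symmetric] using gr_nonneg e_bounds mass_nonneg
    by (intro ennreal_plus[symmetric] integral_nonneg_AE) auto
qed

text \<open>Expresses \<open>gr (D j)\<close> on the event that the target lies beyond
  \<open>j\<close> as a function of the target and the first point, so that their product law
  becomes applicable.\<close>

definition stage :: "real \<Rightarrow> real \<times> real \<Rightarrow> real" where
  "stage j z = (if j < fst z then gr (if j \<le> snd z \<and> snd z < fst z then snd z else fst z) else 0)"

lemma stage_measurable [measurable]: "stage j \<in> borel_measurable (borel \<Otimes>\<^sub>M borel)"
  unfolding stage_def[abs_def] by measurable

lemma stage_nonneg: "0 \<le> stage j z"
  by (simp add: stage_def gr_nonneg)

lemma stage_eq: "stage j (w \<xi>, first j \<xi>) = (if j < w \<xi> then gr (D j \<xi>) else 0)"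
  by (simp add: stage_def D_eq_first)

lemma nn_integral_stage:
  assumes B: "B \<in> sets borel" "B \<subseteq> {..j}"
  shows "(\<integral>\<^sup>+\<xi>\<in>{\<xi>\<in>space P. N \<xi> \<inter> B = {}}. ennreal (stage j (w \<xi>, first j \<xi>)) \<partial>P) = ennreal (exp_neg (\<nu> B) * moment j)"
proof -
  interpret \<kappa>: prob_space "\<kappa> j" by (rule prob_space_\<kappa>)
  interpret pp: pair_sigma_finite \<mu> "\<kappa> j" by unfold_locales
  let ?V = "{\<xi>\<in>space P. N \<xi> \<inter> B = {}}" and ?c = "ennreal (exp_neg (\<nu> B))"
  have V[measurable]: "?V \<in> sets P" by (rule void_sets[OF B(1)])
  have inner: "(\<integral>\<^sup>+n. ennreal (stage j (x, n)) \<partial>\<kappa> j) =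
      ennreal (gr x * e j x) * indicator {j<..} x + (\<integral>\<^sup>+n. ennreal (gr n) * indicator {z. j \<le> fst z \<and> fst z < snd z} (n, x) \<partial>\<kappa> j)" for x
  proof (cases "j < x")
    case True
    have "(\<integral>\<^sup>+n. ennreal (stage j (x, n)) \<partial>\<kappa> j) =
       (\<integral>\<^sup>+n. ennreal (gr x) * indicator (- {j..<x}) n + ennreal (gr n) * indicator {j..<x} n \<partial>\<kappa> j)"
      using True by (intro nn_integral_cong) (auto simp: stage_def indicator_def)
    also have "\<dots> = ennreal (gr x) * emeasure (\<kappa> j) (- {j..<x}) + (\<integral>\<^sup>+n. ennreal (gr n) * indicator {j..<x} n \<partial>\<kappa> j)"
      by (subst nn_integral_add) (auto simp: nn_integral_cmult_indicator)
    also have "emeasure (\<kappa> j) (- {j..<x}) = ennreal (e j x)"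
      using \<kappa>.prob_compl[of "{j..<x}"] measure_\<kappa>_ivl[of j j x] True
      by (simp add: \<kappa>.emeasure_eq_measure Compl_eq_Diff_UNIV)
    also have "(\<integral>\<^sup>+n. ennreal (gr n) * indicator {j..<x} n \<partial>\<kappa> j) =
        (\<integral>\<^sup>+n. ennreal (gr n) * indicator {z. j \<le> fst z \<and> fst z < snd z} (n, x) \<partial>\<kappa> j)"
      by (intro nn_integral_cong) (auto simp: indicator_def)
    finally show ?thesis using True gr_nonneg[of x] by (simp add: ennreal_mult')
  next
    case False
    then have "(\<integral>\<^sup>+n. ennreal (gr n) * indicator {z. j \<le> fst z \<and> fst z < snd z} (n, x) \<partial>\<kappa> j) = (\<integral>\<^sup>+n. 0 \<partial>\<kappa> j)"
      by (intro nn_integral_cong) (auto simp: indicator_def)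
    with False show ?thesis by (simp add: stage_def)
  qed
  have [measurable]: "{z :: real \<times> real. j \<le> fst z \<and> fst z < snd z} \<in> sets (borel \<Otimes>\<^sub>M borel)"
  proof -
    have "{z \<in> space (borel \<Otimes>\<^sub>M borel). j \<le> fst z \<and> fst z < (snd z :: real)} \<in> sets (borel \<Otimes>\<^sub>M borel)" by measurable
    then show ?thesis by (simp add: space_pair_measure)
  qed
  have "(\<integral>\<^sup>+\<xi>\<in>?V. ennreal (stage j (w \<xi>, first j \<xi>)) \<partial>P) =
      (\<integral>\<^sup>+\<xi>. ennreal (stage j (w \<xi>, first j \<xi>)) \<partial>density P (indicator ?V))"
    by (subst nn_integral_density) (auto simp: mult.commute)
  also have "\<dots> = (\<integral>\<^sup>+z. ennreal (stage j z) \<partial>distr (density P (indicator ?V)) (borel \<Otimes>\<^sub>M borel) (\<lambda>\<xi>. (w \<xi>, first j \<xi>)))"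
    by (subst nn_integral_distr) auto
  also have "\<dots> = (\<integral>\<^sup>+z. ennreal (stage j z) \<partial>(density \<mu> (\<lambda>_. ?c) \<Otimes>\<^sub>M \<kappa> j))"
    by (simp only: void_first_law[OF B])
  also have "\<dots> = (\<integral>\<^sup>+x. (\<integral>\<^sup>+n. ennreal (stage j (x, n)) \<partial>\<kappa> j) \<partial>density \<mu> (\<lambda>_. ?c))"
  proof (rule \<kappa>.nn_integral_fst[symmetric])
    have "sets (density \<mu> (\<lambda>_. ?c) \<Otimes>\<^sub>M \<kappa> j) = sets (borel \<Otimes>\<^sub>M borel)" by (intro sets_pair_measure_cong) auto
    then show "(\<lambda>z. ennreal (stage j z)) \<in> borel_measurable (density \<mu> (\<lambda>_. ?c) \<Otimes>\<^sub>M \<kappa> j)"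
      by (subst measurable_cong_sets[OF _ refl]) auto
  qed
  also have "\<dots> = ?c * (\<integral>\<^sup>+x. (\<integral>\<^sup>+n. ennreal (stage j (x, n)) \<partial>\<kappa> j) \<partial>\<mu>)"
    by (subst nn_integral_density) (auto simp: nn_integral_cmult)
  also have "(\<integral>\<^sup>+x. (\<integral>\<^sup>+n. ennreal (stage j (x, n)) \<partial>\<kappa> j) \<partial>\<mu>) =
      (\<integral>\<^sup>+x\<in>{j<..}. ennreal (gr x * e j x) \<partial>\<mu>) +
      (\<integral>\<^sup>+x. (\<integral>\<^sup>+n. ennreal (gr n) * indicator {z. j \<le> fst z \<and> fst z < snd z} (n, x) \<partial>\<kappa> j) \<partial>\<mu>)"
    unfolding inner by (rule nn_integral_add) measurable
  also have "(\<integral>\<^sup>+x. (\<integral>\<^sup>+n. ennreal (gr n) * indicator {z. j \<le> fst z \<and> fst z < snd z} (n, x) \<partial>\<kappa> j) \<partial>\<mu>) =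
      (\<integral>\<^sup>+n. (\<integral>\<^sup>+x. ennreal (gr n) * indicator {z. j \<le> fst z \<and> fst z < snd z} (n, x) \<partial>\<mu>) \<partial>\<kappa> j)"
    by (rule pp.Fubini'[symmetric]) measurable
  also have "\<dots> = (\<integral>\<^sup>+n\<in>{j..}. ennreal (gr n * mass n) \<partial>\<kappa> j)"
  proof (intro nn_integral_cong)
    fix n
    have "(\<integral>\<^sup>+x. ennreal (gr n) * indicator {z. j \<le> fst z \<and> fst z < snd z} (n, x) \<partial>\<mu>) =
        (\<integral>\<^sup>+x. ennreal (gr n) * indicator {j..} n * indicator {n..} x \<partial>\<mu>)"
      by (intro nn_integral_cong_AE) (use AE_neq[of n] in \<open>auto simp: indicator_def elim!: eventually_mono\<close>)
    also have "\<dots> = ennreal (gr n) * indicator {j..} n * emeasure \<mu> {n..}"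
      by (rule nn_integral_cmult_indicator) simp
    also have "\<dots> = ennreal (gr n * mass n) * indicator {j..} n"
      using gr_nonneg[of n] mass_nonneg[of n]
      by (simp add: mass_def emeasure_eq_measure ennreal_mult' mult_ac)
    finally show "(\<integral>\<^sup>+x. ennreal (gr n) * indicator {z. j \<le> fst z \<and> fst z < snd z} (n, x) \<partial>\<mu>) =
        ennreal (gr n * mass n) * indicator {j..} n" .
  qed
  also have "(\<integral>\<^sup>+x\<in>{j<..}. ennreal (gr x * e j x) \<partial>\<mu>) + \<dots> = ennreal (moment j)"
    by (rule group_mean)
  finally show ?thesis using exp_neg_nonneg moment_nonneg by (simp add: ennreal_mult')
qed

text \<open>Both integrals are the same number, one by the group identity and the other by
  independence of \<open>w\<close> and \<open>N\<close>. This is the martingale property tested on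
  generating events.\<close>

lemma integral_stage:
  assumes B: "B \<in> sets borel" "B \<subseteq> {..j}"
  defines "A \<equiv> {\<xi>\<in>space P. N \<xi> \<inter> B = {} \<and> j < w \<xi>}"
  shows "set_integrable P A (\<lambda>\<xi>. gr (D j \<xi>))" (is ?th1)
    and "(LINT \<xi>:A|P. gr (D j \<xi>)) = exp_neg (\<nu> B) * moment j" (is ?th2)
    and "(LINT \<xi>:A|P. w \<xi>) = exp_neg (\<nu> B) * moment j" (is ?th3)
proof -
  let ?V = "{\<xi>\<in>space P. N \<xi> \<inter> B = {}}"
  have V[measurable]: "?V \<in> sets P" by (rule void_sets[OF B(1)])
  let ?s = "\<lambda>\<xi>. indicator ?V \<xi> * stage j (w \<xi>, first j \<xi>)"
  have eq: "indicator A \<xi> *\<^sub>R gr (D j \<xi>) = ?s \<xi>" if "\<xi> \<in> space P" for \<xi>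
    using that by (auto simp: A_def stage_eq indicator_def)
  have m: "?s \<in> borel_measurable P" by measurable
  have nn: "(\<integral>\<^sup>+\<xi>. ennreal (?s \<xi>) \<partial>P) = ennreal (exp_neg (\<nu> B) * moment j)"
  proof -
    have "(\<integral>\<^sup>+\<xi>. ennreal (?s \<xi>) \<partial>P) = (\<integral>\<^sup>+\<xi>\<in>?V. ennreal (stage j (w \<xi>, first j \<xi>)) \<partial>P)"
      by (intro nn_integral_cong) (auto simp: indicator_def)
    then show ?thesis by (simp only: nn_integral_stage[OF B])
  qed
  have int: "integrable P ?s"
    by (rule integrableI_nonneg[OF m]) (use nn stage_nonneg in auto)
  have "integrable P ?s \<longleftrightarrow> integrable P (\<lambda>\<xi>. indicator A \<xi> *\<^sub>R gr (D j \<xi>))"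
    by (intro Bochner_Integration.integrable_cong refl eq[symmetric])
  then show ?th1 unfolding set_integrable_def using int by simp
  have "(LINT \<xi>:A|P. gr (D j \<xi>)) = (\<integral>\<xi>. ?s \<xi> \<partial>P)"
    unfolding set_lebesgue_integral_def by (intro Bochner_Integration.integral_cong refl eq)
  also have "\<dots> = exp_neg (\<nu> B) * moment j"
    using nn nn_integral_eq_integral[OF int] stage_nonneg exp_neg_nonneg moment_nonneg
    by (simp add: integral_nonneg_AE)
  finally show ?th2 .
  have "(LINT \<xi>:A|P. w \<xi>) = (\<integral>\<xi>. indicator ?V \<xi> * (indicator {j<..} (w \<xi>) * w \<xi>) \<partial>P)"
    unfolding set_lebesgue_integral_def by (intro Bochner_Integration.integral_cong) (auto simp: A_def indicator_def)
  also have "\<dots> = (\<integral>\<xi>. indicator {j<..} (w \<xi>) * w \<xi> \<partial>density P (\<lambda>\<xi>. ennreal (indicator ?V \<xi>)))"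
    by (subst integral_real_density) auto
  also have "\<dots> = (\<integral>x. indicator {j<..} x * x \<partial>distr (density P (indicator ?V)) borel w)"
    by (subst integral_distr) (auto simp: ennreal_indicator)
  also have "\<dots> = (\<integral>x. exp_neg (\<nu> B) * (indicator {j<..} x * x) \<partial>\<mu>)"
    unfolding void_w_law[OF B(1)] by (subst integral_real_density) (auto simp: exp_neg_nonneg)
  also have "\<dots> = exp_neg (\<nu> B) * (\<integral>x. indicator {j<..} x * x \<partial>\<mu>)" by simp
  also have "(\<integral>x. indicator {j<..} x * x \<partial>\<mu>) = moment j"
    unfolding moment_def by (intro integral_cong_AE) (use AE_neq[of j] in \<open>simp_all, auto simp: indicator_def elim!: eventually_mono\<close>)
  finally show ?th3 .
qed

section \<open>Path regularity of the martingale\<close>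

lemma bdd_below_points: "bdd_below (insert (w \<xi>) (N \<xi> \<inter> {k<..}))"
  by (auto intro!: bdd_belowI[of _ "min (w \<xi>) k"])

lemma D_le_w: "D k \<xi> \<le> w \<xi>"
  unfolding D_def using bdd_below_points by (intro cInf_lower) auto

lemma D_le_point: "x \<in> N \<xi> \<Longrightarrow> k < x \<Longrightarrow> D k \<xi> \<le> x"
  unfolding D_def using bdd_below_points by (intro cInf_lower) auto

lemma D_ge: "k < w \<xi> \<Longrightarrow> k \<le> D k \<xi>"
  unfolding D_def by (intro cInf_greatest) auto

lemma D_mono: "k \<le> k' \<Longrightarrow> D k \<xi> \<le> D k' \<xi>"
  unfolding D_def using bdd_below_points by (intro cInf_superset_mono) auto

lemma D_less: "D k \<xi> < c \<Longrightarrow> w \<xi> < c \<or> (\<exists>x\<in>N \<xi>. k < x \<and> x < c)"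
  unfolding D_def using cInf_lessD[of "insert (w \<xi>) (N \<xi> \<inter> {k<..})" c] by auto

lemma D_cong: "N \<xi> \<inter> {k<..j} = {} \<Longrightarrow> k \<le> j \<Longrightarrow> D k \<xi> = D j \<xi>"
proof -
  assume "N \<xi> \<inter> {k<..j} = {}" "k \<le> j"
  then have "N \<xi> \<inter> {k<..} = N \<xi> \<inter> {j<..}" by (force simp: not_less)
  then show ?thesis by (simp add: D_def)
qed

lemma D_right_continuous:
  assumes "k < w \<xi>"
  shows "((\<lambda>k. D k \<xi>) \<longlongrightarrow> D k \<xi>) (at_right k)"
proof (rule order_tendstoI)
  fix c assume "c < D k \<xi>"
  moreover have "eventually (\<lambda>y. k < y) (at_right k)" by (simp add: eventually_at_filter)
  ultimately show "eventually (\<lambda>k. c < D k \<xi>) (at_right k)"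
    by (auto elim!: eventually_mono intro: less_le_trans[OF _ D_mono])
next
  fix c assume "D k \<xi> < c"
  then consider "w \<xi> < c" | x where "x \<in> N \<xi>" "k < x" "x < c" using D_less by blast
  then show "eventually (\<lambda>k. D k \<xi> < c) (at_right k)"
  proof cases
    case 1
    then show ?thesis by (intro always_eventually) (auto intro: le_less_trans[OF D_le_w])
  next
    case 2
    then have "eventually (\<lambda>k'. k' < x) (at_right k)" by (auto simp: eventually_at_right[of k x])
    then show ?thesis by eventually_elim (use 2 D_le_point in \<open>auto intro: le_less_trans\<close>)
  qed
qed

text \<open>
  \<open>D k\<close> is the next point of the Poisson set or the target itself; at stage \<open>k\<close> it is known,
  but not which of the two it is.
\<close>

definition M :: "real \<Rightarrow> 'a \<Rightarrow> real" where
  "M k \<xi> = (if k < w \<xi> then gr (D k \<xi>) else w \<xi>)"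

lemma M_mono: "k \<le> k' \<Longrightarrow> k' < w \<xi> \<Longrightarrow> M k \<xi> \<le> M k' \<xi>"
  by (simp add: M_def gr_mono D_mono)

text \<open>Since \<open>D\<close> is right-continuous and nondecreasing in \<open>k\<close>, the
  function \<open>gr\<close> is approached from the right only, which is where it is
  continuous.\<close>

lemma M_right_continuous: "((\<lambda>k. M k \<xi>) \<longlongrightarrow> M k \<xi>) (at_right k)"
proof (cases "k < w \<xi>")
  case True
  have g: "continuous (at (D k \<xi>) within {D k \<xi>..}) gr"
    unfolding continuous_within at_within_Ici_at_right by (rule gr_right_continuous)
  have ev: "eventually (\<lambda>k'. k < k' \<and> k' < w \<xi>) (at_right k)"
    using True by (auto simp: eventually_at_right[of k "w \<xi>"])
  have "((\<lambda>k'. gr (D k' \<xi>)) \<longlongrightarrow> gr (D k \<xi>)) (at_right k)"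
    by (rule continuous_within_tendsto_compose[OF g _ D_right_continuous[OF True]])
       (use ev in \<open>auto elim!: eventually_mono intro: D_mono\<close>)
  moreover have "eventually (\<lambda>k'. gr (D k' \<xi>) = M k' \<xi>) (at_right k)"
    using ev by eventually_elim (simp add: M_def)
  ultimately have "((\<lambda>k. M k \<xi>) \<longlongrightarrow> gr (D k \<xi>)) (at_right k)"
    by (rule Lim_transform_eventually)
  moreover have "M k \<xi> = gr (D k \<xi>)" using True by (simp add: M_def)
  ultimately show ?thesis by simp
next
  case False
  have "eventually (\<lambda>k'. k < k') (at_right k)" by (simp add: eventually_at_filter)
  then have "eventually (\<lambda>k'. M k' \<xi> = M k \<xi>) (at_right k)"
    by eventually_elim (use False in \<open>simp add: M_def\<close>)
  then show ?thesis by (rule tendsto_eventually)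
qed

text \<open>Up to the target the path is nondecreasing and bounded by \<open>gr (w \<xi>)\<close>;
  beyond it the path is constant.\<close>

lemma M_left_limit: "\<exists>l. ((\<lambda>k. M k \<xi>) \<longlongrightarrow> l) (at_left k)"
proof (cases "k \<le> w \<xi>")
  case True
  define l where "l = (SUP k'\<in>{..<k}. M k' \<xi>)"
  have bdd: "bdd_above ((\<lambda>k'. M k' \<xi>) ` {..<k})"
    using True D_le_w by (intro bdd_aboveI2[of _ _ "gr (w \<xi>)"]) (auto simp: M_def intro: gr_mono)
  have "((\<lambda>k. M k \<xi>) \<longlongrightarrow> l) (at_left k)"
  proof (rule order_tendstoI)
    fix c assume "c < l"
    then obtain k' where k': "k' < k" "c < M k' \<xi>"
      using less_cSUP_iff[OF _ bdd, of c] by (auto simp: l_def)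
    have "eventually (\<lambda>z. k' < z \<and> z < k) (at_left k)"
      using k' by (auto simp: eventually_at_left[of k' k])
    then show "eventually (\<lambda>z. c < M z \<xi>) (at_left k)"
      by eventually_elim (use k' True M_mono[of k' _ \<xi>] in \<open>force intro: less_le_trans\<close>)
  next
    fix c assume "l < c"
    have "eventually (\<lambda>z. z < k) (at_left k)" by (simp add: eventually_at_filter)
    then show "eventually (\<lambda>z. M z \<xi> < c) (at_left k)"
    proof eventually_elim
      case (elim z)
      then have "M z \<xi> \<le> l" unfolding l_def using bdd by (intro cSUP_upper) auto
      then show ?case using \<open>l < c\<close> by simp
    qed
  qed
  then show ?thesis ..
next
  case False
  then have "eventually (\<lambda>k'. w \<xi> < k') (at_left k)"
    by (auto simp: eventually_at_left[of "w \<xi>" k] intro!: exI[of _ "w \<xi>"])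
  then have "eventually (\<lambda>k'. M k' \<xi> = w \<xi>) (at_left k)"
    by eventually_elim (simp add: M_def)
  then show ?thesis by (intro exI tendsto_eventually)
qed

text \<open>The value at level - \<infinity>, which becomes time 0; by monotonicity the limit is an
  infimum.\<close>

definition M_bot :: "'a \<Rightarrow> real" where
  "M_bot \<xi> = (INF k\<in>{..<w \<xi>}. M k \<xi>)"

lemma bdd_below_M: "bdd_below ((\<lambda>k. M k \<xi>) ` {..<w \<xi>})"
  by (intro bdd_belowI2[of _ 0]) (auto simp: M_def gr_nonneg)

lemma M_bot_nonneg: "0 \<le> M_bot \<xi>"
  unfolding M_bot_def by (intro cINF_greatest) (auto simp: M_def gr_nonneg)

lemma M_bot_le: "k < w \<xi> \<Longrightarrow> M_bot \<xi> \<le> M k \<xi>"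
  unfolding M_bot_def using bdd_below_M by (intro cINF_lower) auto

lemma M_tendsto_bot: "((\<lambda>k. M k \<xi>) \<longlongrightarrow> M_bot \<xi>) at_bot"
proof (rule order_tendstoI)
  have ev: "eventually (\<lambda>k. k < w \<xi>) at_bot" by (rule eventually_gt_at_bot)
  fix c assume c: "c < M_bot \<xi>"
  show "eventually (\<lambda>k. c < M k \<xi>) at_bot"
    using ev by eventually_elim (rule less_le_trans[OF c M_bot_le])
next
  fix c assume "M_bot \<xi> < c"
  then obtain k where k: "k < w \<xi>" "M k \<xi> < c"
    using cINF_less_iff[OF _ bdd_below_M, of \<xi> c] by (auto simp: M_bot_def)
  have "eventually (\<lambda>z. z \<le> k) at_bot" by (rule eventually_le_at_bot)
  then show "eventually (\<lambda>k. M k \<xi> < c) at_bot"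
    by eventually_elim (use k M_mono[of _ k \<xi>] in \<open>auto intro: le_less_trans\<close>)
qed

subsection \<open>Filtration and martingale property\<close>

text \<open>
  The second family tells that neither a Poisson point nor the target lies in \<open>(k, j]\<close>, but
  it never tells which of the two comes next.
\<close>

definition gen :: "real \<Rightarrow> 'a set set" where
  "gen k = {A. \<exists>B C. B \<in> sets borel \<and> C \<in> sets borel \<and> C \<subseteq> {..k} \<and> A = {\<xi>\<in>space P. N \<xi> \<inter> B = {} \<and> w \<xi> \<in> C}}
    \<union> {A. \<exists>B j. B \<in> sets borel \<and> k \<le> j \<and> B \<subseteq> {..j} \<and> {k<..j} \<subseteq> B \<and> A = {\<xi>\<in>space P. N \<xi> \<inter> B = {} \<and> j < w \<xi>}}"

lemma gen1: "B \<in> sets borel \<Longrightarrow> C \<in> sets borel \<Longrightarrow> C \<subseteq> {..k} \<Longrightarrow> {\<xi>\<in>space P. N \<xi> \<inter> B = {} \<and> w \<xi> \<in> C} \<in> gen k"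
  unfolding gen_def by blast

lemma gen2: "B \<in> sets borel \<Longrightarrow> k \<le> j \<Longrightarrow> B \<subseteq> {..j} \<Longrightarrow> {k<..j} \<subseteq> B \<Longrightarrow> {\<xi>\<in>space P. N \<xi> \<inter> B = {} \<and> j < w \<xi>} \<in> gen k"
  unfolding gen_def by blast

lemma gen_cases:
  assumes "A \<in> gen k"
  obtains B C where "B \<in> sets borel" "C \<in> sets borel" "C \<subseteq> {..k}" "A = {\<xi>\<in>space P. N \<xi> \<inter> B = {} \<and> w \<xi> \<in> C}"
  | B j where "B \<in> sets borel" "k \<le> j" "B \<subseteq> {..j}" "{k<..j} \<subseteq> B" "A = {\<xi>\<in>space P. N \<xi> \<inter> B = {} \<and> j < w \<xi>}"
  using assms unfolding gen_def by blast

lemma gen_sets: "gen k \<subseteq> sets P"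
proof
  fix A assume "A \<in> gen k"
  then show "A \<in> sets P"
    by (cases rule: gen_cases) (simp_all, measurable)
qed

text \<open>The target is at or below \<open>k\<close> in the first family and above
  \<open>k\<close> in the second, so mixed intersections are empty. Within one family the avoided
  sets are united.\<close>

lemma Int_stable_gen: "Int_stable (gen k)"
proof (rule Int_stableI)
  have mixed: "A \<inter> A' \<in> gen k"
    if "C \<subseteq> {..k}" "k \<le> j" "A = {\<xi>\<in>space P. N \<xi> \<inter> B = {} \<and> w \<xi> \<in> C}" "A' = {\<xi>\<in>space P. N \<xi> \<inter> B' = {} \<and> j < w \<xi>}"
    for A A' B C B' j
  proof -
    have "A \<inter> A' = {\<xi>\<in>space P. N \<xi> \<inter> {} = {} \<and> w \<xi> \<in> {}}" using that by force
    then show ?thesis by (simp only:) (rule gen1, auto)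
  qed
  fix A A' assume "A \<in> gen k" "A' \<in> gen k"
  show "A \<inter> A' \<in> gen k"
    using \<open>A \<in> gen k\<close>
  proof (cases rule: gen_cases)
    case (1 B C)
    show ?thesis
      using \<open>A' \<in> gen k\<close>
    proof (cases rule: gen_cases)
      case (1 B' C')
      have "A \<inter> A' = {\<xi>\<in>space P. N \<xi> \<inter> (B \<union> B') = {} \<and> w \<xi> \<in> C \<inter> C'}"
        using 1 \<open>A = _\<close> by auto
      then show ?thesis using 1 \<open>B \<in> _\<close> \<open>C \<in> _\<close> by (simp only:) (rule gen1, auto)
    next
      case (2 B' j')
      then show ?thesis using mixed[OF \<open>C \<subseteq> {..k}\<close> 2(2) \<open>A = _\<close> 2(5)] by simp
    qed
  next
    case (2 B j)
    show ?thesis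
      using \<open>A' \<in> gen k\<close>
    proof (cases rule: gen_cases)
      case (1 B' C')
      show ?thesis
        unfolding Int_commute[of A A']
        by (rule mixed[OF 1(3) \<open>k \<le> j\<close> 1(4) \<open>A = _\<close>])
    next
      case (2 B' j')
      have eq: "A \<inter> A' = {\<xi>\<in>space P. N \<xi> \<inter> (B \<union> B') = {} \<and> max j j' < w \<xi>}"
        using 2 \<open>A = _\<close> by auto
      show ?thesis unfolding eq
      proof (rule gen2)
        show "B \<union> B' \<subseteq> {..max j j'}" using 2 \<open>B \<subseteq> _\<close> by force
        show "{k<..max j j'} \<subseteq> B \<union> B'" using 2 \<open>{k<..j} \<subseteq> B\<close> by (auto simp: max_def split: if_splits)
      qed (use 2 \<open>B \<in> sets borel\<close> \<open>k \<le> j\<close> in auto)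
    qed
  qed
qed

definition FF :: "real \<Rightarrow> 'a measure" where
  "FF k = sigma (space P) (gen k)"

lemma sets_FF: "sets (FF k) = sigma_sets (space P) (gen k)" and space_FF [simp]: "space (FF k) = space P"
proof -
  have "gen k \<subseteq> Pow (space P)" using gen_sets sets.sets_into_space by blast
  then show "sets (FF k) = sigma_sets (space P) (gen k)" "space (FF k) = space P"
    by (simp_all add: FF_def)
qed

lemma gen_FF: "A \<in> gen k \<Longrightarrow> A \<in> sets (FF k)"
  by (simp add: sets_FF)

lemma subalgebra_FF: "subalgebra P (FF k)"
  unfolding subalgebra_def sets_FF by (auto intro!: sets.sigma_sets_subset[OF gen_sets, THEN subsetD])

text \<open>An event of the second family whose level \<open>j\<close> is below the new stage
  \<open>k'\<close> is split at \<open>k'\<close>: either the target has been passed meanwhile,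
  which gives an event of the first family, or it lies beyond \<open>k'\<close>, which gives one of
  the second.\<close>

lemma FF_mono:
  assumes "k \<le> k'"
  shows "sets (FF k) \<subseteq> sets (FF k')"
proof -
  have "gen k \<subseteq> sets (FF k')"
  proof
    fix A assume "A \<in> gen k"
    then show "A \<in> sets (FF k')"
    proof (cases rule: gen_cases)
      case (1 B C)
      then show ?thesis using assms by (auto intro!: gen_FF gen1)
    next
      case (2 B j)
      show ?thesis
      proof (cases "k' \<le> j")
        case True
        have "{k'<..j} \<subseteq> B" using 2 assms by force
        then show ?thesis using 2 True by (auto intro!: gen_FF gen2)
      next
        case False
        have "A = {\<xi>\<in>space P. N \<xi> \<inter> B = {} \<and> w \<xi> \<in> {j<..k'}} \<union> {\<xi>\<in>space P. N \<xi> \<inter> B = {} \<and> k' < w \<xi>}"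
          using 2 False by auto
        moreover have "{\<xi>\<in>space P. N \<xi> \<inter> B = {} \<and> w \<xi> \<in> {j<..k'}} \<in> sets (FF k')"
          using 2 by (intro gen_FF gen1) auto
        moreover have "{\<xi>\<in>space P. N \<xi> \<inter> B = {} \<and> k' < w \<xi>} \<in> sets (FF k')"
          using 2 False by (intro gen_FF gen2) force+
        ultimately show ?thesis by auto
      qed
    qed
  qed
  then show ?thesis
    unfolding sets_FF[of k] using sets.sigma_sets_subset[of "gen k" "FF k'"] by simp
qed

text \<open>Before the target is passed, \<open>D k > j\<close> says that for some \<open>n\<close>
  neither a Poisson point nor the target lies in \<open>(k, j + 1 / Suc n]\<close>. These are events
  of the second family; the shrinking margin accounts for the strict inequality.\<close>

lemma M_measurable: "M k \<in> borel_measurable (FF k)"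
proof -
  have ws: "{\<xi>\<in>space (FF k). k < w \<xi>} \<in> sets (FF k)"
    using gen2[of "{}" k k] by (auto intro: gen_FF)
  define d where "d \<xi> = (if k < w \<xi> then D k \<xi> else k - 1)" for \<xi>
  have d: "d \<in> borel_measurable (FF k)"
  proof (rule borel_measurableI_greater)
    fix j
    show "{\<xi>\<in>space (FF k). j < d \<xi>} \<in> sets (FF k)"
    proof (cases "k \<le> j")
      case True
      have iff: "k < w \<xi> \<and> j < D k \<xi> \<longleftrightarrow> (\<exists>n. N \<xi> \<inter> {k<..j + 1 / real (Suc n)} = {} \<and> j + 1 / real (Suc n) < w \<xi>)" for \<xi>
      proof
        assume *: "k < w \<xi> \<and> j < D k \<xi>"
        then obtain n where "inverse (real (Suc n)) < D k \<xi> - j" using reals_Archimedean[of "D k \<xi> - j"] by auto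
        then have n: "j + 1 / real (Suc n) < D k \<xi>" by (simp add: inverse_eq_divide)
        have "N \<xi> \<inter> {k<..j + 1 / real (Suc n)} = {}"
          using n D_le_point[of _ \<xi> k] by (force simp: disjoint_iff)
        moreover have "j + 1 / real (Suc n) < w \<xi>" using n D_le_w[of k \<xi>] by linarith
        ultimately show "\<exists>n. N \<xi> \<inter> {k<..j + 1 / real (Suc n)} = {} \<and> j + 1 / real (Suc n) < w \<xi>" by blast
      next
        assume "\<exists>n. N \<xi> \<inter> {k<..j + 1 / real (Suc n)} = {} \<and> j + 1 / real (Suc n) < w \<xi>"
        then obtain n where n: "N \<xi> \<inter> {k<..j + 1 / real (Suc n)} = {}" "j + 1 / real (Suc n) < w \<xi>" by blast
        have jn: "j < j + 1 / real (Suc n)" by simp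
        have "D k \<xi> = D (j + 1 / real (Suc n)) \<xi>" using n(1) True jn by (intro D_cong) linarith+
        then have "j + 1 / real (Suc n) \<le> D k \<xi>" using D_ge n(2) by simp
        then show "k < w \<xi> \<and> j < D k \<xi>" using n(2) True jn by linarith
      qed
      have "j < d \<xi> \<longleftrightarrow> k < w \<xi> \<and> j < D k \<xi>" for \<xi> using True by (simp add: d_def)
      then have eqS: "{\<xi>\<in>space (FF k). j < d \<xi>} = (\<Union>n. {\<xi>\<in>space P. N \<xi> \<inter> {k<..j + 1 / real (Suc n)} = {} \<and> j + 1 / real (Suc n) < w \<xi>})"
        unfolding space_FF iff by blast
      have inS: "{\<xi>\<in>space P. N \<xi> \<inter> {k<..j + 1 / real (Suc n)} = {} \<and> j + 1 / real (Suc n) < w \<xi>} \<in> sets (FF k)" for n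
      proof -
        have "j < j + 1 / real (Suc n)" by simp
        then have "k \<le> j + 1 / real (Suc n)" using True by linarith
        then show ?thesis by (intro gen_FF gen2) (auto simp del: of_nat_Suc)
      qed
      show ?thesis unfolding eqS by (intro sets.countable_UN image_subsetI inS)
    next
      case False
      have "{\<xi>\<in>space (FF k). j < d \<xi>} = (if j < k - 1 then space (FF k) else {\<xi>\<in>space (FF k). k < w \<xi>})"
      proof -
        have "j < D k \<xi>" if "k < w \<xi>" for \<xi> using D_ge[OF that] False by linarith
        then show ?thesis by (auto simp: d_def)
      qed
      then show ?thesis using ws sets.top[of "FF k"] by simp
    qed
  qed
  define v where "v \<xi> = (if k < w \<xi> then k + 1 else w \<xi>)" for \<xi>
  have v: "v \<in> borel_measurable (FF k)"
  proof (rule borel_measurableI_le)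
    fix c
    have "{\<xi>\<in>space (FF k). v \<xi> \<le> c} = (if k + 1 \<le> c then space (FF k) else {\<xi>\<in>space P. N \<xi> \<inter> {} = {} \<and> w \<xi> \<in> {..min k c}})"
      by (auto simp: v_def)
    moreover have "{\<xi>\<in>space P. N \<xi> \<inter> {} = {} \<and> w \<xi> \<in> {..min k c}} \<in> sets (FF k)"
      by (intro gen_FF gen1) auto
    ultimately show "{\<xi>\<in>space (FF k). v \<xi> \<le> c} \<in> sets (FF k)" using sets.top[of "FF k"] by simp
  qed
  note [measurable] = d v ws
  have "(\<lambda>\<xi>. if k < w \<xi> then gr (d \<xi>) else v \<xi>) \<in> borel_measurable (FF k)"
    by (rule measurable_If) (use ws in \<open>auto simp del: space_FF\<close>)
  then show ?thesis
    by (rule measurable_cong[THEN iffD1, rotated]) (simp add: M_def d_def v_def)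
qed

lemma M_measurable_P [measurable]: "M k \<in> borel_measurable P"
  by (rule measurable_from_subalg[OF subalgebra_FF M_measurable])

lemma integrable_w: "integrable P w"
  using integrable_id unfolding distr_w[symmetric] by (subst (asm) integrable_distr_eq) auto

lemma expectation_w: "(\<integral>\<xi>. w \<xi> \<partial>P) = 0"
proof -
  have "(\<integral>x. x \<partial>distr P borel w) = (\<integral>\<xi>. w \<xi> \<partial>P)" by (rule integral_distr) auto
  then show ?thesis unfolding distr_w mean_zero by (rule sym)
qed

lemma M_split: "\<xi> \<in> space P \<Longrightarrow> M k \<xi> = indicator {\<xi>\<in>space P. N \<xi> \<inter> {} = {} \<and> k < w \<xi>} \<xi> * gr (D k \<xi>) +
    indicator {\<xi>\<in>space P. w \<xi> \<le> k} \<xi> * w \<xi>"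
  by (simp add: M_def indicator_def)

lemma integrable_M: "integrable P (M k)"
proof -
  have "integrable P (\<lambda>\<xi>. indicator {\<xi>\<in>space P. N \<xi> \<inter> {} = {} \<and> k < w \<xi>} \<xi> * gr (D k \<xi>) +
      indicator {\<xi>\<in>space P. w \<xi> \<le> k} \<xi> * w \<xi>)"
    using integral_stage(1)[of "{}" k] integrable_mult_indicator[OF _ integrable_w, of "{\<xi>\<in>space P. w \<xi> \<le> k}"]
    by (intro Bochner_Integration.integrable_add) (simp_all add: set_integrable_def)
  then show ?thesis
    by (subst Bochner_Integration.integrable_cong[OF refl M_split]) auto
qed

text \<open>On the first family the target has been passed and \<open>M k\<close> is
  \<open>w\<close>. On the second no point lies in \<open>(k, j]\<close>, hence \<open>D k\<close>
  is \<open>D j\<close> and \<open>integral_stage\<close> applies at level \<open>j\<close>.\<close>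

lemma M_gen:
  assumes "A \<in> gen k"
  shows "(LINT \<xi>:A|P. w \<xi>) = (LINT \<xi>:A|P. M k \<xi>)"
  using assms
proof (cases rule: gen_cases)
  case (1 B C)
  show ?thesis
    unfolding set_lebesgue_integral_def
    by (intro Bochner_Integration.integral_cong refl) (use 1 in \<open>auto simp: M_def indicator_def\<close>)
next
  case (2 B j)
  have "(LINT \<xi>:A|P. M k \<xi>) = (LINT \<xi>:A|P. gr (D j \<xi>))"
    unfolding set_lebesgue_integral_def
  proof (intro Bochner_Integration.integral_cong refl)
    fix \<xi>
    show "indicator A \<xi> *\<^sub>R M k \<xi> = indicator A \<xi> *\<^sub>R gr (D j \<xi>)"
    proof (cases "\<xi> \<in> A")
      case True
      then have "N \<xi> \<inter> {k<..j} = {}" "k < w \<xi>" using 2 by auto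
      then show ?thesis using D_cong[of \<xi> k j] 2 by (simp add: M_def)
    qed simp
  qed
  also have "\<dots> = (LINT \<xi>:A|P. w \<xi>)"
    unfolding 2(5) using integral_stage[OF 2(1,3)] by simp
  finally show ?thesis by simp
qed

text \<open>The whole space is the disjoint union of one event from each family.\<close>

lemma M_total: "(\<integral>\<xi>. M k \<xi> \<partial>P) = 0"
proof -
  let ?A = "{\<xi>\<in>space P. N \<xi> \<inter> {} = {} \<and> w \<xi> \<in> {..k}}" and ?B = "{\<xi>\<in>space P. N \<xi> \<inter> {} = {} \<and> k < w \<xi>}"
  have AB: "?A \<in> gen k" "?B \<in> gen k" by (rule gen1; simp) (rule gen2; simp)
  have S: "?A \<in> sets P" "?B \<in> sets P" using AB gen_sets by blast+
  have "(\<integral>\<xi>. f \<xi> \<partial>P) = (LINT \<xi>:?A|P. f \<xi>) + (LINT \<xi>:?B|P. f \<xi>)" if f: "integrable P f" for f :: "_ \<Rightarrow> real"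
  proof -
    have "(\<integral>\<xi>. f \<xi> \<partial>P) = (LINT \<xi>:?A \<union> ?B|P. f \<xi>)"
      unfolding set_lebesgue_integral_def by (intro Bochner_Integration.integral_cong) (auto simp: indicator_def)
    also have "\<dots> = (LINT \<xi>:?A|P. f \<xi>) + (LINT \<xi>:?B|P. f \<xi>)"
      using integrable_mult_indicator[OF S(1) f] integrable_mult_indicator[OF S(2) f]
      by (intro set_integral_Un) (auto simp: set_integrable_def)
    finally show ?thesis .
  qed
  from this[OF integrable_M] this[OF integrable_w] show ?thesis
    using M_gen[OF AB(1)] M_gen[OF AB(2)] expectation_w by simp
qed

lemma M_martingale:
  assumes "A \<in> sets (FF k)"
  shows "(LINT \<xi>:A|P. w \<xi>) = (LINT \<xi>:A|P. M k \<xi>)"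
  using assms unfolding sets_FF
  by (intro set_integral_eq_generated[OF Int_stable_gen gen_sets integrable_w integrable_M M_gen])
     (simp_all add: M_total expectation_w)

text \<open>The positive part of \<open>M (- n)\<close> has mean \<open>moment (- n)\<close>, which
  tends to 0 because \<mu> has mean zero. Fatou passes this on to the nonnegative limit.\<close>

lemma M_bot_AE: "AE \<xi> in P. M_bot \<xi> = 0"
proof -
  have lim: "(\<lambda>n. M (- real n) \<xi>) \<longlonglongrightarrow> M_bot \<xi>" for \<xi>
    by (rule filterlim_compose[OF M_tendsto_bot])
       (rule filterlim_compose[OF filterlim_uminus_at_bot_at_top filterlim_real_sequentially])
  have [measurable]: "M_bot \<in> borel_measurable P"
    by (rule borel_measurable_LIMSEQ_real[OF lim]) simp
  have "(\<integral>\<^sup>+\<xi>. ennreal (M_bot \<xi>) \<partial>P) = (\<integral>\<^sup>+\<xi>. liminf (\<lambda>n. ennreal (M (- real n) \<xi>)) \<partial>P)"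
    by (intro nn_integral_cong lim_imp_Liminf[symmetric] tendsto_ennrealI lim) simp
  also have "\<dots> \<le> liminf (\<lambda>n. \<integral>\<^sup>+\<xi>. ennreal (M (- real n) \<xi>) \<partial>P)"
    by (rule nn_integral_liminf) simp
  also have "\<dots> = liminf (\<lambda>n. ennreal (moment (- real n)))"
  proof (intro arg_cong[where f=liminf] ext)
    fix n
    let ?k = "- real n" and ?B = "{\<xi>\<in>space P. N \<xi> \<inter> {} = {} \<and> - real n < w \<xi>}"
    have "(\<integral>\<^sup>+\<xi>. ennreal (M ?k \<xi>) \<partial>P) = (\<integral>\<^sup>+\<xi>. ennreal (indicator ?B \<xi> * gr (D ?k \<xi>)) \<partial>P)"
      by (intro nn_integral_cong) (auto simp: M_def indicator_def ennreal_neg)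
    also have "\<dots> = ennreal (LINT \<xi>:?B|P. gr (D ?k \<xi>))"
      unfolding set_lebesgue_integral_def using integral_stage(1)[of "{}" ?k] gr_nonneg
      by (subst nn_integral_eq_integral) (auto simp: set_integrable_def)
    also have "(LINT \<xi>:?B|P. gr (D ?k \<xi>)) = moment ?k"
      using integral_stage(2)[of "{}" ?k] by simp
    finally show "(\<integral>\<^sup>+\<xi>. ennreal (M ?k \<xi>) \<partial>P) = ennreal (moment ?k)" .
  qed
  also have "\<dots> = 0"
  proof -
    have "filterlim (\<lambda>n. - real n) at_bot sequentially"
      by (rule filterlim_compose[OF filterlim_uminus_at_bot_at_top filterlim_real_sequentially])
    then have "(\<lambda>n. moment (- real n)) \<longlonglongrightarrow> 0" by (rule filterlim_compose[OF moment_at_bot])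
    then have "(\<lambda>n. ennreal (moment (- real n))) \<longlonglongrightarrow> ennreal 0" by (rule tendsto_ennrealI)
    then show ?thesis by (simp add: lim_imp_Liminf)
  qed
  finally have "(\<integral>\<^sup>+\<xi>. ennreal (M_bot \<xi>) \<partial>P) = 0" by simp
  then have "AE \<xi> in P. ennreal (M_bot \<xi>) = 0" by (subst (asm) nn_integral_0_iff_AE) auto
  then show ?thesis
    by eventually_elim (use M_bot_nonneg in \<open>auto simp: ennreal_eq_0_iff antisym\<close>)
qed

end

subsection \<open>Time change\<close>

text \<open>A logistic bijection from \<open>(0, T)\<close> to the line: level - \<infinity> becomes
  time 0 and level \<infinity> becomes time \<open>T\<close>.\<close>

definition clock :: "real \<Rightarrow> real \<Rightarrow> real" where
  "clock T t = ln t - ln (T - t)"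

lemma clock_mono: "0 < s \<Longrightarrow> s < t \<Longrightarrow> t < T \<Longrightarrow> clock T s < clock T t"
  unfolding clock_def by (intro diff_strict_mono) simp_all

lemma clock_surj: "0 < T \<Longrightarrow> \<exists>t\<in>{0<..<T}. clock T t = k"
proof -
  assume T: "0 < T"
  define t where "t = T * exp k / (1 + exp k)"
  have e: "0 < 1 + exp k" by (simp add: add_pos_pos)
  have Tt: "T - t = T / (1 + exp k)" using e by (simp add: t_def field_simps)
  have t: "0 < t" "t < T"
    using T e by (auto simp: t_def divide_less_eq algebra_simps)
  have "clock T t = k"
    unfolding clock_def Tt using T e by (simp add: t_def ln_div ln_mult)
  then show ?thesis using t by auto
qed

lemma clock_cont: "0 < t \<Longrightarrow> t < T \<Longrightarrow> isCont (clock T) t"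
  unfolding clock_def[abs_def] by (intro continuous_intros) auto

lemma clock_at_right:
  assumes "0 < t" "t < T"
  shows "filterlim (clock T) (at_right (clock T t)) (at_right t)"
proof -
  have "eventually (\<lambda>s. t < s \<and> s < T) (at_right t)"
    using assms by (auto simp: eventually_at_right[of t T])
  then have "eventually (\<lambda>s. clock T t < clock T s) (at_right t)"
    by eventually_elim (use assms clock_mono in auto)
  moreover have "(clock T \<longlongrightarrow> clock T t) (at_right t)"
    using clock_cont[OF assms] by (auto simp: isCont_def intro: tendsto_within_subset)
  ultimately show ?thesis by (auto simp: filterlim_at elim: eventually_mono)
qed

lemma clock_at_left:
  assumes "0 < t" "t < T"
  shows "filterlim (clock T) (at_left (clock T t)) (at_left t)"
proof -
  have "eventually (\<lambda>s. 0 < s \<and> s < t) (at_left t)"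
    using assms by (auto simp: eventually_at_left[of 0 t])
  then have "eventually (\<lambda>s. clock T s < clock T t) (at_left t)"
    by eventually_elim (use assms clock_mono in auto)
  moreover have "(clock T \<longlongrightarrow> clock T t) (at_left t)"
    using clock_cont[OF assms] by (auto simp: isCont_def intro: tendsto_within_subset)
  ultimately show ?thesis by (auto simp: filterlim_at elim: eventually_mono)
qed

lemma clock_at_0:
  assumes "0 < T"
  shows "filterlim (clock T) at_bot (at_right 0)"
proof -
  have "((\<lambda>t. ln (T - t)) \<longlongrightarrow> ln (T - 0)) (at_right 0)"
    using assms by (intro tendsto_intros) auto
  moreover have "filterlim (\<lambda>t. - ln t) at_top (at_right (0::real))"
    by (rule filterlim_compose[OF filterlim_uminus_at_top_at_bot ln_at_0])
  ultimately have "filterlim (\<lambda>t. ln (T - t) + - ln t) at_top (at_right 0)"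
    by (rule filterlim_tendsto_add_at_top)
  then have "filterlim (\<lambda>t. - (ln (T - t) + - ln t)) at_bot (at_right 0)"
    by (rule filterlim_compose[OF filterlim_uminus_at_bot_at_top])
  then show ?thesis by (simp add: clock_def[abs_def])
qed

lemma clock_at_T:
  assumes "0 < T"
  shows "filterlim (clock T) at_top (at_left T)"
proof -
  have "((\<lambda>t. T - t) \<longlongrightarrow> T - T) (at_left T)" by (intro tendsto_intros)
  then have "filterlim (\<lambda>t. T - t) (at_right 0) (at_left T)"
    by (auto simp: filterlim_at eventually_at_filter)
  then have "filterlim (\<lambda>t. ln (T - t)) at_bot (at_left T)"
    by (rule filterlim_compose[OF ln_at_0])
  then have "filterlim (\<lambda>t. - ln (T - t)) at_top (at_left T)"
    by (rule filterlim_compose[OF filterlim_uminus_at_top_at_bot])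
  moreover have "((\<lambda>t. ln t) \<longlongrightarrow> ln T) (at_left T)"
    using assms by (intro tendsto_intros) auto
  ultimately have "filterlim (\<lambda>t. ln t + - ln (T - t)) at_top (at_left T)"
    by (intro filterlim_tendsto_add_at_top)
  then show ?thesis by (simp add: clock_def[abs_def])
qed

context poisson_embedding
begin

definition X :: "real \<Rightarrow> real \<Rightarrow> 'a \<Rightarrow> real" where
  "X T t \<xi> = (if t \<le> 0 then M_bot \<xi> else if t < T then M (clock T t) \<xi> else w \<xi>)"

lemma X_cadlag:
  assumes T: "0 < T"
  shows "cadlag_on T (\<lambda>t. X T t \<xi>)"
  unfolding cadlag_on_def
proof (intro conjI ballI)
  fix t assume "t \<in> {0..<T}"
  then consider "t = 0" | "0 < t" "t < T" by fastforce
  then show "((\<lambda>t. X T t \<xi>) \<longlongrightarrow> X T t \<xi>) (at_right t)"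
  proof cases
    case 1
    have "((\<lambda>t. M (clock T t) \<xi>) \<longlongrightarrow> M_bot \<xi>) (at_right 0)"
      by (rule filterlim_compose[OF M_tendsto_bot clock_at_0[OF T]])
    moreover have "eventually (\<lambda>t. 0 < t \<and> t < T) (at_right 0)"
      using T by (auto simp: eventually_at_right[of 0 T])
    then have "eventually (\<lambda>t. M (clock T t) \<xi> = X T t \<xi>) (at_right 0)"
      by eventually_elim (simp add: X_def)
    ultimately have "((\<lambda>t. X T t \<xi>) \<longlongrightarrow> M_bot \<xi>) (at_right 0)"
      by (rule Lim_transform_eventually)
    then show ?thesis using 1 by (simp add: X_def[of T 0])
  next
    case 2
    have "((\<lambda>t. M (clock T t) \<xi>) \<longlongrightarrow> M (clock T t) \<xi>) (at_right t)"
      by (rule filterlim_compose[OF M_right_continuous clock_at_right[OF 2]])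
    moreover have "eventually (\<lambda>s. t < s \<and> s < T) (at_right t)"
      using 2 by (auto simp: eventually_at_right[of t T])
    then have "eventually (\<lambda>t. M (clock T t) \<xi> = X T t \<xi>) (at_right t)"
      by eventually_elim (use 2 in \<open>simp add: X_def\<close>)
    ultimately have "((\<lambda>t. X T t \<xi>) \<longlongrightarrow> M (clock T t) \<xi>) (at_right t)"
      by (rule Lim_transform_eventually)
    then show ?thesis using 2 by (simp add: X_def[of T t])
  qed
next
  fix t assume "t \<in> {0<..T}"
  then consider "t = T" | "0 < t" "t < T" by fastforce
  then show "\<exists>l. ((\<lambda>t. X T t \<xi>) \<longlongrightarrow> l) (at_left t)"
  proof cases
    case 1
    have "eventually (\<lambda>t. w \<xi> < clock T t) (at_left T)"
      using clock_at_T[OF T] by (auto simp: filterlim_at_top_dense)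
    moreover have "eventually (\<lambda>t. 0 < t \<and> t < T) (at_left T)"
      using T by (auto simp: eventually_at_left[of 0 T])
    ultimately have "eventually (\<lambda>t. X T t \<xi> = w \<xi>) (at_left T)"
      by eventually_elim (simp add: X_def M_def)
    then show ?thesis unfolding 1 by (intro exI tendsto_eventually)
  next
    case 2
    obtain l where "((\<lambda>k. M k \<xi>) \<longlongrightarrow> l) (at_left (clock T t))" using M_left_limit by blast
    then have "((\<lambda>t. M (clock T t) \<xi>) \<longlongrightarrow> l) (at_left t)"
      by (rule filterlim_compose[OF _ clock_at_left[OF 2]])
    moreover have "eventually (\<lambda>s. 0 < s \<and> s < t) (at_left t)"
      using 2 by (auto simp: eventually_at_left[of 0 t])
    then have "eventually (\<lambda>t. M (clock T t) \<xi> = X T t \<xi>) (at_left t)"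
      by eventually_elim (use 2 in \<open>simp add: X_def\<close>)
    ultimately show ?thesis by (blast intro: Lim_transform_eventually)
  qed
qed

lemma M_bot_measurable [measurable]: "M_bot \<in> borel_measurable P"
proof (rule borel_measurable_LIMSEQ_real)
  show "(\<lambda>n. M (- real n) \<xi>) \<longlonglongrightarrow> M_bot \<xi>" for \<xi>
    by (rule filterlim_compose[OF M_tendsto_bot])
       (rule filterlim_compose[OF filterlim_uminus_at_bot_at_top filterlim_real_sequentially])
qed simp

lemma X_measurable [measurable]: "X T t \<in> borel_measurable P"
  unfolding X_def[abs_def] by simp

lemma X_admissible:
  assumes T: "0 < T"
  shows "admissible T \<mu> P (X T)"
proof (rule admissibleI)
  show "prob_space P" by (rule P.prob_space_axioms)
  show "0 < T" by fact
  show "cadlag_on T (\<lambda>t. X T t \<xi>)" for \<xi> by (rule X_cadlag[OF T])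
  show "AE \<xi> in P. X T 0 \<xi> = 0" using M_bot_AE by (simp add: X_def)
  have XT: "X T T = w" using T by (simp add: X_def fun_eq_iff)
  show "distr P borel (X T T) = \<mu>" unfolding XT by (rule distr_w)
  have bot: "integrable P M_bot"
    by (rule integrable_cong_AE_imp[of P "\<lambda>_. 0"]) (use M_bot_AE in auto)
  show "integrable P (X T t)" for t
    using bot integrable_w integrable_M by (cases "t \<le> 0"; cases "t < T") (simp_all add: X_def[abs_def])
  \<comment> \<open>At time 0 the trivial sigma-algebra suffices, since \<open>M_bot\<close> is
    almost surely constant.\<close>
  define G where "G t = (if t \<le> 0 then sigma (space P) {} else if t < T then FF (clock T t) else P)" for t
  show sub: "subalgebra P (G t)" for t
    using subalgebra_FF by (auto simp: G_def subalgebra_def sigma_sets_empty_eq)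
  show "sets (G s) \<subseteq> sets (G t)" if "s \<le> t" for s t
  proof -
    consider "s \<le> 0" | "0 < s" "t < T" | "T \<le> t" by linarith
    then show ?thesis
    proof cases
      case 1
      have sp: "space (G t) = space P" using sub[of t] by (simp add: subalgebra_def)
      have "sets (G s) = {{}, space P}" using 1 by (simp add: G_def sigma_sets_empty_eq)
      then show ?thesis using sets.top[of "G t"] sp by auto
    next
      case 2
      then have "clock T s \<le> clock T t" using clock_mono[of s t T] that by (cases "s = t") auto
      then show ?thesis using 2 that FF_mono by (simp add: G_def)
    next
      case 3
      then show ?thesis using sub[of s] T by (auto simp: G_def subalgebra_def)
    qed
  qed
  show "\<exists>X'\<in>borel_measurable (G t). AE \<xi> in P. X T t \<xi> = X' \<xi>" for t
  proof -
    consider "t \<le> 0" | "0 < t" "t < T" | "0 < t" "T \<le> t" by linarith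
    then show ?thesis
    proof cases
      case 1
      then show ?thesis using M_bot_AE by (intro bexI[of _ "\<lambda>_. 0"]) (auto simp: X_def)
    next
      case 2
      then have "M (clock T t) \<in> borel_measurable (G t)" using M_measurable by (simp add: G_def)
      then show ?thesis using 2 by (intro bexI[of _ "M (clock T t)"]) (auto simp: X_def)
    next
      case 3
      then show ?thesis by (intro bexI[of _ w]) (auto simp: X_def G_def)
    qed
  qed
  show "(LINT \<xi>:A|P. X T T \<xi>) = (LINT \<xi>:A|P. X T t \<xi>)" if "A \<in> sets (G t)" for t A
  proof -
    consider "t \<le> 0" | "0 < t" "t < T" | "0 < t" "T \<le> t" by linarith
    then show ?thesis
    proof cases
      case 1
      then have "A = {} \<or> A = space P" using that by (simp add: G_def sigma_sets_empty_eq)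
      moreover have "(LINT \<xi>:space P|P. X T T \<xi>) = (LINT \<xi>:space P|P. X T t \<xi>)"
      proof -
        have "(\<integral>\<xi>. M_bot \<xi> \<partial>P) = (\<integral>\<xi>. 0 \<partial>P)" by (intro integral_cong_AE) (use M_bot_AE in auto)
        then show ?thesis
          unfolding XT using 1 expectation_w
          by (simp add: set_lebesgue_integral_def X_def[abs_def] cong: Bochner_Integration.integral_cong)
      qed
      ultimately show ?thesis by (auto simp: set_lebesgue_integral_def)
    next
      case 2
      then show ?thesis using M_martingale[of A "clock T t"] that by (simp add: XT X_def[abs_def] G_def)
    next
      case 3
      then show ?thesis unfolding XT using T by (simp add: X_def[abs_def])
    qed
  qed
qed

text \<open>No value exceeds \<open>gr (w \<xi>)\<close>, because \<open>D k \<le> w\<close> before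
  the target and \<open>w \<le> gr w\<close> after it. Conversely \<open>M k \<ge> gr k\<close>, and
  \<open>gr k\<close> tends to \<open>gr (w \<xi>)\<close> as k increases to a continuity point
  \<open>w \<xi>\<close>.\<close>

lemma X_running_max:
  assumes T: "0 < T" and c: "isCont gr (w \<xi>)"
  shows "running_max (X T) T \<xi> = gr (w \<xi>)"
proof (rule antisym)
  have M_le: "M k \<xi> \<le> gr (w \<xi>)" for k
    using gr_mono[OF D_le_w] gr_ge_self by (auto simp: M_def)
  have "M_bot \<xi> \<le> gr (w \<xi>)" using M_bot_le[of "w \<xi> - 1" \<xi>] M_le[of "w \<xi> - 1"] by simp
  then have "X T t \<xi> \<le> gr (w \<xi>)" for t using M_le gr_ge_self by (simp add: X_def)
  then show "running_max (X T) T \<xi> \<le> gr (w \<xi>)"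
    unfolding running_max_def using T by (intro cSUP_least) auto
  have "gr k \<le> running_max (X T) T \<xi>" if k: "k < w \<xi>" for k
  proof -
    obtain t where t: "t \<in> {0<..<T}" "clock T t = k" using clock_surj[OF T] by blast
    have "gr k \<le> M k \<xi>" using k D_ge[OF k] by (simp add: M_def gr_mono)
    also have "\<dots> = X T t \<xi>" using t by (simp add: X_def)
    also have "\<dots> \<le> running_max (X T) T \<xi>" using t by (intro running_max_upper X_cadlag T) auto
    finally show ?thesis .
  qed
  then have "eventually (\<lambda>k. gr k \<le> running_max (X T) T \<xi>) (at_left (w \<xi>))"
    by (simp add: eventually_at_filter)
  moreover have "(gr \<longlongrightarrow> gr (w \<xi>)) (at_left (w \<xi>))"
    using c by (auto simp: isCont_def intro: tendsto_within_subset)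
  ultimately show "gr (w \<xi>) \<le> running_max (X T) T \<xi>"
    by (intro tendsto_upperbound) auto
qed

lemma X_joint_law:
  assumes T: "0 < T" and [measurable]: "g \<in> borel_measurable borel"
  shows "joint_law T P (X T) = graph_law \<mu> g"
proof -
  have XT: "X T T = w" using T by (simp add: X_def fun_eq_iff)
  have [measurable]: "running_max (X T) T \<in> borel_measurable P"
    using T by (intro borel_measurable_running_max X_cadlag) auto
  have "AE x in \<mu>. isCont gr x"
  proof -
    have "countable {x. \<not> isCont gr x}"
      by (rule mono_ctble_discont) (auto intro!: monoI gr_mono)
    then have "AE x in \<mu>. \<forall>y\<in>{x. \<not> isCont gr x}. x \<noteq> y"
      by (subst AE_ball_countable) (auto intro: AE_neq)
    then show ?thesis by eventually_elim auto
  qed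
  then have "AE x in \<mu>. isCont gr x \<and> gr x = g x" using AE_gr_eq by eventually_elim simp
  then have "AE \<xi> in P. isCont gr (w \<xi>) \<and> gr (w \<xi>) = g (w \<xi>)"
    unfolding distr_w[symmetric] by (rule AE_distrD[rotated]) simp
  then have "AE \<xi> in P. running_max (X T) T \<xi> = g (w \<xi>)"
    by eventually_elim (use X_running_max[OF T] in auto)
  then have "joint_law T P (X T) = distr P borel (\<lambda>\<xi>. (w \<xi>, g (w \<xi>)))"
    unfolding joint_law_def XT by (intro distr_cong_AE) (auto elim!: eventually_mono)
  also have "\<dots> = distr (distr P borel w) borel (\<lambda>x. (x, g x))"
    by (subst distr_distr) (auto simp: comp_def)
  finally show ?thesis by (simp add: distr_w graph_law_def)
qed

end

lemma (in capped_target) ex_embedding: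
  assumes "0 < T" "g \<in> borel_measurable borel"
  shows "\<exists>(P :: (real \<Rightarrow> real) measure) M. admissible T \<mu> P M \<and> joint_law T P M = graph_law \<mu> g"
proof (rule ex_poisson_random_set[OF real_distribution_axioms borel_measurable_rate])
  fix P :: "(real \<Rightarrow> real) measure" and w N
  assume P: "prob_space P" "w \<in> borel_measurable P"
    "\<And>B. B \<in> sets borel \<Longrightarrow> {\<xi>\<in>space P. N \<xi> \<inter> B = {}} \<in> sets P"
    "\<And>B C. B \<in> sets borel \<Longrightarrow> C \<in> sets borel \<Longrightarrow>
      measure P {\<xi>\<in>space P. N \<xi> \<inter> B = {} \<and> w \<xi> \<in> C} = exp_neg (\<integral>\<^sup>+x\<in>B. rate x \<partial>\<mu>) * measure \<mu> C"
  interpret P: prob_space P by (rule P)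
  interpret poisson_embedding \<mu> g P w N
    by unfold_locales (use P in \<open>auto simp: \<nu>_def\<close>)
  show ?thesis using X_admissible X_joint_law assms by blast
qed

subsection \<open>Brownian motion as a martingale\<close>

locale brownian = prob_space P for P :: "'a measure" +
  fixes W :: "real \<Rightarrow> 'a \<Rightarrow> real"
  assumes bm: "standard_brownian_motion P W"
begin

lemma W_measurable [measurable]: "0 \<le> t \<Longrightarrow> W t \<in> borel_measurable P"
  and W_0: "AE \<xi> in P. W 0 \<xi> = 0"
  and W_continuous: "\<xi> \<in> space P \<Longrightarrow> continuous_on {0..} (\<lambda>t. W t \<xi>)"
  and W_normal: "0 \<le> s \<Longrightarrow> s < t \<Longrightarrow> distributed P lborel (\<lambda>\<xi>. W t \<xi> - W s \<xi>) (normal_density 0 (sqrt (t - s)))"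
  and W_indep: "0 \<le> ts 0 \<Longrightarrow> mono ts \<Longrightarrow> indep_vars (\<lambda>_. borel) (\<lambda>i \<xi>. W (ts (Suc i)) \<xi> - W (ts i) \<xi>) {..<n::nat}"
  using bm unfolding standard_brownian_motion_def by auto

lemma increment_moments:
  assumes "0 \<le> s" "s \<le> t"
  shows "integrable P (\<lambda>\<xi>. W t \<xi> - W s \<xi>)" "(\<integral>\<xi>. W t \<xi> - W s \<xi> \<partial>P) = 0"
    "integrable P (\<lambda>\<xi>. (W t \<xi> - W s \<xi>)\<^sup>2)" "(\<integral>\<xi>. (W t \<xi> - W s \<xi>)\<^sup>2 \<partial>P) = t - s"
proof -
  have "integrable P (\<lambda>\<xi>. W t \<xi> - W s \<xi>) \<and> (\<integral>\<xi>. W t \<xi> - W s \<xi> \<partial>P) = 0 \<and>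
    integrable P (\<lambda>\<xi>. (W t \<xi> - W s \<xi>)\<^sup>2) \<and> (\<integral>\<xi>. (W t \<xi> - W s \<xi>)\<^sup>2 \<partial>P) = t - s"
  proof (cases "s = t")
    case False
    with assms have st: "s < t" by simp
    note d = W_normal[OF assms(1) st]
    have sd: "0 < sqrt (t - s)" using st by simp
    have "integrable lborel (\<lambda>x. normal_density 0 (sqrt (t - s)) x * (x - 0) ^ k)" for k
      by (rule integrable_normal_moment[OF sd])
    then have i: "integrable P (\<lambda>\<xi>. (W t \<xi> - W s \<xi>) ^ k)" for k
      using distributed_integrable[OF d, of "\<lambda>x. x ^ k"] by simp
    have e: "expectation (\<lambda>\<xi>. W t \<xi> - W s \<xi>) = 0" by (rule normal_distributed_expectation[OF sd d])
    have "variance (\<lambda>\<xi>. W t \<xi> - W s \<xi>) = (sqrt (t - s))\<^sup>2" by (rule normal_distributed_variance[OF sd d])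
    then show ?thesis using i[of 1] i[of 2] e st by simp
  qed simp
  then show "integrable P (\<lambda>\<xi>. W t \<xi> - W s \<xi>)" "(\<integral>\<xi>. W t \<xi> - W s \<xi> \<partial>P) = 0"
    "integrable P (\<lambda>\<xi>. (W t \<xi> - W s \<xi>)\<^sup>2)" "(\<integral>\<xi>. (W t \<xi> - W s \<xi>)\<^sup>2 \<partial>P) = t - s"
    by blast+
qed

text \<open>Cylinder events, an intersection-stable generator of the natural filtration
  \<open>FW\<close>.\<close>

definition past :: "real \<Rightarrow> 'a set set" where
  "past u = {{\<xi>\<in>space P. \<forall>r\<in>J. W r \<xi> \<in> B r} |J B. finite J \<and> J \<subseteq> {0..u} \<and> (\<forall>r. B r \<in> sets borel)}"

definition FW :: "real \<Rightarrow> 'a measure" where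
  "FW u = sigma (space P) (past u)"

lemma pastI: "finite J \<Longrightarrow> J \<subseteq> {0..u} \<Longrightarrow> (\<And>r. B r \<in> sets borel) \<Longrightarrow> {\<xi>\<in>space P. \<forall>r\<in>J. W r \<xi> \<in> B r} \<in> past u"
  unfolding past_def by blast

lemma past_sets: "past u \<subseteq> sets P"
proof
  fix A assume "A \<in> past u"
  then obtain J B where J: "finite J" "J \<subseteq> {0..u}" "\<And>r. B r \<in> sets borel"
    and A: "A = {\<xi>\<in>space P. \<forall>r\<in>J. W r \<xi> \<in> B r}"
    unfolding past_def by blast
  have "{\<xi>\<in>space P. W r \<xi> \<in> B r} \<in> sets P" if "r \<in> J" for r
  proof -
    have [measurable]: "W r \<in> borel_measurable P" "B r \<in> sets borel" using that J by (auto intro!: W_measurable)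
    show ?thesis by measurable
  qed
  then show "A \<in> sets P" unfolding A using J(1) by (intro sets.sets_Collect_finite_All) auto
qed

lemma sets_FW: "sets (FW u) = sigma_sets (space P) (past u)" and space_FW [simp]: "space (FW u) = space P"
proof -
  have "past u \<subseteq> Pow (space P)" using past_sets sets.sets_into_space by blast
  then show "sets (FW u) = sigma_sets (space P) (past u)" "space (FW u) = space P"
    by (simp_all add: FW_def)
qed

lemma subalgebra_FW: "subalgebra P (FW u)"
  unfolding subalgebra_def sets_FW by (auto intro!: sets.sigma_sets_subset[OF past_sets, THEN subsetD])

lemma FW_mono: "u \<le> v \<Longrightarrow> sets (FW u) \<subseteq> sets (FW v)"
proof -
  assume "u \<le> v"
  have "past u \<subseteq> past v"
  proof
    fix A assume "A \<in> past u"
    then obtain J B where J: "finite J" "J \<subseteq> {0..u}" "\<And>r. B r \<in> sets borel"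
      and A: "A = {\<xi>\<in>space P. \<forall>r\<in>J. W r \<xi> \<in> B r}"
      unfolding past_def by blast
    have "J \<subseteq> {0..v}" using J(2) \<open>u \<le> v\<close> by force
    with J show "A \<in> past v" unfolding A by (intro pastI)
  qed
  then show ?thesis unfolding sets_FW by (rule sigma_sets_mono')
qed

lemma W_FW: "0 \<le> r \<Longrightarrow> r \<le> u \<Longrightarrow> W r \<in> borel_measurable (FW u)"
proof (rule measurableI)
  fix B :: "real set" assume "0 \<le> r" "r \<le> u" "B \<in> sets borel"
  then have "{\<xi>\<in>space P. \<forall>r\<in>{r}. W r \<xi> \<in> B} \<in> past u" by (intro pastI) auto
  moreover have "W r -` B \<inter> space (FW u) = {\<xi>\<in>space P. \<forall>r\<in>{r}. W r \<xi> \<in> B}" by auto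
  ultimately show "W r -` B \<inter> space (FW u) \<in> sets (FW u)" by (simp add: sets_FW)
qed simp

lemma Int_stable_past: "Int_stable (past u)"
proof (rule Int_stableI)
  fix A A' assume "A \<in> past u" "A' \<in> past u"
  then obtain J B J' B' where J: "finite J" "J \<subseteq> {0..u}" "\<And>r. B r \<in> sets borel"
    and A: "A = {\<xi>\<in>space P. \<forall>r\<in>J. W r \<xi> \<in> B r}"
    and J': "finite J'" "J' \<subseteq> {0..u}" "\<And>r. B' r \<in> sets borel"
    and A': "A' = {\<xi>\<in>space P. \<forall>r\<in>J'. W r \<xi> \<in> B' r}"
    unfolding past_def by blast
  define B'' where "B'' r = (if r \<in> J then B r else UNIV) \<inter> (if r \<in> J' then B' r else UNIV)" for r
  have "A \<inter> A' = {\<xi>\<in>space P. \<forall>r\<in>J \<union> J'. W r \<xi> \<in> B'' r}"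
    unfolding A A' by (auto simp: B''_def split: if_splits)
  moreover have "\<dots> \<in> past u"
    using J J' by (intro pastI) (auto simp: B''_def)
  ultimately show "A \<inter> A' \<in> past u" by simp
qed

text \<open>Almost surely the path starts at 0, so a cylinder event is a function of the increments
  between its sorted times. The increment from \<open>u\<close> to \<open>v\<close> comes after
  these in a list of independent increments.\<close>

lemma increment_past:
  assumes uv: "0 \<le> u" "u \<le> v" and A: "A \<in> past u"
  shows "(LINT \<xi>:A|P. W v \<xi> - W u \<xi>) = 0"
proof -
  obtain J B where J: "finite J" "J \<subseteq> {0..u}" and B[measurable]: "\<And>r. B r \<in> sets borel"
    and A: "A = {\<xi>\<in>space P. \<forall>r\<in>J. W r \<xi> \<in> B r}"
    using A unfolding past_def by blast
  define l where "l = sorted_list_of_set (insert 0 (insert u J))"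
  define n where "n = length l"
  \<comment> \<open>The sorted list ends at \<open>u\<close>, so increment number
    \<open>n - 1\<close> runs from \<open>u\<close> to \<open>v\<close>; all later times stay at
    \<open>v\<close> to keep the sequence monotone.\<close>
  define ts where "ts i = (if i < n then l ! i else v)" for i
  have fin: "finite (insert 0 (insert u J))" using J by simp
  have setl: "set l = insert 0 (insert u J)" unfolding l_def using fin by (rule set_sorted_list_of_set)
  have sl: "sorted l" by (simp add: l_def)
  have l_bounds: "0 \<le> l ! i \<and> l ! i \<le> u" if "i < n" for i
  proof -
    have "l ! i \<in> set l" using that by (simp add: n_def)
    then show ?thesis using setl J uv by auto
  qed
  have n: "0 < n" using setl by (cases l) (auto simp: n_def)
  have l0: "l ! 0 = 0"
  proof -
    obtain i where i: "i < n" "l ! i = 0" using setl by (metis in_set_conv_nth insertI1 n_def)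
    then have "l ! 0 \<le> 0" using sorted_nth_mono[OF sl, of 0 i] by (simp add: n_def)
    then show ?thesis using l_bounds[OF n] by simp
  qed
  have llast: "l ! (n - 1) = u"
  proof -
    obtain i where i: "i < n" "l ! i = u" using setl by (metis in_set_conv_nth insertI1 insertI2 n_def)
    then have "u \<le> l ! (n - 1)" using sorted_nth_mono[OF sl, of i "n - 1"] by (simp add: n_def)
    then show ?thesis using l_bounds[of "n - 1"] n by simp
  qed
  have mono: "mono ts"
  proof (rule monoI)
    fix i j :: nat assume "i \<le> j"
    then show "ts i \<le> ts j"
      using sorted_nth_mono[OF sl, of i j] l_bounds[of i] uv by (auto simp: ts_def n_def)
  qed
  have ts0: "ts 0 = 0" using n l0 by (simp add: ts_def)
  have ts_nonneg: "0 \<le> ts i" for i using monoD[OF mono, of 0 i] ts0 by simp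
  let ?X = "\<lambda>i \<xi>. W (ts (Suc i)) \<xi> - W (ts i) \<xi>"
  have ind: "indep_vars (\<lambda>_. borel) ?X {..<n}" by (rule W_indep) (use mono ts0 in auto)
  have last: "?X (n - 1) = (\<lambda>\<xi>. W v \<xi> - W u \<xi>)"
    using n llast by (simp add: ts_def fun_eq_iff)
  have iv: "indep_var (PiM {..<n-1} (\<lambda>_. borel)) (\<lambda>\<xi>. restrict (\<lambda>i. ?X i \<xi>) {..<n-1})
      (PiM {n-1} (\<lambda>_. borel)) (\<lambda>\<xi>. restrict (\<lambda>i. ?X i \<xi>) {n-1})"
    by (rule indep_var_restrict[OF ind]) (use n in auto)
  define I where "I = {m. m < n \<and> l ! m \<in> J}"
  \<comment> \<open>Partial sums of increments rebuild the path at the sorted times, so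
    \<open>f\<close> becomes the indicator of \<open>A\<close> outside a null set.\<close>
  define f :: "(nat \<Rightarrow> real) \<Rightarrow> real" where
    "f x = (\<Prod>m\<in>I. indicator (B (l ! m)) (\<Sum>i<m. x i))" for x
  have f[measurable]: "f \<in> borel_measurable (PiM {..<n-1} (\<lambda>_. borel))"
    unfolding f_def
  proof (intro borel_measurable_prod)
    fix m assume "m \<in> I"
    then have m: "m < n" by (simp add: I_def)
    have "(\<lambda>x. \<Sum>i<m. x i) \<in> borel_measurable (PiM {..<n-1} (\<lambda>_. borel :: real measure))"
      using m by (intro borel_measurable_sum measurable_component_singleton) auto
    then show "(\<lambda>x. indicator (B (l ! m)) (\<Sum>i<m. x i)) \<in> borel_measurable (PiM {..<n-1} (\<lambda>_. borel))"
      by measurable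
  qed
  have "indep_var borel (f \<circ> (\<lambda>\<xi>. restrict (\<lambda>i. ?X i \<xi>) {..<n-1})) borel ((\<lambda>x. x (n - 1)) \<circ> (\<lambda>\<xi>. restrict (\<lambda>i. ?X i \<xi>) {n-1}))"
    by (rule indep_var_compose[OF iv f]) auto
  then have iv': "indep_var borel (\<lambda>\<xi>. f (\<lambda>i. if i < n - 1 then ?X i \<xi> else undefined)) borel (\<lambda>\<xi>. W v \<xi> - W u \<xi>)"
    unfolding last[symmetric] by (simp add: comp_def restrict_def)
  have f_eq: "f (\<lambda>i. if i < n - 1 then ?X i \<xi> else undefined) = indicator A \<xi>" if w0: "W 0 \<xi> = 0" and \<xi>: "\<xi> \<in> space P" for \<xi>
  proof -
    have sum: "(\<Sum>i<m. if i < n - 1 then ?X i \<xi> else undefined) = W (l ! m) \<xi>" if "m < n" for m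
    proof -
      have "(\<Sum>i<m. if i < n - 1 then ?X i \<xi> else undefined) = (\<Sum>i<m. W (ts (Suc i)) \<xi> - W (ts i) \<xi>)"
        using that by (intro sum.cong) auto
      also have "\<dots> = W (ts m) \<xi> - W (ts 0) \<xi>" by (rule sum_lessThan_telescope)
      finally show ?thesis using that w0 ts0 by (simp add: ts_def)
    qed
    have "f (\<lambda>i. if i < n - 1 then ?X i \<xi> else undefined) = (\<Prod>m\<in>I. indicator (B (l ! m)) (W (l ! m) \<xi>))"
      unfolding f_def
      by (intro prod.cong refl arg_cong2[where f=indicator] sum) (simp add: I_def)
    also have "\<dots> = (if \<forall>m\<in>I. W (l ! m) \<xi> \<in> B (l ! m) then 1 else 0)"
    proof -
      have finI: "finite I" by (simp add: I_def)
      show ?thesis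
        using finI by (auto simp: indicator_def prod_zero_iff)
    qed
    also have "(\<forall>m\<in>I. W (l ! m) \<xi> \<in> B (l ! m)) \<longleftrightarrow> (\<forall>r\<in>J. W r \<xi> \<in> B r)"
    proof safe
      fix r assume *: "\<forall>m\<in>I. W (l ! m) \<xi> \<in> B (l ! m)" and r: "r \<in> J"
      then have "r \<in> set l" using setl by simp
      then obtain m where "m < n" "l ! m = r" by (auto simp: in_set_conv_nth n_def)
      then show "W r \<xi> \<in> B r" using * r by (auto simp: I_def)
    qed (auto simp: I_def)
    also have "(if \<forall>r\<in>J. W r \<xi> \<in> B r then 1 else 0) = (indicator A \<xi> :: real)"
      using \<xi> unfolding A indicator_def by simp
    finally show ?thesis .
  qed
  have A_sets[measurable]: "A \<in> sets P"
  proof -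
    have "A \<in> past u" unfolding A by (rule pastI) (use J B in auto)
    then show ?thesis using past_sets by (rule subsetD[rotated])
  qed
  have fm: "(\<lambda>\<xi>. f (\<lambda>i. if i < n - 1 then ?X i \<xi> else undefined)) \<in> borel_measurable P"
    using iv' by (rule indep_var_rv1)
  have "(LINT \<xi>:A|P. W v \<xi> - W u \<xi>) = (\<integral>\<xi>. f (\<lambda>i. if i < n - 1 then ?X i \<xi> else undefined) * (W v \<xi> - W u \<xi>) \<partial>P)"
    unfolding set_lebesgue_integral_def
  proof (rule integral_cong_AE)
    show "AE \<xi> in P. indicator A \<xi> *\<^sub>R (W v \<xi> - W u \<xi>) = f (\<lambda>i. if i < n - 1 then ?X i \<xi> else undefined) * (W v \<xi> - W u \<xi>)"
      using W_0 AE_space by eventually_elim (simp only: f_eq real_scaleR_def)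
    show "(\<lambda>\<xi>. indicator A \<xi> *\<^sub>R (W v \<xi> - W u \<xi>)) \<in> borel_measurable P"
      using uv by (intro borel_measurable_scaleR borel_measurable_indicator A_sets borel_measurable_diff W_measurable) auto
    show "(\<lambda>\<xi>. f (\<lambda>i. if i < n - 1 then ?X i \<xi> else undefined) * (W v \<xi> - W u \<xi>)) \<in> borel_measurable P"
      using uv by (intro borel_measurable_times fm borel_measurable_diff W_measurable) auto
  qed
  also have "\<dots> = (\<integral>\<xi>. f (\<lambda>i. if i < n - 1 then ?X i \<xi> else undefined) \<partial>P) * (\<integral>\<xi>. W v \<xi> - W u \<xi> \<partial>P)"
  proof (rule indep_var_lebesgue_integral[OF iv'])
    show "integrable P (\<lambda>\<xi>. f (\<lambda>i. if i < n - 1 then ?X i \<xi> else undefined))"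
    proof (rule integrable_const_bound[where B=1])
      show "AE \<xi> in P. norm (f (\<lambda>i. if i < n - 1 then ?X i \<xi> else undefined)) \<le> 1"
        using W_0 AE_space by eventually_elim (simp only: f_eq, simp)
    qed (rule fm)
    show "integrable P (\<lambda>\<xi>. W v \<xi> - W u \<xi>)" by (rule increment_moments[OF uv])
  qed
  also have "\<dots> = 0" using increment_moments(2)[OF uv] by simp
  finally show ?thesis .
qed

lemma increment_FW:
  assumes uv: "0 \<le> u" "u \<le> v" and A: "A \<in> sets (FW u)"
  shows "(LINT \<xi>:A|P. W v \<xi> - W u \<xi>) = 0"
proof -
  have "(LINT \<xi>:A|P. W v \<xi> - W u \<xi>) = (LINT \<xi>:A|P. 0)"
  proof (rule set_integral_eq_generated[OF Int_stable_past past_sets increment_moments(1)[OF uv]])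
    fix B assume "B \<in> past u"
    then have "(LINT \<xi>:B|P. W v \<xi> - W u \<xi>) = 0" by (rule increment_past[OF uv])
    then show "(LINT \<xi>:B|P. W v \<xi> - W u \<xi>) = (LINT \<xi>:B|P. 0)" by (simp add: set_lebesgue_integral_def)
  qed (use A increment_moments(2)[OF uv] in \<open>simp_all add: sets_FW\<close>)
  then show ?thesis by (simp add: set_lebesgue_integral_def)
qed

lemma increment_orthogonal:
  assumes uv: "0 \<le> u" "u \<le> v" and Z: "Z \<in> borel_measurable (FW u)" and Z2: "integrable P (\<lambda>\<xi>. (Z \<xi>)\<^sup>2)"
  shows "integrable P (\<lambda>\<xi>. Z \<xi> * (W v \<xi> - W u \<xi>))" "(\<integral>\<xi>. Z \<xi> * (W v \<xi> - W u \<xi>) \<partial>P) = 0"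
proof -
  have [measurable]: "Z \<in> borel_measurable P" by (rule measurable_from_subalg[OF subalgebra_FW Z])
  have [measurable]: "W u \<in> borel_measurable P" "W v \<in> borel_measurable P" using uv by auto
  interpret S: sigma_finite_subalgebra P "FW u"
    by (intro finite_measure_subalgebra_is_sigma_finite)
       (simp add: finite_measure_subalgebra_def finite_measure_subalgebra_axioms_def subalgebra_FW finite_measure_axioms)
  show int: "integrable P (\<lambda>\<xi>. Z \<xi> * (W v \<xi> - W u \<xi>))"
  proof (rule Bochner_Integration.integrable_bound)
    show "integrable P (\<lambda>\<xi>. (Z \<xi>)\<^sup>2 + (W v \<xi> - W u \<xi>)\<^sup>2)"
      by (intro Bochner_Integration.integrable_add Z2 increment_moments uv)
    have "\<bar>a * b\<bar> \<le> a\<^sup>2 + b\<^sup>2" for a b :: real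
    proof -
      have "2 * (\<bar>a\<bar> * \<bar>b\<bar>) \<le> a\<^sup>2 + b\<^sup>2" using sum_squares_bound[of "\<bar>a\<bar>" "\<bar>b\<bar>"] by (simp add: mult.assoc)
      moreover have "0 \<le> \<bar>a\<bar> * \<bar>b\<bar>" by simp
      ultimately show ?thesis unfolding abs_mult by linarith
    qed
    then show "AE \<xi> in P. norm (Z \<xi> * (W v \<xi> - W u \<xi>)) \<le> norm ((Z \<xi>)\<^sup>2 + (W v \<xi> - W u \<xi>)\<^sup>2)"
      by (intro AE_I2) simp
  qed measurable
  have "AE \<xi> in P. real_cond_exp P (FW u) (\<lambda>\<xi>. W v \<xi> - W u \<xi>) \<xi> = 0"
    by (rule S.real_cond_exp_charact) (use increment_FW[OF uv] increment_moments[OF uv] in \<open>auto simp: set_lebesgue_integral_def\<close>)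
  then have "(\<integral>\<xi>. Z \<xi> * real_cond_exp P (FW u) (\<lambda>\<xi>. W v \<xi> - W u \<xi>) \<xi> \<partial>P) = (\<integral>\<xi>. 0 \<partial>P)"
    by (intro integral_cong_AE) auto
  then show "(\<integral>\<xi>. Z \<xi> * (W v \<xi> - W u \<xi>) \<partial>P) = 0"
    using S.real_cond_exp_intg(2)[OF int Z] by simp
qed

subsection \<open>Optional stopping\<close>

definition stopping :: "('a \<Rightarrow> ereal) \<Rightarrow> bool" where
  "stopping \<rho> \<longleftrightarrow> (\<forall>\<xi>. 0 \<le> \<rho> \<xi>) \<and> (\<forall>t\<ge>0. {\<xi>\<in>space P. \<rho> \<xi> \<le> ereal t} \<in> sets (FW t))"

definition clip :: "('a \<Rightarrow> ereal) \<Rightarrow> real \<Rightarrow> 'a \<Rightarrow> real" where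
  "clip \<rho> u \<xi> = real_of_ereal (min (\<rho> \<xi>) (ereal u))"

definition stopped :: "('a \<Rightarrow> ereal) \<Rightarrow> real \<Rightarrow> 'a \<Rightarrow> real" where
  "stopped \<rho> u \<xi> = W (clip \<rho> u \<xi>) \<xi>"

lemma ereal_clip: "stopping \<rho> \<Longrightarrow> 0 \<le> u \<Longrightarrow> ereal (clip \<rho> u \<xi>) = min (\<rho> \<xi>) (ereal u)"
proof -
  assume "stopping \<rho>" "0 \<le> u"
  then have "\<bar>min (\<rho> \<xi>) (ereal u)\<bar> \<noteq> \<infinity>"
    by (cases "\<rho> \<xi>") (auto simp: stopping_def min_def dest: spec[of _ \<xi>])
  then show ?thesis by (simp add: clip_def ereal_real')
qed

lemma clip_bounds:
  assumes "stopping \<rho>" "0 \<le> u"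
  shows "0 \<le> clip \<rho> u \<xi>" "clip \<rho> u \<xi> \<le> u"
proof -
  have "0 \<le> ereal (clip \<rho> u \<xi>)" "ereal (clip \<rho> u \<xi>) \<le> ereal u"
    unfolding ereal_clip[OF assms] using assms by (auto simp: stopping_def)
  then show "0 \<le> clip \<rho> u \<xi>" "clip \<rho> u \<xi> \<le> u" by auto
qed

lemma less_clip_iff: "stopping \<rho> \<Longrightarrow> 0 \<le> u \<Longrightarrow> s < clip \<rho> u \<xi> \<longleftrightarrow> ereal s < \<rho> \<xi> \<and> s < u"
  using ereal_clip[of \<rho> u \<xi>] by (metis less_ereal.simps(1) min_less_iff_conj)

lemma clip_eq_if_le: "stopping \<rho> \<Longrightarrow> \<rho> \<xi> \<le> ereal t \<Longrightarrow> t \<le> u \<Longrightarrow> 0 \<le> t \<Longrightarrow> clip \<rho> u \<xi> = clip \<rho> t \<xi>"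
  by (simp add: clip_def min_def) (meson ereal_less_eq(3) order_trans)

lemma clip_eq_if_ge: "ereal u \<le> \<rho> \<xi> \<Longrightarrow> clip \<rho> u \<xi> = u"
  by (simp add: clip_def min_absorb2)

lemma stopping_greater: "stopping \<rho> \<Longrightarrow> 0 \<le> t \<Longrightarrow> {\<xi>\<in>space P. ereal t < \<rho> \<xi>} \<in> sets (FW t)"
proof -
  assume "stopping \<rho>" "0 \<le> t"
  then have "{\<xi>\<in>space P. \<rho> \<xi> \<le> ereal t} \<in> sets (FW t)" by (simp add: stopping_def)
  then have "space (FW t) - {\<xi>\<in>space P. \<rho> \<xi> \<le> ereal t} \<in> sets (FW t)" by (rule sets.compl_sets)
  moreover have "space (FW t) - {\<xi>\<in>space P. \<rho> \<xi> \<le> ereal t} = {\<xi>\<in>space P. ereal t < \<rho> \<xi>}" by auto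
  ultimately show ?thesis by simp
qed

text \<open>A discrete stochastic integral from \<open>t\<close> to \<open>v\<close> that collects
  increments as long as the stopping time is not reached. With \<open>m = n\<close> it ends at the
  first grid point at or after the stopping time (clamped between \<open>t\<close> and
  \<open>v\<close>), hence at most one mesh width too late.\<close>

definition steps :: "('a \<Rightarrow> ereal) \<Rightarrow> real \<Rightarrow> real \<Rightarrow> nat \<Rightarrow> nat \<Rightarrow> 'a \<Rightarrow> real" where
  "steps \<rho> t v n m \<xi> = W t \<xi> + (\<Sum>i<m. indicator {\<xi>\<in>space P. ereal (t + (v - t) * (real i / real n)) < \<rho> \<xi>} \<xi> *
     (W (t + (v - t) * (real (Suc i) / real n)) \<xi> - W (t + (v - t) * (real i / real n)) \<xi>))"

context
  fixes \<rho> :: "'a \<Rightarrow> ereal" and t v :: real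
  assumes \<rho>: "stopping \<rho>" and t: "0 \<le> t" and tv: "t < v"
begin

private abbreviation "g n i \<equiv> t + (v - t) * (real i / real n)"

lemma g_bounds: "0 \<le> g n i" "t \<le> g n i" "i \<le> j \<Longrightarrow> g n i \<le> g n j" "0 < n \<Longrightarrow> m \<le> n \<Longrightarrow> g n m \<le> v"
proof -
  show "t \<le> g n i" using tv by simp
  then show "0 \<le> g n i" using t by simp
  show "g n i \<le> g n j" if "i \<le> j"
    using that tv by (intro add_left_mono mult_left_mono divide_right_mono) auto
  show "g n m \<le> v" if "0 < n" "m \<le> n"
  proof -
    have "(v - t) * (real m / real n) \<le> (v - t) * 1" using that tv by (intro mult_left_mono) (auto simp: divide_le_eq)
    then show ?thesis by simp
  qed
qed

lemma steps_measurable: "steps \<rho> t v n m \<in> borel_measurable (FW (g n m))"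
  unfolding steps_def[abs_def]
proof (intro borel_measurable_add borel_measurable_sum borel_measurable_times borel_measurable_diff)
  show "W t \<in> borel_measurable (FW (g n m))" using g_bounds(1,2)[where n=n and i=m] t by (intro W_FW)
  fix i assume "i \<in> {..<m}"
  then have i: "i \<le> m" "Suc i \<le> m" by auto
  show "W (g n (Suc i)) \<in> borel_measurable (FW (g n m))" "W (g n i) \<in> borel_measurable (FW (g n m))"
    using i by (intro W_FW g_bounds; simp)+
  have "{\<xi>\<in>space P. ereal (g n i) < \<rho> \<xi>} \<in> sets (FW (g n m))"
    using stopping_greater[OF \<rho> g_bounds(1)] FW_mono[OF g_bounds(3)[OF i(1)]] by blast
  then show "indicator {\<xi>\<in>space P. ereal (g n i) < \<rho> \<xi>} \<in> borel_measurable (FW (g n m))"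
    by simp
qed

lemma W_square: "0 \<le> u \<Longrightarrow> integrable P (\<lambda>\<xi>. (W u \<xi>)\<^sup>2) \<and> (\<integral>\<xi>. (W u \<xi>)\<^sup>2 \<partial>P) = u"
proof -
  assume u: "0 \<le> u"
  have ae: "AE \<xi> in P. (W u \<xi> - W 0 \<xi>)\<^sup>2 = (W u \<xi>)\<^sup>2" using W_0 by eventually_elim simp
  have [measurable]: "W u \<in> borel_measurable P" "W 0 \<in> borel_measurable P" using u by auto
  have "integrable P (\<lambda>\<xi>. (W u \<xi> - W 0 \<xi>)\<^sup>2)" by (rule increment_moments) (use u in auto)
  then have "integrable P (\<lambda>\<xi>. (W u \<xi>)\<^sup>2)"
    by (rule integrable_cong_AE_imp) (use ae in auto)
  moreover have "(\<integral>\<xi>. (W u \<xi>)\<^sup>2 \<partial>P) = (\<integral>\<xi>. (W u \<xi> - W 0 \<xi>)\<^sup>2 \<partial>P)"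
    by (intro integral_cong_AE) (use ae in \<open>auto elim: eventually_mono\<close>)
  ultimately show ?thesis using increment_moments(4)[of 0 u] u by simp
qed

text \<open>Orthogonality of increments: mixed terms vanish, and each step adds at most its length
  to the second moment.\<close>

lemma steps_square:
  assumes "0 < n"
  shows "integrable P (\<lambda>\<xi>. (steps \<rho> t v n m \<xi>)\<^sup>2) \<and> (\<integral>\<xi>. (steps \<rho> t v n m \<xi>)\<^sup>2 \<partial>P) \<le> g n m"
proof (induction m)
  case 0
  then show ?case using W_square[OF t] by (simp add: steps_def)
next
  case (Suc m)
  let ?Y = "steps \<rho> t v n m" and ?D = "\<lambda>\<xi>. W (g n (Suc m)) \<xi> - W (g n m) \<xi>"
  let ?I = "indicator {\<xi>\<in>space P. ereal (g n m) < \<rho> \<xi>} :: _ \<Rightarrow> real"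
  have gm: "0 \<le> g n m" "g n m \<le> g n (Suc m)" by (rule g_bounds(1), rule g_bounds(3)) simp
  have Iset: "{\<xi>\<in>space P. ereal (g n m) < \<rho> \<xi>} \<in> sets (FW (g n m))" by (rule stopping_greater[OF \<rho> gm(1)])
  then have [measurable]: "{\<xi>\<in>space P. ereal (g n m) < \<rho> \<xi>} \<in> sets P"
    using subalgebra_FW by (auto simp: subalgebra_def)
  have [measurable]: "?Y \<in> borel_measurable P" by (rule measurable_from_subalg[OF subalgebra_FW steps_measurable])
  have Z: "(\<lambda>\<xi>. ?Y \<xi> * ?I \<xi>) \<in> borel_measurable (FW (g n m))"
    using steps_measurable Iset by (intro borel_measurable_times borel_measurable_indicator)
  have Z2: "integrable P (\<lambda>\<xi>. (?Y \<xi> * ?I \<xi>)\<^sup>2)"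
  proof (rule Bochner_Integration.integrable_bound)
    show "integrable P (\<lambda>\<xi>. (?Y \<xi>)\<^sup>2)" using Suc by blast
    show "(\<lambda>\<xi>. (?Y \<xi> * ?I \<xi>)\<^sup>2) \<in> borel_measurable P" by measurable
    show "AE \<xi> in P. norm ((?Y \<xi> * ?I \<xi>)\<^sup>2) \<le> norm ((?Y \<xi>)\<^sup>2)"
      by (intro AE_I2) (simp add: indicator_def)
  qed
  note orth = increment_orthogonal[OF gm Z Z2]
  note mom = increment_moments[OF gm]
  have D2: "integrable P (\<lambda>\<xi>. ?I \<xi> * (?D \<xi>)\<^sup>2)"
    by (rule integrable_mult_indicator[OF _ mom(3), unfolded real_scaleR_def]) measurable
  have D2_le: "(\<integral>\<xi>. ?I \<xi> * (?D \<xi>)\<^sup>2 \<partial>P) \<le> g n (Suc m) - g n m"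
    unfolding mom(4)[symmetric] by (intro integral_mono D2 mom(3)) (auto simp: indicator_def)
  have eq: "(steps \<rho> t v n (Suc m) \<xi>)\<^sup>2 = (?Y \<xi>)\<^sup>2 + 2 * (?Y \<xi> * ?I \<xi> * ?D \<xi>) + ?I \<xi> * (?D \<xi>)\<^sup>2" for \<xi>
  proof -
    have s: "steps \<rho> t v n (Suc m) \<xi> = ?Y \<xi> + ?I \<xi> * ?D \<xi>" by (simp add: steps_def)
    have "?I \<xi> * ?I \<xi> = ?I \<xi>" by (simp add: indicator_def)
    moreover have "(y + i * d)\<^sup>2 = y\<^sup>2 + 2 * (y * i * d) + i * d\<^sup>2" if "i * i = i" for y i d :: real
    proof -
      have "(y + i * d)\<^sup>2 = y\<^sup>2 + 2 * (y * i * d) + (i * i) * d\<^sup>2" by (simp add: power2_eq_square algebra_simps)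
      then show ?thesis using that by simp
    qed
    ultimately show ?thesis unfolding s by blast
  qed
  have int: "integrable P (\<lambda>\<xi>. (?Y \<xi>)\<^sup>2 + 2 * (?Y \<xi> * ?I \<xi> * ?D \<xi>) + ?I \<xi> * (?D \<xi>)\<^sup>2)"
    using Suc orth D2 by (intro Bochner_Integration.integrable_add integrable_mult_right) auto
  have "(\<integral>\<xi>. (?Y \<xi>)\<^sup>2 + 2 * (?Y \<xi> * ?I \<xi> * ?D \<xi>) + ?I \<xi> * (?D \<xi>)\<^sup>2 \<partial>P) =
      (\<integral>\<xi>. (?Y \<xi>)\<^sup>2 \<partial>P) + 2 * (\<integral>\<xi>. ?Y \<xi> * ?I \<xi> * ?D \<xi> \<partial>P) + (\<integral>\<xi>. ?I \<xi> * (?D \<xi>)\<^sup>2 \<partial>P)"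
    using Suc orth D2 by (subst Bochner_Integration.integral_add, simp, simp, subst Bochner_Integration.integral_add) auto
  also have "\<dots> \<le> g n m + 2 * 0 + (g n (Suc m) - g n m)"
    using Suc orth(2) D2_le by linarith
  finally show ?case unfolding eq using int by simp
qed

text \<open>Each increment is multiplied by an event known at its beginning and therefore has mean
  zero.\<close>

lemma steps_mean:
  assumes A: "A \<in> sets (FW t)"
  shows "(\<integral>\<xi>. indicator A \<xi> * steps \<rho> t v n m \<xi> \<partial>P) = (\<integral>\<xi>. indicator A \<xi> * W t \<xi> \<partial>P)"
proof -
  have AP[measurable]: "A \<in> sets P" using A subalgebra_FW by (auto simp: subalgebra_def)
  let ?I = "\<lambda>i. indicator {\<xi>\<in>space P. ereal (g n i) < \<rho> \<xi>} :: _ \<Rightarrow> real"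
  let ?D = "\<lambda>i \<xi>. W (g n (Suc i)) \<xi> - W (g n i) \<xi>"
  have AI: "A \<inter> {\<xi>\<in>space P. ereal (g n i) < \<rho> \<xi>} \<in> sets (FW (g n i))" for i
    using A FW_mono[OF g_bounds(2)] stopping_greater[OF \<rho> g_bounds(1)] by (intro sets.Int) blast+
  have AIP: "A \<inter> {\<xi>\<in>space P. ereal (g n i) < \<rho> \<xi>} \<in> sets P" for i
    using AI subalgebra_FW by (auto simp: subalgebra_def)
  have mul: "indicator A \<xi> * (?I i \<xi> * ?D i \<xi>) = indicator (A \<inter> {\<xi>\<in>space P. ereal (g n i) < \<rho> \<xi>}) \<xi> *\<^sub>R ?D i \<xi>" for i \<xi>
    by (simp add: indicator_inter_arith)
  have int: "integrable P (\<lambda>\<xi>. indicator A \<xi> * (?I i \<xi> * ?D i \<xi>))" for i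
    unfolding mul by (intro integrable_mult_indicator AIP increment_moments g_bounds) simp
  have zero: "(\<integral>\<xi>. indicator A \<xi> * (?I i \<xi> * ?D i \<xi>) \<partial>P) = 0" for i
    unfolding mul using increment_FW[OF g_bounds(1) g_bounds(3)[of i "Suc i"] AI] by (simp add: set_lebesgue_integral_def del: of_nat_Suc)
  have intW: "integrable P (\<lambda>\<xi>. indicator A \<xi> * W t \<xi>)"
  proof -
    have "integrable P (\<lambda>\<xi>. W t \<xi> - W 0 \<xi>)" using t by (intro increment_moments) auto
    then have "integrable P (W t)"
      by (rule integrable_cong_AE_imp) (use W_0 t in \<open>auto elim: eventually_mono\<close>)
    from integrable_mult_indicator[OF AP this] show ?thesis by simp
  qed
  have "(\<integral>\<xi>. indicator A \<xi> * steps \<rho> t v n m \<xi> \<partial>P) =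
      (\<integral>\<xi>. indicator A \<xi> * W t \<xi> + (\<Sum>i<m. indicator A \<xi> * (?I i \<xi> * ?D i \<xi>)) \<partial>P)"
    by (simp only: steps_def distrib_left sum_distrib_left)
  also have "\<dots> = (\<integral>\<xi>. indicator A \<xi> * W t \<xi> \<partial>P) + (\<Sum>i<m. \<integral>\<xi>. indicator A \<xi> * (?I i \<xi> * ?D i \<xi>) \<partial>P)"
    unfolding Bochner_Integration.integral_add[OF intW Bochner_Integration.integrable_sum[OF int]] Bochner_Integration.integral_sum[OF int] by (rule refl)
  finally show ?thesis unfolding zero by simp
qed

lemma steps_eq:
  assumes \<xi>: "\<xi> \<in> space P" and n: "0 < n"
  defines "r \<equiv> max t (clip \<rho> v \<xi>)"
  obtains s where "steps \<rho> t v n n \<xi> = W s \<xi>" "r \<le> s" "s \<le> r + (v - t) / real n" "s \<le> v"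
proof -
  have v: "0 \<le> v" using t tv by simp
  \<comment> \<open>The position of \<open>r\<close> in grid units; its ceiling is the index of the
    first grid point at or beyond \<open>r\<close>.\<close>
  define x where "x = (r - t) / (v - t) * real n"
  have rv: "t \<le> r" "r \<le> v" using tv clip_bounds[OF \<rho> v] by (auto simp: r_def)
  have x0: "0 \<le> x" using rv tv by (simp add: x_def)
  have iff: "ereal (g n i) < \<rho> \<xi> \<longleftrightarrow> real i < x" if "i < n" for i
  proof -
    have gv: "g n i < v"
    proof -
      have "(v - t) * (real i / real n) < (v - t) * 1" using that tv by (intro mult_strict_left_mono) (auto simp: divide_less_eq)
      then show ?thesis by simp
    qed
    have "ereal (g n i) < \<rho> \<xi> \<longleftrightarrow> g n i < r"
    proof (cases "t < clip \<rho> v \<xi>")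
      case True
      then show ?thesis using less_clip_iff[OF \<rho> v, of "g n i"] gv by (simp add: r_def max_def)
    next
      case False
      then have "\<not> ereal t < \<rho> \<xi>" using less_clip_iff[OF \<rho> v, of t] tv by auto
      moreover have "ereal t \<le> ereal (g n i)" using g_bounds(2)[where n=n and i=i] by simp
      ultimately have "\<not> ereal (g n i) < \<rho> \<xi>" by (meson not_le order_trans)
      moreover have "\<not> g n i < r" using False g_bounds(2)[where n=n and i=i] by (simp add: r_def)
      ultimately show ?thesis by simp
    qed
    also have "\<dots> \<longleftrightarrow> real i < x" using tv n by (simp add: x_def field_simps)
    finally show ?thesis .
  qed
  have ind: "indicator {\<xi>\<in>space P. ereal (g n i) < \<rho> \<xi>} \<xi> * d = (if real i < x then d else 0)" if "i < n" for i and d :: real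
    unfolding iff[OF that, symmetric] using \<xi> by (simp add: indicator_def)
  have "steps \<rho> t v n n \<xi> = W (g n 0) \<xi> + (\<Sum>i<n. if real i < x then W (g n (Suc i)) \<xi> - W (g n i) \<xi> else 0)"
    unfolding steps_def
  proof (intro arg_cong2[where f="(+)"] sum.cong refl)
    show "W t \<xi> = W (g n 0) \<xi>" by simp
  qed (rule ind, simp)
  also have "\<dots> = W (g n (min n (nat \<lceil>x\<rceil>))) \<xi>"
    using sum_levels[OF x0, of "\<lambda>i. W (g n i) \<xi>"] by simp
  finally have "steps \<rho> t v n n \<xi> = W (g n (min n (nat \<lceil>x\<rceil>))) \<xi>" .
  moreover
  have "x \<le> 1 * real n" unfolding x_def using rv tv by (intro mult_right_mono) auto
  then have xn: "x \<le> real n" by simp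
  then have "nat \<lceil>x\<rceil> \<le> n" by (simp add: ceiling_le_iff)
  then have m: "min n (nat \<lceil>x\<rceil>) = nat \<lceil>x\<rceil>" by simp
  have gx: "t + (v - t) * (x / real n) = r" using tv n by (simp add: x_def)
  have c: "x \<le> real (nat \<lceil>x\<rceil>)" "real (nat \<lceil>x\<rceil>) \<le> x + 1" using x0 by linarith+
  have "r \<le> g n (nat \<lceil>x\<rceil>)"
    unfolding gx[symmetric] using c tv by (intro add_left_mono mult_left_mono divide_right_mono) auto
  moreover have "g n (nat \<lceil>x\<rceil>) \<le> t + (v - t) * ((x + 1) / real n)"
    using c tv by (intro add_left_mono mult_left_mono divide_right_mono) auto
  moreover have "t + (v - t) * ((x + 1) / real n) = r + (v - t) / real n"
    unfolding gx[symmetric] by (simp add: add_divide_distrib distrib_left)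
  moreover have "g n (nat \<lceil>x\<rceil>) \<le> v" using \<open>nat \<lceil>x\<rceil> \<le> n\<close> n g_bounds(4) by blast
  ultimately show ?thesis using that[of "g n (nat \<lceil>x\<rceil>)"] m by simp
qed

lemma steps_tendsto:
  assumes \<xi>: "\<xi> \<in> space P"
  shows "(\<lambda>n. steps \<rho> t v (Suc n) (Suc n) \<xi>) \<longlonglongrightarrow> W (max t (clip \<rho> v \<xi>)) \<xi>"
proof -
  let ?r = "max t (clip \<rho> v \<xi>)"
  have "\<forall>n. \<exists>s. steps \<rho> t v (Suc n) (Suc n) \<xi> = W s \<xi> \<and> ?r \<le> s \<and> s \<le> ?r + (v - t) / real (Suc n) \<and> s \<le> v"
    using steps_eq[OF \<xi>] by (metis zero_less_Suc)
  then obtain s where s: "\<And>n. steps \<rho> t v (Suc n) (Suc n) \<xi> = W (s n) \<xi>" "\<And>n. ?r \<le> s n" "\<And>n. s n \<le> ?r + (v - t) / real (Suc n)"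
    by metis
  have "(\<lambda>n. ?r + (v - t) * (1 / real (Suc n))) \<longlonglongrightarrow> ?r + (v - t) * 0"
    by (intro tendsto_add tendsto_mult tendsto_const LIMSEQ_Suc lim_1_over_n)
  then have upper: "(\<lambda>n. ?r + (v - t) / real (Suc n)) \<longlonglongrightarrow> ?r" by simp
  have "s \<longlonglongrightarrow> ?r"
    by (rule tendsto_sandwich[OF _ _ tendsto_const upper]) (use s in auto)
  moreover have "0 \<le> s n" for n using s(2)[of n] t by simp
  ultimately have "(\<lambda>n. W (s n) \<xi>) \<longlonglongrightarrow> W ?r \<xi>"
    using continuous_on_tendsto_compose[OF W_continuous[OF \<xi>], of s ?r] t by auto
  then show ?thesis by (simp add: s(1))
qed

lemma late_stopped_measurable: "(\<lambda>\<xi>. W (max t (clip \<rho> v \<xi>)) \<xi>) \<in> borel_measurable (FW v)"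
proof (rule borel_measurable_LIMSEQ_real)
  show "(\<lambda>n. steps \<rho> t v (Suc n) (Suc n) \<xi>) \<longlonglongrightarrow> W (max t (clip \<rho> v \<xi>)) \<xi>" if "\<xi> \<in> space (FW v)" for \<xi>
    using steps_tendsto that by simp
  show "steps \<rho> t v (Suc n) (Suc n) \<in> borel_measurable (FW v)" for n
    using steps_measurable[of "Suc n" "Suc n"] by simp
qed

text \<open>
  The grid approximations are not uniformly bounded, but their second moments are; truncation
  at level \<open>C\<close> costs at most \<open>v / C\<close>.
\<close>

lemma late_stopped_mean:
  assumes A: "A \<in> sets (FW t)" and K: "AE \<xi> in P. \<xi> \<in> A \<longrightarrow> \<bar>W (max t (clip \<rho> v \<xi>)) \<xi>\<bar> \<le> K"
  shows "(\<integral>\<xi>. indicator A \<xi> * W (max t (clip \<rho> v \<xi>)) \<xi> \<partial>P) = (\<integral>\<xi>. indicator A \<xi> * W t \<xi> \<partial>P)"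
proof -
  have AP[measurable]: "A \<in> sets P" using A subalgebra_FW by (auto simp: subalgebra_def)
  let ?R = "\<lambda>\<xi>. W (max t (clip \<rho> v \<xi>)) \<xi>"
  let ?Y = "\<lambda>n. steps \<rho> t v (Suc n) (Suc n)"
  have [measurable]: "?R \<in> borel_measurable P" by (rule measurable_from_subalg[OF subalgebra_FW late_stopped_measurable])
  have [measurable]: "?Y n \<in> borel_measurable P" for n by (rule measurable_from_subalg[OF subalgebra_FW steps_measurable])
  let ?\<phi> = "\<lambda>C x :: real. max (- C) (min C x)"
  let ?d = "(\<integral>\<xi>. indicator A \<xi> * W t \<xi> \<partial>P) - (\<integral>\<xi>. indicator A \<xi> * ?R \<xi> \<partial>P)"
  have bound: "\<bar>?d\<bar> \<le> v / C" if C: "0 < C" "K \<le> C" for C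
  proof -
    have "(\<lambda>n. \<integral>\<xi>. indicator A \<xi> * ?\<phi> C (?Y n \<xi>) \<partial>P) \<longlonglongrightarrow> (\<integral>\<xi>. indicator A \<xi> * ?\<phi> C (?R \<xi>) \<partial>P)"
    proof (rule integral_dominated_convergence[where w="\<lambda>_. C"])
      show "AE \<xi> in P. (\<lambda>n. indicator A \<xi> * ?\<phi> C (?Y n \<xi>)) \<longlonglongrightarrow> indicator A \<xi> * ?\<phi> C (?R \<xi>)"
        by (intro AE_I2 tendsto_mult tendsto_max tendsto_min tendsto_const steps_tendsto)
    qed (use C in \<open>auto simp: indicator_def\<close>)
    moreover have "(\<integral>\<xi>. indicator A \<xi> * ?\<phi> C (?R \<xi>) \<partial>P) = (\<integral>\<xi>. indicator A \<xi> * ?R \<xi> \<partial>P)"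
    proof (intro integral_cong_AE)
      show "AE \<xi> in P. indicator A \<xi> * ?\<phi> C (?R \<xi>) = indicator A \<xi> * ?R \<xi>"
        using K by eventually_elim (use C in \<open>auto simp: indicator_def\<close>)
    qed measurable
    ultimately have lim: "(\<lambda>n. (\<integral>\<xi>. indicator A \<xi> * W t \<xi> \<partial>P) - (\<integral>\<xi>. indicator A \<xi> * ?\<phi> C (?Y n \<xi>) \<partial>P)) \<longlonglongrightarrow> ?d"
      by (intro tendsto_diff tendsto_const) simp
    have "\<bar>(\<integral>\<xi>. indicator A \<xi> * W t \<xi> \<partial>P) - (\<integral>\<xi>. indicator A \<xi> * ?\<phi> C (?Y n \<xi>) \<partial>P)\<bar> \<le> v / C" for n
    proof -
      have sq: "integrable P (\<lambda>\<xi>. (?Y n \<xi>)\<^sup>2)" "(\<integral>\<xi>. (?Y n \<xi>)\<^sup>2 \<partial>P) \<le> v"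
        using steps_square[of "Suc n" "Suc n"] by simp_all
      have iY: "integrable P (?Y n)" by (rule square_integrable_imp_integrable[OF _ sq(1)]) simp
      have iA: "integrable P (\<lambda>\<xi>. indicator A \<xi> * ?Y n \<xi>)" using integrable_mult_indicator[OF AP iY] by simp
      have iC: "integrable P (\<lambda>\<xi>. indicator A \<xi> * ?\<phi> C (?Y n \<xi>))"
        by (rule integrable_const_bound[where B=C]) (use C in \<open>auto simp: indicator_def\<close>)
      have pw: "\<bar>y - ?\<phi> C y\<bar> \<le> y\<^sup>2 / C" for y
      proof (cases "\<bar>y\<bar> \<le> C")
        case True
        then have "?\<phi> C y = y" by auto
        then show ?thesis using C by simp
      next
        case False
        then have "\<bar>y - ?\<phi> C y\<bar> \<le> \<bar>y\<bar>" using C by auto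
        also have "\<bar>y\<bar> * C \<le> \<bar>y\<bar> * \<bar>y\<bar>" using False by (intro mult_left_mono) auto
        then have "\<bar>y\<bar> \<le> y\<^sup>2 / C" using C by (simp add: le_divide_eq power2_eq_square)
        finally show ?thesis .
      qed
      have diff: "(\<integral>\<xi>. indicator A \<xi> * W t \<xi> \<partial>P) - (\<integral>\<xi>. indicator A \<xi> * ?\<phi> C (?Y n \<xi>) \<partial>P) =
          (\<integral>\<xi>. indicator A \<xi> * ?Y n \<xi> - indicator A \<xi> * ?\<phi> C (?Y n \<xi>) \<partial>P)"
        using steps_mean[OF A, of "Suc n" "Suc n"] iA iC by (simp add: Bochner_Integration.integral_diff)
      have "\<bar>(\<integral>\<xi>. indicator A \<xi> * W t \<xi> \<partial>P) - (\<integral>\<xi>. indicator A \<xi> * ?\<phi> C (?Y n \<xi>) \<partial>P)\<bar> \<le>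
          (\<integral>\<xi>. \<bar>indicator A \<xi> * ?Y n \<xi> - indicator A \<xi> * ?\<phi> C (?Y n \<xi>)\<bar> \<partial>P)"
        unfolding diff by (rule integral_abs_bound)
      also have "\<dots> \<le> (\<integral>\<xi>. (?Y n \<xi>)\<^sup>2 / C \<partial>P)"
      proof (rule integral_mono)
        show "integrable P (\<lambda>\<xi>. \<bar>indicator A \<xi> * ?Y n \<xi> - indicator A \<xi> * ?\<phi> C (?Y n \<xi>)\<bar>)"
          using iA iC by (intro integrable_abs Bochner_Integration.integrable_diff)
        show "integrable P (\<lambda>\<xi>. (?Y n \<xi>)\<^sup>2 / C)" using sq(1) by simp
        show "\<bar>indicator A \<xi> * ?Y n \<xi> - indicator A \<xi> * ?\<phi> C (?Y n \<xi>)\<bar> \<le> (?Y n \<xi>)\<^sup>2 / C" for \<xi>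
          using pw[of "?Y n \<xi>"] C by (cases "\<xi> \<in> A") auto
      qed
      also have "\<dots> \<le> v / C" using sq(2) C by (simp add: divide_right_mono)
      finally show ?thesis .
    qed
    then show ?thesis
      by (intro LIMSEQ_le_const2[OF tendsto_rabs[OF lim]]) auto
  qed
  have "\<bar>?d\<bar> \<le> 0"
  proof (rule LIMSEQ_le_const)
    show "(\<lambda>n. v / (\<bar>K\<bar> + real (Suc n))) \<longlonglongrightarrow> 0"
    proof (rule tendsto_divide_0[OF tendsto_const])
      have "filterlim (\<lambda>n. real (Suc n)) at_top sequentially"
        by (rule filterlim_compose[OF filterlim_real_sequentially filterlim_Suc])
      then have "filterlim (\<lambda>n. \<bar>K\<bar> + real (Suc n)) at_top sequentially"
        by (rule filterlim_tendsto_add_at_top[OF tendsto_const])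
      then show "filterlim (\<lambda>n. \<bar>K\<bar> + real (Suc n)) at_infinity sequentially"
        by (rule filterlim_at_top_imp_at_infinity)
    qed
    show "\<exists>N. \<forall>n\<ge>N. \<bar>?d\<bar> \<le> v / (\<bar>K\<bar> + real (Suc n))"
      by (intro exI[of _ 0] allI impI bound) auto
  qed
  then show ?thesis by simp
qed

end

lemma stopped_measurable:
  assumes \<rho>: "stopping \<rho>" and u: "0 \<le> u"
  shows "stopped \<rho> u \<in> borel_measurable (FW u)"
proof (cases "u = 0")
  case True
  then have "clip \<rho> u \<xi> = 0" for \<xi> using clip_bounds[OF \<rho> u, of \<xi>] by simp
  then have "stopped \<rho> u = W 0" by (simp add: stopped_def fun_eq_iff)
  then show ?thesis using W_FW[of 0 u] u by simp
next
  case False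
  then have "(\<lambda>\<xi>. W (max 0 (clip \<rho> u \<xi>)) \<xi>) \<in> borel_measurable (FW u)"
    using u by (intro late_stopped_measurable[OF \<rho>]) auto
  then show ?thesis using clip_bounds[OF \<rho> u] by (simp add: stopped_def[abs_def] max_absorb2)
qed

lemma stopped_measurable_P: "stopping \<rho> \<Longrightarrow> 0 \<le> u \<Longrightarrow> stopped \<rho> u \<in> borel_measurable P"
  by (rule measurable_from_subalg[OF subalgebra_FW stopped_measurable])

text \<open>Where the stopping time is at most \<open>t\<close>, both stopped values coincide. The
  complement is an event known at time \<open>t\<close>; on it the stopped value at \<open>v\<close>
  is the one treated by \<open>late_stopped_mean\<close>, and the stopped value at \<open>t\<close>
  is \<open>W t\<close>.\<close>

lemma optional_stopping:
  assumes \<rho>: "stopping \<rho>" and t: "0 \<le> t" "t \<le> v" and A: "A \<in> sets (FW t)"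
    and K: "\<And>u. 0 \<le> u \<Longrightarrow> AE \<xi> in P. \<bar>stopped \<rho> u \<xi>\<bar> \<le> K"
  shows "(\<integral>\<xi>. indicator A \<xi> * stopped \<rho> v \<xi> \<partial>P) = (\<integral>\<xi>. indicator A \<xi> * stopped \<rho> t \<xi> \<partial>P)"
proof (cases "t = v")
  case False
  then have tv: "t < v" and v: "0 \<le> v" using t by auto
  let ?G = "{\<xi>\<in>space P. ereal t < \<rho> \<xi>}" and ?L = "{\<xi>\<in>space P. \<rho> \<xi> \<le> ereal t}"
  have AG: "A \<inter> ?G \<in> sets (FW t)" using A stopping_greater[OF \<rho> t(1)] by simp
  have AP: "A \<in> sets P" "A \<inter> ?G \<in> sets P" "A \<inter> ?L \<in> sets P"
    using A AG \<rho> t subalgebra_FW[of t] by (auto simp: subalgebra_def stopping_def)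
  have [measurable]: "stopped \<rho> t \<in> borel_measurable P" "stopped \<rho> v \<in> borel_measurable P"
    using stopped_measurable_P[OF \<rho>] t v by auto
  have int: "integrable P (\<lambda>\<xi>. indicator B \<xi> * stopped \<rho> u \<xi>)" if "0 \<le> u" "B \<in> sets P" for B u
  proof -
    have "integrable P (stopped \<rho> u)"
      by (rule integrable_const_bound[where B=K]) (use K[OF that(1)] stopped_measurable_P[OF \<rho> that(1)] in auto)
    from integrable_mult_indicator[OF that(2) this] show ?thesis by simp
  qed
  have split: "(\<integral>\<xi>. indicator A \<xi> * stopped \<rho> u \<xi> \<partial>P) =
      (\<integral>\<xi>. indicator (A \<inter> ?G) \<xi> * stopped \<rho> u \<xi> \<partial>P) + (\<integral>\<xi>. indicator (A \<inter> ?L) \<xi> * stopped \<rho> u \<xi> \<partial>P)" if "0 \<le> u" for u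
    unfolding Bochner_Integration.integral_add[OF int[OF that AP(2)] int[OF that AP(3)], symmetric]
    by (intro Bochner_Integration.integral_cong refl) (auto simp: indicator_def)
  have clip_G: "max t (clip \<rho> v \<xi>) = clip \<rho> v \<xi>" "clip \<rho> t \<xi> = t" if "\<xi> \<in> ?G" for \<xi>
    using that less_clip_iff[OF \<rho> v, of t \<xi>] tv by (auto intro: clip_eq_if_ge)
  have "(\<integral>\<xi>. indicator (A \<inter> ?G) \<xi> * stopped \<rho> v \<xi> \<partial>P) = (\<integral>\<xi>. indicator (A \<inter> ?G) \<xi> * W (max t (clip \<rho> v \<xi>)) \<xi> \<partial>P)"
    by (intro Bochner_Integration.integral_cong refl) (auto simp: indicator_def stopped_def clip_G(1))
  also have "\<dots> = (\<integral>\<xi>. indicator (A \<inter> ?G) \<xi> * W t \<xi> \<partial>P)"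
  proof (rule late_stopped_mean[OF \<rho> t(1) tv AG])
    show "AE \<xi> in P. \<xi> \<in> A \<inter> ?G \<longrightarrow> \<bar>W (max t (clip \<rho> v \<xi>)) \<xi>\<bar> \<le> K"
      using K[OF v] by eventually_elim (auto simp: stopped_def clip_G(1))
  qed
  also have "\<dots> = (\<integral>\<xi>. indicator (A \<inter> ?G) \<xi> * stopped \<rho> t \<xi> \<partial>P)"
    by (intro Bochner_Integration.integral_cong refl) (auto simp: indicator_def stopped_def clip_G(2))
  moreover have "(\<integral>\<xi>. indicator (A \<inter> ?L) \<xi> * stopped \<rho> v \<xi> \<partial>P) = (\<integral>\<xi>. indicator (A \<inter> ?L) \<xi> * stopped \<rho> t \<xi> \<partial>P)"
    by (intro Bochner_Integration.integral_cong refl)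
       (use clip_eq_if_le[OF \<rho> _ t(2) t(1)] in \<open>auto simp: indicator_def stopped_def\<close>)
  ultimately show ?thesis using split t v by simp
qed simp

end

subsection \<open>Hitting times of the pair formed by the path and its maximum\<close>

lemma continuous_imp_cadlag_on:
  assumes f: "continuous_on {0..} f"
  shows "cadlag_on T f"
  unfolding cadlag_on_def
proof (intro conjI ballI)
  have lim: "(f \<longlongrightarrow> f t) (at t within {0..})" if "0 \<le> t" for t
    using f that by (auto simp: continuous_on)
  fix t
  show "(f \<longlongrightarrow> f t) (at_right t)" if "t \<in> {0..<T}"
    using that by (intro tendsto_within_subset[OF lim]) auto
  show "\<exists>l. (f \<longlongrightarrow> l) (at_left t)" if "t \<in> {0<..T}"
  proof -
    have "at t within {0..} = at t" using that by (intro at_within_interior) (auto simp: interior_real_atLeast)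
    then have "(f \<longlongrightarrow> f t) (at t)" using lim[of t] that by auto
    then have "(f \<longlongrightarrow> f t) (at_left t)" by (rule tendsto_within_subset) auto
    then show ?thesis ..
  qed
qed

text \<open>Earlier times count for both maxima, so the maximum moves no more than the path
  oscillates near \<open>t\<close>.\<close>

lemma running_max_continuous:
  assumes f: "continuous_on {0..} (\<lambda>t. X t \<xi>)"
  shows "continuous_on {0..} (\<lambda>t. running_max X t \<xi>)"
  unfolding continuous_on_iff dist_real_def
proof (intro ballI allI impI)
  have upper: "X r \<xi> \<le> running_max X u \<xi>" if "0 \<le> r" "r \<le> u" for r u
    using that by (intro running_max_upper continuous_imp_cadlag_on f)
  fix t e :: real assume t: "t \<in> {0..}" and e: "0 < e"
  obtain d where d: "0 < d" "\<And>r. 0 \<le> r \<Longrightarrow> \<bar>r - t\<bar> < d \<Longrightarrow> \<bar>X r \<xi> - X t \<xi>\<bar> < e / 4"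
    using f[unfolded continuous_on_iff dist_real_def, rule_format, OF t, of "e / 4"] e by (auto simp del: less_divide_eq_numeral1)
  have le: "running_max X u \<xi> \<le> running_max X v \<xi> + e / 2" if "0 \<le> u" "0 \<le> v" "\<bar>u - t\<bar> < d" "\<bar>v - t\<bar> < d" for u v
  proof -
    have "X r \<xi> \<le> running_max X v \<xi> + e / 2" if r: "r \<in> {0..u}" for r
    proof (cases "r \<le> v")
      case True
      then show ?thesis using upper[of r v] r e by simp
    next
      case False
      then have "\<bar>r - t\<bar> < d" using r \<open>\<bar>u - t\<bar> < d\<close> \<open>\<bar>v - t\<bar> < d\<close> by auto
      then have "\<bar>X r \<xi> - X t \<xi>\<bar> < e / 4" "\<bar>X v \<xi> - X t \<xi>\<bar> < e / 4" "X v \<xi> \<le> running_max X v \<xi>"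
        using d(2) upper r \<open>0 \<le> v\<close> \<open>\<bar>v - t\<bar> < d\<close> by (simp_all del: less_divide_eq_numeral1)
      then show ?thesis by linarith
    qed
    then show ?thesis unfolding running_max_def[of X u] using \<open>0 \<le> u\<close> by (intro cSUP_least) auto
  qed
  have "\<bar>running_max X r \<xi> - running_max X t \<xi>\<bar> < e" if "r \<in> {0..}" "\<bar>r - t\<bar> < d" for r
    using le[of r t] le[of t r] that t d(1) e by auto
  then show "\<exists>d>0. \<forall>r\<in>{0..}. \<bar>r - t\<bar> < d \<longrightarrow> \<bar>running_max X r \<xi> - running_max X t \<xi>\<bar> < e"
    using d(1) by blast
qed

context brownian
begin

abbreviation S :: "real \<Rightarrow> 'a \<Rightarrow> real" where
  "S \<equiv> running_max W"

definition hit :: "(real \<times> real) set \<Rightarrow> 'a \<Rightarrow> ereal" where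
  "hit C \<xi> = Inf (ereal ` {t. 0 \<le> t \<and> (W t \<xi>, S t \<xi>) \<in> C})"

lemma S_upper: "\<xi> \<in> space P \<Longrightarrow> 0 \<le> r \<Longrightarrow> r \<le> t \<Longrightarrow> W r \<xi> \<le> S t \<xi>"
  by (intro running_max_upper continuous_imp_cadlag_on W_continuous)

lemma S_attained:
  assumes "\<xi> \<in> space P" "0 \<le> t"
  obtains r where "0 \<le> r" "r \<le> t" "S t \<xi> = W r \<xi>"
proof -
  have "continuous_on {0..t} (\<lambda>t. W t \<xi>)" by (rule continuous_on_subset[OF W_continuous[OF assms(1)]]) auto
  then obtain r where r: "r \<in> {0..t}" "\<And>u. u \<in> {0..t} \<Longrightarrow> W u \<xi> \<le> W r \<xi>"
    using continuous_attains_sup[of "{0..t}" "\<lambda>t. W t \<xi>"] assms(2) by auto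
  have "S t \<xi> = W r \<xi>" unfolding running_max_def by (rule cSup_eq_maximum) (use r in auto)
  then show thesis using that r by auto
qed

lemma path_continuous: "\<xi> \<in> space P \<Longrightarrow> continuous_on {0..} (\<lambda>t. (W t \<xi>, S t \<xi>))"
  by (intro continuous_on_Pair running_max_continuous W_continuous)

lemma hit_cases:
  assumes C: "closed C" and \<xi>: "\<xi> \<in> space P"
  obtains (never) "hit C \<xi> = \<infinity>" "\<And>t. 0 \<le> t \<Longrightarrow> (W t \<xi>, S t \<xi>) \<notin> C"
    | (at) r where "0 \<le> r" "hit C \<xi> = ereal r" "(W r \<xi>, S r \<xi>) \<in> C" "\<And>u. 0 \<le> u \<Longrightarrow> u < r \<Longrightarrow> (W u \<xi>, S u \<xi>) \<notin> C"
proof (cases "{t. 0 \<le> t \<and> (W t \<xi>, S t \<xi>) \<in> C} = {}")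
  case True
  then have "hit C \<xi> = \<infinity>" unfolding hit_def by (simp only: image_empty Inf_empty top_ereal_def)
  then show thesis using never True by blast
next
  case False
  let ?A = "{t. 0 \<le> t \<and> (W t \<xi>, S t \<xi>) \<in> C}"
  have "?A = {0..} \<inter> (\<lambda>t. (W t \<xi>, S t \<xi>)) -` C" by auto
  then have "closed ?A" using continuous_closed_preimage[OF path_continuous[OF \<xi>] closed_atLeast C] by simp
  moreover have bdd: "bdd_below ?A" by (rule bdd_belowI[of _ 0]) auto
  ultimately have A: "Inf ?A \<in> ?A" using closed_contains_Inf[OF False] by blast
  have "hit C \<xi> = ereal (Inf ?A)"
    unfolding hit_def
  proof (rule antisym)
    show "Inf (ereal ` ?A) \<le> ereal (Inf ?A)" using A by (rule INF_lower)
    show "ereal (Inf ?A) \<le> Inf (ereal ` ?A)" using cInf_lower[OF _ bdd] by (intro INF_greatest) simp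
  qed
  moreover have "(W u \<xi>, S u \<xi>) \<notin> C" if "0 \<le> u" "u < Inf ?A" for u
    using cInf_lower[OF _ bdd, of u] that by auto
  ultimately show thesis using at[of "Inf ?A"] A by blast
qed

lemma hit_le_iff:
  assumes C: "closed C" and \<xi>: "\<xi> \<in> space P" and t: "0 \<le> t"
  shows "hit C \<xi> \<le> ereal t \<longleftrightarrow> (\<exists>r\<in>{0..t}. (W r \<xi>, S r \<xi>) \<in> C)"
  using C \<xi>
proof (cases rule: hit_cases)
  case never
  then show ?thesis by auto
next
  case (at r)
  then show ?thesis by (auto simp: not_less[symmetric] intro!: bexI[of _ r])
qed

lemma hit_mono:
  assumes "C \<subseteq> D" shows "hit D \<xi> \<le> hit C \<xi>"
  unfolding hit_def using assms by (intro Inf_superset_mono) auto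

text \<open>For a closed set, entering by time \<open>t\<close> means that the distance to it
  attains 0 on \<open>[0, t]\<close>, that is, the running maximum of minus the distance is
  nonnegative. The earlier result on running maxima then avoids an uncountable union.\<close>

lemma stopping_hit:
  assumes C: "closed C" "C \<noteq> {}"
  shows "stopping (hit C)"
  unfolding stopping_def
proof (intro conjI allI impI)
  show "0 \<le> hit C \<xi>" for \<xi> unfolding hit_def by (intro Inf_greatest) auto
  fix t :: real assume t: "0 \<le> t"
  define D where "D r \<xi> = - infdist (W r \<xi>, S r \<xi>) C" for r \<xi>
  have D_cont: "continuous_on {0..} (\<lambda>r. D r \<xi>)" if "\<xi> \<in> space P" for \<xi>
    unfolding D_def by (intro continuous_on_minus continuous_on_infdist path_continuous that)
  have D_meas: "D r \<in> borel_measurable (FW t)" if r: "0 \<le> r" "r \<le> t" for r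
  proof -
    have "S r \<in> borel_measurable (FW t)"
      by (rule borel_measurable_running_max) (use r W_continuous in \<open>auto intro: continuous_imp_cadlag_on W_FW\<close>)
    then have "(\<lambda>\<xi>. (W r \<xi>, S r \<xi>)) \<in> borel_measurable (FW t)"
      using W_FW[of r t] r by (intro borel_measurable_Pair) auto
    moreover have "(\<lambda>z. - infdist z C) \<in> borel_measurable borel"
      by (intro borel_measurable_continuous_onI continuous_on_minus continuous_on_infdist continuous_on_id)
    ultimately show ?thesis unfolding D_def[abs_def] by (rule measurable_compose)
  qed
  have "running_max D t \<in> borel_measurable (FW t)"
    by (rule borel_measurable_running_max) (use t D_cont D_meas in \<open>auto intro: continuous_imp_cadlag_on\<close>)
  then have "{\<xi>\<in>space (FW t). 0 \<le> running_max D t \<xi>} \<in> sets (FW t)" by measurable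
  moreover have "0 \<le> running_max D t \<xi> \<longleftrightarrow> hit C \<xi> \<le> ereal t" if \<xi>: "\<xi> \<in> space P" for \<xi>
  proof -
    have "continuous_on {0..t} (\<lambda>r. D r \<xi>)" by (rule continuous_on_subset[OF D_cont[OF \<xi>]]) auto
    then obtain r where r: "r \<in> {0..t}" "\<And>u. u \<in> {0..t} \<Longrightarrow> D u \<xi> \<le> D r \<xi>"
      using continuous_attains_sup[of "{0..t}" "\<lambda>t. D t \<xi>"] t by auto
    have eq: "running_max D t \<xi> = D r \<xi>" unfolding running_max_def by (rule cSup_eq_maximum) (use r in auto)
    have zero: "0 \<le> D u \<xi> \<longleftrightarrow> (W u \<xi>, S u \<xi>) \<in> C" for u
      unfolding D_def in_closed_iff_infdist_zero[OF C] using infdist_nonneg[of "(W u \<xi>, S u \<xi>)" C] by auto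
    show ?thesis unfolding eq hit_le_iff[OF C(1) \<xi> t] zero using r zero by (meson order_trans)
  qed
  then have "{\<xi>\<in>space (FW t). 0 \<le> running_max D t \<xi>} = {\<xi>\<in>space P. hit C \<xi> \<le> ereal t}" by auto
  ultimately show "{\<xi>\<in>space P. hit C \<xi> \<le> ereal t} \<in> sets (FW t)" by simp
qed

lemma azema_yor_time_eq_hit: "azema_yor_time \<mu> W \<xi> = hit {(w, s). barycenter \<mu> w \<le> s} \<xi>"
  by (simp add: azema_yor_time_def hit_def)

end

subsection \<open>The law of Brownian motion stopped in a truncated Azema--Yor region\<close>

text \<open>
  Both \<open>p\<close> and \<open>m\<close> solve \<open>(e f)' = - f\<close>, in the integrated form of the sandwich hypotheses;
  increments of \<open>p / m\<close> are then quadratically small.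
\<close>

lemma proportional_tails:
  fixes e p m :: "real \<Rightarrow> real"
  assumes ab: "a \<le> b"
    and e: "\<And>k. a \<le> k \<Longrightarrow> k \<le> b \<Longrightarrow> 0 < e k" "continuous_on {a..b} e"
    and p: "\<And>k k'. a \<le> k \<Longrightarrow> k \<le> k' \<Longrightarrow> k' \<le> b \<Longrightarrow>
      p k' * (k' - k) \<le> e k * p k - e k' * p k' \<and> e k * p k - e k' * p k' \<le> p k * (k' - k)"
    and m: "\<And>k k'. a \<le> k \<Longrightarrow> k \<le> k' \<Longrightarrow> k' \<le> b \<Longrightarrow>
      m k' * (k' - k) \<le> e k * m k - e k' * m k' \<and> e k * m k - e k' * m k' \<le> m k * (k' - k)"
    and pos: "\<And>k. 0 \<le> p k" "\<And>k. a \<le> k \<Longrightarrow> k \<le> b \<Longrightarrow> 0 < m k"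
  shows "p a * m b = p b * m a"
proof -
  have anti: "f k' \<le> f k"
    if "\<And>k k'. a \<le> k \<Longrightarrow> k \<le> k' \<Longrightarrow> k' \<le> b \<Longrightarrow>
        f k' * (k' - k) \<le> e k * f k - e k' * f k' \<and> e k * f k - e k' * f k' \<le> f k * (k' - k)"
      and "a \<le> k" "k \<le> k'" "k' \<le> b" for f k k'
  proof (cases "k = k'")
    case False
    then have "0 < k' - k" using that(3) by simp
    moreover have "f k' * (k' - k) \<le> f k * (k' - k)" using that(1)[of k k'] that(2-4) by linarith
    ultimately show ?thesis by (simp add: mult_le_cancel_right)
  qed simp
  have cont: "continuous_on {a..b} f"
    if f: "\<And>k k'. a \<le> k \<Longrightarrow> k \<le> k' \<Longrightarrow> k' \<le> b \<Longrightarrow>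
        f k' * (k' - k) \<le> e k * f k - e k' * f k' \<and> e k * f k - e k' * f k' \<le> f k * (k' - k)"
      and nn: "\<And>k. a \<le> k \<Longrightarrow> k \<le> b \<Longrightarrow> 0 \<le> f k" for f
  proof -
    have inc: "\<bar>e k * f k - e k' * f k'\<bar> \<le> f a * \<bar>k - k'\<bar>" if k: "a \<le> k" "k \<le> k'" "k' \<le> b" for k k'
    proof -
      have "0 \<le> f k' * (k' - k)" using nn[of k'] k by simp
      moreover have "f k * (k' - k) \<le> f a * (k' - k)"
        using anti[of f a k, OF f] k by (intro mult_right_mono) auto
      ultimately show ?thesis using f[OF k] k by simp
    qed
    have "(f a)-lipschitz_on {a..b} (\<lambda>k. e k * f k)"
    proof (rule lipschitz_onI)
      show "0 \<le> f a" using nn[of a] ab by simp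
      fix x y assume "x \<in> {a..b}" "y \<in> {a..b}"
      then show "dist (e x * f x) (e y * f y) \<le> f a * dist x y"
        using inc[of x y] inc[of y x] by (cases "x \<le> y") (auto simp: dist_real_def abs_minus_commute)
    qed
    then have "continuous_on {a..b} (\<lambda>k. e k * f k)" by (rule lipschitz_on_continuous_on)
    then have "continuous_on {a..b} (\<lambda>k. e k * f k / e k)" using e(1) by (intro continuous_on_divide e(2)) force+
    then show ?thesis by (rule continuous_on_eq) (use e(1) in force)
  qed
  have p_anti: "p k' \<le> p k" and m_anti: "m k' \<le> m k" if "a \<le> k" "k \<le> k'" "k' \<le> b" for k k'
    using anti[OF p] anti[OF m] that by auto
  have p_cont: "continuous_on {a..b} p" by (rule cont[OF p pos(1)])
  have m_cont: "continuous_on {a..b} m" by (rule cont[OF m less_imp_le[OF pos(2)]])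
  obtain x where x: "x \<in> {a..b}" "\<And>k. k \<in> {a..b} \<Longrightarrow> e x \<le> e k"
    using continuous_attains_inf[of "{a..b}" e] e(2) ab by auto
  have e0: "0 < e x" using e(1) x(1) by simp
  have ma: "0 < m a" and mb: "0 < m b" using pos(2) ab by auto
  \<comment> \<open>Makes the increments of c p / m at most the square of those of \<open>T\<close>.
    It consists of the smallest values of \<open>e\<close> and \<open>m\<close> on the interval and
    the largest ones of \<open>p\<close> and \<open>m\<close>.\<close>
  define c where "c = e x * (m b)\<^sup>2 / (p a + m a)"
  have c: "0 < c" unfolding c_def using e0 mb ma pos(1)[of a] by simp
  \<comment> \<open>Clamping to \<open>[a, b]\<close> extends the estimate to all reals, as
    \<open>eq_if_quadratic_increments\<close> demands.\<close>
  define cl where "cl y = max a (min b y)" for y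
  have cl: "a \<le> cl y" "cl y \<le> b" for y using ab by (auto simp: cl_def)
  define d where "d y = c * (p (cl y) / m (cl y))" for y
  \<comment> \<open>Since \<open>p\<close> and \<open>m\<close> are antitone, an increment of
    \<open>T\<close> is the sum of the sizes of the increments of the argument, \<open>p\<close> and
    \<open>m\<close>.\<close>
  define T where "T y = cl y - p (cl y) - m (cl y)" for y
  have bound: "\<bar>c * (p k / m k) - c * (p k' / m k')\<bar> \<le> ((k' - k) + (p k - p k') + (m k - m k'))\<^sup>2"
    if k: "a \<le> k" "k \<le> k'" "k' \<le> b" for k k'
  proof -
    let ?h = "k' - k" and ?p = "p k - p k'" and ?m = "m k - m k'"
    have nn: "0 \<le> ?h" "0 \<le> ?p" "0 \<le> ?m" using p_anti[OF k] m_anti[OF k] k by auto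
    have pos_k: "0 < e k" "0 < e k'" "0 < m k" "0 < m k'" using e(1) pos(2) k by auto
    let ?C = "e k * p k" and ?C' = "e k' * p k'" and ?D = "e k * m k" and ?D' = "e k' * m k'"
    let ?N = "p k * m k' - p k' * m k"
    \<comment> \<open>The product rule for p / m: inserting the sandwich bounds for \<open>p\<close>
      and \<open>m\<close> cancels the first-order terms and leaves products of two
      increments.\<close>
    have N: "e k * e k' * ?N = (?C - ?C') * ?D' - ?C' * (?D - ?D')" by (simp add: algebra_simps)
    have "(?C - ?C') * ?D' \<le> (p k * ?h) * ?D'" using p[OF k] pos_k by (intro mult_right_mono) auto
    moreover have "?C' * (m k' * ?h) \<le> ?C' * (?D - ?D')" using m[OF k] pos_k pos(1)[of k'] by (intro mult_left_mono) auto
    moreover have "(p k * ?h) * ?D' - ?C' * (m k' * ?h) = e k' * (?h * m k' * ?p)" by (simp add: algebra_simps)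
    ultimately have "e k' * (e k * ?N) \<le> e k' * (?h * m k' * ?p)" using N by (simp add: mult.assoc mult.left_commute)
    then have up: "e k * ?N \<le> ?h * m k' * ?p" using pos_k by (simp add: mult_le_cancel_left)
    have "(p k' * ?h) * ?D' \<le> (?C - ?C') * ?D'" using p[OF k] pos_k by (intro mult_right_mono) auto
    moreover have "?C' * (?D - ?D') \<le> ?C' * (m k * ?h)" using m[OF k] pos_k pos(1)[of k'] by (intro mult_left_mono) auto
    moreover have "(p k' * ?h) * ?D' - ?C' * (m k * ?h) = e k' * - (?h * p k' * ?m)" by (simp add: algebra_simps)
    ultimately have "e k' * - (?h * p k' * ?m) \<le> e k' * (e k * ?N)" using N by (simp add: mult.assoc mult.left_commute)
    then have low: "- (?h * p k' * ?m) \<le> e k * ?N" using pos_k by (simp only: mult_le_cancel_left)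
    let ?s = "?h + ?p + ?m"
    have le: "p k' \<le> p a" "m k' \<le> m a" "m b \<le> m k" "m b \<le> m k'" using p_anti m_anti k by auto
    have sq: "?h * ?p \<le> ?s\<^sup>2" "?h * ?m \<le> ?s\<^sup>2"
      unfolding power2_eq_square using nn by (intro mult_mono; simp)+
    have "?h * m k' * ?p \<le> m a * ?s\<^sup>2"
      using mult_mono[OF le(2) sq(1)] nn ma by (simp add: mult_ac)
    moreover have "?h * p k' * ?m \<le> p a * ?s\<^sup>2"
      using mult_mono[OF le(1) sq(2)] nn pos(1)[of a] by (simp add: mult_ac)
    moreover have "0 \<le> p a * ?s\<^sup>2" "0 \<le> m a * ?s\<^sup>2" using pos(1)[of a] ma by simp_all
    ultimately have abs: "\<bar>e k * ?N\<bar> \<le> (p a + m a) * ?s\<^sup>2" using up low by (simp add: distrib_right)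
    have "e x * (m b)\<^sup>2 * \<bar>?N\<bar> \<le> e k * (m k * m k') * \<bar>?N\<bar>"
      unfolding power2_eq_square using x(2)[of k] le e0 mb k
      by (intro mult_right_mono mult_mono) auto
    also have "\<dots> = \<bar>e k * ?N\<bar> * (m k * m k')" using pos_k by (simp add: abs_mult mult_ac)
    also have "\<dots> \<le> (p a + m a) * ?s\<^sup>2 * (m k * m k')" using abs pos_k by (intro mult_right_mono) auto
    finally have "c * \<bar>?N\<bar> \<le> ?s\<^sup>2 * (m k * m k')"
      unfolding c_def using ma pos(1)[of a] by (simp add: divide_le_eq mult_ac)
    moreover have "c * (p k / m k) - c * (p k' / m k') = c * ?N / (m k * m k')"
      using pos_k by (simp add: field_simps)
    ultimately show ?thesis using c pos_k by (simp add: abs_mult divide_le_eq)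
  qed
  have q: "\<bar>d y - d z\<bar> \<le> (T y - T z)\<^sup>2" for y z
  proof (cases "cl y \<le> cl z")
    case True
    have "(T y - T z)\<^sup>2 = ((cl z - cl y) + (p (cl y) - p (cl z)) + (m (cl y) - m (cl z)))\<^sup>2"
      unfolding T_def by (simp add: power2_eq_square algebra_simps)
    then show ?thesis unfolding d_def using bound[OF cl(1) True cl(2)] by simp
  next
    case False
    then have "cl z \<le> cl y" by simp
    have "(T y - T z)\<^sup>2 = ((cl y - cl z) + (p (cl z) - p (cl y)) + (m (cl z) - m (cl y)))\<^sup>2"
      unfolding T_def by (simp add: power2_eq_square algebra_simps)
    then show ?thesis unfolding d_def using bound[OF cl(1) \<open>cl z \<le> cl y\<close> cl(2)] by (simp add: abs_minus_commute)
  qed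
  have "continuous_on {a..b} (\<lambda>y. y - p y - m y)" by (intro continuous_intros p_cont m_cont)
  then have "continuous_on {a..b} T" by (rule continuous_on_eq) (simp add: T_def cl_def)
  from eq_if_quadratic_increments[OF q this ab] have "d a = d b" .
  then show ?thesis using ab ma mb c by (simp add: d_def cl_def field_simps)
qed

text \<open>The integrated form of (E (X - k)^+)' = - P (X \<ge> k): between the two strikes the
  payoff drops by k' - k on {X \<ge> k'}, by at most this on {X \<ge> k}, and not at all
  elsewhere.\<close>

lemma (in prob_space) call_increment:
  assumes X: "integrable M X" and k: "k \<le> k'"
  shows "prob {\<xi>\<in>space M. k' \<le> X \<xi>} * (k' - k) \<le> (\<integral>\<xi>. max 0 (X \<xi> - k) \<partial>M) - (\<integral>\<xi>. max 0 (X \<xi> - k') \<partial>M)"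
    and "(\<integral>\<xi>. max 0 (X \<xi> - k) \<partial>M) - (\<integral>\<xi>. max 0 (X \<xi> - k') \<partial>M) \<le> prob {\<xi>\<in>space M. k \<le> X \<xi>} * (k' - k)"
proof -
  have [measurable]: "X \<in> borel_measurable M" using X by simp
  have int: "integrable M (\<lambda>\<xi>. max 0 (X \<xi> - c))" for c using X by (intro integrable_max) auto
  have ind: "prob {\<xi>\<in>space M. c \<le> X \<xi>} * (k' - k) = (\<integral>\<xi>. indicator {\<xi>\<in>space M. c \<le> X \<xi>} \<xi> * (k' - k) \<partial>M)" for c
    by simp
  have int': "integrable M (\<lambda>\<xi>. indicator {\<xi>\<in>space M. c \<le> X \<xi>} \<xi> * (k' - k))" for c
    by (intro integrable_mult_left integrable_real_indicator) (simp_all add: emeasure_eq_measure)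
  show "prob {\<xi>\<in>space M. k' \<le> X \<xi>} * (k' - k) \<le> (\<integral>\<xi>. max 0 (X \<xi> - k) \<partial>M) - (\<integral>\<xi>. max 0 (X \<xi> - k') \<partial>M)"
    unfolding ind Bochner_Integration.integral_diff[OF int int, symmetric]
    by (intro integral_mono int' Bochner_Integration.integrable_diff int) (use k in \<open>auto simp: indicator_def\<close>)
  show "(\<integral>\<xi>. max 0 (X \<xi> - k) \<partial>M) - (\<integral>\<xi>. max 0 (X \<xi> - k') \<partial>M) \<le> prob {\<xi>\<in>space M. k \<le> X \<xi>} * (k' - k)"
    unfolding ind Bochner_Integration.integral_diff[OF int int, symmetric]
    by (intro integral_mono int' Bochner_Integration.integrable_diff int) (use k in \<open>auto simp: indicator_def\<close>)
qed

section \<open>Values at almost surely finite stopping times\<close>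

context brownian
begin

text \<open>The density of the increment over time i is at most 1 / sqrt (2 pi i), so the
  probability of remaining in a fixed interval at all integer times is 0.\<close>

lemma exits_interval: "AE \<xi> in P. \<exists>v\<ge>0. K < \<bar>W v \<xi>\<bar>"
proof -
  let ?A = "\<lambda>i. {\<xi>\<in>space P. \<bar>W (real (Suc i)) \<xi> - W 0 \<xi>\<bar> \<le> K}"
  have [measurable]: "W (real (Suc i)) \<in> borel_measurable P" "W 0 \<in> borel_measurable P" for i
    by (rule W_measurable, simp)+
  have A: "?A i \<in> sets P" for i by measurable
  have bound: "prob (\<Inter>i. ?A i) \<le> 2 * \<bar>K\<bar> * (1 / sqrt (2 * pi * real (Suc i)))" for i
  proof -
    let ?c = "1 / sqrt (2 * pi * real (Suc i))"
    have "emeasure P (?A i) = emeasure P ((\<lambda>\<xi>. W (real (Suc i)) \<xi> - W 0 \<xi>) -` {- K..K} \<inter> space P)"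
      by (intro arg_cong2[where f=emeasure]) auto
    also have "\<dots> = (\<integral>\<^sup>+x. ennreal (normal_density 0 (sqrt (real (Suc i) - 0)) x) * indicator {- K..K} x \<partial>lborel)"
      by (rule distributed_emeasure[OF W_normal]) auto
    also have "\<dots> \<le> (\<integral>\<^sup>+x. ennreal ?c * indicator {- K..K} x \<partial>lborel)"
    proof (intro nn_integral_mono mult_right_mono ennreal_leI)
      fix x
      have "?c * exp (- (x - 0)\<^sup>2 / (2 * (sqrt (real (Suc i)))\<^sup>2)) \<le> ?c * 1" by (intro mult_left_mono) auto
      then show "normal_density 0 (sqrt (real (Suc i) - 0)) x \<le> ?c" unfolding normal_density_def by simp
    qed auto
    also have "\<dots> = ennreal ?c * emeasure lborel {- K..K}" by (rule nn_integral_cmult_indicator) simp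
    also have "\<dots> \<le> ennreal ?c * ennreal (2 * \<bar>K\<bar>)" by (intro mult_left_mono) (auto simp: emeasure_lborel_Icc_eq intro!: ennreal_leI)
    also have "\<dots> = ennreal (2 * \<bar>K\<bar> * ?c)" by (subst mult.commute, rule ennreal_mult[symmetric]) auto
    finally have "prob (?A i) \<le> 2 * \<bar>K\<bar> * ?c" by (simp add: emeasure_eq_measure)
    moreover have "prob (\<Inter>i. ?A i) \<le> prob (?A i)" using A by (intro finite_measure_mono) auto
    ultimately show ?thesis by simp
  qed
  have "(\<lambda>i. 2 * \<bar>K\<bar> * (1 / sqrt (2 * pi * real (Suc i)))) \<longlonglongrightarrow> 2 * \<bar>K\<bar> * 0"
    by (intro tendsto_mult tendsto_const) real_asymp
  then have "prob (\<Inter>i. ?A i) \<le> 2 * \<bar>K\<bar> * 0" by (rule LIMSEQ_le_const) (use bound in blast)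
  then have "prob (\<Inter>i. ?A i) = 0" by (intro antisym measure_nonneg) simp
  moreover have "(\<Inter>i. ?A i) \<in> sets P" by (rule sets.countable_INT) (use A in auto)
  ultimately have "AE \<xi> in P. \<xi> \<notin> (\<Inter>i. ?A i)"
    by (intro AE_not_in null_setsI) (simp_all add: emeasure_eq_measure)
  then show ?thesis
    using W_0 AE_space
  proof eventually_elim
    case (elim \<xi>)
    then obtain i where "K < \<bar>W (real (Suc i)) \<xi>\<bar>" by (auto simp: not_le simp del: of_nat_Suc)
    then show ?case by (intro exI[of _ "real (Suc i)"]) auto
  qed
qed

text \<open>On paths with infinite stopping time this is \<open>W 0\<close>, as
  \<open>real_of_ereal \<infinity>\<close> is 0.\<close>

definition final :: "('a \<Rightarrow> ereal) \<Rightarrow> 'a \<Rightarrow> real" where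
  "final \<rho> \<xi> = W (real_of_ereal (\<rho> \<xi>)) \<xi>"

lemma stopped_eventually_final:
  assumes "stopping \<rho>" "\<rho> \<xi> \<noteq> \<infinity>"
  shows "\<forall>\<^sub>F i in sequentially. stopped \<rho> (real i) \<xi> = final \<rho> \<xi>"
proof -
  obtain r where r: "\<rho> \<xi> = ereal r" "0 \<le> r"
    using assms by (cases "\<rho> \<xi>") (auto simp: stopping_def dest: spec[of _ \<xi>])
  have "\<forall>\<^sub>F i in sequentially. r \<le> real i" by real_asymp
  then show ?thesis by eventually_elim (simp add: stopped_def final_def clip_def r min_def)
qed

lemma stopping_measurable: "stopping \<rho> \<Longrightarrow> \<rho> \<in> borel_measurable P"
proof (rule borel_measurableI_le)
  fix y assume \<rho>: "stopping \<rho>"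
  show "{\<xi>\<in>space P. \<rho> \<xi> \<le> y} \<in> sets P"
  proof (cases y)
    case (real r)
    show ?thesis
    proof (cases "0 \<le> r")
      case True
      then show ?thesis using \<rho> subalgebra_FW[of r] real by (auto simp: stopping_def subalgebra_def)
    next
      case False
      have "\<not> \<rho> \<xi> \<le> y" for \<xi>
      proof
        assume "\<rho> \<xi> \<le> y"
        moreover have "0 \<le> \<rho> \<xi>" using \<rho> by (simp add: stopping_def)
        ultimately have "0 \<le> ereal r" using real order_trans by blast
        then show False using False by simp
      qed
      then have eq: "{\<xi>\<in>space P. \<rho> \<xi> \<le> y} = {}" by simp
      show ?thesis unfolding eq by simp
    qed
  next
    case MInf
    have eq: "{\<xi>\<in>space P. \<rho> \<xi> \<le> y} = {}" using \<rho> MInf by (auto simp: stopping_def)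
    show ?thesis unfolding eq by simp
  qed simp
qed

lemma final_measurable:
  assumes \<rho>: "stopping \<rho>"
  shows "final \<rho> \<in> borel_measurable P"
proof (rule borel_measurable_LIMSEQ_real)
  have [measurable]: "\<rho> \<in> borel_measurable P" "W 0 \<in> borel_measurable P" "stopped \<rho> (real i) \<in> borel_measurable P" for i
    using stopping_measurable[OF \<rho>] stopped_measurable_P[OF \<rho>] by auto
  show "(\<lambda>\<xi>. if \<rho> \<xi> = \<infinity> then W 0 \<xi> else stopped \<rho> (real i) \<xi>) \<in> borel_measurable P" for i by measurable
  show "(\<lambda>i. if \<rho> \<xi> = \<infinity> then W 0 \<xi> else stopped \<rho> (real i) \<xi>) \<longlonglongrightarrow> final \<rho> \<xi>" for \<xi>
    using stopped_eventually_final[OF \<rho>, of \<xi>] by (cases "\<rho> \<xi> = \<infinity>") (auto simp: final_def intro: tendsto_eventually)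
qed

lemma final_bounded:
  assumes \<rho>: "stopping \<rho>" "AE \<xi> in P. \<rho> \<xi> \<noteq> \<infinity>"
    and K: "\<And>u. 0 \<le> u \<Longrightarrow> AE \<xi> in P. \<bar>stopped \<rho> u \<xi>\<bar> \<le> K"
  shows "AE \<xi> in P. \<bar>final \<rho> \<xi>\<bar> \<le> K" "integrable P (final \<rho>)"
proof -
  have "AE \<xi> in P. \<forall>i. \<bar>stopped \<rho> (real i) \<xi>\<bar> \<le> K" using K by (simp add: AE_all_countable)
  then show *: "AE \<xi> in P. \<bar>final \<rho> \<xi>\<bar> \<le> K"
    using \<rho>(2)
  proof eventually_elim
    case (elim \<xi>)
    then obtain i where "stopped \<rho> (real i) \<xi> = final \<rho> \<xi>"
      using stopped_eventually_final[OF \<rho>(1)] by (meson eventually_sequentially order_refl)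
    then show ?case using elim(1) by metis
  qed
  show "integrable P (final \<rho>)"
    by (rule integrable_const_bound[where B=K]) (use * final_measurable[OF \<rho>(1)] in auto)
qed

lemma final_mean:
  assumes \<rho>: "stopping \<rho>" "AE \<xi> in P. \<rho> \<xi> \<noteq> \<infinity>"
    and K: "\<And>u. 0 \<le> u \<Longrightarrow> AE \<xi> in P. \<bar>stopped \<rho> u \<xi>\<bar> \<le> K"
    and t: "0 \<le> t" and A: "A \<in> sets (FW t)"
  shows "(\<integral>\<xi>. indicator A \<xi> * final \<rho> \<xi> \<partial>P) = (\<integral>\<xi>. indicator A \<xi> * stopped \<rho> t \<xi> \<partial>P)"
proof -
  have AP[measurable]: "A \<in> sets P" using A subalgebra_FW by (auto simp: subalgebra_def)
  have [measurable]: "final \<rho> \<in> borel_measurable P" "stopped \<rho> (real i) \<in> borel_measurable P" for i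
    using final_measurable[OF \<rho>(1)] stopped_measurable_P[OF \<rho>(1)] by auto
  have "(\<lambda>i. \<integral>\<xi>. indicator A \<xi> * stopped \<rho> (real i) \<xi> \<partial>P) \<longlonglongrightarrow> (\<integral>\<xi>. indicator A \<xi> * final \<rho> \<xi> \<partial>P)"
  proof (rule integral_dominated_convergence[where w="\<lambda>_. K"])
    show "AE \<xi> in P. (\<lambda>i. indicator A \<xi> * stopped \<rho> (real i) \<xi>) \<longlonglongrightarrow> indicator A \<xi> * final \<rho> \<xi>"
      using \<rho>(2) by eventually_elim (intro tendsto_mult tendsto_const tendsto_eventually stopped_eventually_final[OF \<rho>(1)])
    show "AE \<xi> in P. norm (indicator A \<xi> * stopped \<rho> (real i) \<xi>) \<le> K" for i
      using K[of "real i", OF of_nat_0_le_iff] by eventually_elim (auto split: split_indicator)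
  qed simp_all
  moreover have "\<forall>\<^sub>F i in sequentially. (\<integral>\<xi>. indicator A \<xi> * stopped \<rho> (real i) \<xi> \<partial>P) = (\<integral>\<xi>. indicator A \<xi> * stopped \<rho> t \<xi> \<partial>P)"
  proof -
    have "\<forall>\<^sub>F i in sequentially. t \<le> real i" by real_asymp
    then show ?thesis by eventually_elim (rule optional_stopping[OF \<rho>(1) t _ A K])
  qed
  then have "(\<lambda>i. \<integral>\<xi>. indicator A \<xi> * stopped \<rho> (real i) \<xi> \<partial>P) \<longlonglongrightarrow> (\<integral>\<xi>. indicator A \<xi> * stopped \<rho> t \<xi> \<partial>P)"
    by (rule tendsto_eventually)
  ultimately show ?thesis by (rule LIMSEQ_unique)
qed

lemma stopped_0: "stopping \<rho> \<Longrightarrow> stopped \<rho> 0 = W 0"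
proof
  fix \<xi> assume "stopping \<rho>"
  then have "clip \<rho> 0 \<xi> = 0" using clip_bounds[of \<rho> 0 \<xi>] by simp
  then show "stopped \<rho> 0 \<xi> = W 0 \<xi>" by (simp add: stopped_def)
qed

lemma final_mean_zero:
  assumes \<rho>: "stopping \<rho>" "AE \<xi> in P. \<rho> \<xi> \<noteq> \<infinity>"
    and K: "\<And>u. 0 \<le> u \<Longrightarrow> AE \<xi> in P. \<bar>stopped \<rho> u \<xi>\<bar> \<le> K"
  shows "(\<integral>\<xi>. final \<rho> \<xi> \<partial>P) = 0"
proof -
  have "space P \<in> sets (FW 0)" using sets.top[of "FW 0"] by simp
  from final_mean[OF \<rho> K order_refl this]
  have "(\<integral>\<xi>. indicator (space P) \<xi> * final \<rho> \<xi> \<partial>P) = (\<integral>\<xi>. indicator (space P) \<xi> * W 0 \<xi> \<partial>P)"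
    by (simp add: stopped_0[OF \<rho>(1)])
  also have "\<dots> = (\<integral>\<xi>. 0 \<partial>P)"
    by (intro integral_cong_AE) (use W_0 in \<open>auto elim: eventually_mono\<close>)
  also have "(\<integral>\<xi>. indicator (space P) \<xi> * final \<rho> \<xi> \<partial>P) = (\<integral>\<xi>. final \<rho> \<xi> \<partial>P)"
    by (intro Bochner_Integration.integral_cong refl) simp
  finally show ?thesis by simp
qed

end

section \<open>Exit from a box around the stopping region\<close>

locale azema_yor = brownian P W + target: atomless_target \<mu>
  for P :: "'a measure" and W :: "real \<Rightarrow> 'a \<Rightarrow> real" and \<mu> :: "real measure"
begin

abbreviation \<beta> :: "real \<Rightarrow> real" where "\<beta> \<equiv> barycenter \<mu>"
abbreviation mass :: "real \<Rightarrow> real" where "mass \<equiv> target.mass"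
abbreviation moment :: "real \<Rightarrow> real" where "moment \<equiv> target.moment"
abbreviation call :: "real \<Rightarrow> real" where "call \<equiv> target.call"

definition region :: "(real \<times> real) set" where
  "region = {(w, s). \<beta> w \<le> s}"

text \<open>The barriers at \<open>- n\<close> and \<open>s\<close> bound the stopped path, which
  makes optional stopping applicable.\<close>

definition box :: "real \<Rightarrow> real \<Rightarrow> (real \<times> real) set" where
  "box n s = region \<union> {z. fst z \<le> - n} \<union> {z. s \<le> fst z}"

lemma mem_box: "(w, m) \<in> box n s \<longleftrightarrow> \<beta> w \<le> m \<or> w \<le> - n \<or> s \<le> w"
  by (auto simp: box_def region_def)

text \<open>Where the tail has mass, \<beta> is continuous. Beyond the support \<beta> is 0 by
  default, so only a nonnegative second coordinate is required of the limit; this holds because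
  \<beta> is nonnegative everywhere.\<close>

lemma closed_region: "closed region"
  unfolding closed_sequential_limits
proof (intro allI impI, elim conjE)
  fix x :: "nat \<Rightarrow> real \<times> real" and l assume x: "\<forall>n. x n \<in> region" and lim: "x \<longlonglongrightarrow> l"
  have w: "(\<lambda>n. fst (x n)) \<longlonglongrightarrow> fst l" and s: "(\<lambda>n. snd (x n)) \<longlonglongrightarrow> snd l"
    using tendsto_fst[OF lim] tendsto_snd[OF lim] by auto
  have le: "\<beta> (fst (x n)) \<le> snd (x n)" for n using x by (auto simp: region_def split_beta)
  have "\<beta> (fst l) \<le> snd l"
  proof (cases "mass (fst l) > 0")
    case True
    from isCont_tendsto_compose[OF target.isCont_barycenter[OF True] w]
    show ?thesis by (rule LIMSEQ_le[OF _ s]) (use le in auto)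
  next
    case False
    then have "mass (fst l) = 0" using target.mass_nonneg[of "fst l"] by simp
    then have "\<beta> (fst l) = 0" by (simp add: target.barycenter_eq)
    moreover have "0 \<le> snd l"
    proof (rule LIMSEQ_le_const[OF s], intro exI allI impI)
      show "0 \<le> snd (x n)" for n using le[of n] target.barycenter_nonneg[of "fst (x n)"] by simp
    qed
    ultimately show ?thesis by simp
  qed
  then show "l \<in> region" by (simp add: region_def split_beta)
qed

lemma closed_box: "closed (box n s)"
  unfolding box_def
  by (intro closed_Un closed_region closed_Collect_le continuous_on_fst continuous_on_const continuous_on_id)

lemma region_nonempty: "region \<noteq> {}" and box_nonempty: "box n s \<noteq> {}"
proof -
  have "(0, \<beta> 0) \<in> region" by (simp add: region_def)
  then show "region \<noteq> {}" "box n s \<noteq> {}" by (auto simp: box_def)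
qed

abbreviation exit_time :: "real \<Rightarrow> real \<Rightarrow> 'a \<Rightarrow> ereal" where
  "exit_time n s \<equiv> hit (box n s)"

lemma stopping_exit_time: "stopping (exit_time n s)" and stopping_region: "stopping (hit region)"
  by (intro stopping_hit closed_box closed_region box_nonempty region_nonempty)+

lemma before_hit: "0 \<le> u \<Longrightarrow> ereal u < hit C \<xi> \<Longrightarrow> (W u \<xi>, S u \<xi>) \<notin> C"
proof
  assume u: "0 \<le> u" "ereal u < hit C \<xi>" and C: "(W u \<xi>, S u \<xi>) \<in> C"
  have "hit C \<xi> \<le> ereal u" unfolding hit_def using u C by (intro Inf_lower) auto
  then show False using u(2) by simp
qed

lemma exit_bounds:
  assumes \<xi>: "\<xi> \<in> space P" "W 0 \<xi> = 0" and n: "0 \<le> n" and s: "0 \<le> s"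
    and u: "0 \<le> u" "ereal u \<le> exit_time n s \<xi>"
  shows "- n \<le> W u \<xi>" "W u \<xi> \<le> s"
proof -
  have cont: "continuous_on {0..u} (\<lambda>t. W t \<xi>)" by (rule continuous_on_subset[OF W_continuous[OF \<xi>(1)]]) auto
  have inside: "- n < W t \<xi> \<and> W t \<xi> < s" if "0 \<le> t" "t < u" for t
  proof -
    have "ereal t < exit_time n s \<xi>" using that(2) u(2) by (metis less_ereal.simps(1) less_le_trans)
    then show ?thesis using before_hit[OF that(1), of "box n s" \<xi>] by (auto simp: mem_box)
  qed
  show "W u \<xi> \<le> s"
  proof (rule ccontr)
    assume *: "\<not> W u \<xi> \<le> s"
    then obtain t where "0 \<le> t" "t \<le> u" "W t \<xi> = s" using IVT'[of "\<lambda>t. W t \<xi>" 0 s u] \<xi> s u cont by auto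
    then show False using inside[of t] * by (cases "t = u") auto
  qed
  show "- n \<le> W u \<xi>"
  proof (rule ccontr)
    assume *: "\<not> - n \<le> W u \<xi>"
    then obtain t where "0 \<le> t" "t \<le> u" "W t \<xi> = - n" using IVT2'[of "\<lambda>t. W t \<xi>" u "- n" 0] \<xi> n u cont by auto
    then show False using inside[of t] * by (cases "t = u") auto
  qed
qed

lemma exit_time_finite: "AE \<xi> in P. exit_time n s \<xi> \<noteq> \<infinity>"
  using exits_interval[of "\<bar>n\<bar> + \<bar>s\<bar>"] AE_space
proof eventually_elim
  case (elim \<xi>)
  then obtain v where v: "0 \<le> v" "\<bar>n\<bar> + \<bar>s\<bar> < \<bar>W v \<xi>\<bar>" by blast
  then have "(W v \<xi>, S v \<xi>) \<in> box n s" unfolding mem_box by linarith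
  then have "exit_time n s \<xi> \<le> ereal v" using hit_le_iff[OF closed_box elim(2) v(1)] v(1) by auto
  then show ?case by auto
qed

lemma exit_stopped_bounds:
  assumes "0 \<le> n" "0 \<le> s" "0 \<le> u"
  shows "AE \<xi> in P. \<bar>stopped (exit_time n s) u \<xi>\<bar> \<le> max n s"
  using W_0 AE_space
proof eventually_elim
  case (elim \<xi>)
  have "ereal (clip (exit_time n s) u \<xi>) \<le> exit_time n s \<xi>"
    unfolding ereal_clip[OF stopping_exit_time assms(3)] by simp
  from exit_bounds[OF elim(2,1) assms(1,2) clip_bounds(1)[OF stopping_exit_time assms(3)] this]
  show ?case unfolding stopped_def by linarith
qed

abbreviation V :: "real \<Rightarrow> real \<Rightarrow> 'a \<Rightarrow> real" where
  "V n s \<equiv> final (exit_time n s)"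

lemma V_cases:
  assumes "\<xi> \<in> space P" "exit_time n s \<xi> \<noteq> \<infinity>"
  obtains r where "0 \<le> r" "exit_time n s \<xi> = ereal r" "V n s \<xi> = W r \<xi>" "(W r \<xi>, S r \<xi>) \<in> box n s"
    "\<And>u. 0 \<le> u \<Longrightarrow> u < r \<Longrightarrow> (W u \<xi>, S u \<xi>) \<notin> box n s"
  using closed_box assms(1)
proof (cases rule: hit_cases[of "box n s"])
  case never
  then show thesis using assms(2) by simp
next
  case (at r)
  then show thesis using that[of r] by (simp add: final_def)
qed

lemma V_measurable [measurable]: "V n s \<in> borel_measurable P"
  by (rule final_measurable[OF stopping_exit_time])

lemma V_integrable: "0 \<le> n \<Longrightarrow> 0 \<le> s \<Longrightarrow> integrable P (V n s)"
  and V_mean: "0 \<le> n \<Longrightarrow> 0 \<le> s \<Longrightarrow> (\<integral>\<xi>. V n s \<xi> \<partial>P) = 0"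
  by (rule final_bounded[OF stopping_exit_time exit_time_finite] final_mean_zero[OF stopping_exit_time exit_time_finite],
      erule (2) exit_stopped_bounds)+

lemma V_bounds:
  assumes "0 \<le> n" "0 \<le> s"
  shows "AE \<xi> in P. - n \<le> V n s \<xi> \<and> V n s \<xi> \<le> s"
  using W_0 exit_time_finite[of n s] AE_space
proof eventually_elim
  case (elim \<xi>)
  obtain r where "0 \<le> r" "exit_time n s \<xi> = ereal r" "V n s \<xi> = W r \<xi>" by (rule V_cases[OF elim(3,2)]) blast
  then show ?case using exit_bounds[OF elim(3,1) assms, of r] by simp
qed

text \<open>
  Up to the exit time from the smaller box the two stopping rules coincide. If the path leaves
  the smaller box through its top \<open>\<beta> k\<close>, it cannot return below \<open>k\<close> without meeting
  the region at the point \<open>(k, S)\<close> with \<open>S \<ge> \<beta> k\<close>.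
\<close>

lemma exit_comparison:
  assumes \<xi>: "\<xi> \<in> space P" and k: "mass k > 0" "- n < k" "\<beta> k \<le> s"
    and fin: "exit_time n s \<xi> \<noteq> \<infinity>" "exit_time n (\<beta> k) \<xi> \<noteq> \<infinity>"
  shows "\<beta> k \<le> V n (\<beta> k) \<xi> \<Longrightarrow> k \<le> V n s \<xi>"
    and "V n (\<beta> k) \<xi> < \<beta> k \<Longrightarrow> V n s \<xi> = V n (\<beta> k) \<xi> \<and> V n s \<xi> < k"
proof -
  obtain r where r: "0 \<le> r" "exit_time n s \<xi> = ereal r" "V n s \<xi> = W r \<xi>" "(W r \<xi>, S r \<xi>) \<in> box n s"
    "\<And>u. 0 \<le> u \<Longrightarrow> u < r \<Longrightarrow> (W u \<xi>, S u \<xi>) \<notin> box n s"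
    by (rule V_cases[OF \<xi> fin(1)]) blast
  obtain r' where r': "0 \<le> r'" "exit_time n (\<beta> k) \<xi> = ereal r'" "V n (\<beta> k) \<xi> = W r' \<xi>"
    "(W r' \<xi>, S r' \<xi>) \<in> box n (\<beta> k)" "\<And>u. 0 \<le> u \<Longrightarrow> u < r' \<Longrightarrow> (W u \<xi>, S u \<xi>) \<notin> box n (\<beta> k)"
    by (rule V_cases[OF \<xi> fin(2)]) blast
  have kb: "k < \<beta> k" by (rule target.barycenter_greater[OF k(1)])
  have "box n s \<subseteq> box n (\<beta> k)" using k(3) by (auto simp: box_def)
  from hit_mono[OF this, of \<xi>] have le: "r' \<le> r" by (simp add: r(2) r'(2))
  show "k \<le> V n s \<xi>" if "\<beta> k \<le> V n (\<beta> k) \<xi>"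
  proof (rule ccontr)
    assume "\<not> k \<le> V n s \<xi>"
    then have neg: "W r \<xi> < k" using r(3) by simp
    have "continuous_on {r'..r} (\<lambda>t. W t \<xi>)" by (rule continuous_on_subset[OF W_continuous[OF \<xi>]]) (use r' in auto)
    moreover have "k \<le> W r' \<xi>" using that r'(3) kb by simp
    ultimately obtain u where u: "r' \<le> u" "u \<le> r" "W u \<xi> = k"
      using IVT2'[of "\<lambda>t. W t \<xi>" r k r'] neg le by auto
    have "\<beta> (W u \<xi>) \<le> S u \<xi>" using S_upper[OF \<xi> r'(1) u(1)] that r'(3) u(3) by simp
    moreover have "u < r" using u neg by (cases "u = r") auto
    ultimately show False using r(5)[of u] u r'(1) by (simp add: mem_box)
  qed
  show "V n s \<xi> = V n (\<beta> k) \<xi> \<and> V n s \<xi> < k" if *: "V n (\<beta> k) \<xi> < \<beta> k"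
  proof -
    have "(W r' \<xi>, S r' \<xi>) \<in> box n s" using r'(3,4) * by (auto simp: mem_box)
    then have "exit_time n s \<xi> \<le> ereal r'" using hit_le_iff[OF closed_box \<xi> r'(1)] r'(1) by auto
    then have eq: "r = r'" using le r(2) by simp
    obtain u where u: "0 \<le> u" "u \<le> r'" "S r' \<xi> = W u \<xi>" by (rule S_attained[OF \<xi> r'(1)])
    have Sb: "S r' \<xi> < \<beta> k" using u r'(5)[of u] r'(3) * by (cases "u = r'") (auto simp: mem_box)
    have "V n s \<xi> < k"
    proof (rule ccontr)
      assume "\<not> V n s \<xi> < k"
      then have kW: "k \<le> W r' \<xi>" using r(3) eq by simp
      then have region: "\<beta> (W r' \<xi>) \<le> S r' \<xi>" using r'(3,4) * k(2) by (auto simp: mem_box)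
      \<comment> \<open>Monotonicity of \<beta> requires mass beyond \<open>W r' \<xi>\<close>; it
        exists since this point lies below \<open>\<beta> k\<close>.\<close>
      have "mass (\<beta> k) \<le> mass (W r' \<xi>)" using * r'(3) by (intro target.mass_antimono) simp
      then have "mass (W r' \<xi>) > 0" using target.mass_barycenter_pos[OF k(1)] by simp
      from target.barycenter_mono[OF kW this] show False using region Sb by simp
    qed
    then show ?thesis using r(3) r'(3) eq by simp
  qed
qed

definition tail :: "real \<Rightarrow> real \<Rightarrow> real \<Rightarrow> real" where
  "tail n s k = prob {\<xi>\<in>space P. k \<le> V n s \<xi>}"

text \<open>Let V' be the value for the smaller box with top \<open>\<beta> k\<close>. If that box
  is left through its top, then V \<ge> k and V' = \<beta> k; otherwise V = V' < k. In both cases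
  1{V \<ge> k} V = V - V' + \<beta> k 1{V \<ge> k}, and V and V' have mean zero.\<close>

lemma exit_tail_mean:
  assumes n: "0 < n" and k: "mass k > 0" "- n < k" "\<beta> k \<le> s"
  shows "(\<integral>\<xi>. indicator {\<xi>\<in>space P. k \<le> V n s \<xi>} \<xi> * V n s \<xi> \<partial>P) = \<beta> k * tail n s k"
proof -
  have b: "0 \<le> \<beta> k" "0 \<le> s" using target.barycenter_nonneg[of k] k(3) by auto
  let ?I = "indicator {\<xi>\<in>space P. k \<le> V n s \<xi>} :: 'a \<Rightarrow> real"
  have I: "{\<xi>\<in>space P. k \<le> V n s \<xi>} \<in> sets P" by measurable
  have iI: "integrable P ?I" using I by (simp add: emeasure_eq_measure)
  have "(\<integral>\<xi>. ?I \<xi> * V n s \<xi> \<partial>P) = (\<integral>\<xi>. V n s \<xi> - V n (\<beta> k) \<xi> + \<beta> k * ?I \<xi> \<partial>P)"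
  proof (rule integral_cong_AE)
    show "AE \<xi> in P. ?I \<xi> * V n s \<xi> = V n s \<xi> - V n (\<beta> k) \<xi> + \<beta> k * ?I \<xi>"
      using exit_time_finite[of n s] exit_time_finite[of n "\<beta> k"] V_bounds[OF less_imp_le[OF n] b(1)] AE_space
    proof eventually_elim
      case (elim \<xi>)
      note comparison = exit_comparison[OF elim(4) k elim(1,2)]
      show ?case
      proof (cases "V n (\<beta> k) \<xi> < \<beta> k")
        case True
        then show ?thesis using comparison(2) by simp
      next
        case False
        then have "V n (\<beta> k) \<xi> = \<beta> k" using elim(3) by simp
        then show ?thesis using comparison(1) elim(4) by simp
      qed
    qed
  qed (use I in measurable)
  also have "\<dots> = (\<integral>\<xi>. V n s \<xi> \<partial>P) - (\<integral>\<xi>. V n (\<beta> k) \<xi> \<partial>P) + \<beta> k * (\<integral>\<xi>. ?I \<xi> \<partial>P)"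
    using V_integrable n b iI by (simp add: Bochner_Integration.integral_add Bochner_Integration.integral_diff)
  also have "\<dots> = \<beta> k * tail n s k" using V_mean n b I by (simp add: tail_def)
  finally show ?thesis .
qed

lemma exit_call:
  assumes n: "0 < n" and k: "mass k > 0" "- n < k" "\<beta> k \<le> s"
  shows "(\<integral>\<xi>. max 0 (V n s \<xi> - k) \<partial>P) = (\<beta> k - k) * tail n s k"
proof -
  let ?I = "indicator {\<xi>\<in>space P. k \<le> V n s \<xi>} :: 'a \<Rightarrow> real"
  have I: "{\<xi>\<in>space P. k \<le> V n s \<xi>} \<in> sets P" by measurable
  have "0 \<le> s" using target.barycenter_nonneg[of k] k(3) by simp
  then have "integrable P (V n s)" using V_integrable n by simp
  from integrable_mult_indicator[OF I this] have int: "integrable P (\<lambda>\<xi>. ?I \<xi> * V n s \<xi>)" by simp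
  have iI: "integrable P (\<lambda>\<xi>. ?I \<xi> * k)" using I by (simp add: emeasure_eq_measure)
  have "(\<integral>\<xi>. max 0 (V n s \<xi> - k) \<partial>P) = (\<integral>\<xi>. ?I \<xi> * V n s \<xi> - ?I \<xi> * k \<partial>P)"
    by (intro Bochner_Integration.integral_cong refl) (auto simp: indicator_def)
  also have "\<dots> = \<beta> k * tail n s k - tail n s k * k"
    unfolding Bochner_Integration.integral_diff[OF int iI] exit_tail_mean[OF assms] using I by (simp add: tail_def)
  finally show ?thesis by (simp add: algebra_simps)
qed

lemma target_call_increment:
  assumes "k \<le> k'"
  shows "mass k' * (k' - k) \<le> call k - call k'" "call k - call k' \<le> mass k * (k' - k)"
  using target.call_increment[OF target.integrable_id assms]
  by (simp_all add: target.call_eq target.mass_def atLeast_def)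

text \<open>The tail of the stopped value and \<open>mass\<close> solve the same equation (e f)' = -
  f with e k = \<beta> k - k, so they are proportional. The factor is read off at the lower barrier:
  the stopped value is at least \<open>- n\<close> with mean zero, so its call value there is
  \<open>n\<close>, against \<open>call (- n)\<close> for the target. The barrier is approached from
  above, because \<open>exit_call\<close> holds for k > - n only.\<close>

lemma exit_tail:
  assumes n: "0 < n" and b: "mass b > 0" and k: "- n < k" "k \<le> b"
  shows "tail n (\<beta> b) k * call (- n) = n * mass k"
proof -
  let ?s = "\<beta> b" and ?C = "\<lambda>k. \<integral>\<xi>. max 0 (V n (\<beta> b) \<xi> - k) \<partial>P"
  have s: "0 \<le> ?s" by (rule target.barycenter_nonneg)
  have iV: "integrable P (V n ?s)" using V_integrable n s by simp
  have pos: "mass l > 0" if "l \<le> b" for l using target.mass_antimono[OF that] b by simp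
  have le: "\<beta> l \<le> ?s" if "l \<le> b" for l by (rule target.barycenter_mono[OF that b])
  have C: "?C l = (\<beta> l - l) * tail n ?s l" if "- n < l" "l \<le> b" for l
    by (rule exit_call[OF n pos that(1) le]) (use that in auto)
  have inc: "tail n ?s l' * (l' - l) \<le> ?C l - ?C l' \<and> ?C l - ?C l' \<le> tail n ?s l * (l' - l)" if "l \<le> l'" for l l'
    unfolding tail_def using call_increment[OF iV that] by auto
  have eq: "?C a * mass k = tail n ?s k * call a" if a: "- n < a" "a \<le> k" for a
  proof -
    have "tail n ?s a * mass k = tail n ?s k * mass a"
    proof (rule proportional_tails[where e="\<lambda>l. \<beta> l - l"])
      show "0 < \<beta> l - l" if "l \<le> k" for l using target.barycenter_greater[OF pos[of l]] that k by simp
      show "continuous_on {a..k} (\<lambda>l. \<beta> l - l)"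
        using k by (intro continuous_intros continuous_at_imp_continuous_on ballI target.isCont_barycenter pos) auto
      show "0 \<le> tail n ?s l" for l by (simp add: tail_def)
      show "0 < mass l" if "l \<le> k" for l using pos[of l] that k by simp
      fix l l' assume l: "a \<le> l" "l \<le> l'" "l' \<le> k"
      show "tail n ?s l' * (l' - l) \<le> (\<beta> l - l) * tail n ?s l - (\<beta> l' - l') * tail n ?s l' \<and>
          (\<beta> l - l) * tail n ?s l - (\<beta> l' - l') * tail n ?s l' \<le> tail n ?s l * (l' - l)"
        using inc[OF l(2)] C[of l] C[of l'] l a k by auto
      show "mass l' * (l' - l) \<le> (\<beta> l - l) * mass l - (\<beta> l' - l') * mass l' \<and>
          (\<beta> l - l) * mass l - (\<beta> l' - l') * mass l' \<le> mass l * (l' - l)"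
        using target_call_increment[OF l(2)] by (simp add: target.call_eq_barycenter)
    qed (use a in auto)
    then show ?thesis using C[of a] a k by (simp add: target.call_eq_barycenter mult_ac)
  qed
  have Cn: "?C (- n) = n"
  proof -
    have "?C (- n) = (\<integral>\<xi>. V n ?s \<xi> + n \<partial>P)"
      by (intro integral_cong_AE) (use V_bounds[of n ?s] n s in \<open>auto elim: eventually_mono\<close>)
    also have "\<dots> = n" using iV V_mean[of n ?s] n s prob_space by simp
    finally show ?thesis .
  qed
  have tail1: "tail n ?s l \<le> 1" "0 \<le> tail n ?s l" for l by (simp_all add: tail_def)
  \<comment> \<open>Call values change at rate at most 1, so replacing \<open>- n\<close> by
    \<open>- n + \<epsilon>\<close> costs at most \<epsilon> on either side.\<close>
  have close: "\<bar>n * mass k - tail n ?s k * call (- n)\<bar> \<le> 2 * \<epsilon>" if \<epsilon>: "0 < \<epsilon>" "- n + \<epsilon> \<le> k" for \<epsilon>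
  proof -
    let ?a = "- n + \<epsilon>"
    have h: "?a - - n = \<epsilon>" "- n \<le> ?a" using \<epsilon> by simp_all
    have "0 \<le> tail n ?s ?a * \<epsilon>" "tail n ?s (- n) * \<epsilon> \<le> 1 * \<epsilon>" "0 \<le> mass ?a * \<epsilon>" "mass (- n) * \<epsilon> \<le> 1 * \<epsilon>"
      using tail1 target.mass_nonneg target.mass_le_1 \<epsilon> by (auto intro!: mult_nonneg_nonneg mult_right_mono simp del: mult_1)
    then have c1: "0 \<le> ?C (- n) - ?C ?a" "?C (- n) - ?C ?a \<le> \<epsilon>" and c2: "0 \<le> call (- n) - call ?a" "call (- n) - call ?a \<le> \<epsilon>"
      using inc[OF h(2)] target_call_increment[OF h(2)] unfolding h(1) by linarith+
    have "n * mass k - tail n ?s k * call (- n) = (?C (- n) - ?C ?a) * mass k - tail n ?s k * (call (- n) - call ?a)"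
      using eq[of ?a] \<epsilon> Cn by (simp add: algebra_simps)
    moreover have "\<bar>(?C (- n) - ?C ?a) * mass k\<bar> \<le> \<epsilon> * 1"
      unfolding abs_mult using c1 target.mass_le_1[of k] target.mass_nonneg[of k] \<epsilon> by (intro mult_mono) auto
    moreover have "\<bar>tail n ?s k * (call (- n) - call ?a)\<bar> \<le> 1 * \<epsilon>"
      unfolding abs_mult using c2 tail1[of k] \<epsilon> by (intro mult_mono) auto
    ultimately show ?thesis by linarith
  qed
  have "\<bar>n * mass k - tail n ?s k * call (- n)\<bar> \<le> 0"
  proof (rule field_le_epsilon)
    fix e :: real assume e: "0 < e"
    let ?\<epsilon> = "min (e / 2) (k + n)"
    have "\<bar>n * mass k - tail n ?s k * call (- n)\<bar> \<le> 2 * ?\<epsilon>" by (rule close) (use e k in auto)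
    moreover have "?\<epsilon> \<le> e / 2" by (rule min.cobounded1)
    ultimately show "\<bar>n * mass k - tail n ?s k * call (- n)\<bar> \<le> 0 + e" by (simp only: field_simps)
  qed
  then show ?thesis by simp
qed

lemma call_ge: "0 < n \<Longrightarrow> n \<le> call (- n)"
proof -
  assume n: "0 < n"
  have "(\<integral>x. x + n \<partial>\<mu>) \<le> (\<integral>x. max 0 (x - - n) \<partial>\<mu>)"
    by (intro integral_mono target.integrable_pos_part) (auto intro: target.integrable_id)
  then show ?thesis using target.integrable_id target.mean_zero target.prob_space by (simp add: target.call_eq)
qed

text \<open>As \<open>k\<close> decreases to \<open>- n\<close> in \<open>exit_tail\<close>, the
  tail tends to n mass (- n) / call (- n). At most moment (- n) / call (- n) of the total
  probability is left for the barrier, and call (- n) \<ge> n.\<close>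

lemma exit_below:
  assumes n: "0 < n" and b: "mass b > 0" "- n < b"
  shows "n * prob {\<xi>\<in>space P. V n (\<beta> b) \<xi> \<le> - n} \<le> moment (- n)"
proof -
  let ?q = "prob {\<xi>\<in>space P. V n (\<beta> b) \<xi> \<le> - n}" and ?c = "call (- n)"
  have c: "n \<le> ?c" by (rule call_ge[OF n])
  have le: "?c * ?q \<le> ?c - n * mass k" if k: "- n < k" "k \<le> b" for k
  proof -
    have "?q + tail n (\<beta> b) k = prob ({\<xi>\<in>space P. V n (\<beta> b) \<xi> \<le> - n} \<union> {\<xi>\<in>space P. k \<le> V n (\<beta> b) \<xi>})"
      unfolding tail_def by (rule finite_measure_Union[symmetric]) (use k in auto)
    also have "\<dots> \<le> 1" by (rule prob_le_1)
    finally have "?c * (?q + tail n (\<beta> b) k) \<le> ?c * 1" using c n by (intro mult_left_mono) auto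
    then show ?thesis using exit_tail[OF n b(1) k] by (simp add: algebra_simps)
  qed
  have "((\<lambda>k. ?c - n * mass k) \<longlongrightarrow> ?c - n * mass (- n)) (at_right (- n))"
    using target.isCont_mass[of "- n"] by (intro tendsto_intros) (auto simp: isCont_def intro: filterlim_mono at_le)
  moreover have "\<forall>\<^sub>F k in at_right (- n). ?c * ?q \<le> ?c - n * mass k"
    unfolding eventually_at_right_field using b(2) le by (intro exI[of _ b]) auto
  ultimately have "?c * ?q \<le> ?c - n * mass (- n)" by (rule tendsto_lowerbound) simp
  moreover have "n * ?q \<le> ?c * ?q" using c by (intro mult_right_mono) auto
  ultimately show ?thesis by (simp add: target.call_def)
qed

text \<open>The proportionality factor n / call (- n) is at most 1, so the tail of the stopped value
  at \<open>b\<close> is at most that of the target.\<close>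

lemma exit_above:
  assumes n: "0 < n" and b: "mass b > 0" "- n < b"
  shows "\<beta> b * prob {\<xi>\<in>space P. b \<le> V n (\<beta> b) \<xi>} \<le> moment b" "prob {\<xi>\<in>space P. b \<le> V n (\<beta> b) \<xi>} \<le> mass b"
proof -
  let ?p = "tail n (\<beta> b) b"
  have "n * ?p \<le> call (- n) * ?p" using call_ge[OF n] by (intro mult_right_mono) (auto simp: tail_def)
  then have p: "?p \<le> mass b" using exit_tail[OF n b(1) b(2) order_refl] n by (simp add: mult.commute)
  then show "prob {\<xi>\<in>space P. b \<le> V n (\<beta> b) \<xi>} \<le> mass b" by (simp add: tail_def)
  show "\<beta> b * prob {\<xi>\<in>space P. b \<le> V n (\<beta> b) \<xi>} \<le> moment b"
    using mult_left_mono[OF p target.barycenter_nonneg[of b]] by (simp add: target.moment_eq tail_def)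
qed

end

subsection \<open>The Azema--Yor stopping time\<close>

text \<open>The tops of the boxes are barycenters of points with mass beyond them. When the support
  is bounded above, the sequence must therefore approach its right end strictly from the
  left.\<close>

lemma (in atomless_target) exhausting_sequence:
  obtains b :: "nat \<Rightarrow> real" where "incseq b" "\<And>j. 0 \<le> b j" "\<And>j. mass (b j) > 0"
    "(\<lambda>j. mass (b j)) \<longlonglongrightarrow> 0" "(\<lambda>j. moment (b j)) \<longlonglongrightarrow> 0"
proof (cases "\<forall>k. mass k > 0")
  case True
  have "incseq real" by (simp add: incseq_def)
  moreover have "(\<lambda>j. mass (real j)) \<longlonglongrightarrow> 0" "(\<lambda>j. moment (real j)) \<longlonglongrightarrow> 0"
    by (rule filterlim_compose[OF _ filterlim_real_sequentially], rule mass_at_top moment_at_top)+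
  ultimately show thesis using True that[of real] by simp
next
  case False
  let ?Z = "{k. mass k \<le> 0}"
  have ne: "?Z \<noteq> {}" using False by (auto simp: not_less)
  have "continuous_on UNIV mass" using isCont_mass by (simp add: continuous_on_eq_continuous_at)
  then have "closed ?Z" by (intro closed_Collect_le continuous_on_const) auto
  moreover have bdd: "bdd_below ?Z"
  proof (rule bdd_belowI)
    show "0 \<le> x" if "x \<in> ?Z" for x using mass_greater_0_if_nonpos[of x] that by (cases "x \<le> 0") auto
  qed
  ultimately have "Inf ?Z \<in> ?Z" using closed_contains_Inf[OF ne] by blast
  define B where "B = Inf ?Z"
  have B: "mass B = 0" using \<open>Inf ?Z \<in> ?Z\<close> mass_nonneg[of B] by (simp add: B_def)
  have pos: "mass k > 0" if "k < B" for k
    using cInf_lower[OF _ bdd, of k] that by (auto simp: B_def not_le[symmetric])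
  have B0: "0 < B" using mass_greater_0_if_nonpos[of B] B by force
  define b where "b j = B - B / real (Suc j)" for j
  have "(\<lambda>j. B - B * (1 / real (Suc j))) \<longlonglongrightarrow> B - B * 0"
    by (intro tendsto_diff tendsto_mult tendsto_const LIMSEQ_Suc lim_1_over_n)
  then have lim: "b \<longlonglongrightarrow> B" by (simp add: b_def[abs_def])
  have less: "b j < B" for j using B0 by (simp add: b_def)
  show thesis
  proof (rule that[of b])
    show "incseq b" unfolding b_def using B0 by (intro incseq_SucI diff_left_mono divide_left_mono) auto
    show "0 \<le> b j" for j
      using B0 by (simp add: b_def divide_le_eq mult_le_cancel_left1 del: of_nat_Suc)
    show "mass (b j) > 0" for j by (rule pos[OF less])
    show "(\<lambda>j. mass (b j)) \<longlonglongrightarrow> 0" using isCont_tendsto_compose[OF isCont_mass lim] B by simp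
    show "(\<lambda>j. moment (b j)) \<longlonglongrightarrow> 0" using isCont_tendsto_compose[OF isCont_moment lim] B by (simp add: moment_eq)
  qed
qed

section \<open>Convergence along growing boxes\<close>

context azema_yor
begin

context
  fixes b :: "nat \<Rightarrow> real"
  assumes b_inc: "incseq b" and b_nonneg: "\<And>j. 0 \<le> b j" and b_pos: "\<And>j. mass (b j) > 0"
    and b_mass: "(\<lambda>j. mass (b j)) \<longlonglongrightarrow> 0" and b_moment: "(\<lambda>j. moment (b j)) \<longlonglongrightarrow> 0"
begin

private abbreviation "n j \<equiv> real (Suc j)"
private abbreviation "R j \<equiv> exit_time (n j) (\<beta> (b j))"
private abbreviation "VR j \<equiv> V (n j) (\<beta> (b j))"
private abbreviation "\<tau> \<equiv> hit region"
private abbreviation "E j \<equiv> {\<xi>\<in>space P. R j \<xi> < \<tau> \<xi>}"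

lemma R_mono: "i \<le> j \<Longrightarrow> R i \<xi> \<le> R j \<xi>"
proof (rule hit_mono)
  assume ij: "i \<le> j"
  then have "\<beta> (b i) \<le> \<beta> (b j)" using b_inc by (intro target.barycenter_mono b_pos) (auto simp: incseq_def)
  then show "box (n j) (\<beta> (b j)) \<subseteq> box (n i) (\<beta> (b i))" using ij by (auto simp: box_def)
qed

lemma R_le: "R j \<xi> \<le> \<tau> \<xi>"
  by (rule hit_mono) (auto simp: box_def)

lemma R_finite: "AE \<xi> in P. \<forall>j. R j \<xi> \<noteq> \<infinity>"
  using exit_time_finite by (simp add: AE_all_countable)

lemma E_sets [measurable]: "E j \<in> sets P"
  using stopping_measurable[OF stopping_exit_time] stopping_measurable[OF stopping_region]
  by (intro borel_measurable_less)

lemma eq_outside_E: "\<xi> \<in> space P \<Longrightarrow> \<xi> \<notin> E j \<Longrightarrow> R j \<xi> = \<tau> \<xi>"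
  using R_le[of j \<xi>] by auto

lemma exit_on_E:
  assumes "\<xi> \<in> E j" "R j \<xi> \<noteq> \<infinity>"
  shows "VR j \<xi> \<le> - n j \<or> \<beta> (b j) \<le> VR j \<xi>"
proof -
  have \<xi>: "\<xi> \<in> space P" and less: "R j \<xi> < \<tau> \<xi>" using assms(1) by auto
  obtain r where r: "0 \<le> r" "R j \<xi> = ereal r" "VR j \<xi> = W r \<xi>" "(W r \<xi>, S r \<xi>) \<in> box (n j) (\<beta> (b j))"
    by (rule V_cases[OF \<xi> assms(2)]) blast
  have "(W r \<xi>, S r \<xi>) \<notin> region" using less r(1,2) by (intro before_hit) auto
  then show ?thesis using r(3,4) by (auto simp: box_def)
qed

text \<open>On \<open>E j\<close> the stopped value is one of the two barriers, whose shares are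
  estimated by \<open>exit_below\<close> and \<open>exit_above\<close>. The bounds vanish in the
  limit, which takes the place of uniform boundedness.\<close>

lemma
  shows E_mean: "(\<integral>\<xi>. indicator (E j) \<xi> * \<bar>VR j \<xi>\<bar> \<partial>P) \<le> moment (- n j) + moment (b j)"
    and E_prob: "prob (E j) \<le> moment (- n j) + mass (b j)"
proof -
  let ?s = "\<beta> (b j)" and ?L = "{\<xi>\<in>space P. VR j \<xi> \<le> - n j}" and ?U = "{\<xi>\<in>space P. b j \<le> VR j \<xi>}"
  have s: "0 \<le> ?s" by (rule target.barycenter_nonneg)
  have bs: "b j < ?s" by (rule target.barycenter_greater[OF b_pos])
  have nb: "0 < n j" "- n j < b j" using b_nonneg[of j] by (auto simp del: of_nat_Suc intro: less_le_trans[of _ 0])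
  have below: "n j * prob ?L \<le> moment (- n j)" by (rule exit_below[OF nb(1) b_pos nb(2)])
  have above: "?s * prob ?U \<le> moment (b j)" "prob ?U \<le> mass (b j)" using exit_above[OF nb(1) b_pos nb(2)] by auto
  have LU[measurable]: "?L \<in> sets P" "?U \<in> sets P" by measurable
  have out: "AE \<xi> in P. \<xi> \<in> E j \<longrightarrow> VR j \<xi> = - n j \<and> \<xi> \<in> ?L \<or> VR j \<xi> = ?s \<and> \<xi> \<in> ?U"
    using R_finite V_bounds[OF less_imp_le[OF nb(1)] s] AE_space
  proof eventually_elim
    case (elim \<xi>)
    show ?case using exit_on_E[of \<xi> j] elim bs by (auto simp del: of_nat_Suc)
  qed
  have iV: "integrable P (VR j)" using V_integrable[OF less_imp_le[OF nb(1)] s] .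
  have int: "integrable P (\<lambda>\<xi>. c * indicator ?L \<xi> + d * indicator ?U \<xi>)" for c d :: real
    by (intro Bochner_Integration.integrable_add integrable_mult_right integrable_real_indicator LU)
       (simp_all add: emeasure_eq_measure)
  have eq: "(\<integral>\<xi>. c * indicator ?L \<xi> + d * indicator ?U \<xi> \<partial>P) = c * prob ?L + d * prob ?U" for c d :: real
    using LU by (subst Bochner_Integration.integral_add)
      (auto intro!: integrable_mult_right integrable_real_indicator simp: emeasure_eq_measure simp del: of_nat_Suc)
  have "(\<integral>\<xi>. indicator (E j) \<xi> * \<bar>VR j \<xi>\<bar> \<partial>P) \<le> (\<integral>\<xi>. n j * indicator ?L \<xi> + ?s * indicator ?U \<xi> \<partial>P)"
  proof (rule integral_mono_AE)
    show "integrable P (\<lambda>\<xi>. indicator (E j) \<xi> * \<bar>VR j \<xi>\<bar>)"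
      using integrable_mult_indicator[OF E_sets integrable_abs[OF iV]] by simp
    show "AE \<xi> in P. indicator (E j) \<xi> * \<bar>VR j \<xi>\<bar> \<le> n j * indicator ?L \<xi> + ?s * indicator ?U \<xi>"
      using out by eventually_elim (use s nb in \<open>auto simp: indicator_def simp del: of_nat_Suc\<close>)
  qed (rule int)
  then show "(\<integral>\<xi>. indicator (E j) \<xi> * \<bar>VR j \<xi>\<bar> \<partial>P) \<le> moment (- n j) + moment (b j)"
    unfolding eq using below above(1) by linarith
  have "(\<integral>\<xi>. (indicator (E j) \<xi> :: real) \<partial>P) \<le> (\<integral>\<xi>. 1 * indicator ?L \<xi> + 1 * indicator ?U \<xi> \<partial>P)"
  proof (rule integral_mono_AE)
    show "integrable P (indicator (E j) :: 'a \<Rightarrow> real)"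
      by (intro integrable_real_indicator E_sets) (simp add: emeasure_eq_measure)
    show "AE \<xi> in P. (indicator (E j) \<xi> :: real) \<le> 1 * indicator ?L \<xi> + 1 * indicator ?U \<xi>"
      using out by eventually_elim (auto simp: indicator_def simp del: of_nat_Suc)
  qed (rule int)
  then have "prob (E j) \<le> prob ?L + prob ?U" unfolding eq using E_sets[of j] by simp
  moreover have "1 * prob ?L \<le> n j * prob ?L" by (intro mult_right_mono) auto
  ultimately show "prob (E j) \<le> moment (- n j) + mass (b j)" using below above(2) by linarith
qed

lemma minus_n_at_bot: "filterlim (\<lambda>j. - n j) at_bot sequentially"
  by real_asymp

lemma E_mean_tendsto: "(\<lambda>j. moment (- n j) + moment (b j)) \<longlonglongrightarrow> 0"
  and E_prob_tendsto: "(\<lambda>j. moment (- n j) + mass (b j)) \<longlonglongrightarrow> 0"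
  using tendsto_add[OF filterlim_compose[OF target.moment_at_bot minus_n_at_bot] b_moment]
    tendsto_add[OF filterlim_compose[OF target.moment_at_bot minus_n_at_bot] b_mass]
  by simp_all

text \<open>The exit times increase with \<open>j\<close>, so the events \<open>E j\<close>
  decrease, and their probabilities tend to 0.\<close>

lemma eventually_outside_E: "AE \<xi> in P. \<forall>\<^sub>F j in sequentially. \<xi> \<notin> E j"
proof -
  have "prob (\<Inter>j. E j) \<le> moment (- n j) + mass (b j)" for j
  proof -
    have "prob (\<Inter>j. E j) \<le> prob (E j)" by (rule finite_measure_mono[OF _ E_sets]) blast
    then show ?thesis using E_prob by (rule order_trans)
  qed
  then have "prob (\<Inter>j. E j) \<le> 0" by (intro LIMSEQ_le_const[OF E_prob_tendsto]) blast
  then have "prob (\<Inter>j. E j) = 0" by (intro antisym measure_nonneg)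
  moreover have "(\<Inter>j. E j) \<in> sets P" by (rule sets.countable_INT) (use E_sets in auto)
  ultimately have "AE \<xi> in P. \<xi> \<notin> (\<Inter>j. E j)"
    by (intro AE_not_in null_setsI) (simp_all add: emeasure_eq_measure)
  then show ?thesis
  proof eventually_elim
    case (elim \<xi>)
    then obtain j where j: "\<xi> \<notin> E j" by blast
    have "\<xi> \<notin> E i" if "j \<le> i" for i
      using j R_mono[OF that, of \<xi>] by (auto dest: le_less_trans)
    then show ?case by (auto simp: eventually_sequentially)
  qed
qed

lemma \<tau>_finite: "AE \<xi> in P. \<tau> \<xi> \<noteq> \<infinity>"
  using eventually_outside_E R_finite AE_space
proof eventually_elim
  case (elim \<xi>)
  then obtain j where "\<xi> \<notin> E j" by (meson eventually_sequentially order_refl)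
  then show ?case using eq_outside_E[OF elim(3)] elim(2) by metis
qed

lemma indicator_E_tendsto:
  fixes Y :: "'a \<Rightarrow> real"
  assumes Y: "integrable P Y"
  shows "(\<lambda>j. \<integral>\<xi>. indicator (E j) \<xi> * \<bar>Y \<xi>\<bar> \<partial>P) \<longlonglongrightarrow> 0"
proof -
  have "(\<lambda>j. \<integral>\<xi>. indicator (E j) \<xi> * \<bar>Y \<xi>\<bar> \<partial>P) \<longlonglongrightarrow> (\<integral>\<xi>. 0 \<partial>P)"
  proof (rule integral_dominated_convergence[where w="\<lambda>\<xi>. \<bar>Y \<xi>\<bar>"])
    show "AE \<xi> in P. (\<lambda>j. indicator (E j) \<xi> * \<bar>Y \<xi>\<bar>) \<longlonglongrightarrow> 0"
      using eventually_outside_E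
      by eventually_elim (rule tendsto_eventually, erule eventually_mono, simp)
    show "(\<lambda>\<xi>. indicator (E j) \<xi> * \<bar>Y \<xi>\<bar>) \<in> borel_measurable P" for j using Y by measurable
    show "AE \<xi> in P. norm (indicator (E j) \<xi> * \<bar>Y \<xi>\<bar>) \<le> \<bar>Y \<xi>\<bar>" for j
      by (intro AE_I2) (simp add: indicator_def)
  qed (use Y in auto)
  then show ?thesis by simp
qed

text \<open>Serves both the terminal value and the value stopped at a fixed time: outside
  \<open>E j\<close> nothing changes, and on \<open>E j\<close> both terms are small in
  mean.\<close>

lemma tendsto_set_mean:
  assumes Y: "integrable P Y" and Yj: "\<And>j. Yj j \<in> borel_measurable P" and A: "A \<in> sets P"
    and close: "\<And>j. AE \<xi> in P. \<bar>Yj j \<xi> - Y \<xi>\<bar> \<le> indicator (E j) \<xi> * \<bar>VR j \<xi>\<bar> + indicator (E j) \<xi> * \<bar>Y \<xi>\<bar>"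
  shows "(\<lambda>j. \<integral>\<xi>. indicator A \<xi> * Yj j \<xi> \<partial>P) \<longlonglongrightarrow> (\<integral>\<xi>. indicator A \<xi> * Y \<xi> \<partial>P)"
proof -
  have D1: "integrable P (\<lambda>\<xi>. indicator (E j) \<xi> * \<bar>VR j \<xi>\<bar>)" for j
    using integrable_mult_indicator[OF E_sets integrable_abs[OF V_integrable[of "n j" "\<beta> (b j)"]]] target.barycenter_nonneg by simp
  have D2: "integrable P (\<lambda>\<xi>. indicator (E j) \<xi> * \<bar>Y \<xi>\<bar>)" for j
    using integrable_mult_indicator[OF E_sets integrable_abs[OF Y]] by simp
  note D = Bochner_Integration.integrable_add[OF D1 D2]
  have diff: "integrable P (\<lambda>\<xi>. Yj j \<xi> - Y \<xi>)" for j
    by (rule Bochner_Integration.integrable_bound[OF D[of j]]) (use Y Yj close[of j] in \<open>auto elim!: eventually_mono\<close>)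
  have iYj: "integrable P (Yj j)" for j using Bochner_Integration.integrable_add[OF diff[of j] Y] by simp
  have iA: "integrable P (\<lambda>\<xi>. indicator A \<xi> * f \<xi>)" if "integrable P f" for f :: "'a \<Rightarrow> real"
    using integrable_mult_indicator[OF A that] by simp
  have bound: "\<bar>(\<integral>\<xi>. indicator A \<xi> * Yj j \<xi> \<partial>P) - (\<integral>\<xi>. indicator A \<xi> * Y \<xi> \<partial>P)\<bar> \<le>
      (moment (- n j) + moment (b j)) + (\<integral>\<xi>. indicator (E j) \<xi> * \<bar>Y \<xi>\<bar> \<partial>P)" for j
  proof -
    have eq: "(\<integral>\<xi>. indicator A \<xi> * Yj j \<xi> \<partial>P) - (\<integral>\<xi>. indicator A \<xi> * Y \<xi> \<partial>P) = (\<integral>\<xi>. indicator A \<xi> * (Yj j \<xi> - Y \<xi>) \<partial>P)"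
      unfolding Bochner_Integration.integral_diff[OF iA[OF iYj] iA[OF Y], symmetric] by (simp add: right_diff_distrib)
    have "\<bar>\<integral>\<xi>. indicator A \<xi> * (Yj j \<xi> - Y \<xi>) \<partial>P\<bar> \<le> (\<integral>\<xi>. \<bar>indicator A \<xi> * (Yj j \<xi> - Y \<xi>)\<bar> \<partial>P)"
      by (rule integral_abs_bound)
    also have "\<dots> \<le> (\<integral>\<xi>. indicator (E j) \<xi> * \<bar>VR j \<xi>\<bar> + indicator (E j) \<xi> * \<bar>Y \<xi>\<bar> \<partial>P)"
    proof (rule integral_mono_AE[OF integrable_abs[OF iA[OF diff]] D])
      show "AE \<xi> in P. \<bar>indicator A \<xi> * (Yj j \<xi> - Y \<xi>)\<bar> \<le> indicator (E j) \<xi> * \<bar>VR j \<xi>\<bar> + indicator (E j) \<xi> * \<bar>Y \<xi>\<bar>"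
        using close[of j]
      proof eventually_elim
        case (elim \<xi>)
        have "\<bar>indicator A \<xi> * (Yj j \<xi> - Y \<xi>)\<bar> \<le> \<bar>Yj j \<xi> - Y \<xi>\<bar>" by (simp add: indicator_def)
        then show ?case using elim by linarith
      qed
    qed
    also have "\<dots> = (\<integral>\<xi>. indicator (E j) \<xi> * \<bar>VR j \<xi>\<bar> \<partial>P) + (\<integral>\<xi>. indicator (E j) \<xi> * \<bar>Y \<xi>\<bar> \<partial>P)"
      by (rule Bochner_Integration.integral_add[OF D1 D2])
    finally show ?thesis unfolding eq using E_mean[of j] by linarith
  qed
  have "(\<lambda>j. (moment (- n j) + moment (b j)) + (\<integral>\<xi>. indicator (E j) \<xi> * \<bar>Y \<xi>\<bar> \<partial>P)) \<longlonglongrightarrow> 0 + 0"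
    by (rule tendsto_add[OF E_mean_tendsto indicator_E_tendsto[OF Y]])
  then have "(\<lambda>j. (moment (- n j) + moment (b j)) + (\<integral>\<xi>. indicator (E j) \<xi> * \<bar>Y \<xi>\<bar> \<partial>P)) \<longlonglongrightarrow> 0" by simp
  then have "(\<lambda>j. (\<integral>\<xi>. indicator A \<xi> * Yj j \<xi> \<partial>P) - (\<integral>\<xi>. indicator A \<xi> * Y \<xi> \<partial>P)) \<longlonglongrightarrow> 0"
    by (rule Lim_null_comparison[rotated]) (intro always_eventually allI, use bound in simp)
  then show ?thesis by (rule LIM_zero_cancel)
qed

lemma final_measurable_\<tau> [measurable]: "final \<tau> \<in> borel_measurable P"
  by (rule final_measurable[OF stopping_region])

lemma final_outside_E: "\<xi> \<in> space P \<Longrightarrow> \<xi> \<notin> E j \<Longrightarrow> VR j \<xi> = final \<tau> \<xi>"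
  using eq_outside_E[of \<xi> j] by (simp add: final_def)

lemma final_tail_eq_if_pos:
  assumes k: "mass k > 0"
  shows "prob {\<xi>\<in>space P. k \<le> final \<tau> \<xi>} = mass k"
proof -
  let ?p = "prob {\<xi>\<in>space P. k \<le> final \<tau> \<xi>}" and ?q = "\<lambda>j. tail (n j) (\<beta> (b j)) k"
  have close: "norm (?q j - ?p) \<le> moment (- n j) + mass (b j)" for j
  proof -
    have sets: "{\<xi>\<in>space P. k \<le> final \<tau> \<xi>} \<in> sets P" "{\<xi>\<in>space P. k \<le> VR j \<xi>} \<in> sets P" by measurable
    have "?q j \<le> prob ({\<xi>\<in>space P. k \<le> final \<tau> \<xi>} \<union> E j)"
      unfolding tail_def using final_outside_E[of _ j]
      by (intro finite_measure_mono sets.Un sets E_sets) auto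
    also have "\<dots> \<le> ?p + prob (E j)" by (intro measure_Un_le sets E_sets)
    finally have up: "?q j \<le> ?p + prob (E j)" .
    have "?p \<le> prob ({\<xi>\<in>space P. k \<le> VR j \<xi>} \<union> E j)"
      using final_outside_E[of _ j] by (intro finite_measure_mono sets.Un sets E_sets) auto
    also have "\<dots> \<le> ?q j + prob (E j)" unfolding tail_def by (intro measure_Un_le sets E_sets)
    finally show ?thesis using up E_prob[of j] unfolding real_norm_def by linarith
  qed
  have "(\<lambda>j. ?q j - ?p) \<longlonglongrightarrow> 0"
    by (rule Lim_null_comparison[OF _ E_prob_tendsto]) (intro always_eventually allI close)
  then have lim: "?q \<longlonglongrightarrow> ?p" by (rule LIM_zero_cancel)
  \<comment> \<open>This is \<open>exit_tail\<close> divided by \<open>n j\<close>, with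
    \<open>call (- n j)\<close> expanded; the bracket tends to 1.\<close>
  have "(\<lambda>j. ?q j * (moment (- n j) * (1 / n j) + mass (- n j))) \<longlonglongrightarrow> ?p * (0 * 0 + 1)"
    by (intro tendsto_mult tendsto_add lim LIMSEQ_Suc[OF lim_1_over_n]
        filterlim_compose[OF target.moment_at_bot minus_n_at_bot] filterlim_compose[OF target.mass_at_bot minus_n_at_bot])
  moreover have "\<forall>\<^sub>F j in sequentially. ?q j * (moment (- n j) * (1 / n j) + mass (- n j)) = mass k"
  proof -
    have "\<forall>\<^sub>F j in sequentially. mass (b j) < mass k" by (rule order_tendstoD(2)[OF b_mass k])
    moreover have "\<forall>\<^sub>F j in sequentially. - n j < k" using minus_n_at_bot unfolding filterlim_at_bot_dense by blast
    ultimately show ?thesis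
    proof eventually_elim
      case (elim j)
      have nj: "0 < n j" by simp
      have "k \<le> b j" using target.mass_antimono[of "b j" k] elim(1) by linarith
      from exit_tail[OF nj b_pos elim(2) this] have "?q j * call (- n j) = n j * mass k" .
      then have "?q j * (moment (- n j) + n j * mass (- n j)) / n j = mass k"
        using nj by (simp add: target.call_def del: of_nat_Suc)
      moreover have "?q j * (moment (- n j) + n j * mass (- n j)) / n j = ?q j * (moment (- n j) * (1 / n j) + mass (- n j))"
        using nj by (simp add: field_simps del: of_nat_Suc)
      ultimately show ?case by simp
    qed
  qed
  then have "(\<lambda>j. ?q j * (moment (- n j) * (1 / n j) + mass (- n j))) \<longlonglongrightarrow> mass k" by (rule tendsto_eventually)
  ultimately have "?p * (0 * 0 + 1) = mass k" by (rule LIMSEQ_unique)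
  then show ?thesis by simp
qed

lemma final_law_along: "distr P borel (final \<tau>) = \<mu>"
proof (rule measure_eqI_atLeast)
  show "finite_measure (distr P borel (final \<tau>))" by (intro finite_measure_distr) measurable
  fix k
  have "prob {\<xi>\<in>space P. k \<le> final \<tau> \<xi>} = mass k"
  proof (cases "mass k > 0")
    case False
    then have m: "mass k = 0" using target.mass_nonneg[of k] by simp
    have "prob {\<xi>\<in>space P. k \<le> final \<tau> \<xi>} \<le> mass (b j)" for j
    proof -
      have "b j \<le> k" using target.mass_antimono[of k "b j"] b_pos[of j] m by linarith
      then have "prob {\<xi>\<in>space P. k \<le> final \<tau> \<xi>} \<le> prob {\<xi>\<in>space P. b j \<le> final \<tau> \<xi>}"
        by (intro finite_measure_mono) auto
      then show ?thesis using final_tail_eq_if_pos[OF b_pos] by simp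
    qed
    then have "prob {\<xi>\<in>space P. k \<le> final \<tau> \<xi>} \<le> 0" by (intro LIMSEQ_le_const[OF b_mass]) blast
    then show ?thesis using m by (intro antisym) simp_all
  qed (rule final_tail_eq_if_pos)
  moreover have "final \<tau> -` {k..} \<inter> space P = {\<xi>\<in>space P. k \<le> final \<tau> \<xi>}" by auto
  ultimately show "emeasure (distr P borel (final \<tau>)) {k..} = emeasure \<mu> {k..}"
    by (simp add: emeasure_distr emeasure_eq_measure target.mass_def target.emeasure_eq_measure)
qed simp_all

lemma final_integrable_along: "integrable P (final \<tau>)"
proof -
  have "integrable (distr P borel (final \<tau>)) (\<lambda>x. x)" unfolding final_law_along by (rule target.integrable_id)
  then show ?thesis by (subst (asm) integrable_distr_eq) auto
qed

lemma VR_integrable: "integrable P (VR j)"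
  using V_integrable[of "n j" "\<beta> (b j)"] target.barycenter_nonneg by simp

lemma stopped_bounded_R: "0 \<le> u \<Longrightarrow> AE \<xi> in P. \<bar>stopped (R j) u \<xi>\<bar> \<le> max (n j) (\<beta> (b j))"
  by (rule exit_stopped_bounds) (auto simp: target.barycenter_nonneg)

lemma stopped_R_mean: "0 \<le> u \<Longrightarrow> A \<in> sets (FW u) \<Longrightarrow>
    (\<integral>\<xi>. indicator A \<xi> * VR j \<xi> \<partial>P) = (\<integral>\<xi>. indicator A \<xi> * stopped (R j) u \<xi> \<partial>P)"
  by (rule final_mean[OF stopping_exit_time exit_time_finite stopped_bounded_R])

lemma stopped_R_integrable:
  assumes u: "0 \<le> u"
  shows "integrable P (stopped (R j) u)"
  by (rule integrable_const_bound[where B="max (n j) (\<beta> (b j))"])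
     (use stopped_bounded_R[OF u] stopped_measurable_P[OF stopping_exit_time u] in auto)

text \<open>Jensen's inequality for conditional means, obtained by testing with the sign of the
  stopped value: \<open>?s Y\<close> is Y times this sign.\<close>

lemma stopped_R_abs_le:
  assumes u: "0 \<le> u"
  shows "(\<integral>\<xi>. \<bar>stopped (R j) u \<xi>\<bar> \<partial>P) \<le> (\<integral>\<xi>. \<bar>VR j \<xi>\<bar> \<partial>P)"
proof -
  let ?A = "{\<xi>\<in>space (FW u). 0 \<le> stopped (R j) u \<xi>}"
  let ?s = "\<lambda>Y \<xi>. 2 * (indicator ?A \<xi> * Y \<xi>) - indicator (space (FW u)) \<xi> * Y \<xi> :: real"
  have A: "?A \<in> sets (FW u)" using stopped_measurable[OF stopping_exit_time u] by measurable
  have AP: "?A \<in> sets P" "space (FW u) \<in> sets P" using A subalgebra_FW[of u] by (auto simp: subalgebra_def)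
  have int: "(\<integral>\<xi>. ?s Y \<xi> \<partial>P) = 2 * (\<integral>\<xi>. indicator ?A \<xi> * Y \<xi> \<partial>P) - (\<integral>\<xi>. indicator (space (FW u)) \<xi> * Y \<xi> \<partial>P)"
    "integrable P (?s Y)" if "integrable P Y" for Y
    using integrable_mult_indicator[OF AP(1) that] integrable_mult_indicator[OF AP(2) that]
    by (simp_all add: Bochner_Integration.integral_diff)
  have "(\<integral>\<xi>. \<bar>stopped (R j) u \<xi>\<bar> \<partial>P) = (\<integral>\<xi>. ?s (stopped (R j) u) \<xi> \<partial>P)"
    by (intro Bochner_Integration.integral_cong refl) (auto simp: indicator_def)
  also have "\<dots> = (\<integral>\<xi>. ?s (VR j) \<xi> \<partial>P)"
    unfolding int(1)[OF stopped_R_integrable[OF u]] int(1)[OF VR_integrable]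
      stopped_R_mean[OF u A] stopped_R_mean[OF u sets.top] ..
  also have "\<dots> \<le> (\<integral>\<xi>. \<bar>VR j \<xi>\<bar> \<partial>P)"
    by (intro integral_mono int(2) VR_integrable integrable_abs) (auto simp: indicator_def)
  finally show ?thesis .
qed

lemma VR_abs_le: "(\<integral>\<xi>. \<bar>VR j \<xi>\<bar> \<partial>P) \<le> (moment (- n j) + moment (b j)) + (\<integral>\<xi>. \<bar>final \<tau> \<xi>\<bar> \<partial>P)"
proof -
  have D: "integrable P (\<lambda>\<xi>. indicator (E j) \<xi> * \<bar>VR j \<xi>\<bar>)"
    using integrable_mult_indicator[OF E_sets integrable_abs[OF VR_integrable]] by simp
  have "(\<integral>\<xi>. \<bar>VR j \<xi>\<bar> \<partial>P) \<le> (\<integral>\<xi>. indicator (E j) \<xi> * \<bar>VR j \<xi>\<bar> + \<bar>final \<tau> \<xi>\<bar> \<partial>P)"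
  proof (rule integral_mono)
    show "\<bar>VR j \<xi>\<bar> \<le> indicator (E j) \<xi> * \<bar>VR j \<xi>\<bar> + \<bar>final \<tau> \<xi>\<bar>" if "\<xi> \<in> space P" for \<xi>
      using final_outside_E[OF that, of j] by (cases "\<xi> \<in> E j") (auto simp del: of_nat_Suc)
  qed (intro Bochner_Integration.integrable_add D integrable_abs VR_integrable final_integrable_along)+
  also have "\<dots> = (\<integral>\<xi>. indicator (E j) \<xi> * \<bar>VR j \<xi>\<bar> \<partial>P) + (\<integral>\<xi>. \<bar>final \<tau> \<xi>\<bar> \<partial>P)"
    by (intro Bochner_Integration.integral_add D integrable_abs final_integrable_along)
  finally show ?thesis using E_mean[of j] by linarith
qed

lemma stopped_outside_E: "\<xi> \<in> space P \<Longrightarrow> \<xi> \<notin> E j \<Longrightarrow> stopped (R j) u \<xi> = stopped \<tau> u \<xi>"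
  using eq_outside_E[of \<xi> j] by (simp add: stopped_def clip_def)

text \<open>The stopped path may be unbounded. Along the boxes the absolute means are bounded by
  those of the terminal values, and Fatou transfers the bound.\<close>

lemma stopped_integrable_along:
  assumes u: "0 \<le> u"
  shows "integrable P (stopped \<tau> u)"
proof -
  have [measurable]: "stopped \<tau> u \<in> borel_measurable P" "stopped (R j) u \<in> borel_measurable P" for j
    using stopped_measurable_P[OF stopping_region u] stopped_measurable_P[OF stopping_exit_time u] by auto
  obtain C where C: "\<And>j. moment (- n j) + moment (b j) \<le> C"
    using convergent_imp_Bseq[OF convergentI[OF E_mean_tendsto]] unfolding Bseq_def by (metis abs_le_D1 real_norm_def)
  let ?K = "C + (\<integral>\<xi>. \<bar>final \<tau> \<xi>\<bar> \<partial>P)"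
  have "(\<integral>\<^sup>+\<xi>. ennreal \<bar>stopped (R j) u \<xi>\<bar> \<partial>P) \<le> ennreal ?K" for j
  proof -
    have "(\<integral>\<^sup>+\<xi>. ennreal \<bar>stopped (R j) u \<xi>\<bar> \<partial>P) = ennreal (\<integral>\<xi>. \<bar>stopped (R j) u \<xi>\<bar> \<partial>P)"
      by (intro nn_integral_eq_integral integrable_abs stopped_R_integrable u) auto
    also have "\<dots> \<le> ennreal ?K" using stopped_R_abs_le[OF u, of j] VR_abs_le[of j] C[of j] by (intro ennreal_leI) linarith
    finally show ?thesis .
  qed
  then have "liminf (\<lambda>j. \<integral>\<^sup>+\<xi>. ennreal \<bar>stopped (R j) u \<xi>\<bar> \<partial>P) \<le> ennreal ?K"
    by (intro order_trans[OF Liminf_le_Limsup Limsup_bounded]) auto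
  then have fatou: "(\<integral>\<^sup>+\<xi>. liminf (\<lambda>j. ennreal \<bar>stopped (R j) u \<xi>\<bar>) \<partial>P) \<le> ennreal ?K"
    by (rule order_trans[rotated]) (rule nn_integral_liminf, measurable)
  have "(\<integral>\<^sup>+\<xi>. ennreal \<bar>stopped \<tau> u \<xi>\<bar> \<partial>P) = (\<integral>\<^sup>+\<xi>. liminf (\<lambda>j. ennreal \<bar>stopped (R j) u \<xi>\<bar>) \<partial>P)"
  proof (rule nn_integral_cong_AE)
    show "AE \<xi> in P. ennreal \<bar>stopped \<tau> u \<xi>\<bar> = liminf (\<lambda>j. ennreal \<bar>stopped (R j) u \<xi>\<bar>)"
      using eventually_outside_E AE_space
    proof eventually_elim
      case (elim \<xi>)
      have "\<forall>\<^sub>F j in sequentially. ennreal \<bar>stopped (R j) u \<xi>\<bar> = ennreal \<bar>stopped \<tau> u \<xi>\<bar>"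
        using elim(1) by (rule eventually_mono) (use stopped_outside_E[OF elim(2)] in simp)
      then have "(\<lambda>j. ennreal \<bar>stopped (R j) u \<xi>\<bar>) \<longlonglongrightarrow> ennreal \<bar>stopped \<tau> u \<xi>\<bar>" by (rule tendsto_eventually)
      from lim_imp_Liminf[OF _ this] show ?case by simp
    qed
  qed
  then have "(\<integral>\<^sup>+\<xi>. ennreal (norm (stopped \<tau> u \<xi>)) \<partial>P) < \<infinity>" using fatou by (simp add: le_less_trans ennreal_less_top)
  then show ?thesis by (intro integrableI_bounded) measurable
qed

lemma final_stopped_mean_along:
  assumes u: "0 \<le> u" and A: "A \<in> sets (FW u)"
  shows "(\<integral>\<xi>. indicator A \<xi> * final \<tau> \<xi> \<partial>P) = (\<integral>\<xi>. indicator A \<xi> * stopped \<tau> u \<xi> \<partial>P)"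
proof -
  have AP: "A \<in> sets P" using A subalgebra_FW by (auto simp: subalgebra_def)
  have "(\<lambda>j. \<integral>\<xi>. indicator A \<xi> * VR j \<xi> \<partial>P) \<longlonglongrightarrow> (\<integral>\<xi>. indicator A \<xi> * final \<tau> \<xi> \<partial>P)"
  proof (rule tendsto_set_mean[OF final_integrable_along V_measurable AP])
    show "AE \<xi> in P. \<bar>VR j \<xi> - final \<tau> \<xi>\<bar> \<le> indicator (E j) \<xi> * \<bar>VR j \<xi>\<bar> + indicator (E j) \<xi> * \<bar>final \<tau> \<xi>\<bar>" for j
    proof (rule AE_I2)
      fix \<xi> assume "\<xi> \<in> space P"
      from final_outside_E[OF this, of j]
      show "\<bar>VR j \<xi> - final \<tau> \<xi>\<bar> \<le> indicator (E j) \<xi> * \<bar>VR j \<xi>\<bar> + indicator (E j) \<xi> * \<bar>final \<tau> \<xi>\<bar>"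
        by (cases "\<xi> \<in> E j") (auto simp del: of_nat_Suc)
    qed
  qed
  moreover have "(\<lambda>j. \<integral>\<xi>. indicator A \<xi> * stopped (R j) u \<xi> \<partial>P) \<longlonglongrightarrow> (\<integral>\<xi>. indicator A \<xi> * stopped \<tau> u \<xi> \<partial>P)"
  proof (rule tendsto_set_mean[OF stopped_integrable_along[OF u] stopped_measurable_P[OF stopping_exit_time u] AP])
    show "AE \<xi> in P. \<bar>stopped (R j) u \<xi> - stopped \<tau> u \<xi>\<bar> \<le> indicator (E j) \<xi> * \<bar>VR j \<xi>\<bar> + indicator (E j) \<xi> * \<bar>stopped \<tau> u \<xi>\<bar>" for j
    proof (rule AE_I2)
      fix \<xi> assume \<xi>: "\<xi> \<in> space P"
      show "\<bar>stopped (R j) u \<xi> - stopped \<tau> u \<xi>\<bar> \<le> indicator (E j) \<xi> * \<bar>VR j \<xi>\<bar> + indicator (E j) \<xi> * \<bar>stopped \<tau> u \<xi>\<bar>"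
      proof (cases "\<xi> \<in> E j")
        case True
        show ?thesis
        \<comment> \<open>If the box was left by time \<open>u\<close>, the value is already
          \<open>VR j\<close>; otherwise neither rule has stopped before \<open>u\<close> and the
          values agree.\<close>
        proof (cases "R j \<xi> \<le> ereal u")
          case le: True
          then have "stopped (R j) u \<xi> = VR j \<xi>" by (simp add: stopped_def clip_def final_def min_absorb1)
          then show ?thesis using True by simp
        next
          case False
          then have "ereal u \<le> R j \<xi>" "ereal u \<le> \<tau> \<xi>" using R_le[of j \<xi>] by (auto intro: order_trans less_imp_le)
          then have "stopped (R j) u \<xi> = stopped \<tau> u \<xi>" by (simp only: stopped_def clip_eq_if_ge)
          then show ?thesis by simp
        qed
      next
        case False
        then show ?thesis using stopped_outside_E[OF \<xi> False, of u] by simp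
      qed
    qed
  qed
  ultimately show ?thesis using stopped_R_mean[OF u A] LIMSEQ_unique by (simp only:) blast
qed

end

lemma region_time_finite: "AE \<xi> in P. hit region \<xi> \<noteq> \<infinity>"
  and region_final_law: "distr P borel (final (hit region)) = \<mu>"
  and region_final_integrable: "integrable P (final (hit region))"
  and region_stopped_integrable: "0 \<le> u \<Longrightarrow> integrable P (stopped (hit region) u)"
  and region_stopped_mean: "0 \<le> u \<Longrightarrow> A \<in> sets (FW u) \<Longrightarrow>
    (\<integral>\<xi>. indicator A \<xi> * final (hit region) \<xi> \<partial>P) = (\<integral>\<xi>. indicator A \<xi> * stopped (hit region) u \<xi> \<partial>P)"
proof -
  obtain b where b: "incseq b" "\<And>j. 0 \<le> b j" "\<And>j. mass (b j) > 0" "(\<lambda>j. mass (b j)) \<longlonglongrightarrow> 0" "(\<lambda>j. moment (b j)) \<longlonglongrightarrow> 0"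
    by (rule target.exhausting_sequence) blast
  show "AE \<xi> in P. hit region \<xi> \<noteq> \<infinity>" by (rule \<tau>_finite[OF b])
  show "distr P borel (final (hit region)) = \<mu>" by (rule final_law_along[OF b])
  show "integrable P (final (hit region))" by (rule final_integrable_along[OF b])
  show "0 \<le> u \<Longrightarrow> integrable P (stopped (hit region) u)" by (rule stopped_integrable_along[OF b])
  show "0 \<le> u \<Longrightarrow> A \<in> sets (FW u) \<Longrightarrow>
    (\<integral>\<xi>. indicator A \<xi> * final (hit region) \<xi> \<partial>P) = (\<integral>\<xi>. indicator A \<xi> * stopped (hit region) u \<xi> \<partial>P)"
    by (rule final_stopped_mean_along[OF b])
qed

end

section \<open>Paths and joint law of the time-changed process\<close>

lemma continuous_on_tendsto_at_left:
  fixes f :: "real \<Rightarrow> 'b::topological_space"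
  assumes "continuous_on {0..} f" "0 < r"
  shows "(f \<longlongrightarrow> f r) (at_left r)"
proof -
  have "at r within {0..} = at r" using assms(2) by (intro at_within_interior) (auto simp: interior_real_atLeast)
  then have "(f \<longlongrightarrow> f r) (at r)" using assms by (auto simp: continuous_on dest!: bspec[of _ _ r])
  then show ?thesis by (rule tendsto_within_subset) auto
qed

context azema_yor
begin

lemma azema_yor_time_region: "azema_yor_time \<mu> W \<xi> = hit region \<xi>"
  by (simp add: region_def azema_yor_time_eq_hit)

lemma azema_yor_process_infinite: "hit region \<xi> = \<infinity> \<Longrightarrow> azema_yor_process T \<mu> W t \<xi> = 0"
  by (simp add: azema_yor_process_def azema_yor_time_region)

lemma azema_yor_process_ereal:
  "hit region \<xi> = ereal r \<Longrightarrow> azema_yor_process T \<mu> W t \<xi> = (if t < T then W (min r (t / (T - t))) \<xi> else W r \<xi>)"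
  by (simp add: azema_yor_process_def azema_yor_time_region)

lemma azema_yor_process_eq:
  "azema_yor_process T \<mu> W t \<xi> = (if hit region \<xi> = \<infinity> then 0
     else if t < T then stopped (hit region) (t / (T - t)) \<xi> else final (hit region) \<xi>)"
proof (cases "hit region \<xi>")
  case (real r)
  then show ?thesis
    by (simp add: azema_yor_process_ereal stopped_def clip_def final_def min_def)
next
  case MInf
  then show ?thesis using stopping_region by (auto simp: stopping_def dest: spec[of _ \<xi>])
qed (simp add: azema_yor_process_infinite)

lemma azema_yor_process_measurable:
  assumes "0 \<le> t"
  shows "azema_yor_process T \<mu> W t \<in> borel_measurable P"
proof -
  have [measurable]: "hit region \<in> borel_measurable P" "final (hit region) \<in> borel_measurable P"
    by (rule stopping_measurable[OF stopping_region] final_measurable[OF stopping_region])+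
  show ?thesis
  proof (cases "t < T")
    case True
    then have [measurable]: "stopped (hit region) (t / (T - t)) \<in> borel_measurable P"
      using assms by (intro stopped_measurable_P stopping_region) auto
    show ?thesis unfolding azema_yor_process_eq[abs_def] by measurable
  next
    case False
    then show ?thesis unfolding azema_yor_process_eq[abs_def] by (simp only: if_False) measurable
  qed
qed

lemma azema_yor_process_cadlag:
  assumes \<xi>: "\<xi> \<in> space P" and T: "0 < T"
  shows "cadlag_on T (\<lambda>t. azema_yor_process T \<mu> W t \<xi>)"
  using closed_region \<xi>
proof (cases rule: hit_cases)
  case never
  then show ?thesis by (auto simp: azema_yor_process_infinite cadlag_on_def)
next
  case (at r)
  let ?X = "\<lambda>t. azema_yor_process T \<mu> W t \<xi>" and ?g = "\<lambda>t. min r (t / (T - t))"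
  note X = azema_yor_process_ereal[OF at(2), of T]
  have lim: "(?X \<longlongrightarrow> ?X t) (at t within A)"
    if t: "0 \<le> t" "t < T" and A: "\<forall>\<^sub>F s in at t within A. 0 \<le> s" for t A
  proof -
    have "\<forall>\<^sub>F s in at t within A. s < T"
      using order_tendstoD(2)[OF tendsto_ident_at t(2)] .
    then have ev: "\<forall>\<^sub>F s in at t within A. W (?g s) \<xi> = ?X s" by eventually_elim (simp add: X)
    have g: "(?g \<longlongrightarrow> ?g t) (at t within A)" using t by (intro tendsto_intros) auto
    have "\<forall>\<^sub>F s in at t within A. ?g s \<in> {0..}"
      using A \<open>\<forall>\<^sub>F s in at t within A. s < T\<close> by eventually_elim (use at(1) in auto)
    then have "((\<lambda>s. W (?g s) \<xi>) \<longlongrightarrow> W (?g t) \<xi>) (at t within A)"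
      using continuous_on_tendsto_compose[OF W_continuous[OF \<xi>] g] t at(1) by auto
    then have "(?X \<longlongrightarrow> W (?g t) \<xi>) (at t within A)" by (rule Lim_transform_eventually[OF _ ev])
    then show ?thesis using t by (simp add: X)
  qed
  show ?thesis
    unfolding cadlag_on_def
  proof (intro conjI ballI)
    fix t assume t: "t \<in> {0..<T}"
    show "(?X \<longlongrightarrow> ?X t) (at_right t)"
      by (rule lim) (use t in \<open>auto simp: eventually_at_filter intro!: always_eventually\<close>)
  next
    fix t assume t: "t \<in> {0<..T}"
    show "\<exists>l. (?X \<longlongrightarrow> l) (at_left t)"
    proof (cases "t < T")
      case True
      have "\<forall>\<^sub>F s in at_left t. 0 < s" by (rule order_tendstoD(1)[OF tendsto_ident_at]) (use t in auto)
      then have "(?X \<longlongrightarrow> ?X t) (at_left t)" using t True by (intro lim) (auto elim: eventually_mono)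
      then show ?thesis ..
    next
      case False
      then have tT: "t = T" using t by simp
      have "\<forall>\<^sub>F s in at_left T. W r \<xi> = ?X s"
        unfolding eventually_at_left_field
      \<comment> \<open>The time at which \<open>t / (T - t)\<close> reaches \<open>r\<close>; from
        then on the process is constant.\<close>
      proof (intro exI[of _ "r * T / (1 + r)"] conjI allI impI)
        show "r * T / (1 + r) < T" using T at(1) by (simp add: divide_less_eq algebra_simps)
        fix s assume s: "r * T / (1 + r) < s" "s < T"
        have "r * T < s * (1 + r)" using s(1) at(1) by (simp add: divide_less_eq)
        then have "r \<le> s / (T - s)" using s(2) by (simp add: le_divide_eq algebra_simps)
        then show "W r \<xi> = ?X s" using s(2) by (simp add: X min_absorb1)
      qed
      then have "(?X \<longlongrightarrow> W r \<xi>) (at_left t)" unfolding tT by (rule Lim_transform_eventually[OF tendsto_const])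
      then show ?thesis ..
    qed
  qed
qed

text \<open>When the closed region is first met, the maximum is at least \<beta> of the path. Just
  before it is smaller, and continuity of both sides at \<open>r\<close> turns this into equality.
  The left limit requires \<open>r > 0\<close>, which follows from
  \<open>0 < \<beta> 0\<close>.\<close>

lemma azema_yor_running_max:
  assumes \<xi>: "\<xi> \<in> space P" "W 0 \<xi> = 0" "hit region \<xi> \<noteq> \<infinity>" "mass (final (hit region) \<xi>) > 0" and T: "0 < T"
  shows "running_max (azema_yor_process T \<mu> W) T \<xi> = \<beta> (final (hit region) \<xi>)"
  using closed_region \<xi>(1)
proof (cases rule: hit_cases)
  case never
  then show ?thesis using \<xi>(3) by simp
next
  case (at r)
  note X = azema_yor_process_ereal[OF at(2), of T]
  have final: "final (hit region) \<xi> = W r \<xi>" by (simp add: final_def at(2))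
  have "(\<lambda>t. azema_yor_process T \<mu> W t \<xi>) ` {0..T} = (\<lambda>u. W u \<xi>) ` {0..r}"
  proof safe
    fix t assume t: "t \<in> {0..T}"
    show "azema_yor_process T \<mu> W t \<xi> \<in> (\<lambda>u. W u \<xi>) ` {0..r}"
      using at(1) t by (auto simp: X)
  next
    fix u assume u: "u \<in> {0..r}"
    \<comment> \<open>The inverse of the time change \<open>t / (T - t)\<close>.\<close>
    let ?t = "u * T / (1 + u)"
    have t: "0 \<le> ?t" "?t < T" using u T by (auto simp: divide_less_eq algebra_simps)
    have "T - ?t = T / (1 + u)" using u by (simp add: field_simps)
    then have "?t / (T - ?t) = u * T / (1 + u) / (T / (1 + u))" by (simp only:)
    also have "\<dots> = u" using u T by simp
    finally have "?t / (T - ?t) = u" .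
    then have "azema_yor_process T \<mu> W ?t \<xi> = W u \<xi>" using t(2) u by (simp add: X)
    then show "W u \<xi> \<in> (\<lambda>t. azema_yor_process T \<mu> W t \<xi>) ` {0..T}" using t by (intro image_eqI[of _ _ ?t]) auto
  qed
  then have eq: "running_max (azema_yor_process T \<mu> W) T \<xi> = S r \<xi>" by (simp add: running_max_def)
  have ge: "\<beta> (W r \<xi>) \<le> S r \<xi>" using at(3) by (simp add: region_def)
  have "S 0 \<xi> = 0" using \<xi>(2) by (simp add: running_max_def)
  then have r: "0 < r" using ge \<xi>(2) target.barycenter_pos_0 at(1) by (cases "r = 0") auto
  have "S r \<xi> \<le> \<beta> (W r \<xi>)"
  proof (rule tendsto_le)
    show "((\<lambda>u. S u \<xi>) \<longlongrightarrow> S r \<xi>) (at_left r)"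
      by (rule continuous_on_tendsto_at_left[OF running_max_continuous[of W] r]) (rule W_continuous[OF \<xi>(1)])
    show "((\<lambda>u. \<beta> (W u \<xi>)) \<longlongrightarrow> \<beta> (W r \<xi>)) (at_left r)"
      using \<xi>(4) unfolding final
      by (intro isCont_tendsto_compose[OF target.isCont_barycenter] continuous_on_tendsto_at_left[OF W_continuous[OF \<xi>(1)] r])
    have "\<forall>\<^sub>F u in at_left r. 0 < u" by (rule order_tendstoD(1)[OF tendsto_ident_at r])
    moreover have "\<forall>\<^sub>F u in at_left r. u < r" by (simp add: eventually_at_filter)
    ultimately show "\<forall>\<^sub>F u in at_left r. S u \<xi> \<le> \<beta> (W u \<xi>)"
    proof eventually_elim
      case (elim u)
      then show ?case using at(4)[of u] by (simp add: region_def)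
    qed
  qed simp
  then show ?thesis using eq ge final by simp
qed

lemma azema_yor_admissible:
  assumes T: "0 < T"
  shows "admissible T \<mu> P (azema_yor_process T \<mu> W)"
proof -
  let ?X = "azema_yor_process T \<mu> W"
  define G where "G t = (if t < T then FW (t / (T - t)) else P)" for t
  define Y where "Y t = (if t < T then stopped (hit region) (t / (T - t)) else final (hit region))" for t
  have Y: "integrable P (Y t)" "Y t \<in> borel_measurable (G t)" if "0 \<le> t" for t
    using that region_stopped_integrable region_final_integrable stopped_measurable[OF stopping_region]
      final_measurable[OF stopping_region] by (auto simp: Y_def G_def)
  have XY: "AE \<xi> in P. ?X t \<xi> = Y t \<xi>" for t
    using region_time_finite by eventually_elim (simp add: azema_yor_process_eq Y_def)
  have sub: "subalgebra P (G t)" for t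
    using subalgebra_FW by (auto simp: G_def subalgebra_def)
  note X_meas = azema_yor_process_measurable
  show ?thesis
  proof (rule admissibleI[where G=G])
    show "prob_space P" by (rule prob_space_axioms)
    show "0 < T" by (rule T)
    show "cadlag_on T (\<lambda>t. ?X t \<xi>)" if "\<xi> \<in> space P" for \<xi> by (rule azema_yor_process_cadlag[OF that T])
    show "AE \<xi> in P. ?X 0 \<xi> = 0"
      using W_0 XY[of 0] by eventually_elim (simp add: Y_def T stopped_0[OF stopping_region])
    have "distr P borel (?X T) = distr P borel (final (hit region))"
      by (rule distr_cong_AE) (use XY[of T] X_meas[of T] T final_measurable[OF stopping_region] in \<open>auto simp: Y_def\<close>)
    then show "distr P borel (?X T) = \<mu>" by (simp add: region_final_law)
    show "integrable P (?X t)" if "0 \<le> t" for t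
      by (rule integrable_cong_AE_imp[OF Y(1)[OF that] X_meas[OF that]]) (use XY[of t] in \<open>auto elim: eventually_mono\<close>)
    show "subalgebra P (G t)" for t by (rule sub)
    show "sets (G s) \<subseteq> sets (G t)" if st: "0 \<le> s" "s \<le> t" "t \<le> T" for s t
    proof (cases "t < T")
      case True
      then have "s / (T - s) \<le> t / (T - t)" using st by (intro frac_le) auto
      then show ?thesis using FW_mono[of "s / (T - s)" "t / (T - t)"] True st by (simp add: G_def)
    next
      case False
      then show ?thesis using sub[of s] by (simp add: G_def subalgebra_def)
    qed
    show "\<exists>X'\<in>borel_measurable (G t). AE \<xi> in P. ?X t \<xi> = X' \<xi>" if "0 \<le> t" for t
      using Y(2)[OF that] XY[of t] by blast
    show "(LINT \<xi>:A|P. ?X T \<xi>) = (LINT \<xi>:A|P. ?X t \<xi>)" if t: "0 \<le> t" "t \<le> T" and A: "A \<in> sets (G t)" for t A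
    proof -
      have AP: "A \<in> sets P" using sub[of t] A by (auto simp: subalgebra_def)
      have eq: "(LINT \<xi>:A|P. ?X s \<xi>) = (\<integral>\<xi>. indicator A \<xi> * Y s \<xi> \<partial>P)" if "0 \<le> s" for s
        unfolding set_lebesgue_integral_def
      proof (rule integral_cong_AE)
        show "(\<lambda>\<xi>. indicator A \<xi> *\<^sub>R ?X s \<xi>) \<in> borel_measurable P" "(\<lambda>\<xi>. indicator A \<xi> * Y s \<xi>) \<in> borel_measurable P"
          using AP X_meas[OF that] borel_measurable_integrable[OF Y(1)[OF that]] by auto
        show "AE \<xi> in P. indicator A \<xi> *\<^sub>R ?X s \<xi> = indicator A \<xi> * Y s \<xi>"
          using XY[of s] by eventually_elim simp
      qed
      have "(\<integral>\<xi>. indicator A \<xi> * Y T \<xi> \<partial>P) = (\<integral>\<xi>. indicator A \<xi> * Y t \<xi> \<partial>P)"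
        using region_stopped_mean[of "t / (T - t)" A] t A by (auto simp: Y_def G_def)
      then show ?thesis using eq t T by simp
    qed
  qed
qed

lemma azema_yor_joint_law:
  assumes T: "0 < T"
  shows "joint_law T P (azema_yor_process T \<mu> W) = graph_law \<mu> \<beta>"
proof -
  let ?X = "azema_yor_process T \<mu> W" and ?V = "final (hit region)"
  have V[measurable]: "?V \<in> borel_measurable P" by (rule final_measurable[OF stopping_region])
  have X[measurable]: "?X T \<in> borel_measurable P" using azema_yor_process_measurable[of T T] T by simp
  have [measurable]: "running_max ?X T \<in> borel_measurable P"
    by (rule borel_measurable_running_max) (use azema_yor_process_cadlag azema_yor_process_measurable T in auto)
  have "AE w in distr P borel ?V. mass w > 0" unfolding region_final_law by (rule target.AE_mass_pos)
  then have "AE \<xi> in P. mass (?V \<xi>) > 0" by (subst (asm) AE_distr_iff) measurable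
  then have "AE \<xi> in P. (?X T \<xi>, running_max ?X T \<xi>) = (?V \<xi>, \<beta> (?V \<xi>))"
    using W_0 region_time_finite AE_space
  proof eventually_elim
    case (elim \<xi>)
    then show ?case using azema_yor_running_max[of \<xi> T] T by (simp add: azema_yor_process_eq)
  qed
  then have "joint_law T P ?X = distr P borel (\<lambda>\<xi>. (?V \<xi>, \<beta> (?V \<xi>)))"
    unfolding joint_law_def by (intro distr_cong_AE refl) measurable
  also have "\<dots> = distr (distr P borel ?V) borel (\<lambda>w. (w, \<beta> w))"
    by (subst distr_distr) (auto simp: comp_def)
  finally show ?thesis by (simp add: region_final_law graph_law_def)
qed

end

section \<open>The capped barycenter as prescribed maximum and its optimality\<close>

context embedding_problem
begin

lemma ereal_capped_barycenter: "ereal (capped_barycenter \<mu> a w) = min (ereal (\<beta> w)) (c w)"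
proof -
  have "0 \<le> c w" unfolding c_def by (rule max.coboundedI2) (rule max.cobounded1)
  then have "0 \<le> min (ereal (\<beta> w)) (c w)" using barycenter_nonneg[of w] by simp
  moreover have "min (ereal (\<beta> w)) (c w) \<le> ereal (\<beta> w)" by simp
  ultimately have "\<bar>min (ereal (\<beta> w)) (c w)\<bar> \<noteq> \<infinity>" by (cases "min (ereal (\<beta> w)) (c w)") auto
  then show ?thesis by (simp add: capped_barycenter_def c_def ereal_real')
qed

lemma capped_target_capped_barycenter: "capped_target \<mu> (capped_barycenter \<mu> a)"
proof (intro capped_target.intro atomless_target_axioms capped_target_axioms.intro)
  fix x y :: real
  show "capped_barycenter \<mu> a x \<le> capped_barycenter \<mu> a y" if "x \<le> y" "mass y > 0"
  proof -
    have "min (ereal (\<beta> x)) (c x) \<le> min (ereal (\<beta> y)) (c y)"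
      using barycenter_mono[OF that] ridge_mono[OF that(1)] that(1)
      unfolding c_def by (intro min.mono max.mono) auto
    then show ?thesis by (simp flip: ereal_capped_barycenter)
  qed
  assume x: "mass x > 0"
  have "ereal (max 0 x) \<le> min (ereal (\<beta> x)) (c x)"
    using max0_le_c[of x] barycenter_nonneg[of x] barycenter_greater[OF x] by (simp del: ereal_max)
  then show "max 0 x \<le> capped_barycenter \<mu> a x" unfolding ereal_capped_barycenter[symmetric] by (simp del: ereal_max)
  have "ereal (capped_barycenter \<mu> a x) \<le> ereal (\<beta> x)" unfolding ereal_capped_barycenter by simp
  then show "capped_barycenter \<mu> a x \<le> \<beta> x" by simp
qed

text \<open>The value depends on the joint law alone, so it can be computed under \<mu>, and every
  realization of this law inherits the bound.\<close>

lemma no_higher_value: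
  assumes T: "0 < T" and M: "admissible T \<mu> P M" "joint_law T P M = graph_law \<mu> (capped_barycenter \<mu> a)"
    and N: "admissible T \<mu> Q N"
  shows "achieves_no_higher_value T F Q N P M"
  unfolding achieves_no_higher_value_def functional_value_def
proof (intro allI impI)
  fix v v'
  assume v: "has_expectation P (\<lambda>\<xi>. F (M T \<xi>) (running_max M T \<xi>)) v"
    and v': "has_expectation Q (\<lambda>\<xi>. F (N T \<xi>) (running_max N T \<xi>)) v'"
  have "(\<lambda>\<xi>. (M T \<xi>, running_max M T \<xi>)) \<in> borel_measurable P"
    using embeddedD(2,3)[OF admissible_embedded[OF M(1) T]] by (intro borel_measurable_Pair)
  from has_expectation_graph[OF this M(2)[unfolded joint_law_def] v]
  show "v' \<le> v" by (rule optimality[OF admissible_embedded[OF N T] _ v'])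
qed

end

theorem theorem5:
  fixes T :: real
    and \<mu> :: "real measure"
    and F :: "real \<Rightarrow> real \<Rightarrow> real"
    and a :: "real \<Rightarrow> ereal"
  assumes "T > 0"
    and "centred \<mu>"
    and "no_atoms \<mu>"
    and "usc (\<lambda>(w, s). F w s)"
    and "strictly_supermodular F"
    and "serrated_with_ridge F a"
  shows "((\<forall>w. a w = \<infinity>) \<longrightarrow>
           (\<forall>(\<Omega> :: 'b measure) W. standard_brownian_motion \<Omega> W \<longrightarrow>
              admissible T \<mu> \<Omega> (azema_yor_process T \<mu> W) \<and>
              (\<forall>(Q :: 'a measure) N. admissible T \<mu> Q N \<longrightarrow>
                 achieves_no_higher_value T F Q N \<Omega> (azema_yor_process T \<mu> W))))
       \<and> ((\<exists>(P :: (real \<Rightarrow> real) measure) M. admissible T \<mu> P M \<and>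
             joint_law T P M = graph_law \<mu> (capped_barycenter \<mu> a)) \<and>
          (\<forall>(P :: 'c measure) M. admissible T \<mu> P M \<and>
             joint_law T P M = graph_law \<mu> (capped_barycenter \<mu> a) \<longrightarrow>
             (\<forall>(Q :: 'a measure) N. admissible T \<mu> Q N \<longrightarrow>
                achieves_no_higher_value T F Q N P M)))"
proof -
  have target: "atomless_target \<mu>"
    using assms(2,3) by (auto simp: centred_def no_atoms_def atomless_target_def atomless_target_axioms_def)
  interpret embedding_problem \<mu> F a
    using target assms(4-6) by (intro embedding_problem.intro serrated_payoff.intro)
  interpret capped: capped_target \<mu> "capped_barycenter \<mu> a" by (rule capped_target_capped_barycenter)
  show ?thesis
  proof (intro conjI impI allI)
    fix \<Omega> :: "'b measure" and W
    assume a: "\<forall>w. a w = \<infinity>" and W: "standard_brownian_motion \<Omega> W"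
    have "prob_space \<Omega>" using W by (simp add: standard_brownian_motion_def)
    then have "brownian \<Omega> W" using W by (intro brownian.intro brownian_axioms.intro)
    then interpret AY: azema_yor \<Omega> W \<mu> using target by (intro azema_yor.intro)
    show adm: "admissible T \<mu> \<Omega> (azema_yor_process T \<mu> W)" by (rule AY.azema_yor_admissible[OF assms(1)])
    have "capped_barycenter \<mu> a = barycenter \<mu>" using a by (simp add: fun_eq_iff capped_barycenter_def)
    then have "joint_law T \<Omega> (azema_yor_process T \<mu> W) = graph_law \<mu> (capped_barycenter \<mu> a)"
      using AY.azema_yor_joint_law[OF assms(1)] by simp
    then show "achieves_no_higher_value T F Q N \<Omega> (azema_yor_process T \<mu> W)"
      if "admissible T \<mu> Q N" for Q :: "'a measure" and N
      by (rule no_higher_value[OF assms(1) adm _ that])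
  next
    show "\<exists>(P :: (real \<Rightarrow> real) measure) M. admissible T \<mu> P M \<and>
        joint_law T P M = graph_law \<mu> (capped_barycenter \<mu> a)"
      by (rule capped.ex_embedding[OF assms(1) borel_measurable_capped])
  next
    fix P :: "'c measure" and M and Q :: "'a measure" and N
    assume "admissible T \<mu> P M \<and> joint_law T P M = graph_law \<mu> (capped_barycenter \<mu> a)" "admissible T \<mu> Q N"
    then show "achieves_no_higher_value T F Q N P M" by (intro no_higher_value[OF assms(1)]) auto
  qed
qed

end
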